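(* Let $n\ge1$. If $H\subset\mathrm{U}(n)\times\mathrm{U}(n)$ is a closed subgroup, then the following holds for every $\lambda>2n-1$. (1) A symbol $a\in L^\infty(\mathrm{D}^{\mathrm{I}}_{n\times n})$ is $H$-invariant if and only if $T^{(\lambda)}_a$ is intertwining for $\pi_\lambda|_H$. In other words, $\mathcal{T}^{(\lambda)}(L^\infty(\mathrm{D}^{\mathrm{I}}_{n\times n})^H)\subset\mathrm{End}_H(\mathcal{A}^2_\lambda(\mathrm{D}^{\mathrm{I}}_{n\times n}))$. (2) For every $T\in\mathrm{End}_H(\mathcal{A}^2_\lambda(\mathrm{D}^{\mathrm{I}}_{n\times n}))$ and any finite dimensional $\pi_\lambda|_H$-invariant subspace $W\subset\mathcal{A}^2_\lambda(\mathrm{D}^{\mathrm{I}}_{n\times n})$, there exists a symbol $a\in L^\infty(\mathrm{D}^{\mathrm{I}}_{n\times n})^H$ such that $\langle Tf,g\rangle_\lambda=\langle T^{(\lambda)}_af,g\rangle_\lambda$ for every $f,g\in W$. (3) If all the isotypic components associated to $\pi_\lambda|_H$ are finite dimensional, then the $C^*$-algebra $\mathcal{T}^{(\lambda)}(L^\infty(\mathrm{D}^{\mathrm{I}}_{n\times n})^H)$ is commutative if and only if the isotypic decomposition of the restriction $\pi_\lambda|_H$ is multiplicity-free.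
   Context: $\mathrm{D}^{\mathrm{I}}_{n\times n}=\{Z\in M_{n\times n}(\mathbb{C}): Z^*Z<I_n\}$. For $\lambda>2n-1$, $dv_\lambda(Z)=c_\lambda\det(I_n-ZZ^* )^{\lambda-2n}dv(Z)$, with $dv$ Lebesgue measure and $c_\lambda>0$ such that $v_\lambda(\mathrm{D}^{\mathrm{I}}_{n\times n})=1$. $\mathcal{A}^2_\lambda(\mathrm{D}^{\mathrm{I}}_{n\times n})$ is the weighted Bergman space: the closed subspace of holomorphic functions in $L^2(\mathrm{D}^{\mathrm{I}}_{n\times n},v_\lambda)$, with inner product $\langle\cdot,\cdot\rangle_\lambda$, and $B_\lambda:L^2(\mathrm{D}^{\mathrm{I}}_{n\times n},v_\lambda)\to\mathcal{A}^2_\lambda(\mathrm{D}^{\mathrm{I}}_{n\times n})$ is the orthogonal projection. For $a\in L^\infty(\mathrm{D}^{\mathrm{I}}_{n\times n})$ (a symbol; functions equal a.e. are identified), the Toeplitz operator is $T^{(\lambda)}_a(f)=B_\lambda(af)$ on $\mathcal{A}^2_\lambda(\mathrm{D}^{\mathrm{I}}_{n\times n})$. For a set $\mathcal{S}$ of symbols, $\mathcal{T}^{(\lambda)}(\mathcal{S})$ is the unital Banach algebra (norm-closed subalgebra of bounded operators) generated by the $T^{(\lambda)}_a$, $a\in\mathcal{S}$. $\pi_\lambda$ is the unitary representation of $\mathrm{U}(n)\times\mathrm{U}(n)$ on $\mathcal{A}^2_\lambda(\mathrm{D}^{\mathrm{I}}_{n\times n})$ given by $(\pi_\lambda(A,B)f)(Z)=f(A^{-1}ZB)$.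 A symbol $a$ is $H$-invariant if $a(A^{-1}ZB)=a(Z)$ for every $(A,B)\in H$; $L^\infty(\mathrm{D}^{\mathrm{I}}_{n\times n})^H$ is the space of $H$-invariant symbols (it is closed under conjugation, so $\mathcal{T}^{(\lambda)}$ of it is a $C^*$-algebra). $\mathrm{End}_H(\mathcal{H})$ is the algebra of bounded operators on $\mathcal{H}$ commuting with the $H$-action (intertwining operators). For a unitary representation of a compact group $H$ on $\mathcal{H}$ and an equivalence class $[\mathcal{K}]$ of irreducible $H$-modules, the isotypic component $\mathcal{H}_{[\mathcal{K}]}$ is the closed subspace given by the sum of all $H$-submodules of $\mathcal{H}$ in the class $[\mathcal{K}]$; the Hilbert direct sum of the isotypic components is the isotypic decomposition, which is multiplicity-free if every isotypic component is either $0$ or irreducible. *)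

theory Defs
  imports
    "HOL-Analysis.Analysis"
    "HOL-Library.Function_Algebras"
    "HOL-Algebra.Group"
begin

section \<open>The domain and the unitary group\<close>

definition conj_transpose :: "complex^'n^'m \<Rightarrow> complex^'m^'n" where
  "conj_transpose A = (\<chi> i j. cnj (A $ j $ i))"

definition hermitian_pos_def :: "complex^'n^'n \<Rightarrow> bool" where
  "hermitian_pos_def A \<longleftrightarrow> conj_transpose A = A \<and>
     (\<forall>v. v \<noteq> 0 \<longrightarrow> 0 < Re (\<Sum>i\<in>UNIV. cnj (v $ i) * (A *v v) $ i))"

definition cartan_domain :: "(complex^'n^'n) set" where
  "cartan_domain = {Z. hermitian_pos_def (mat 1 - conj_transpose Z ** Z)}"

definition unitary_group :: "(complex^'n^'n) monoid" where
  "unitary_group = \<lparr>carrier = {A. conj_transpose A ** A = mat 1}, mult = (**), one = mat 1\<rparr>"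

section \<open>Weighted Bergman spaces\<close>

text \<open>The determinant of \<open>1 - Z Z\<^sup>*\<close> is a positive real number for \<open>Z\<close> in the domain.\<close>

definition weighted_measure :: "real \<Rightarrow> real \<Rightarrow> (complex^'n^'n) measure" where
  "weighted_measure lam c = density (lebesgue_on cartan_domain)
     (\<lambda>Z. ennreal (c * Re (det (mat 1 - Z ** conj_transpose Z)) powr (lam - 2 * real CARD('n))))"

definition bergman_measure :: "real \<Rightarrow> (complex^'n^'n) measure" where
  "bergman_measure lam = weighted_measure lam
     (THE c. c > 0 \<and>
        emeasure (weighted_measure lam c :: (complex^'n^'n) measure) cartan_domain = 1)"

text \<open>Elements of \<open>L\<^sup>2\<close> are represented by functions, not by classes; every notion below that is
  applied to them only depends on the class.\<close>

definition L2_space :: "real \<Rightarrow> (complex^'n^'n \<Rightarrow> complex) set" where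
  "L2_space lam = {f \<in> borel_measurable (bergman_measure lam).
     integrable (bergman_measure lam) (\<lambda>Z. (norm (f Z))\<^sup>2)}"

definition ip :: "real \<Rightarrow> (complex^'n^'n \<Rightarrow> complex) \<Rightarrow> (complex^'n^'n \<Rightarrow> complex) \<Rightarrow> complex" where
  "ip lam f g = (LINT Z|bergman_measure lam. f Z * cnj (g Z))"

definition L2_norm :: "real \<Rightarrow> (complex^'n^'n \<Rightarrow> complex) \<Rightarrow> real" where
  "L2_norm lam f = sqrt (Re (ip lam f f))"

text \<open>Several complex variables: real differentiability with a complex linear derivative.\<close>

definition holomorphic_matrix :: "(complex^'n^'n \<Rightarrow> complex) \<Rightarrow> (complex^'n^'n) set \<Rightarrow> bool" where
  "holomorphic_matrix f S \<longleftrightarrow> (\<forall>Z\<in>S. \<exists>f'. (f has_derivative f') (at Z within S) \<and>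
     (\<forall>c V. f' (\<chi> i j. c * V $ i $ j) = c * f' V))"

text \<open>A holomorphic function on the domain is represented by its extension by \<open>0\<close>. As holomorphic
  functions that agree almost everywhere agree, equality of functions is then the
  equality of elements of the Bergman space.\<close>

definition bergman_space :: "real \<Rightarrow> (complex^'n^'n \<Rightarrow> complex) set" where
  "bergman_space lam = {f \<in> L2_space lam. holomorphic_matrix f cartan_domain \<and>
     (\<forall>Z. Z \<notin> cartan_domain \<longrightarrow> f Z = 0)}"

text \<open>The orthogonal projection of \<open>L\<^sup>2\<close> onto the Bergman space.\<close>

definition bergman_proj ::
    "real \<Rightarrow> (complex^'n^'n \<Rightarrow> complex) \<Rightarrow> (complex^'n^'n \<Rightarrow> complex)" where
  "bergman_proj lam f =
     (THE g. g \<in> bergman_space lam \<and> (\<forall>h\<in>bergman_space lam. ip lam (f - g) h = 0))"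

section \<open>Subspaces and operators\<close>

definition cscale :: "complex \<Rightarrow> ('a \<Rightarrow> complex) \<Rightarrow> 'a \<Rightarrow> complex" where
  "cscale c f = (\<lambda>x. c * f x)"

interpretation cfun: vector_space cscale
  by unfold_locales (auto simp: cscale_def fun_eq_iff algebra_simps)

definition finite_dimensional :: "('a \<Rightarrow> complex) set \<Rightarrow> bool" where
  "finite_dimensional W \<longleftrightarrow> (\<exists>B. finite B \<and> W = cfun.span B)"

definition bergman_closure ::
    "real \<Rightarrow> (complex^'n^'n \<Rightarrow> complex) set \<Rightarrow> (complex^'n^'n \<Rightarrow> complex) set" where
  "bergman_closure lam V =
     {f \<in> bergman_space lam. \<forall>e>0. \<exists>g\<in>V. L2_norm lam (f - g) < e}"

text \<open>Operators between subspaces are functions of which only the values on the source matter.\<close>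

definition bounded_operators :: "real \<Rightarrow> (complex^'n^'n \<Rightarrow> complex) set \<Rightarrow>
    (complex^'n^'n \<Rightarrow> complex) set \<Rightarrow>
    ((complex^'n^'n \<Rightarrow> complex) \<Rightarrow> (complex^'n^'n \<Rightarrow> complex)) set" where
  "bounded_operators lam V W = {T. T ` V \<subseteq> W \<and>
     (\<forall>f\<in>V. \<forall>g\<in>V. T (f + g) = T f + T g) \<and>
     (\<forall>c. \<forall>f\<in>V. T (cscale c f) = cscale c (T f)) \<and>
     (\<exists>C. \<forall>f\<in>V. L2_norm lam (T f) \<le> C * L2_norm lam f)}"

text \<open>The last clause is closedness in operator norm; it also makes membership independent of the
  values of operators outside the Bergman space.\<close>

definition unital_banach_subalgebra ::
    "real \<Rightarrow> ((complex^'n^'n \<Rightarrow> complex) \<Rightarrow> (complex^'n^'n \<Rightarrow> complex)) set \<Rightarrow> bool" where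
  "unital_banach_subalgebra lam X \<longleftrightarrow>
     X \<subseteq> bounded_operators lam (bergman_space lam) (bergman_space lam) \<and>
     (\<lambda>f. f) \<in> X \<and>
     (\<forall>S\<in>X. \<forall>T\<in>X. (\<lambda>f. S f + T f) \<in> X) \<and>
     (\<forall>c. \<forall>T\<in>X. (\<lambda>f. cscale c (T f)) \<in> X) \<and>
     (\<forall>S\<in>X. \<forall>T\<in>X. (\<lambda>f. S (T f)) \<in> X) \<and>
     (\<forall>T\<in>bounded_operators lam (bergman_space lam) (bergman_space lam).
        (\<forall>e>0. \<exists>S\<in>X. \<forall>f\<in>bergman_space lam. L2_norm lam (T f - S f) \<le> e * L2_norm lam f)
        \<longrightarrow> T \<in> X)"

definition commuting_on ::
    "'f set \<Rightarrow> ('f \<Rightarrow> 'f) set \<Rightarrow> bool" where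
  "commuting_on V X \<longleftrightarrow> (\<forall>S\<in>X. \<forall>T\<in>X. \<forall>f\<in>V. S (T f) = T (S f))"

section \<open>Symbols and Toeplitz operators\<close>

definition symbols :: "(complex^'n^'n \<Rightarrow> complex) set" where
  "symbols = {a \<in> borel_measurable (lebesgue_on cartan_domain).
     \<exists>C. AE Z in lebesgue_on cartan_domain. norm (a Z) \<le> C}"

text \<open>Symbols that agree almost everywhere are identified, so invariance under each \<open>(A, B)\<close> is
  an almost everywhere equality (with an exceptional set that may depend on \<open>(A, B)\<close>).\<close>

definition invariant_symbol ::
    "((complex^'n^'n) \<times> (complex^'n^'n)) set \<Rightarrow> (complex^'n^'n \<Rightarrow> complex) \<Rightarrow> bool" where
  "invariant_symbol H a \<longleftrightarrow> (\<forall>(A, B)\<in>H.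
     AE Z in lebesgue_on cartan_domain. a (matrix_inv A ** Z ** B) = a Z)"

definition invariant_symbols ::
    "((complex^'n^'n) \<times> (complex^'n^'n)) set \<Rightarrow> (complex^'n^'n \<Rightarrow> complex) set" where
  "invariant_symbols H = {a \<in> symbols. invariant_symbol H a}"

definition toeplitz :: "real \<Rightarrow> (complex^'n^'n \<Rightarrow> complex) \<Rightarrow>
    (complex^'n^'n \<Rightarrow> complex) \<Rightarrow> (complex^'n^'n \<Rightarrow> complex)" where
  "toeplitz lam a f = bergman_proj lam (\<lambda>Z. a Z * f Z)"

definition toeplitz_algebra :: "real \<Rightarrow> (complex^'n^'n \<Rightarrow> complex) set \<Rightarrow>
    ((complex^'n^'n \<Rightarrow> complex) \<Rightarrow> (complex^'n^'n \<Rightarrow> complex)) set" where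
  "toeplitz_algebra lam S =
     \<Inter>{X. unital_banach_subalgebra lam X \<and> toeplitz lam ` S \<subseteq> X}"

section \<open>The representation and its isotypic components\<close>

definition bergman_rep :: "(complex^'n^'n) \<times> (complex^'n^'n) \<Rightarrow>
    (complex^'n^'n \<Rightarrow> complex) \<Rightarrow> (complex^'n^'n \<Rightarrow> complex)" where
  "bergman_rep = (\<lambda>(A, B) f Z. f (matrix_inv A ** Z ** B))"

definition intertwining_operators :: "real \<Rightarrow> ((complex^'n^'n) \<times> (complex^'n^'n)) set \<Rightarrow>
    (complex^'n^'n \<Rightarrow> complex) set \<Rightarrow> (complex^'n^'n \<Rightarrow> complex) set \<Rightarrow>
    ((complex^'n^'n \<Rightarrow> complex) \<Rightarrow> (complex^'n^'n \<Rightarrow> complex)) set" where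
  "intertwining_operators lam H V W = {T \<in> bounded_operators lam V W.
     \<forall>h\<in>H. \<forall>f\<in>V. T (bergman_rep h f) = bergman_rep h (T f)}"

definition invariant_subspace :: "real \<Rightarrow> ((complex^'n^'n) \<times> (complex^'n^'n)) set \<Rightarrow>
    (complex^'n^'n \<Rightarrow> complex) set \<Rightarrow> bool" where
  "invariant_subspace lam H W \<longleftrightarrow> W \<subseteq> bergman_space lam \<and> cfun.subspace W \<and>
     (\<forall>h\<in>H. bergman_rep h ` W \<subseteq> W)"

definition submodule :: "real \<Rightarrow> ((complex^'n^'n) \<times> (complex^'n^'n)) set \<Rightarrow>
    (complex^'n^'n \<Rightarrow> complex) set \<Rightarrow> bool" where
  "submodule lam H W \<longleftrightarrow> invariant_subspace lam H W \<and> bergman_closure lam W = W"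

definition irreducible_submodule :: "real \<Rightarrow> ((complex^'n^'n) \<times> (complex^'n^'n)) set \<Rightarrow>
    (complex^'n^'n \<Rightarrow> complex) set \<Rightarrow> bool" where
  "irreducible_submodule lam H K \<longleftrightarrow> submodule lam H K \<and> K \<noteq> {0} \<and>
     (\<forall>L. submodule lam H L \<and> L \<subseteq> K \<longrightarrow> L = {0} \<or> L = K)"

definition equivalent_submodules :: "real \<Rightarrow> ((complex^'n^'n) \<times> (complex^'n^'n)) set \<Rightarrow>
    (complex^'n^'n \<Rightarrow> complex) set \<Rightarrow> (complex^'n^'n \<Rightarrow> complex) set \<Rightarrow> bool" where
  "equivalent_submodules lam H K L \<longleftrightarrow>
     (\<exists>T\<in>intertwining_operators lam H K L. bij_betw T K L)"

definition isotypic_component :: "real \<Rightarrow> ((complex^'n^'n) \<times> (complex^'n^'n)) set \<Rightarrow>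
    (complex^'n^'n \<Rightarrow> complex) set \<Rightarrow> (complex^'n^'n \<Rightarrow> complex) set" where
  "isotypic_component lam H K = bergman_closure lam
     (cfun.span (\<Union>{L. submodule lam H L \<and> equivalent_submodules lam H K L}))"

text \<open>The class of an irreducible module that does not occur in the Bergman space has isotypic
  component \<open>0\<close>, so the isotypic decomposition is indexed by the classes of the irreducible
  submodules of the Bergman space.\<close>

definition isotypic_components :: "real \<Rightarrow> ((complex^'n^'n) \<times> (complex^'n^'n)) set \<Rightarrow>
    (complex^'n^'n \<Rightarrow> complex) set set" where
  "isotypic_components lam H = isotypic_component lam H ` {K. irreducible_submodule lam H K}"

definition multiplicity_free ::
    "real \<Rightarrow> ((complex^'n^'n) \<times> (complex^'n^'n)) set \<Rightarrow> bool" where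
  "multiplicity_free lam H \<longleftrightarrow>
     (\<forall>V\<in>isotypic_components lam H. V = {0} \<or> irreducible_submodule lam H V)"

end

theory Submission
  imports Defs "HOL-Complex_Analysis.Complex_Analysis"
    "HOL-Computational_Algebra.Fundamental_Theorem_Algebra"
begin

text \<open>The proof uses three properties of the domain and of its Bergman space. First, a bounded symbol is
  determined by its Toeplitz operator, since \<open>\<langle>T\<^sub>a f, g\<rangle>\<close> is the integral of \<open>a f (cnj g)\<close> and the
  functions \<open>f (cnj g)\<close> with \<open>f\<close>, \<open>g\<close> holomorphic span an algebra that contains all real polynomials
  (\<open>symbol_zero\<close>). Secondly, an identity \<open>\<Sum>f\<^sub>i(Z) cnj (g\<^sub>i(Z)) = 0\<close> between holomorphic functions
  remains true when the two arguments are separated (\<open>polarization\<close>). Thirdly, the functions in the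
  Bergman space that are homogeneous of degree \<open>m\<close> form a finite dimensional space, preserved by the
  unitary group, and all these spaces together are total (\<open>finite_dimensional_homogeneous\<close>,
  \<open>homogeneous_total\<close>).

  The group acts unitarily, and conjugating \<open>T\<^sub>a\<close> by a group element composes the symbol with that
  element. As the symbol is determined by the operator, \<open>T\<^sub>a\<close> commutes with the action if and only
  if \<open>a\<close> is invariant. The intertwining operators form a norm closed algebra, so they contain
  the algebra generated by these Toeplitz operators.

  For the second part let \<open>E\<close> be an orthonormal basis of \<open>W\<close> and \<open>k(Z) = \<Sum>\<bar>e(Z)\<bar>\<^sup>2\<close> its reproducing
  kernel on the diagonal. The symbol is sought in the form \<open>\<Sum>c(e,e') cnj e e' / k\<close>, a bounded function.
  The required equations form a Gram system for the functions \<open>cnj e e' / \<surd>k\<close>, which are independent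
  by polarization, so there is exactly one solution. Replacing \<open>T\<close> by its conjugate under a
  group element changes the solution by the action of that element, because \<open>k\<close> is invariant; as \<open>T\<close>
  is equal to its conjugates, uniqueness makes the symbol invariant (\<open>finite_dimensional_realization\<close>).

  In the third part every intertwining operator preserves the isotypic components. If these are
  irreducible, then by Schur's lemma any two intertwining operators commute on every finite dimensional
  irreducible submodule, hence on the homogeneous functions, hence everywhere. Conversely, if a finite
  dimensional isotypic component contains a second copy of the irreducible module \<open>K\<close>, the projection
  to \<open>K\<close> and an operator from \<open>K\<close> to a copy orthogonal to \<open>K\<close> do not commute, and by the second part
  Toeplitz operators with invariant symbols coincide with them on this component.

  The analytic basis consists of the finiteness of the weighted volume, obtained by adding the columns
  of the matrix one at a time; of the invariance of Lebesgue measure under isometries; of the description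
  of holomorphic functions by their restrictions to complex lines; and of the mean value property on balls,
  which makes point evaluations bounded and the Bergman space complete.\<close>

\<comment> \<open>The coefficient notation of power series would clash with the entries of matrices.\<close>
unbundle no fps_syntax

section \<open>Invariance of Lebesgue measure under isometries\<close>

text \<open>Uniqueness of Haar measure on a Euclidean space: integrating \<open>1\<^sub>A x * 1\<^sub>B (x + y)\<close> against
  \<open>dN x dy\<close> in both orders gives \<open>N A * vol B = N B * vol A\<close>.\<close>

lemma translation_invariant_measure_proportional:
  fixes N :: "'a::euclidean_space measure"
  assumes sf: "sigma_finite_measure N" and sN [measurable_cong]: "sets N = sets borel"
    and tr: "\<And>t. distr N borel (\<lambda>x. x + t) = N"
    and A [measurable]: "A \<in> sets borel" and B [measurable]: "B \<in> sets borel"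
  shows "emeasure N A * emeasure lborel B = emeasure N B * emeasure lborel A"
proof -
  interpret N: sigma_finite_measure N by fact
  interpret P: pair_sigma_finite N "lborel :: 'a measure"
    by (simp add: pair_sigma_finite_def sf lborel.sigma_finite_measure_axioms)
  have "emeasure N A * emeasure lborel B
      = (\<integral>\<^sup>+x. indicator A x * emeasure lborel B \<partial>N)"
    by (simp add: nn_integral_multc)
  also have "\<dots> = (\<integral>\<^sup>+x. indicator A x * (\<integral>\<^sup>+y. indicator B (x + y) \<partial>lborel) \<partial>N)"
  proof (rule nn_integral_cong)
    fix x :: 'a
    have "emeasure lborel B = (\<integral>\<^sup>+y. indicator B y \<partial>distr lborel borel ((+) x))"
      by (simp add: lborel_distr_plus)
    also have "\<dots> = (\<integral>\<^sup>+y. indicator B (x + y) \<partial>lborel)"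
      by (subst nn_integral_distr) auto
    finally show "indicator A x * emeasure lborel B
        = indicator A x * (\<integral>\<^sup>+y. indicator B (x + y) \<partial>lborel)" by simp
  qed
  also have "\<dots> = (\<integral>\<^sup>+x. (\<integral>\<^sup>+y. indicator A x * indicator B (x + y) \<partial>lborel) \<partial>N)"
    by (intro nn_integral_cong nn_integral_cmult[symmetric]) measurable
  also have "\<dots> = (\<integral>\<^sup>+y. (\<integral>\<^sup>+x. indicator A x * indicator B (x + y) \<partial>N) \<partial>lborel)"
    by (rule P.Fubini'[symmetric]) measurable
  also have "\<dots> = (\<integral>\<^sup>+y. (\<integral>\<^sup>+x. indicator A (x - y) * indicator B x \<partial>N) \<partial>lborel)"
  proof (rule nn_integral_cong)
    fix y :: 'a
    have "(\<integral>\<^sup>+x. indicator A (x - y) * indicator B x \<partial>N)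
        = (\<integral>\<^sup>+x. indicator A (x - y) * indicator B x \<partial>distr N borel (\<lambda>x. x + y))"
      by (simp add: tr)
    also have "\<dots> = (\<integral>\<^sup>+x. indicator A x * indicator B (x + y) \<partial>N)"
      by (subst nn_integral_distr) auto
    finally show "(\<integral>\<^sup>+x. indicator A x * indicator B (x + y) \<partial>N)
        = (\<integral>\<^sup>+x. indicator A (x - y) * indicator B x \<partial>N)" by simp
  qed
  also have "\<dots> = (\<integral>\<^sup>+x. (\<integral>\<^sup>+y. indicator A (x - y) * indicator B x \<partial>lborel) \<partial>N)"
    by (rule P.Fubini') measurable
  also have "\<dots> = (\<integral>\<^sup>+x. emeasure lborel A * indicator B x \<partial>N)"
  proof (rule nn_integral_cong)
    fix x :: 'a
    have "emeasure lborel A = (\<integral>\<^sup>+y. indicator A y \<partial>lborel)" by simp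
    also have "\<dots> = (\<integral>\<^sup>+y. indicator A y \<partial>(density (distr lborel borel (\<lambda>y. x + (-1) *\<^sub>R y)) (\<lambda>_. ennreal (\<bar>-1\<bar> ^ DIM('a)))))"
      by (subst lborel_affine[of "-1" x]) auto
    also have "\<dots> = (\<integral>\<^sup>+y. indicator A (x - y) \<partial>lborel)"
      by (subst nn_integral_density, simp, simp, subst nn_integral_distr) auto
    finally show "(\<integral>\<^sup>+y. indicator A (x - y) * indicator B x \<partial>lborel)
        = emeasure lborel A * indicator B x"
      by (simp add: nn_integral_multc)
  qed
  also have "\<dots> = emeasure N B * emeasure lborel A"
    by (subst nn_integral_cmult) (simp_all add: mult.commute)
  finally show ?thesis .
qed

text \<open>The image measure is again translation invariant, and it agrees with Lebesgue measure on the unit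
  ball, which an isometry preserves.\<close>

lemma lborel_distr_isometry:
  fixes f :: "'a::euclidean_space \<Rightarrow> 'a"
  assumes f: "orthogonal_transformation f"
  shows "distr lborel borel f = lborel"
proof -
  have lin: "linear f" using f by (simp add: orthogonal_transformation_linear)
  have [measurable]: "f \<in> borel_measurable borel"
    by (intro borel_measurable_continuous_onI linear_continuous_on)
      (use lin linear_conv_bounded_linear in blast)
  have bij: "bij f" using f by (rule orthogonal_transformation_bij)
  define g where "g = inv_into UNIV f"
  have g: "orthogonal_transformation g" unfolding g_def using f by (rule orthogonal_transformation_inv)
  have ling: "linear g" using g by (simp add: orthogonal_transformation_linear)
  have fg: "f (g x) = x" "g (f x) = x" for x
    using bij by (auto simp: g_def bij_def surj_f_inv_f)
  let ?N = "distr lborel borel f"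
  have ball: "f -` ball 0 r = ball 0 r" for r
    using f by (auto simp: orthogonal_transformation_norm)
  have sf: "sigma_finite_measure ?N"
  proof
    show "\<exists>A. countable A \<and> A \<subseteq> sets ?N \<and> \<Union> A = space ?N \<and> (\<forall>a\<in>A. emeasure ?N a \<noteq> \<infinity>)"
    proof (intro exI conjI ballI)
      show "countable (range (\<lambda>n::nat. ball (0::'a) (real n)))" by simp
      have "\<exists>n. x \<in> ball 0 (real n)" for x :: 'a by (simp add: reals_Archimedean2)
      then show "\<Union> (range (\<lambda>n::nat. ball (0::'a) (real n))) = space ?N"
        by (auto simp del: mem_ball)
      fix a assume "a \<in> range (\<lambda>n::nat. ball (0::'a) (real n))"
      then obtain n where a: "a = ball 0 (real n)" by auto
      show "emeasure ?N a \<noteq> \<infinity>" unfolding a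
        using emeasure_lborel_ball_finite[of "0::'a" "real n"]
      by (subst emeasure_distr) (auto simp: ball)
    qed auto
  qed
  have tr: "distr ?N borel (\<lambda>x. x + t) = ?N" for t
  proof -
    have "distr ?N borel (\<lambda>x. x + t) = distr lborel borel (\<lambda>x. f x + t)"
      by (subst distr_distr) (auto simp: comp_def)
    also have "(\<lambda>x. f x + t) = f \<circ> ((+) (g t))"
      using fg lin by (auto simp: fun_eq_iff linear_add)
    also have "distr lborel borel (f \<circ> (+) (g t)) = distr (distr lborel borel ((+) (g t))) borel f"
      by (subst distr_distr) auto
    also have "\<dots> = ?N" by (simp add: lborel_distr_plus)
    finally show ?thesis .
  qed
  have "emeasure ?N A = emeasure lborel A" if A: "A \<in> sets borel" for A
  proof -
    have c: "emeasure ?N (ball 0 1) = emeasure lborel (ball (0::'a) 1)"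
      by (subst emeasure_distr) (auto simp: ball)
    have fin: "emeasure lborel (ball (0::'a) 1) < \<infinity>" by (rule emeasure_lborel_ball_finite)
    have "emeasure lborel (ball (0::'a) 1) \<noteq> 0"
      using emeasure_eq_ennreal_measure[of lborel "ball (0::'a) 1"] fin
        content_ball_pos[of 1 "0::'a"] by (auto simp: measure_def)
    moreover have "emeasure lborel (ball (0::'a) 1) * emeasure ?N A
        = emeasure lborel (ball (0::'a) 1) * emeasure lborel A"
      using translation_invariant_measure_proportional[OF sf _ tr A, of "ball 0 1"]
      unfolding c by (simp add: mult.commute)
    ultimately show ?thesis
      using fin unfolding ennreal_mult_cancel_left by auto
  qed
  then show ?thesis by (intro measure_eqI) auto
qed

section \<open>Geometry of the domain\<close>

definition mscale :: "complex \<Rightarrow> complex^'n^'m \<Rightarrow> complex^'n^'m" where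
  "mscale c Z = (\<chi> i j. c * Z $ i $ j)"

lemma mscale_nth [simp]: "mscale c Z $ i $ j = c * Z $ i $ j"
  by (simp add: mscale_def)

lemma mscale_of_real: "mscale (of_real r) Z = r *\<^sub>R Z"
  unfolding vec_eq_iff vector_scaleR_component mscale_nth by (simp add: scaleR_conv_of_real)

lemma mscale_simps [simp]:
  "mscale c 0 = 0" "mscale 0 Z = 0" "mscale 1 Z = Z" "mscale c (mscale d Z) = mscale (c * d) Z"
  by (simp_all add: vec_eq_iff)

lemma mscale_add_right: "mscale c (Z + W) = mscale c Z + mscale c W"
  and mscale_add_left: "mscale (c + d) Z = mscale c Z + mscale d Z"
  by (simp_all add: vec_eq_iff algebra_simps)

lemma norm_mscale [simp]: "norm (mscale c Z) = norm c * norm Z"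
proof -
  have "norm (mscale c Z $ i) = norm c * norm (Z $ i)" for i
    by (simp add: norm_vec_def L2_set_right_distrib norm_mult)
  then show ?thesis
    by (simp add: norm_vec_def[of "mscale c Z"] norm_vec_def[of Z] L2_set_right_distrib)
qed

lemma bounded_bilinear_mscale: "bounded_bilinear mscale"
  by (rule bounded_bilinear.intro)
    (auto simp: mscale_add_right mscale_add_left vec_eq_iff intro!: exI[of _ 1])

lemmas bounded_linear_mscale = bounded_bilinear.bounded_linear_right[OF bounded_bilinear_mscale]
lemmas bounded_linear_mscale_left = bounded_bilinear.bounded_linear_left[OF bounded_bilinear_mscale]
lemmas continuous_on_mscale [continuous_intros] =
  bounded_bilinear.continuous_on[OF bounded_bilinear_mscale]

lemma conj_transpose_nth [simp]: "conj_transpose A $ i $ j = cnj (A $ j $ i)"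
  by (simp add: conj_transpose_def)

lemma conj_transpose_simps [simp]:
  "conj_transpose (conj_transpose A) = A"
  "conj_transpose (mat 1 :: complex^'n^'n) = mat 1"
  by (auto simp: vec_eq_iff mat_def)

lemma conj_transpose_mult: "conj_transpose (A ** B) = conj_transpose B ** conj_transpose A"
  by (simp add: vec_eq_iff matrix_matrix_mult_def mult.commute)

lemma conj_transpose_diff: "conj_transpose (A - B) = conj_transpose A - conj_transpose B"
  by (simp add: vec_eq_iff)

lemma matrix_mult_diff:
  fixes A B C :: "complex^'n^'n"
  shows "A ** (B - C) = A ** B - A ** C" "(A - B) ** C = A ** C - B ** C"
  by (simp_all add: vec_eq_iff matrix_matrix_mult_def algebra_simps sum_subtractf)

lemma inner_complex_vec: "(v::complex^'n) \<bullet> w = Re (\<Sum>i\<in>UNIV. cnj (v $ i) * w $ i)"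
  by (simp add: inner_vec_def inner_complex_def)

lemma matrix_vector_mult_nth: "(A *v v) $ i = (\<Sum>j\<in>UNIV. A $ i $ j * v $ j)"
  by (simp add: matrix_vector_mult_def)

lemma inner_conj_transpose:
  fixes A :: "complex^'n^'m"
  shows "v \<bullet> (A *v w) = (conj_transpose A *v v) \<bullet> w"
proof -
  have "(\<Sum>i\<in>UNIV. cnj (v $ i) * (A *v w) $ i)
      = (\<Sum>i\<in>UNIV. \<Sum>j\<in>UNIV. cnj (v $ i) * A $ i $ j * w $ j)"
    by (simp add: matrix_vector_mult_nth sum_distrib_left mult.assoc)
  also have "\<dots> = (\<Sum>j\<in>UNIV. \<Sum>i\<in>UNIV. cnj (v $ i) * A $ i $ j * w $ j)"
    by (rule sum.swap)
  also have "\<dots> = (\<Sum>j\<in>UNIV. cnj ((conj_transpose A *v v) $ j) * w $ j)"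
    by (simp add: matrix_vector_mult_nth sum_distrib_right sum_distrib_left mult_ac)
  finally show ?thesis by (simp add: inner_complex_vec)
qed

lemma linear_matrix_vector_mult: "linear ((*v) (A :: complex^'n^'m))"
  by (rule linearI) (simp_all add: matrix_vector_right_distrib vec_eq_iff matrix_vector_mult_nth
      scaleR_sum_right)

lemma bounded_linear_matrix_vector_mult: "bounded_linear ((*v) (A :: complex^'n^'m))"
  using linear_matrix_vector_mult linear_conv_bounded_linear by blast

lemma norm_matrix_vector_mult_le: "norm ((A :: complex^'n^'m) *v v) \<le> norm A * norm v"
proof -
  have "norm ((A *v v) $ i) \<le> norm (A $ i) * norm v" for i
  proof -
    have "norm ((A *v v) $ i) \<le> (\<Sum>j\<in>UNIV. norm (A $ i $ j) * norm (v $ j))"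
      unfolding matrix_vector_mult_nth by (rule sum_norm_le) (simp add: norm_mult)
    also have "\<dots> \<le> norm (A $ i) * norm v"
      using L2_set_mult_ineq[of "\<lambda>j. norm (A $ i $ j)" "\<lambda>j. norm (v $ j)" UNIV]
      by (simp add: norm_vec_def)
    finally show ?thesis .
  qed
  then have "norm (A *v v) \<le> L2_set (\<lambda>i. norm (A $ i) * norm v) UNIV"
    unfolding norm_vec_def[of "A *v v"] by (intro L2_set_mono) auto
  then show ?thesis
    by (simp add: norm_vec_def[of A] L2_set_left_distrib)
qed

lemma matrix_matrix_mult_diff_rdistrib: "(A - B) *v v = A *v v - B *v (v :: complex^'n)"
  by (simp add: vec_eq_iff matrix_vector_mult_nth algebra_simps sum_subtractf)

lemma hermitian_pos_def_iff:
  "hermitian_pos_def (mat 1 - conj_transpose Z ** Z)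
    \<longleftrightarrow> (\<forall>v. v \<noteq> 0 \<longrightarrow> norm (Z *v v) < norm (v :: complex^'n))"
proof -
  have *: "Re (\<Sum>i\<in>UNIV. cnj (v $ i) * ((mat 1 - conj_transpose Z ** Z) *v v) $ i)
      = (norm v)\<^sup>2 - (norm (Z *v v))\<^sup>2" for v
  proof -
    have "Re (\<Sum>i\<in>UNIV. cnj (v $ i) * ((mat 1 - conj_transpose Z ** Z) *v v) $ i)
        = v \<bullet> ((mat 1 - conj_transpose Z ** Z) *v v)"
      by (simp add: inner_complex_vec)
    also have "\<dots> = v \<bullet> v - v \<bullet> (conj_transpose Z *v (Z *v v))"
      by (simp add: matrix_matrix_mult_diff_rdistrib inner_diff_right matrix_vector_mul_assoc)
    also have "\<dots> = v \<bullet> v - (Z *v v) \<bullet> (Z *v v)"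
      by (simp add: inner_conj_transpose)
    finally show ?thesis by (simp add: power2_norm_eq_inner)
  qed
  have "conj_transpose (mat 1 - conj_transpose Z ** Z) = mat 1 - conj_transpose Z ** Z"
    by (simp add: conj_transpose_diff conj_transpose_mult)
  then show ?thesis
    unfolding hermitian_pos_def_def * by (simp add: abs_le_square_iff[symmetric] not_le[symmetric])
qed

lemma mem_cartan_domain:
  "Z \<in> cartan_domain \<longleftrightarrow> (\<forall>v. v \<noteq> 0 \<longrightarrow> norm (Z *v v) < norm v)"
  by (simp add: cartan_domain_def hermitian_pos_def_iff)

lemma cartan_domain_norm_le: "Z \<in> cartan_domain \<Longrightarrow> norm (Z *v v) \<le> norm v"
  by (cases "v = 0") (auto simp: mem_cartan_domain less_imp_le)

text \<open>The unit sphere is compact, so a strict contraction has a contraction factor below \<open>1\<close>.\<close>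

lemma cartan_domain_contraction:
  assumes "(Z :: complex^'n^'n) \<in> cartan_domain"
  obtains k where "0 \<le> k" "k < 1" "\<And>v. norm (Z *v v) \<le> k * norm v"
proof -
  have "compact (sphere (0::complex^'n) 1)" by simp
  moreover have "sphere (0::complex^'n) 1 \<noteq> {}"
    using vector_choose_size[of 1] by force
  moreover have "continuous_on (sphere 0 1) (\<lambda>v. norm (Z *v v))"
    by (intro continuous_on_norm linear_continuous_on bounded_linear_matrix_vector_mult)
  ultimately obtain v0 where v0: "v0 \<in> sphere 0 1"
    and max: "\<And>v. v \<in> sphere 0 1 \<Longrightarrow> norm (Z *v v) \<le> norm (Z *v v0)"
    using continuous_attains_sup by (metis (no_types, lifting))
  have "norm (Z *v v) \<le> norm (Z *v v0) * norm v" for v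
  proof (cases "v = 0")
    case False
    have "norm (Z *v (inverse (norm v) *\<^sub>R v)) \<le> norm (Z *v v0)"
      using False by (intro max) simp
    then show ?thesis
      using False by (simp add: linear_scale[OF linear_matrix_vector_mult] field_simps)
  qed simp
  moreover have "norm (Z *v v0) < 1"
    using assms v0 by (metis mem_cartan_domain mem_sphere_0 norm_zero zero_neq_one)
  ultimately show ?thesis using that[of "norm (Z *v v0)"] by simp
qed

lemma zero_in_cartan_domain [simp]: "0 \<in> cartan_domain"
  by (simp add: mem_cartan_domain)

lemma norm_less_1_in_cartan_domain: "norm (Z :: complex^'n^'n) < 1 \<Longrightarrow> Z \<in> cartan_domain"
  unfolding mem_cartan_domain
proof (intro allI impI)
  fix v :: "complex^'n" assume "norm Z < 1" "v \<noteq> 0"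
  then have "norm Z * norm v < 1 * norm v" by (intro mult_strict_right_mono) auto
  then show "norm (Z *v v) < norm v" using norm_matrix_vector_mult_le[of Z v] by linarith
qed

lemma open_cartan_domain: "open (cartan_domain :: (complex^'n^'n) set)"
  unfolding open_dist
proof (intro ballI)
  fix Z :: "complex^'n^'n" assume "Z \<in> cartan_domain"
  then obtain k where k: "k < 1" "\<And>v. norm (Z *v v) \<le> k * norm v"
    by (metis cartan_domain_contraction)
  have "W \<in> cartan_domain" if "dist W Z < 1 - k" for W
    unfolding mem_cartan_domain
  proof (intro allI impI)
    fix v :: "complex^'n" assume v: "v \<noteq> 0"
    have "norm (W *v v) \<le> norm (Z *v v) + norm ((W - Z) *v v)"
      by (metis matrix_matrix_mult_diff_rdistrib norm_triangle_sub)
    also have "\<dots> \<le> k * norm v + norm (W - Z) * norm v"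
      by (intro add_mono k norm_matrix_vector_mult_le)
    also have "\<dots> < k * norm v + (1 - k) * norm v"
      using that v by (simp add: dist_norm)
    finally show "norm (W *v v) < norm v" by (simp add: algebra_simps)
  qed
  then show "\<exists>e>0. \<forall>W. dist W Z < e \<longrightarrow> W \<in> cartan_domain"
    using k(1) by (intro exI[of _ "1 - k"]) auto
qed

lemma convex_cartan_domain: "convex (cartan_domain :: (complex^'n^'n) set)"
proof (rule convexI)
  fix Z W :: "complex^'n^'n" and u v :: real
  assume *: "Z \<in> cartan_domain" "W \<in> cartan_domain" "0 \<le> u" "0 \<le> v" "u + v = 1"
  show "u *\<^sub>R Z + v *\<^sub>R W \<in> cartan_domain" unfolding mem_cartan_domain
  proof (intro allI impI)
    fix x :: "complex^'n" assume x: "x \<noteq> 0"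
    have "(u *\<^sub>R Z + v *\<^sub>R W) *v x = u *\<^sub>R (Z *v x) + v *\<^sub>R (W *v x)"
      by (simp add: vec_eq_iff matrix_vector_mult_nth algebra_simps sum.distrib scaleR_sum_right)
    then have "norm ((u *\<^sub>R Z + v *\<^sub>R W) *v x) \<le> u * norm (Z *v x) + v * norm (W *v x)"
      using * by (metis abs_of_nonneg norm_scaleR norm_triangle_ineq)
    also have "\<dots> < u * norm x + v * norm x"
    proof (cases "u = 0")
      case True then show ?thesis using * x by (simp add: mem_cartan_domain)
    next
      case False
      then have "u * norm (Z *v x) < u * norm x" using * x by (simp add: mem_cartan_domain)
      moreover have "v * norm (W *v x) \<le> v * norm x"
        using * x by (intro mult_left_mono) (auto simp: cartan_domain_norm_le)
      ultimately show ?thesis by linarith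
    qed
    also have "\<dots> = norm x" using * by (metis distrib_right mult_1)
    finally show "norm ((u *\<^sub>R Z + v *\<^sub>R W) *v x) < norm x" .
  qed
qed

lemma mscale_matrix_vector: "mscale c Z *v (v :: complex^'n) = c *s (Z *v v)"
  by (simp add: vec_eq_iff matrix_vector_mult_nth sum_distrib_left mult.assoc)

lemma norm_vector_scale: "norm (c *s (v :: complex^'n)) = norm c * norm v"
  by (simp add: norm_vec_def L2_set_right_distrib norm_mult)

lemma mscale_in_cartan_domain:
  assumes "norm c \<le> 1" "(Z :: complex^'n^'n) \<in> cartan_domain" shows "mscale c Z \<in> cartan_domain"
  unfolding mem_cartan_domain
proof (intro allI impI)
  fix v :: "complex^'n" assume v: "v \<noteq> 0"
  have "norm (mscale c Z *v v) \<le> 1 * norm (Z *v v)"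
    unfolding mscale_matrix_vector norm_vector_scale using assms by (intro mult_right_mono) auto
  also have "\<dots> < norm v" using assms v by (simp add: mem_cartan_domain)
  finally show "norm (mscale c Z *v v) < norm v" .
qed

lemma cartan_domain_column_le: "norm (column j Z) \<le> 1" if "Z \<in> cartan_domain"
proof -
  have "column j Z = Z *v axis j 1"
    by (simp add: vec_eq_iff column_def matrix_vector_mult_nth axis_def if_distrib cong: if_cong)
  then show ?thesis using cartan_domain_norm_le[OF that, of "axis j 1"] by (simp add: norm_axis_1)
qed

lemma norm_le_columns: "norm (Z :: complex^'n^'m) \<le> (\<Sum>j\<in>UNIV. \<Sum>i\<in>UNIV. norm (Z $ i $ j))"
proof -
  have "norm Z \<le> (\<Sum>i\<in>UNIV. norm (Z $ i))" by (simp add: norm_vec_def L2_set_le_sum)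
  also have "\<dots> \<le> (\<Sum>i\<in>UNIV. \<Sum>j\<in>UNIV. norm (Z $ i $ j))"
    by (intro sum_mono) (simp add: norm_vec_def L2_set_le_sum)
  also have "\<dots> = (\<Sum>j\<in>UNIV. \<Sum>i\<in>UNIV. norm (Z $ i $ j))" by (rule sum.swap)
  finally show ?thesis .
qed

lemma bounded_cartan_domain: "bounded (cartan_domain :: (complex^'n^'n) set)"
  unfolding bounded_iff
proof (intro exI ballI)
  fix Z :: "complex^'n^'n" assume Z: "Z \<in> cartan_domain"
  have "norm (Z $ i $ j) \<le> 1" for i j
    using Finite_Cartesian_Product.norm_nth_le[of "column j Z" i] cartan_domain_column_le[OF Z, of j]
    by (simp add: column_def)
  then have "(\<Sum>j\<in>UNIV. \<Sum>i\<in>UNIV. norm (Z $ i $ j)) \<le> (\<Sum>j\<in>(UNIV::'n set). \<Sum>i\<in>(UNIV::'n set). 1)"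
    by (intro sum_mono) auto
  then show "norm Z \<le> (\<Sum>j\<in>(UNIV::'n set). \<Sum>i\<in>(UNIV::'n set). 1)"
    using norm_le_columns[of Z] by linarith
qed

subsection \<open>The action of the unitary group\<close>

definition umap :: "(complex^'n^'n) \<times> (complex^'n^'n) \<Rightarrow> complex^'n^'n \<Rightarrow> complex^'n^'n" where
  "umap h Z = matrix_inv (fst h) ** Z ** snd h"

abbreviation unitary_pairs :: "((complex^'n^'n) \<times> (complex^'n^'n)) set" where
  "unitary_pairs \<equiv> carrier unitary_group \<times> carrier unitary_group"

lemma unitary_iff: "A \<in> carrier unitary_group \<longleftrightarrow> conj_transpose A ** A = mat 1"
  by (simp add: unitary_group_def)

lemma unitary_right: "A \<in> carrier unitary_group \<Longrightarrow> A ** conj_transpose A = mat 1"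
  by (simp add: unitary_iff matrix_left_right_inverse)

lemma unitary_conj_transpose: "A \<in> carrier unitary_group \<Longrightarrow> conj_transpose A \<in> carrier unitary_group"
  using unitary_right by (simp add: unitary_iff)

lemma unitary_matrix_inv: "A \<in> carrier unitary_group \<Longrightarrow> matrix_inv A = conj_transpose A"
  unfolding matrix_inv_def
proof (rule some_equality)
  assume A: "A \<in> carrier unitary_group"
  then show "A ** conj_transpose A = mat 1 \<and> conj_transpose A ** A = mat 1"
    by (simp add: unitary_right unitary_iff)
  fix B assume "A ** B = mat 1 \<and> B ** A = mat 1"
  then show "B = conj_transpose A"
    using A by (metis matrix_mul_assoc matrix_mul_lid matrix_mul_rid unitary_iff)
qed

lemma norm_unitary_vector:
  assumes "A \<in> carrier unitary_group" shows "norm (A *v v) = norm (v :: complex^'n)"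
proof -
  have "(A *v v) \<bullet> (A *v v) = v \<bullet> v"
    using assms by (simp add: inner_conj_transpose matrix_vector_mul_assoc unitary_iff)
  then show ?thesis by (simp add: norm_eq_sqrt_inner)
qed

lemma norm_sq_columns: "(norm (Z :: complex^'n^'m))\<^sup>2 = (\<Sum>j\<in>UNIV. (norm (column j Z))\<^sup>2)"
proof -
  have "(norm Z)\<^sup>2 = (\<Sum>i\<in>UNIV. \<Sum>j\<in>UNIV. (norm (Z $ i $ j))\<^sup>2)"
    by (simp add: norm_vec_def L2_set_def sum_nonneg)
  also have "\<dots> = (\<Sum>j\<in>UNIV. \<Sum>i\<in>UNIV. (norm (Z $ i $ j))\<^sup>2)" by (rule sum.swap)
  finally show ?thesis by (simp add: norm_vec_def L2_set_def sum_nonneg column_def)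
qed

lemma norm_conj_transpose: "norm (conj_transpose Z) = norm Z"
proof -
  have "(norm (conj_transpose Z))\<^sup>2 = (norm Z)\<^sup>2"
    by (subst norm_sq_columns) (simp add: norm_vec_def L2_set_def sum_nonneg column_def)
  then show ?thesis by simp
qed

lemma norm_unitary_left:
  assumes "A \<in> carrier unitary_group" shows "norm (A ** Z) = norm Z"
proof -
  have "column j (A ** Z) = A *v column j Z" for j
    by (simp add: vec_eq_iff column_def matrix_matrix_mult_def matrix_vector_mult_nth)
  then have "(norm (A ** Z))\<^sup>2 = (norm Z)\<^sup>2"
    by (simp add: norm_sq_columns norm_unitary_vector[OF assms])
  then show ?thesis by simp
qed

lemma norm_umap: "h \<in> unitary_pairs \<Longrightarrow> norm (umap h Z) = norm Z"
proof -
  assume h: "h \<in> unitary_pairs"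
  have "norm (W ** snd h) = norm W" for W
    using norm_unitary_left[of "conj_transpose (snd h)" "conj_transpose W"] h
    by (auto simp: conj_transpose_mult[symmetric] norm_conj_transpose unitary_conj_transpose)
  then show ?thesis
    using h by (auto simp: umap_def unitary_matrix_inv matrix_mul_assoc[symmetric]
        norm_unitary_left unitary_conj_transpose)
qed

lemma linear_umap: "linear (umap h)"
  by (rule linearI)
    (simp_all add: umap_def vec_eq_iff matrix_matrix_mult_def scaleR_sum_right sum_distrib_right
      sum_distrib_left algebra_simps sum.distrib)

lemma mscale_umap: "umap h (mscale c Z) = mscale c (umap h Z)"
  by (simp add: umap_def vec_eq_iff matrix_matrix_mult_def sum_distrib_left sum_distrib_right mult_ac)

lemma orthogonal_transformation_umap:
  "h \<in> unitary_pairs \<Longrightarrow> orthogonal_transformation (umap h)"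
  by (simp add: orthogonal_transformation linear_umap norm_umap)

lemma umap_in_cartan_domain:
  assumes "h \<in> unitary_pairs" "(Z :: complex^'n^'n) \<in> cartan_domain" shows "umap h Z \<in> cartan_domain"
  unfolding mem_cartan_domain
proof (intro allI impI)
  fix v :: "complex^'n" assume v: "v \<noteq> 0"
  have "umap h Z *v v = conj_transpose (fst h) *v (Z *v (snd h *v v))"
    using assms by (auto simp: umap_def unitary_matrix_inv matrix_vector_mul_assoc matrix_mul_assoc)
  then have "norm (umap h Z *v v) = norm (Z *v (snd h *v v))"
    using assms by (auto simp: norm_unitary_vector unitary_conj_transpose)
  moreover have "norm (snd h *v v) = norm v" using assms by (auto simp: norm_unitary_vector)
  moreover have "snd h *v v \<noteq> 0" using v calculation(2) by auto
  ultimately show "norm (umap h Z *v v) < norm v"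
    using assms(2) by (metis mem_cartan_domain)
qed

definition uinv :: "(complex^'n^'n) \<times> (complex^'n^'n) \<Rightarrow> (complex^'n^'n) \<times> (complex^'n^'n)" where
  "uinv h = (conj_transpose (fst h), conj_transpose (snd h))"

lemma uinv_unitary: "h \<in> unitary_pairs \<Longrightarrow> uinv h \<in> unitary_pairs"
  by (auto simp: uinv_def unitary_conj_transpose)

lemma umap_uinv:
  assumes "h \<in> unitary_pairs"
  shows "umap h (umap (uinv h) Z) = Z" "umap (uinv h) (umap h Z) = Z"
proof -
  obtain A B where h: "h = (A, B)" "A \<in> carrier unitary_group" "B \<in> carrier unitary_group"
    using assms by auto
  note u = unitary_matrix_inv unitary_conj_transpose
  have "umap h (umap (uinv h) Z) = conj_transpose A ** A ** Z ** (conj_transpose B ** B)"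
    using h by (simp add: umap_def uinv_def u matrix_mul_assoc)
  then show "umap h (umap (uinv h) Z) = Z" using h by (simp add: unitary_iff)
  have "umap (uinv h) (umap h Z) = A ** conj_transpose A ** Z ** (B ** conj_transpose B)"
    using h by (simp add: umap_def uinv_def u matrix_mul_assoc)
  then show "umap (uinv h) (umap h Z) = Z" using h by (simp add: unitary_right)
qed

lemma umap_in_cartan_domain_iff:
  "h \<in> unitary_pairs \<Longrightarrow> umap h Z \<in> cartan_domain \<longleftrightarrow> Z \<in> cartan_domain"
  by (metis umap_in_cartan_domain umap_uinv(2) uinv_unitary)

subsection \<open>The determinant of the defect\<close>

definition defect_det :: "complex^'n^'m \<Rightarrow> real" where
  "defect_det Z = Re (det (mat 1 - Z ** conj_transpose Z))"

lemma det_conj_transpose: "det (conj_transpose A) = cnj (det (A :: complex^'n^'n))"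
proof -
  have "det (conj_transpose A) = det (\<chi> i j. cnj (A $ i $ j))"
    by (subst det_transpose[symmetric]) (simp add: transpose_def conj_transpose_def)
  also have "\<dots> = cnj (det A)"
    by (simp add: det_def of_int_def)
  finally show ?thesis .
qed

lemma det_defect_real: "det (mat 1 - Z ** conj_transpose Z) = of_real (defect_det Z)"
proof -
  have "conj_transpose (mat 1 - Z ** conj_transpose Z) = mat 1 - Z ** conj_transpose Z"
    by (simp add: conj_transpose_diff conj_transpose_mult)
  then have "cnj (det (mat 1 - Z ** conj_transpose Z)) = det (mat 1 - Z ** conj_transpose Z)"
    by (metis det_conj_transpose)
  then show ?thesis unfolding defect_det_def
    by (metis Reals_cnj_iff of_real_Re)
qed

lemma continuous_defect_det: "continuous_on S (defect_det :: complex^'n^'m \<Rightarrow> real)"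
  unfolding defect_det_def det_def matrix_matrix_mult_def conj_transpose_def mat_def
  by (simp, intro continuous_intros)

lemma conj_transpose_in_cartan_domain:
  assumes Z: "Z \<in> cartan_domain" shows "conj_transpose Z \<in> cartan_domain"
proof -
  obtain k where k: "0 \<le> k" "k < 1" "\<And>v. norm (Z *v v) \<le> k * norm v"
    using cartan_domain_contraction[OF Z] by blast
  have "norm (conj_transpose Z *v v) < norm v" if v: "v \<noteq> 0" for v
  proof -
    let ?w = "conj_transpose Z *v v"
    have "norm ?w * norm ?w = ?w \<bullet> ?w" by (simp add: norm_eq_sqrt_inner)
    also have "\<dots> = v \<bullet> (Z *v ?w)" by (simp add: inner_conj_transpose)
    also have "\<dots> \<le> norm v * norm (Z *v ?w)" by (rule norm_cauchy_schwarz)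
    also have "\<dots> \<le> norm v * (k * norm ?w)" by (intro mult_left_mono k) auto
    finally have "norm ?w * norm ?w \<le> (k * norm v) * norm ?w" by (simp add: mult_ac)
    then have "norm ?w \<le> k * norm v" by (cases "norm ?w = 0") (use k in auto)
    also have "\<dots> < norm v" using k v by simp
    finally show ?thesis .
  qed
  then show ?thesis by (simp add: mem_cartan_domain)
qed

text \<open>The defect is invertible on the domain, so along the segment from \<open>0\<close> its determinant
  cannot change sign.\<close>

lemma defect_det_pos:
  assumes Z: "(Z :: complex^'n^'n) \<in> cartan_domain" shows "defect_det Z > 0"
proof (rule ccontr)
  assume neg: "\<not> defect_det Z > 0"
  have nz: "defect_det W \<noteq> 0" if W: "W \<in> cartan_domain" for W :: "complex^'n^'n"
  proof
    assume "defect_det W = 0"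
    then have "det (mat 1 - W ** conj_transpose W) = 0" by (simp add: det_defect_real)
    then have "\<not> invertible (mat 1 - W ** conj_transpose W)" by (simp add: invertible_det_nz)
    then obtain v where v: "v \<noteq> 0" "(mat 1 - W ** conj_transpose W) *v v = 0"
      by (metis invertible_left_inverse matrix_left_invertible_ker)
    then have "v = W *v (conj_transpose W *v v)"
      by (simp add: matrix_matrix_mult_diff_rdistrib matrix_vector_mul_assoc)
    then have "norm v \<le> norm (conj_transpose W *v v)"
      using cartan_domain_norm_le[OF W, of "conj_transpose W *v v"] by simp
    also have "\<dots> < norm v"
      using conj_transpose_in_cartan_domain[OF W] v by (simp add: mem_cartan_domain)
    finally show False by simp
  qed
  have "continuous_on {0..1} (\<lambda>t::real. defect_det (t *\<^sub>R Z))"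
    by (rule continuous_on_compose2[OF continuous_defect_det[of UNIV]]) (auto intro!: continuous_intros)
  moreover have "defect_det (0 *\<^sub>R Z) = 1"
    by (simp add: defect_det_def)
  ultimately obtain t where "0 \<le> t" "t \<le> 1" "defect_det (t *\<^sub>R Z) = 0"
    using IVT2'[of "\<lambda>t. defect_det (t *\<^sub>R Z)" 1 0 0] neg by fastforce
  moreover have "t *\<^sub>R Z \<in> cartan_domain"
    using calculation Z by (metis abs_of_nonneg mscale_in_cartan_domain mscale_of_real norm_of_real)
  ultimately show False using nz by blast
qed

lemma defect_det_umap: "h \<in> unitary_pairs \<Longrightarrow> defect_det (umap h Z) = defect_det Z"
proof -
  assume "h \<in> unitary_pairs"
  then obtain A B where h: "h = (A, B)" "A \<in> carrier unitary_group" "B \<in> carrier unitary_group"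
    by auto
  have *: "conj_transpose A ** A = mat 1" "B ** conj_transpose B = mat 1"
    using h by (auto simp: unitary_iff unitary_right)
  have "umap h Z ** conj_transpose (umap h Z)
      = conj_transpose A ** (Z ** (B ** conj_transpose B) ** conj_transpose Z) ** A"
    using h by (simp add: umap_def unitary_matrix_inv conj_transpose_mult matrix_mul_assoc)
  also have "\<dots> = conj_transpose A ** (Z ** conj_transpose Z) ** A" by (simp add: *)
  finally have "mat 1 - umap h Z ** conj_transpose (umap h Z)
      = conj_transpose A ** (mat 1 - Z ** conj_transpose Z) ** A"
    using * by (simp add: matrix_mult_diff matrix_mul_assoc)
  then have "det (mat 1 - umap h Z ** conj_transpose (umap h Z))
      = det (conj_transpose A) * det A * det (mat 1 - Z ** conj_transpose Z)"
    by (simp add: det_mul)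
  also have "det (conj_transpose A) * det A = 1"
    by (metis * det_I det_mul)
  finally show ?thesis by (simp add: defect_det_def)
qed

section \<open>Finiteness of the weighted volume\<close>

text \<open>A function \<open>u\<close> whose sublevel sets have mass \<open>O(\<epsilon>)\<close> has integrable powers \<open>u powr s\<close> for
  \<open>s > -1\<close>: compare with a geometric series over the dyadic shells
  \<open>2 ^ -(m + 1) < u \<le> 2 ^ -m\<close>.\<close>

lemma nn_integral_powr_finite:
  assumes "finite_measure M" and [measurable]: "u \<in> borel_measurable M"
    and pos: "AE x in M. 0 < u x"
    and lev: "\<And>e. 0 < e \<Longrightarrow> e \<le> 1 \<Longrightarrow> emeasure M {x\<in>space M. u x \<le> e} \<le> ennreal (C * e)"
    and C: "0 \<le> C" and s: "-1 < s" "s \<le> 0"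
  shows "(\<integral>\<^sup>+x. ennreal (u x powr s) \<partial>M) < \<infinity>"
proof -
  interpret finite_measure M by fact
  define a where "a m = (2::real) powr (- (real m + 1) * s)" for m :: nat
  let ?S = "\<lambda>m. {x\<in>space M. u x \<le> (1/2)^m}"
  have bnd: "ennreal (u x powr s) \<le> 1 + (\<Sum>m. ennreal (a m) * indicator (?S m) x)"
    if x: "x \<in> space M" "0 < u x" for x
  proof (cases "u x \<le> 1")
    case False
    then have "u x powr s \<le> 1"
      using s powr_mono[of s 0 "u x"] by simp
    then have "ennreal (u x powr s) \<le> 1" by simp
    then show ?thesis by (meson add_increasing2 order_trans zero_le)
  next
    case True
    have "\<exists>m. (1/2::real)^m < u x" using x(2) by (simp add: real_arch_pow_inv)
    then obtain m0 where m0: "(1/2)^m0 < u x" "\<And>m. m < m0 \<Longrightarrow> \<not> (1/2)^m < u x"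
      using exists_least_iff[of "\<lambda>m. (1/2::real)^m < u x"] by auto
    obtain m where m: "m0 = Suc m" using m0 True by (cases m0) auto
    have "u x powr s \<le> ((1/2)^Suc m) powr s"
      using s m0(1) m by (intro powr_mono2') auto
    also have "(1/2::real)^Suc m = 2 powr (- (real m + 1))"
      by (subst powr_minus, subst powr_realpow[symmetric, of "1/2"])
        (auto simp: powr_divide inverse_eq_divide add.commute)
    also have "(2 powr (- (real m + 1))) powr s = a m"
      by (simp only: a_def powr_powr)
    finally have "ennreal (u x powr s) \<le> ennreal (a m) * indicator (?S m) x"
      using m0(2)[of m] m x by (simp add: not_less ennreal_leI)
    also have "\<dots> \<le> (\<Sum>m. ennreal (a m) * indicator (?S m) x)"
      using sum_le_suminf[of "\<lambda>m. ennreal (a m) * indicator (?S m) x" "{m}"]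
      by (simp only: summableI sum.insert finite.emptyI empty_iff sum.empty add_0_right
          finite.insertI zero_le if_False not_False_eq_True)
    finally show ?thesis by (meson add_increasing order_trans zero_le)
  qed
  have "(\<integral>\<^sup>+x. ennreal (u x powr s) \<partial>M) \<le> (\<integral>\<^sup>+x. 1 + (\<Sum>m. ennreal (a m) * indicator (?S m) x) \<partial>M)"
    using pos by (intro nn_integral_mono_AE) (auto intro: bnd)
  also have "\<dots> = emeasure M (space M) + (\<Sum>m. ennreal (a m) * emeasure M (?S m))"
    by (subst nn_integral_add, measurable, subst nn_integral_suminf, measurable)
      (simp add: nn_integral_cmult_indicator)
  also have "\<dots> \<le> emeasure M (space M) + (\<Sum>m. ennreal (a m * (C * (1/2)^m)))"
  proof (intro add_left_mono suminf_le)
    fix m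
    have "emeasure M (?S m) \<le> ennreal (C * (1/2)^m)" by (rule lev) (auto simp: power_le_one)
    then show "ennreal (a m) * emeasure M (?S m) \<le> ennreal (a m * (C * (1/2)^m))"
      by (subst ennreal_mult') (auto simp: a_def intro!: mult_left_mono)
  qed auto
  also have "\<dots> < \<infinity>"
  proof -
    define r where "r = (2::real) powr (- (1 + s))"
    have r: "0 < r" "r < 1" using s powr_less_mono[of "-(1+s)" 0 2] by (auto simp: r_def)
    have eq: "a m * (C * (1/2)^m) = C * 2 powr (-s) * r ^ m" for m
    proof -
      have "(1/2::real)^m = 2 powr (- real m)"
        by (simp add: powr_minus powr_realpow power_one_over inverse_eq_divide)
      moreover have "r ^ m = 2 powr (- (1 + s) * real m)"
        using r(1) by (simp add: r_def powr_powr flip: powr_realpow)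
      ultimately show ?thesis
        by (simp add: a_def powr_add[symmetric] algebra_simps)
    qed
    have "(\<lambda>m. a m * (C * (1/2)^m)) sums (C * 2 powr (-s) * (1 / (1 - r)))"
      unfolding eq using r by (intro sums_mult geometric_sums) auto
    then have "(\<Sum>m. ennreal (a m * (C * (1/2)^m))) = ennreal (C * 2 powr (-s) * (1 / (1 - r)))"
      using C by (intro suminf_ennreal_eq) (auto simp: a_def)
    then show ?thesis by (simp add: less_top[symmetric] emeasure_finite)
  qed
  finally show ?thesis .
qed

text \<open>Row operations turn a rank one perturbation into the perturbation of a single row.\<close>

lemma det_rank_one_affine:
  fixes M :: "'a::field^'n^'n"
  shows "\<exists>b. \<forall>t. det (\<chi> i j. M $ i $ j - t * (z $ i * w $ j)) = det M + t * b"
proof (cases "z = 0")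
  case True then show ?thesis by (intro exI[of _ 0]) simp
next
  case False
  then obtain a where a: "z $ a \<noteq> 0" by (metis vec_eq_iff zero_index)
  define P :: "'a^'n^'n" where "P = (\<chi> i j. if j = a then z $ i / z $ a else if i = j then 1 else 0)"
  define R :: "'n \<Rightarrow> 'a^'n" where "R i = M $ i - (z $ i / z $ a) *s (M $ a)" for i
  define N where "N t = (\<chi> i. if i = a then M $ a + (- t * z $ a) *s w else R i)" for t
  have PN: "(\<chi> i j. M $ i $ j - t * (z $ i * w $ j)) = P ** N t" for t
  proof -
    have "(P ** N t) $ i $ j = M $ i $ j - t * (z $ i * w $ j)" for i j
    proof -
      have "(P ** N t) $ i $ j = P $ i $ a * N t $ a $ j + (\<Sum>l\<in>UNIV - {a}. P $ i $ l * N t $ l $ j)"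
        by (simp add: matrix_matrix_mult_def sum.remove)
      also have "(\<Sum>l\<in>UNIV - {a}. P $ i $ l * N t $ l $ j) = (if i = a then 0 else R i $ j)"
      proof -
        have "(\<Sum>l\<in>UNIV - {a}. P $ i $ l * N t $ l $ j) = (\<Sum>l\<in>UNIV - {a}. if i = l then R i $ j else 0)"
          by (intro sum.cong) (auto simp: P_def N_def)
        then show ?thesis by simp
      qed
      moreover have "P $ i $ a * N t $ a $ j = z $ i / z $ a * M $ a $ j - t * (z $ i * w $ j)"
        using a by (simp add: P_def N_def field_simps)
      ultimately show ?thesis using a by (simp add: R_def)
    qed
    then show ?thesis by (simp add: vec_eq_iff)
  qed
  have Nt: "det (N t) = det (N 0) + t * (- z $ a * det (\<chi> i. if i = a then w else R i))" for t
  proof -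
    have "det (N t) = det (\<chi> i. if i = a then M $ a else R i)
        + (- t * z $ a) * det (\<chi> i. if i = a then w else R i)" for t
      using det_row_add[of a "\<lambda>_. M $ a" "\<lambda>_. (- t * z $ a) *s w" R]
        det_row_mul[of a "- t * z $ a" "\<lambda>_. w" R]
      by (simp only: N_def)
    from this[of t] this[of 0] show ?thesis by simp
  qed
  have "M = P ** N 0" using PN[of 0] by (simp add: vec_eq_iff)
  then have "det M = det P * det (N 0)" by (metis det_mul)
  then have "\<forall>t. det (\<chi> i j. M $ i $ j - t * (z $ i * w $ j))
      = det M + t * (det P * (- z $ a * det (\<chi> i. if i = a then w else R i)))"
    unfolding PN det_mul by (subst Nt) (simp add: right_diff_distrib mult.left_commute)
  then show ?thesis by blast
qed

definition keep_columns :: "'n set \<Rightarrow> complex^'n^'m \<Rightarrow> complex^'n^'m" where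
  "keep_columns J Z = (\<chi> i j. if j \<in> J then Z $ i $ j else 0)"

definition scale_column :: "'n \<Rightarrow> real \<Rightarrow> complex^'n^'m \<Rightarrow> complex^'n^'m" where
  "scale_column k r Z = (\<chi> i j. if j = k then r *\<^sub>R Z $ i $ j else Z $ i $ j)"

lemma linear_keep_columns: "linear (keep_columns J)"
  by (rule linearI) (auto simp: keep_columns_def vec_eq_iff)

lemma linear_scale_column: "linear (scale_column k r)"
  by (rule linearI) (auto simp: scale_column_def vec_eq_iff algebra_simps)

lemma continuous_keep_columns: "continuous_on S (keep_columns J)"
  by (intro linear_continuous_on) (use linear_keep_columns linear_conv_bounded_linear in blast)

lemma keep_columns_in_domain:
  assumes K: "keep_columns K Z \<in> cartan_domain" "J \<subseteq> K" and r: "\<bar>r\<bar> \<le> 1"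
  shows "keep_columns J (scale_column k r (Z :: complex^'n^'n)) \<in> cartan_domain"
  unfolding mem_cartan_domain
proof (intro allI impI)
  fix v :: "complex^'n" assume v: "v \<noteq> 0"
  define w :: "complex^'n"
    where "w = (\<chi> j. if j \<in> J then if j = k then r *\<^sub>R v $ j else v $ j else 0)"
  have eq: "keep_columns J (scale_column k r Z) *v v = keep_columns K Z *v w"
    using K(2) by (auto simp: vec_eq_iff matrix_vector_mult_nth keep_columns_def scale_column_def w_def
        intro!: sum.cong)
  have "norm (w $ j) \<le> norm (v $ j)" for j
    using r by (auto simp: w_def mult_left_le_one_le)
  then have "norm w \<le> norm v" unfolding norm_vec_def by (intro L2_set_mono) auto
  moreover have "w \<noteq> 0 \<Longrightarrow> norm (keep_columns K Z *v w) < norm w"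
    using K(1) by (simp add: mem_cartan_domain)
  ultimately show "norm (keep_columns J (scale_column k r Z) *v v) < norm v"
    unfolding eq using v by (cases "w = 0") auto
qed

lemma scale_column_1 [simp]: "scale_column k 1 Z = Z"
  by (simp add: scale_column_def vec_eq_iff)

lemma keep_scale_column: "k \<notin> J \<Longrightarrow> keep_columns J (scale_column k r Z) = keep_columns J Z"
  by (auto simp: keep_columns_def scale_column_def vec_eq_iff)

text \<open>The part of \<open>1 - Z Z\<^sup>*\<close> that comes from column \<open>k\<close> has rank one.\<close>

lemma defect_det_scale_column:
  fixes Z :: "complex^'n^'n"
  assumes k: "k \<notin> J"
  shows "defect_det (keep_columns (insert k J) (scale_column k r Z))
     = (1 - r\<^sup>2) * defect_det (keep_columns J Z) + r\<^sup>2 * defect_det (keep_columns (insert k J) Z)"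
proof -
  define M where "M = mat 1 - keep_columns J Z ** conj_transpose (keep_columns J Z)"
  define z :: "complex^'n" where "z = column k Z"
  define w :: "complex^'n" where "w = (\<chi> i. cnj (z $ i))"
  have eq: "mat 1 - keep_columns (insert k J) (scale_column k r Z)
        ** conj_transpose (keep_columns (insert k J) (scale_column k r Z))
      = (\<chi> i j. M $ i $ j - of_real (r\<^sup>2) * (z $ i * w $ j))" for r
  proof -
    let ?K = "keep_columns (insert k J) (scale_column k r Z)"
    have "(\<Sum>l\<in>UNIV. ?K $ i $ l * cnj (?K $ j $ l))
        = (\<Sum>l\<in>UNIV. keep_columns J Z $ i $ l * cnj (keep_columns J Z $ j $ l))
          + of_real (r\<^sup>2) * (z $ i * w $ j)" for i j
    proof -
      have *: "(\<Sum>l\<in>UNIV - {k}. ?K $ i $ l * cnj (?K $ j $ l))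
          = (\<Sum>l\<in>UNIV - {k}. keep_columns J Z $ i $ l * cnj (keep_columns J Z $ j $ l))"
        by (intro sum.cong) (auto simp: keep_columns_def scale_column_def)
      show ?thesis
        using k unfolding sum.remove[OF finite UNIV_I[of k]] *
        by (simp add: keep_columns_def scale_column_def z_def w_def column_def power2_eq_square
            scaleR_conv_of_real)
    qed
    then show ?thesis
      by (simp add: vec_eq_iff M_def matrix_matrix_mult_def)
  qed
  obtain b where b: "\<And>t. det (\<chi> i j. M $ i $ j - t * (z $ i * w $ j)) = det M + t * b"
    using det_rank_one_affine[of M z w] by blast
  have D: "defect_det (keep_columns (insert k J) (scale_column k r Z)) = Re (det M) + r\<^sup>2 * Re b" for r
    unfolding defect_det_def eq b by simp
  have "defect_det (keep_columns J Z) = Re (det M)" by (simp add: defect_det_def M_def)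
  then show ?thesis using D[of r] D[of 1] by (simp add: algebra_simps)
qed

lemma lborel_scale_column:
  assumes r: "r \<noteq> 0"
  shows "lborel = density (distr lborel borel (scale_column k r :: complex^'n^'m \<Rightarrow> _))
    (\<lambda>_. ennreal (\<bar>r\<bar> ^ card {b \<in> (Basis :: (complex^'n^'m) set). column k b \<noteq> 0}))"
proof -
  let ?B = "Basis :: (complex^'n^'m) set"
  define c where "c b = (if column k b \<noteq> 0 then r else 1)" for b :: "complex^'n^'m"
  have sb: "scale_column k r b = c b *\<^sub>R b" if "b \<in> ?B" for b
  proof -
    obtain i l w where b: "b = axis i (axis l w)" "w \<in> Basis"
      using \<open>b \<in> ?B\<close> by (auto simp: Basis_vec_def)
    have "column k b \<noteq> 0 \<longleftrightarrow> l = k"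
      using b(2) by (auto simp: b(1) vec_eq_iff column_def axis_def)
    then show ?thesis
      by (auto simp: b(1) c_def scale_column_def vec_eq_iff axis_def)
  qed
  have "scale_column k r x = 0 + (\<Sum>j\<in>?B. (c j * (x \<bullet> j)) *\<^sub>R j)" for x
  proof -
    have "scale_column k r x = scale_column k r (\<Sum>j\<in>?B. (x \<bullet> j) *\<^sub>R j)"
      by (simp add: euclidean_representation)
    also have "\<dots> = (\<Sum>j\<in>?B. (x \<bullet> j) *\<^sub>R scale_column k r j)"
      by (simp add: linear_sum[OF linear_scale_column] linear_scale[OF linear_scale_column])
    finally show ?thesis by (simp add: sb mult.commute)
  qed
  then have sc: "(\<lambda>x. 0 + (\<Sum>j\<in>?B. (c j * (x \<bullet> j)) *\<^sub>R j)) = scale_column k r" by (simp add: fun_eq_iff)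
  have "c j \<noteq> 0" for j using r by (simp add: c_def)
  then have *: "lborel = density (distr lborel borel (scale_column k r :: complex^'n^'m \<Rightarrow> _)) (\<lambda>_. (\<Prod>j\<in>?B. \<bar>c j\<bar>))"
    using lborel_affine_euclidean[of c 0] unfolding sc by blast
  have "(\<Prod>j\<in>?B. \<bar>c j\<bar>) = (\<Prod>j\<in>?B. if column k j \<noteq> 0 then \<bar>r\<bar> else 1)"
    by (intro prod.cong) (auto simp: c_def)
  also have "\<dots> = \<bar>r\<bar> ^ card {b \<in> ?B. column k b \<noteq> 0}"
    by (simp add: prod.If_cases Int_def)
  finally show ?thesis using * by simp
qed

text \<open>The columns outside \<open>J\<close> are only confined to the unit ball. Thus the region is a bounded set with
  constant integrand for \<open>J = {}\<close>, it is the domain for \<open>J = UNIV\<close>, and it shrinks as \<open>J\<close> grows.\<close>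

definition column_region :: "'n set \<Rightarrow> (complex^'n^'n) set" where
  "column_region J = {Z. keep_columns J Z \<in> cartan_domain \<and> (\<forall>j. j \<notin> J \<longrightarrow> norm (column j Z) < 1)}"

lemma linear_column: "linear (column j :: complex^'n^'m \<Rightarrow> _)"
  by (rule linearI) (auto simp: column_def vec_eq_iff)

lemma open_column_region: "open (column_region J :: (complex^'n^'n) set)"
proof -
  have "continuous_on UNIV (\<lambda>Z :: complex^'n^'n. norm (column j Z))" for j
    by (intro continuous_on_norm linear_continuous_on)
      (use linear_column linear_conv_bounded_linear in blast)
  then have "open {Z :: complex^'n^'n. norm (column j Z) < 1}" for j
    by (intro open_Collect_less continuous_on_const)
  then have "open (\<Inter>j\<in>-J. {Z :: complex^'n^'n. norm (column j Z) < 1})"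
    by (intro open_INT) auto
  moreover have "open (keep_columns J -` cartan_domain :: (complex^'n^'n) set)"
    by (intro open_vimage open_cartan_domain continuous_keep_columns)
  ultimately have "open ((keep_columns J -` cartan_domain)
      \<inter> (\<Inter>j\<in>-J. {Z :: complex^'n^'n. norm (column j Z) < 1}))" by blast
  also have "\<dots> = column_region J" by (auto simp: column_region_def)
  finally show ?thesis .
qed

lemma column_region_insert:
  assumes "Z \<in> column_region (insert k J)" shows "Z \<in> column_region J"
proof -
  have K: "keep_columns (insert k J) Z \<in> cartan_domain" using assms by (simp add: column_region_def)
  have "keep_columns J Z \<in> cartan_domain"
    using keep_columns_in_domain[OF K, of J 1 k] by auto
  moreover have "norm (column k Z) < 1"
  proof -
    have "column k Z = keep_columns (insert k J) Z *v axis k 1"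
      by (simp add: vec_eq_iff column_def matrix_vector_mult_nth axis_def keep_columns_def
          if_distrib[of "\<lambda>x. _ * x"] if_distrib[of "\<lambda>x. x * _"] cong: if_cong)
    moreover have "axis k (1::complex) \<noteq> 0" by (simp add: axis_eq_0_iff)
    ultimately show ?thesis
      using K[unfolded mem_cartan_domain, rule_format, of "axis k 1"] by (simp add: norm_axis_1)
  qed
  ultimately show ?thesis using assms by (auto simp: column_region_def)
qed

lemma scale_column_in_region:
  assumes Z: "Z \<in> column_region (insert k J)" and r: "\<bar>r\<bar> \<le> 1"
  shows "scale_column k r Z \<in> column_region (insert k J)"
proof -
  have "keep_columns (insert k J) (scale_column k r Z) \<in> cartan_domain"
    using Z r by (intro keep_columns_in_domain[where K = "insert k J"]) (auto simp: column_region_def)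
  moreover have "column j (scale_column k r Z) = column j Z" if "j \<noteq> k" for j
    using that by (simp add: column_def scale_column_def)
  ultimately show ?thesis using Z by (auto simp: column_region_def)
qed

lemma borel_measurable_defect_det [measurable]: "defect_det \<in> borel_measurable borel"
  by (intro borel_measurable_continuous_onI continuous_defect_det)

lemma borel_measurable_keep_columns [measurable]: "keep_columns J \<in> borel_measurable borel"
  by (intro borel_measurable_continuous_onI continuous_keep_columns)

lemma borel_measurable_scale_column [measurable]: "scale_column k r \<in> borel_measurable borel"
  by (intro borel_measurable_continuous_onI linear_continuous_on)
    (use linear_scale_column linear_conv_bounded_linear in blast)

lemma sets_column_region [measurable]: "column_region J \<in> sets borel"
  using open_column_region by (rule borel_open)

text \<open>One column is added at a time. With the other columns fixed, the new factor of the determinant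
  is \<open>u = 1 - q\<close> with \<open>q\<close> homogeneous of degree 2 in the new column, so shrinking that column shows
  that the region \<open>u \<le> \<epsilon>\<close> carries at most a fraction \<open>O(\<epsilon>)\<close> of the mass.\<close>

lemma weighted_volume_insert_column:
  fixes J :: "'n::finite set"
  assumes k: "k \<notin> J" and s: "-1 < s" "s \<le> 0"
    and fin: "(\<integral>\<^sup>+Z. ennreal (defect_det (keep_columns J Z) powr s) * indicator (column_region J) Z \<partial>lborel) < \<infinity>"
  shows "(\<integral>\<^sup>+Z. ennreal (defect_det (keep_columns (insert k J) Z) powr s)
      * indicator (column_region (insert k J)) Z \<partial>lborel) < \<infinity>"
proof -
  let ?E = "column_region (insert k J) :: (complex^'n^'n) set"
  define F where "F Z = ennreal (defect_det (keep_columns J Z) powr s) * indicator ?E Z"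
    for Z :: "complex^'n^'n"
  have [measurable]: "F \<in> borel_measurable borel" unfolding F_def by measurable
  define u where "u Z = defect_det (keep_columns (insert k J) Z) / defect_det (keep_columns J Z)"
    for Z :: "complex^'n^'n"
  have [measurable]: "u \<in> borel_measurable borel" unfolding u_def by measurable
  define M where "M = density lborel F"
  have sM [measurable_cong, simp]: "sets M = sets borel" "space M = UNIV" by (auto simp: M_def)
  have emM: "emeasure M A = (\<integral>\<^sup>+Z. F Z * indicator A Z \<partial>lborel)" if "A \<in> sets borel" for A
    using that unfolding M_def by (subst emeasure_density) auto
  have pos: "defect_det (keep_columns J Z) > 0" "defect_det (keep_columns (insert k J) Z) > 0"
    if "Z \<in> ?E" for Z
    using that column_region_insert[OF that] by (auto simp: column_region_def defect_det_pos)
  have tot: "emeasure M UNIV < \<infinity>"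
  proof -
    have "emeasure M UNIV = (\<integral>\<^sup>+Z. F Z \<partial>lborel)" by (simp add: emM)
    also have "\<dots> \<le> (\<integral>\<^sup>+Z. ennreal (defect_det (keep_columns J Z) powr s) * indicator (column_region J) Z \<partial>lborel)"
      unfolding F_def by (intro nn_integral_mono) (auto simp: indicator_def column_region_insert)
    finally show ?thesis using fin by (rule order.strict_trans1)
  qed
  interpret M: finite_measure M by (rule finite_measureI) (use tot in auto)
  define I where "I = measure M UNIV"
  have I: "emeasure M UNIV = ennreal I" "0 \<le> I" unfolding I_def by (simp_all add: M.emeasure_eq_measure)
  define N where "N = card {b \<in> (Basis :: (complex^'n^'n) set). column k b \<noteq> 0}"
  have lev: "emeasure M {Z. u Z \<le> e} \<le> ennreal ((1 + real N) * I * e)" if e: "0 < e" "e \<le> 1" for e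
  proof (cases "e = 1")
    case True
    have "emeasure M {Z. u Z \<le> e} \<le> emeasure M UNIV" by (intro emeasure_mono) auto
    also have "\<dots> \<le> ennreal ((1 + real N) * I * e)"
      unfolding I(1) True using I(2) by (intro ennreal_leI) (simp add: algebra_simps)
    finally show ?thesis .
  next
    case False
    \<comment> \<open>Scaling the new column by \<open>r\<close> turns \<open>u\<close> into \<open>1 - r\<^sup>2 + r\<^sup>2 * u\<close>, which is more than \<open>e\<close>.\<close>
    define r where "r = sqrt (1 - e)"
    have r: "0 < r" "r \<le> 1" "r\<^sup>2 = 1 - e" using e False by (auto simp: r_def)
    have sub: "F Z \<le> F (scale_column k r Z) * indicator {Z. e < u Z} (scale_column k r Z)" for Z
    proof (cases "Z \<in> ?E")
      case True
      then have sZ: "scale_column k r Z \<in> ?E" using r by (intro scale_column_in_region) auto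
      have "u (scale_column k r Z) = (1 - r\<^sup>2) + r\<^sup>2 * u Z"
        using pos(1)[OF True] k
        by (simp add: u_def keep_scale_column defect_det_scale_column add_divide_distrib)
      moreover have "u Z > 0" using pos[OF True] by (simp add: u_def)
      moreover have "0 < 1 - e" using e False by simp
      ultimately have "e < u (scale_column k r Z)" using r(3) by simp
      then show ?thesis using True sZ k by (simp add: F_def keep_scale_column)
    qed (simp add: F_def)
    have lb: "density (distr lborel borel (scale_column k r :: complex^'n^'n \<Rightarrow> _)) (\<lambda>_. ennreal (\<bar>r\<bar> ^ N)) = lborel"
      unfolding N_def using r by (intro lborel_scale_column[symmetric]) simp
    have "ennreal (r ^ N) * emeasure M UNIV = ennreal (r ^ N) * (\<integral>\<^sup>+Z. F Z \<partial>lborel)"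
      by (simp add: emM)
    also have "\<dots> \<le> ennreal (r ^ N)
        * (\<integral>\<^sup>+Z. F (scale_column k r Z) * indicator {Z. e < u Z} (scale_column k r Z) \<partial>lborel)"
      by (intro mult_left_mono nn_integral_mono sub) auto
    also have "\<dots> = (\<integral>\<^sup>+Z. F Z * indicator {Z. e < u Z} Z \<partial>density
        (distr lborel borel (scale_column k r)) (\<lambda>_. ennreal (\<bar>r\<bar> ^ N)))"
      using r by (subst nn_integral_density, measurable, subst nn_integral_cmult, measurable,
          subst nn_integral_distr) auto
    also have "\<dots> = emeasure M {Z. e < u Z}"
      using r lb by (simp add: emM)
    finally have ge: "ennreal (r ^ N * I) \<le> emeasure M {Z. e < u Z}"
      using r I by (simp add: ennreal_mult)
    have "measure M {Z. u Z \<le> e} = I - measure M {Z. e < u Z}"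
      unfolding I_def using M.finite_measure_compl[of "{Z. e < u Z}"]
      by (simp add: Compl_eq_Diff_UNIV[symmetric] Collect_neg_eq[symmetric] not_less)
    moreover have "r ^ N * I \<le> measure M {Z. e < u Z}"
      using ge by (simp add: M.emeasure_eq_measure)
    moreover have "1 - r ^ N \<le> real N * e"
    proof -
      have "1 + real N * (r - 1) \<le> (1 + (r - 1)) ^ N"
        using r by (intro Bernoulli_inequality) auto
      moreover have "real N * (1 - r) \<le> real N * e"
      proof (intro mult_left_mono)
        have "r * r \<le> 1 * r" using r by (intro mult_right_mono) auto
        then show "1 - r \<le> e" using r(3) by (simp add: power2_eq_square)
      qed auto
      ultimately show ?thesis by (simp add: algebra_simps)
    qed
    then have "(1 - r ^ N) * I \<le> real N * e * I" using I(2) by (intro mult_right_mono)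
    ultimately have "measure M {Z. u Z \<le> e} \<le> (1 + real N) * I * e"
      using I(2) e by (simp add: algebra_simps add_increasing)
    then show ?thesis by (simp add: M.emeasure_eq_measure ennreal_leI)
  qed
  have "(\<integral>\<^sup>+Z. ennreal (u Z powr s) \<partial>M) < \<infinity>"
  proof (rule nn_integral_powr_finite[where C = "(1 + real N) * I"])
    show "finite_measure M" by (rule M.finite_measure_axioms)
    show "AE Z in M. 0 < u Z"
      unfolding M_def by (subst AE_density) (auto simp: F_def u_def pos indicator_def)
  qed (use lev I s in auto)
  also have "(\<integral>\<^sup>+Z. ennreal (u Z powr s) \<partial>M) = (\<integral>\<^sup>+Z. F Z * ennreal (u Z powr s) \<partial>lborel)"
    unfolding M_def by (subst nn_integral_density) auto
  also have "\<dots> = (\<integral>\<^sup>+Z. ennreal (defect_det (keep_columns (insert k J) Z) powr s) * indicator ?E Z \<partial>lborel)"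
  proof (rule nn_integral_cong)
    fix Z :: "complex^'n^'n"
    show "F Z * ennreal (u Z powr s) = ennreal (defect_det (keep_columns (insert k J) Z) powr s) * indicator ?E Z"
      using pos[of Z] by (auto simp: F_def u_def indicator_def ennreal_mult[symmetric] powr_divide)
  qed
  finally show ?thesis .
qed

text \<open>The exponents \<open>s > 0\<close> are left out because they need no induction: the integrand is then bounded.\<close>

lemma weighted_volume_finite_neg:
  assumes s: "-1 < s" "s \<le> 0"
  shows "(\<integral>\<^sup>+Z. ennreal (defect_det Z powr s) * indicator cartan_domain (Z :: complex^'n^'n) \<partial>lborel) < \<infinity>"
proof -
  have "(\<integral>\<^sup>+Z. ennreal (defect_det (keep_columns J Z) powr s)
      * indicator (column_region J) (Z :: complex^'n^'n) \<partial>lborel) < \<infinity>" for J :: "'n set"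
  proof (induction J rule: finite_induct[OF finite])
    case 1
    have "bounded (column_region {} :: (complex^'n^'n) set)"
      unfolding bounded_iff
    proof (intro exI ballI)
      fix Z :: "complex^'n^'n" assume Z: "Z \<in> column_region {}"
      have "norm (Z $ i $ j) \<le> 1" for i j
        using Z Finite_Cartesian_Product.norm_nth_le[of "column j Z" i]
        by (fastforce simp: column_region_def column_def intro: less_imp_le order.strict_trans1)
      then have "(\<Sum>j\<in>UNIV. \<Sum>i\<in>UNIV. norm (Z $ i $ j)) \<le> (\<Sum>j\<in>(UNIV::'n set). \<Sum>i\<in>(UNIV::'n set). 1)"
        by (intro sum_mono) auto
      then show "norm Z \<le> (\<Sum>j\<in>(UNIV::'n set). \<Sum>i\<in>(UNIV::'n set). 1)"
        using norm_le_columns[of Z] by linarith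
    qed
    then have "emeasure lborel (column_region {} :: (complex^'n^'n) set) < \<infinity>"
      by (rule emeasure_bounded_finite)
    moreover have "defect_det (keep_columns {} (Z :: complex^'n^'n)) = 1" for Z
    proof -
      have "keep_columns {} Z = 0" by (simp add: keep_columns_def vec_eq_iff)
      then show ?thesis by (simp add: defect_det_def)
    qed
    ultimately show ?case by simp
  next
    case (2 k J)
    then show ?case using weighted_volume_insert_column[OF _ s, of k J] by blast
  qed
  from this[of UNIV] show ?thesis
    by (simp add: column_region_def keep_columns_def)
qed

lemma weighted_volume_finite:
  assumes s: "-1 < s"
  shows "(\<integral>\<^sup>+Z. ennreal (defect_det Z powr s) * indicator cartan_domain (Z :: complex^'n^'n) \<partial>lborel) < \<infinity>"
proof (cases "s \<le> 0")
  case True then show ?thesis using s by (rule weighted_volume_finite_neg[rotated])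
next
  case False
  have "compact (closure (cartan_domain :: (complex^'n^'n) set))"
    using bounded_cartan_domain by simp
  then have "bounded (defect_det ` closure (cartan_domain :: (complex^'n^'n) set))"
    by (intro compact_imp_bounded compact_continuous_image continuous_defect_det)
  then obtain K where K: "\<And>Z. Z \<in> closure (cartan_domain :: (complex^'n^'n) set) \<Longrightarrow> norm (defect_det Z) \<le> K"
    by (auto simp: bounded_iff)
  have "(\<integral>\<^sup>+Z. ennreal (defect_det Z powr s) * indicator cartan_domain (Z :: complex^'n^'n) \<partial>lborel)
      \<le> (\<integral>\<^sup>+Z. ennreal (K powr s) * indicator cartan_domain (Z :: complex^'n^'n) \<partial>lborel)"
  proof (intro nn_integral_mono)
    fix Z :: "complex^'n^'n"
    show "ennreal (defect_det Z powr s) * indicator cartan_domain Z \<le> ennreal (K powr s) * indicator cartan_domain Z"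
    proof (cases "Z \<in> cartan_domain")
      case True
      then have "defect_det Z \<le> K" "0 < defect_det Z"
        using K[of Z] closure_subset[of cartan_domain] defect_det_pos[of Z] by auto
      then show ?thesis using False True by (auto intro!: ennreal_leI powr_mono2)
    qed simp
  qed
  also have "\<dots> = ennreal (K powr s) * emeasure lborel (cartan_domain :: (complex^'n^'n) set)"
    by (intro nn_integral_cmult_indicator) (simp add: borel_open[OF open_cartan_domain])
  also have "\<dots> < \<infinity>"
    using emeasure_bounded_finite[OF bounded_cartan_domain[where 'n = 'n]]
    by (simp add: ennreal_mult_less_top)
  finally show ?thesis .
qed

section \<open>The weighted measure\<close>

lemma lebesgue_distr_isometry:
  fixes f :: "'a::euclidean_space \<Rightarrow> 'a"
  assumes f: "orthogonal_transformation f"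
  shows "f \<in> measurable lebesgue lebesgue" "distr lebesgue lebesgue f = lebesgue"
proof -
  have [measurable]: "f \<in> borel_measurable borel"
    by (intro borel_measurable_continuous_onI linear_continuous_on)
      (use orthogonal_transformation_linear[OF f] linear_conv_bounded_linear in blast)
  have eq: "distr lebesgue lborel f = lborel"
  proof -
    have "distr lebesgue lborel f = distr lborel lborel f"
      by (rule distr_completion) simp
    also have "\<dots> = distr lborel borel f" by (rule distr_cong) auto
    finally show ?thesis using lborel_distr_isometry[OF f] by simp
  qed
  show m: "f \<in> measurable lebesgue lebesgue"
    by (rule completion.measurable_completion2) (simp_all add: eq measurable_completion)
  have "lebesgue = completion (distr lebesgue lborel f)" by (simp add: eq)
  also have "\<dots> = distr lebesgue lebesgue f"
    by (rule completion.completion_distr_eq) (simp_all add: eq measurable_completion)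
  finally show "distr lebesgue lebesgue f = lebesgue" by simp
qed

locale bergman =
  fixes lam :: real and dimtype :: "'n::finite itself"
  assumes lam: "lam > 2 * real CARD('n) - 1"
begin

abbreviation mu :: "(complex^'n^'n) measure" where "mu \<equiv> bergman_measure lam"

abbreviation dom :: "(complex^'n^'n) set" where "dom \<equiv> cartan_domain"

definition norm_const :: real where
  "norm_const = (THE c. c > 0 \<and>
     emeasure (weighted_measure lam c :: (complex^'n^'n) measure) cartan_domain = 1)"

definition weight :: "complex^'n^'n \<Rightarrow> real" where
  "weight Z = norm_const * defect_det Z powr (lam - 2 * real CARD('n))"

lemma sets_dom [measurable, simp]: "dom \<in> sets borel" "dom \<in> sets lebesgue"
  by (simp_all add: borel_open[OF open_cartan_domain])

lemma emeasure_weighted_measure: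
  assumes A: "A \<in> sets (lebesgue_on dom)" and c: "c \<ge> 0"
  shows "emeasure (weighted_measure lam c) A
    = (\<integral>\<^sup>+Z. ennreal (c * defect_det Z powr (lam - 2 * real CARD('n))) * indicator A Z \<partial>lebesgue)"
proof -
  have [measurable]: "defect_det \<in> borel_measurable (lebesgue_on dom)"
    by (intro measurable_restrict_space1 measurable_completion) simp
  have "emeasure (weighted_measure lam c) A
    = (\<integral>\<^sup>+Z. ennreal (c * defect_det Z powr (lam - 2 * real CARD('n))) * indicator A Z \<partial>lebesgue_on dom)"
    unfolding weighted_measure_def defect_det_def[symmetric]
    using A by (subst emeasure_density) auto
  also have "\<dots> = (\<integral>\<^sup>+Z. ennreal (c * defect_det Z powr (lam - 2 * real CARD('n))) * indicator A Z
      * indicator dom Z \<partial>lebesgue)"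
    by (subst nn_integral_restrict_space) auto
  also have "\<dots> = (\<integral>\<^sup>+Z. ennreal (c * defect_det Z powr (lam - 2 * real CARD('n))) * indicator A Z \<partial>lebesgue)"
    using A by (intro nn_integral_cong) (auto simp: indicator_def sets_restrict_space)
  finally show ?thesis .
qed

lemma norm_const:
  "norm_const > 0" "emeasure (weighted_measure lam norm_const) dom = 1"
proof -
  define I where "I = (\<integral>\<^sup>+Z. ennreal (defect_det Z powr (lam - 2 * real CARD('n))) * indicator dom Z \<partial>lborel)"
  have fin: "I < \<infinity>" unfolding I_def by (rule weighted_volume_finite) (use lam in simp)
  have pos: "I \<noteq> 0"
  proof
    assume "I = 0"
    then have "AE Z in lborel. ennreal (defect_det Z powr (lam - 2 * real CARD('n))) * indicator dom Z = 0"
      unfolding I_def by (subst (asm) nn_integral_0_iff_AE) measurable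
    then have "AE Z in lborel. Z \<notin> dom"
      by eventually_elim (use defect_det_pos in \<open>fastforce simp: indicator_def\<close>)
    then have "emeasure lborel dom = 0" by (subst (asm) AE_iff_measurable[where N = dom]) auto
    then have "dom \<in> null_sets lebesgue" by (intro null_sets_completionI null_setsI) auto
    then have "negligible dom" by (simp add: negligible_iff_null_sets)
    then show False
      using open_not_negligible[OF open_cartan_domain] zero_in_cartan_domain by blast
  qed
  obtain J where J: "I = ennreal J" "J > 0"
    using fin pos by (cases I) (auto simp: less_top[symmetric] ennreal_eq_0_iff not_le)
  have em: "emeasure (weighted_measure lam c) dom = ennreal (c * J)" if "c > 0" for c
  proof -
    have "emeasure (weighted_measure lam c) dom
      = (\<integral>\<^sup>+Z. ennreal (c * defect_det Z powr (lam - 2 * real CARD('n))) * indicator dom Z \<partial>lborel)"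
      using that by (subst emeasure_weighted_measure)
        (auto intro!: nn_integral_completion simp: sets_restrict_space)
    also have "\<dots> = (\<integral>\<^sup>+Z. ennreal c * (ennreal (defect_det Z powr (lam - 2 * real CARD('n)))
        * indicator dom Z) \<partial>lborel)"
      using that by (simp add: ennreal_mult mult.assoc)
    also have "\<dots> = ennreal c * I" unfolding I_def by (rule nn_integral_cmult) measurable
    finally show ?thesis using that J by (simp add: ennreal_mult)
  qed
  have "\<exists>!c. c > 0 \<and> emeasure (weighted_measure lam c :: (complex^'n^'n) measure) cartan_domain = 1"
  proof (rule ex1I[of _ "1 / J"])
    show "1 / J > 0 \<and> emeasure (weighted_measure lam (1 / J) :: (complex^'n^'n) measure) cartan_domain = 1"
      using J by (simp add: em)
    fix c assume "c > 0 \<and> emeasure (weighted_measure lam c :: (complex^'n^'n) measure) cartan_domain = 1"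
    then show "c = 1 / J" using em[of c] J by (simp add: field_simps)
  qed
  from theI'[OF this] show "norm_const > 0" "emeasure (weighted_measure lam norm_const) dom = 1"
    by (simp_all add: norm_const_def)
qed

lemma mu_eq: "mu = weighted_measure lam norm_const"
  by (simp add: bergman_measure_def norm_const_def)

lemma mu_density: "mu = density (lebesgue_on dom) (\<lambda>Z. ennreal (weight Z))"
  by (simp add: mu_eq weighted_measure_def weight_def defect_det_def)

lemma sets_mu [measurable_cong]: "sets mu = sets (lebesgue_on dom)"
  and space_mu [simp]: "space mu = dom"
  by (simp_all add: mu_density)

lemma emeasure_mu_space: "emeasure mu dom = 1"
  by (simp add: mu_eq norm_const)

lemma weight_pos: "Z \<in> dom \<Longrightarrow> weight Z > 0"
  using defect_det_pos[of Z] norm_const(1) by (simp add: weight_def)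

lemma continuous_on_weight: "continuous_on dom weight"
  unfolding weight_def using defect_det_pos
  by (intro continuous_intros continuous_on_powr continuous_defect_det) force+

lemma weight_measurable [measurable]: "weight \<in> borel_measurable borel"
  unfolding weight_def by measurable

lemma weight_measurable_dom [measurable]: "weight \<in> borel_measurable (lebesgue_on dom)"
  by (intro measurable_restrict_space1 measurable_completion) simp

sublocale mu: finite_measure mu
  by (rule finite_measureI) (simp add: emeasure_mu_space)

lemma measure_mu_space [simp]: "measure mu dom = 1"
  using emeasure_mu_space by (simp add: measure_def)

lemma AE_mu_iff: "(AE Z in mu. P Z) \<longleftrightarrow> (AE Z in lebesgue_on dom. P Z)"
proof -
  have "(AE Z in mu. P Z) \<longleftrightarrow> (AE Z in lebesgue_on dom. 0 < ennreal (weight Z) \<longrightarrow> P Z)"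
    unfolding mu_density by (rule AE_density) measurable
  also have "\<dots> \<longleftrightarrow> (AE Z in lebesgue_on dom. P Z)"
    by (rule AE_cong) (simp add: weight_pos)
  finally show ?thesis .
qed

lemma borel_measurable_mu_iff:
  "(f \<in> borel_measurable mu) \<longleftrightarrow> (f \<in> borel_measurable (lebesgue_on dom))"
  by (rule arg_cong[where f = "\<lambda>S. f \<in> S"]) (rule measurable_cong_sets[OF sets_mu refl])

lemma borel_measurable_mu_continuous:
  fixes f :: "complex^'n^'n \<Rightarrow> 'b::topological_space"
  assumes "continuous_on dom f"
  shows "f \<in> borel_measurable mu"
proof -
  have "f \<in> measurable (restrict_space borel dom) borel"
    using assms by (rule borel_measurable_continuous_on_restrict)
  then have "f \<in> measurable (lebesgue_on dom) borel"
    by (rule measurable_mono[THEN subsetD, rotated -1])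
      (auto simp: sets_restrict_space space_restrict_space intro!: image_mono)
  then show ?thesis by (simp add: borel_measurable_mu_iff)
qed

lemma borel_measurable_mu_borel:
  assumes "f \<in> borel_measurable borel" shows "f \<in> borel_measurable mu"
  unfolding borel_measurable_mu_iff
  by (intro measurable_restrict_space1 measurable_completion) (use assms in simp)

lemma emeasure_mu:
  assumes "A \<in> sets mu"
  shows "emeasure mu A = (\<integral>\<^sup>+Z. ennreal (weight Z) * indicator A Z \<partial>lebesgue)"
  using emeasure_weighted_measure[of A norm_const] norm_const assms
  by (simp add: mu_eq weight_def sets_mu[unfolded mu_eq])

subsection \<open>Symmetries of the measure\<close>

definition domain_isometry :: "(complex^'n^'n \<Rightarrow> complex^'n^'n) \<Rightarrow> bool" where
  "domain_isometry T \<longleftrightarrow> orthogonal_transformation T \<and>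
     (\<forall>Z. T Z \<in> dom \<longleftrightarrow> Z \<in> dom) \<and> (\<forall>Z. defect_det (T Z) = defect_det Z)"

lemma domain_isometry_umap: "h \<in> unitary_pairs \<Longrightarrow> domain_isometry (umap h)"
  by (simp add: domain_isometry_def orthogonal_transformation_umap umap_in_cartan_domain_iff
      defect_det_umap)

lemma domain_isometry_mscale:
  assumes c: "norm c = 1" shows "domain_isometry (mscale c)"
proof -
  have "mscale c Z ** conj_transpose (mscale c Z) = Z ** conj_transpose Z" for Z :: "complex^'n^'n"
  proof -
    have "c * cnj c = 1" using c by (metis complex_norm_square of_real_1 power_one)
    then have "(c * x) * (cnj c * y) = x * y" for x y
      by (metis mult.assoc mult.left_commute mult_1)
    then show ?thesis
      by (simp only: vec_eq_iff matrix_matrix_mult_def vec_lambda_beta mscale_nth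
          conj_transpose_nth complex_cnj_mult) simp
  qed
  moreover have "linear (mscale c :: complex^'n^'n \<Rightarrow> _)"
    using bounded_linear_mscale by (rule bounded_linear.linear)
  moreover have "mscale c Z \<in> dom \<longleftrightarrow> Z \<in> dom" for Z :: "complex^'n^'n"
    using c mscale_in_cartan_domain[of c Z] mscale_in_cartan_domain[of "inverse c" "mscale c Z"]
    by (cases "c = 0") (auto simp: norm_inverse)
  ultimately show ?thesis
    using c by (auto simp: domain_isometry_def orthogonal_transformation defect_det_def)
qed

lemma domain_isometry_measurable:
  assumes "domain_isometry T" shows "T \<in> measurable mu mu"
proof -
  have "T \<in> measurable lebesgue lebesgue"
    using assms lebesgue_distr_isometry(1) by (auto simp: domain_isometry_def)
  then have "T \<in> measurable (lebesgue_on dom) (lebesgue_on dom)"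
    using assms by (intro measurable_restrict_space3) (auto simp: domain_isometry_def)
  then show ?thesis by (simp add: measurable_cong_sets[OF sets_mu sets_mu])
qed

lemma domain_isometry_distr:
  assumes T: "domain_isometry T" shows "distr mu mu T = mu"
proof (rule measure_eqI)
  fix A assume "A \<in> sets (distr mu mu T)"
  then have A: "A \<in> sets mu" by simp
  then have AL: "A \<in> sets lebesgue" "A \<subseteq> dom"
    by (auto simp: sets_mu sets_restrict_space_iff)
  note m [measurable] = domain_isometry_measurable[OF T]
  have iso: "orthogonal_transformation T" using T by (simp add: domain_isometry_def)
  note L [measurable] = lebesgue_distr_isometry(1)[OF iso]
  have w: "weight (T Z) = weight Z" for Z using T by (simp add: domain_isometry_def weight_def)
  have [measurable]: "weight \<in> borel_measurable lebesgue" by (simp add: measurable_completion)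
  have "emeasure (distr mu mu T) A = emeasure mu (T -` A \<inter> dom)"
    using A m by (simp add: emeasure_distr)
  also have "\<dots> = (\<integral>\<^sup>+Z. ennreal (weight Z) * indicator (T -` A \<inter> dom) Z \<partial>lebesgue)"
    using measurable_sets[OF m A] by (intro emeasure_mu) simp
  also have "\<dots> = (\<integral>\<^sup>+Z. ennreal (weight (T Z)) * indicator A (T Z) \<partial>lebesgue)"
    using T AL by (intro nn_integral_cong) (auto simp: w indicator_def domain_isometry_def)
  also have "\<dots> = (\<integral>\<^sup>+Z. ennreal (weight Z) * indicator A Z \<partial>distr lebesgue lebesgue T)"
    using AL by (subst nn_integral_distr) auto
  also have "\<dots> = emeasure mu A"
    using A by (simp add: lebesgue_distr_isometry(2)[OF iso] emeasure_mu)
  finally show "emeasure (distr mu mu T) A = emeasure mu A" .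
qed simp

lemma integral_domain_isometry:
  fixes f :: "complex^'n^'n \<Rightarrow> 'b::{banach,second_countable_topology}"
  assumes T: "domain_isometry T" and f: "f \<in> borel_measurable mu"
  shows "(LINT Z|mu. f (T Z)) = (LINT Z|mu. f Z)"
  using integral_distr[OF domain_isometry_measurable[OF T] f] domain_isometry_distr[OF T] by simp

lemma integrable_domain_isometry:
  fixes f :: "complex^'n^'n \<Rightarrow> 'b::{banach,second_countable_topology}"
  assumes T: "domain_isometry T" and f: "f \<in> borel_measurable mu"
  shows "integrable mu (\<lambda>Z. f (T Z)) \<longleftrightarrow> integrable mu f"
  using integrable_distr_eq[OF domain_isometry_measurable[OF T] f] domain_isometry_distr[OF T] by simp

lemma AE_domain_isometry:
  assumes T: "domain_isometry T" and P: "AE Z in mu. P Z"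
  shows "AE Z in mu. P (T Z)"
proof -
  have "AE Z in distr mu mu T. P Z" unfolding domain_isometry_distr[OF T] by (rule P)
  then show ?thesis by (rule AE_distrD[OF domain_isometry_measurable[OF T]])
qed

subsection \<open>Comparison with Lebesgue measure\<close>

lemma weight_lower_bound:
  assumes "compact K" "K \<subseteq> dom"
  obtains d where "d > 0" "\<And>Z. Z \<in> K \<Longrightarrow> d \<le> weight Z"
proof (cases "K = {}")
  case False
  have "continuous_on K weight" using continuous_on_subset[OF continuous_on_weight assms(2)] .
  from continuous_attains_inf[OF assms(1) False this] obtain Z0 where
    "Z0 \<in> K" "\<And>Z. Z \<in> K \<Longrightarrow> weight Z0 \<le> weight Z" by blast
  then show ?thesis using that[of "weight Z0"] weight_pos assms(2) by blast
qed (use that[of 1] in auto)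

lemma AE_dom_continuous_zero:
  fixes f :: "complex^'n^'n \<Rightarrow> 'b::t1_space"
  assumes f: "continuous_on dom f" and ae: "AE Z in mu. f Z = c" and Z: "Z \<in> dom"
  shows "f Z = c"
proof (rule ccontr)
  assume "f Z \<noteq> c"
  define U where "U = {Z \<in> dom. f Z \<in> - {c}}"
  have "open U" unfolding U_def
    using f open_cartan_domain continuous_on_open_vimage[of dom f] 
    by (metis Collect_conj_eq Collect_mem_eq Int_commute open_Compl closed_singleton vimage_def)
  have U: "U \<subseteq> dom" "Z \<in> U" using Z \<open>f Z \<noteq> c\<close> by (auto simp: U_def)
  have "AE Z in lebesgue_on dom. Z \<notin> U"
    using ae unfolding AE_mu_iff by eventually_elim (auto simp: U_def)
  then have "AE Z in lebesgue. Z \<in> dom \<longrightarrow> Z \<notin> U"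
    by (subst (asm) AE_restrict_space_iff) auto
  then have "AE Z in lebesgue. Z \<notin> U" by eventually_elim (use U in auto)
  then have "U \<in> null_sets lebesgue"
    using \<open>open U\<close> by (subst AE_iff_null_sets) auto
  then have "negligible U" by (simp add: negligible_iff_null_sets)
  then show False using open_not_negligible[OF \<open>open U\<close>] U(2) by auto
qed

text \<open>Where the weight is at least \<open>d\<close>, the measure dominates \<open>d\<close> times Lebesgue measure. This transfers
  mean values over balls, which refer to Lebesgue measure, to the weighted measure.\<close>

lemma set_integral_lborel_le:
  fixes f :: "complex^'n^'n \<Rightarrow> complex"
  assumes S: "S \<in> sets borel" "S \<subseteq> dom" and d: "d > 0" "\<And>Z. Z \<in> S \<Longrightarrow> d \<le> weight Z"
    and f: "continuous_on dom f" "integrable mu f"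
  shows "set_integrable lborel S f"
    "norm (LINT Z:S|lborel. f Z) \<le> (LINT Z|mu. norm (f Z)) / d"
proof -
  have fS [measurable]: "(\<lambda>Z. indicator S Z *\<^sub>R f Z) \<in> borel_measurable borel"
  proof -
    have "f \<in> borel_measurable (restrict_space borel S)"
      using continuous_on_subset[OF f(1) S(2)] by (rule borel_measurable_continuous_on_restrict)
    then show ?thesis using S by (subst (asm) borel_measurable_restrict_space_iff) auto
  qed
  have "(\<integral>\<^sup>+Z. ennreal d * ennreal (norm (indicator S Z *\<^sub>R f Z)) \<partial>lborel)
      \<le> (\<integral>\<^sup>+Z. ennreal (norm (f Z)) \<partial>mu)"
  proof -
    have m: "f \<in> borel_measurable (lebesgue_on dom)"
      using borel_measurable_mu_continuous[OF f(1)] by (simp add: borel_measurable_mu_iff)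
    have "(\<integral>\<^sup>+Z. ennreal d * ennreal (norm (indicator S Z *\<^sub>R f Z)) \<partial>lborel)
      = (\<integral>\<^sup>+Z. ennreal d * ennreal (norm (indicator S Z *\<^sub>R f Z)) \<partial>lebesgue)"
      by (intro nn_integral_completion[symmetric]) measurable
    also have "\<dots> \<le> (\<integral>\<^sup>+Z. (ennreal (weight Z) * ennreal (norm (f Z))) * indicator dom Z \<partial>lebesgue)"
      using S d by (intro nn_integral_mono) (auto simp: indicator_def intro!: mult_right_mono ennreal_leI)
    also have "\<dots> = (\<integral>\<^sup>+Z. ennreal (weight Z) * ennreal (norm (f Z)) \<partial>lebesgue_on dom)"
      by (subst nn_integral_restrict_space) auto
    also have "\<dots> = (\<integral>\<^sup>+Z. ennreal (norm (f Z)) \<partial>mu)"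
      unfolding mu_density using m by (subst nn_integral_density) auto
    finally show ?thesis .
  qed
  also have mu_f: "(\<integral>\<^sup>+Z. ennreal (norm (f Z)) \<partial>mu) = ennreal (LINT Z|mu. norm (f Z))"
    using f(2) by (intro nn_integral_eq_integral) auto
  finally have le: "ennreal d * (\<integral>\<^sup>+Z. ennreal (norm (indicator S Z *\<^sub>R f Z)) \<partial>lborel)
      \<le> ennreal (LINT Z|mu. norm (f Z))"
    by (subst (asm) nn_integral_cmult) measurable
  then have fin: "(\<integral>\<^sup>+Z. ennreal (norm (indicator S Z *\<^sub>R f Z)) \<partial>lborel) < \<infinity>"
  proof -
    define X where "X = (\<integral>\<^sup>+Z. ennreal (norm (indicator S Z *\<^sub>R f Z)) \<partial>lborel)"
    have "X \<noteq> \<infinity>"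
    proof
      assume "X = \<infinity>"
      then have "ennreal d * X = \<infinity>" using d(1) by (simp add: ennreal_mult_top)
      then show False using le unfolding X_def[symmetric] by (simp add: top_unique)
    qed
    then show ?thesis by (simp add: X_def less_top)
  qed
  then show int: "set_integrable lborel S f"
    unfolding set_integrable_def by (intro integrableI_bounded) auto
  have "ennreal d * ennreal (LINT Z|lborel. norm (indicator S Z *\<^sub>R f Z)) \<le> ennreal (LINT Z|mu. norm (f Z))"
  proof -
    have "integrable lborel (\<lambda>Z. norm (indicator S Z *\<^sub>R f Z))"
      using int unfolding set_integrable_def by (rule integrable_norm)
    from nn_integral_eq_integral[OF this] le show ?thesis by simp
  qed
  then have "d * (LINT Z|lborel. norm (indicator S Z *\<^sub>R f Z)) \<le> (LINT Z|mu. norm (f Z))"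
    using d by (subst (asm) ennreal_mult'[symmetric]) (auto simp: ennreal_le_iff)
  moreover have "norm (LINT Z:S|lborel. f Z) \<le> (LINT Z|lborel. norm (indicator S Z *\<^sub>R f Z))"
    unfolding set_lebesgue_integral_def by (rule integral_norm_bound)
  ultimately show "norm (LINT Z:S|lborel. f Z) \<le> (LINT Z|mu. norm (f Z)) / d"
    using d(1) by (simp add: pos_le_divide_eq mult.commute) (meson mult_left_mono less_imp_le order_trans)
qed

end

section \<open>Holomorphic functions of a matrix\<close>

text \<open>Cauchy's inequality bounds the \<open>k\<close>-th Taylor term by \<open>M * (norm w / r) ^ k\<close>, so the remainder is at
  most a geometric series with ratio at most \<open>1/2\<close>.\<close>

lemma taylor_remainder_bound:
  fixes f :: "complex \<Rightarrow> complex"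
  assumes holf: "f holomorphic_on ball 0 r" and contf: "continuous_on (cball 0 r) f"
    and r: "0 < r" and M: "\<And>x. norm x = r \<Longrightarrow> norm (f x) \<le> M" and w: "norm w \<le> r / 2"
  shows "norm (f w - (\<Sum>k<m. (deriv ^^ k) f 0 / fact k * w ^ k)) \<le> 2 * M * (norm w / r) ^ m"
proof -
  define a where "a k = (deriv ^^ k) f 0 / fact k" for k
  have a: "norm (a k) \<le> M / r ^ k" for k
  proof -
    have "norm ((deriv ^^ k) f 0) \<le> fact k * M / r ^ k"
      by (rule Cauchy_inequality[OF holf contf r]) (use M in simp)
    then show ?thesis by (simp add: a_def norm_divide field_simps)
  qed
  have "M \<ge> 0" using a[of 0] order_trans[OF norm_ge_zero] by fastforce
  define q where "q = norm w / r"
  have q: "0 \<le> q" "q \<le> 1/2" using w r by (auto simp: q_def field_simps)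
  have "(\<lambda>k. a k * w ^ k) sums f w"
    using holomorphic_power_series[OF holf, of w] w r by (simp add: a_def)
  then have s: "(\<lambda>k. a (k + m) * w ^ (k + m)) sums (f w - (\<Sum>k<m. a k * w ^ k))"
    by (rule sums_split_initial_segment)
  have b: "norm (a (k + m) * w ^ (k + m)) \<le> M * q ^ m * q ^ k" for k
  proof -
    have "norm (a (k + m) * w ^ (k + m)) \<le> M / r ^ (k + m) * norm w ^ (k + m)"
      unfolding norm_mult norm_power by (intro mult_right_mono a) auto
    also have "\<dots> = M * q ^ m * q ^ k" by (simp add: q_def power_divide power_add mult_ac)
    finally show ?thesis .
  qed
  have g: "(\<lambda>k. M * q ^ m * q ^ k) sums (M * q ^ m * (1 / (1 - q)))"
    using q by (intro sums_mult geometric_sums) auto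
  have "norm (f w - (\<Sum>k<m. a k * w ^ k)) = norm (\<Sum>k. a (k + m) * w ^ (k + m))"
    using s by (simp add: sums_iff)
  also have "\<dots> \<le> (\<Sum>k. M * q ^ m * q ^ k)"
    by (rule norm_suminf_le[OF b]) (use g in \<open>simp add: sums_iff\<close>)
  also have "\<dots> = M * q ^ m * (1 / (1 - q))" using g by (simp add: sums_iff)
  also have "\<dots> \<le> M * q ^ m * 2"
    using q \<open>M \<ge> 0\<close> by (intro mult_left_mono) (auto simp: field_simps)
  finally show ?thesis by (simp add: a_def q_def mult_ac)
qed

text \<open>Continuity and holomorphy on complex lines together are equivalent to holomorphy (Osgood). In this form
  holomorphy is inherited from one complex variable by products, limits and Taylor coefficients.\<close>

definition line_holomorphic :: "(complex^'n^'n \<Rightarrow> complex) \<Rightarrow> (complex^'n^'n) set \<Rightarrow> bool" where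
  "line_holomorphic f S \<longleftrightarrow> continuous_on S f \<and>
    (\<forall>Z V. (\<lambda>t. f (Z + mscale t V)) holomorphic_on {t. Z + mscale t V \<in> S})"

lemma line_holomorphicD:
  assumes "line_holomorphic f S"
  shows "continuous_on S f" "(\<lambda>t. f (Z + mscale t V)) holomorphic_on {t. Z + mscale t V \<in> S}"
    "(\<lambda>t. f (mscale t V)) holomorphic_on {t. mscale t V \<in> S}"
  using assms by (auto simp: line_holomorphic_def dest: spec[of _ 0])

lemma continuous_on_line: "continuous_on A (\<lambda>t. Z + mscale t V)"
  by (intro continuous_intros)

lemma open_line: "open S \<Longrightarrow> open {t. Z + mscale t V \<in> S}"
  using open_vimage[of S "\<lambda>t. Z + mscale t V"] continuous_on_line by (auto simp: vimage_def)

lemma has_derivative_line: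
  "((\<lambda>t. Z + mscale t V) has_derivative (\<lambda>t. mscale t V)) F"
proof -
  have "((\<lambda>t. mscale t V) has_derivative (\<lambda>t. mscale t V)) F"
    by (rule bounded_linear_imp_has_derivative[OF bounded_linear_mscale_left])
  from has_derivative_add[OF has_derivative_const this, of Z] show ?thesis by simp
qed

lemma holomorphic_matrix_imp_line_holomorphic:
  assumes f: "holomorphic_matrix f S" and S: "open S"
  shows "line_holomorphic f S"
  unfolding line_holomorphic_def
proof (intro conjI allI)
  show "continuous_on S f"
    using f unfolding holomorphic_matrix_def continuous_on_eq_continuous_within
    by (blast intro: has_derivative_continuous)
  fix Z V :: "complex^'a^'a"
  show "(\<lambda>t. f (Z + mscale t V)) holomorphic_on {t. Z + mscale t V \<in> S}"
    unfolding holomorphic_on_def field_differentiable_def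
  proof (intro ballI)
    fix t assume t: "t \<in> {t. Z + mscale t V \<in> S}"
    then obtain f' where f': "(f has_derivative f') (at (Z + mscale t V) within S)"
      "\<And>c V. f' (\<chi> i j. c * V $ i $ j) = c * f' V"
      using f by (auto simp: holomorphic_matrix_def)
    have "(f has_derivative f') (at (Z + mscale t V))"
    proof -
      have "at (Z + mscale t V) within S = at (Z + mscale t V)"
        using t S by (intro at_within_open) auto
      then show ?thesis using f'(1) by metis
    qed
    then have "((\<lambda>t. f (Z + mscale t V)) has_derivative (\<lambda>h. f' (mscale h V)))
        (at t within {t. Z + mscale t V \<in> S})"
      by (rule has_derivative_compose[OF has_derivative_line])
    moreover have "f' (mscale h V) = f' V * h" for h
      using f'(2)[of h V] by (simp add: mscale_def mult.commute)
    ultimately show "\<exists>f'. ((\<lambda>t. f (Z + mscale t V)) has_field_derivative f')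
        (at t within {t. Z + mscale t V \<in> S})"
      by (auto simp: has_field_derivative_def mult_commute_abs)
  qed
qed

text \<open>Conversely, Cauchy's inequality on complex lines bounds the Taylor remainder by \<open>O(|V|\<^sup>2)\<close>
  uniformly in the direction \<open>V\<close>, so only additivity of the directional derivative is at stake. That
  follows by moving from \<open>Z\<close> first along \<open>W\<close> and then along \<open>V\<close>, since the derivative along \<open>V\<close> depends
  continuously on the base point.\<close>

lemma line_holomorphic_imp_holomorphic_matrix:
  fixes f :: "complex^'n^'n \<Rightarrow> complex"
  assumes f: "line_holomorphic f S" and S: "open S"
  shows "holomorphic_matrix f S"
  unfolding holomorphic_matrix_def
proof (intro ballI)
  fix Z assume "Z \<in> S"
  then obtain R0 where R0: "R0 > 0" "cball Z R0 \<subseteq> S" using S open_contains_cball by blast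
  define R where "R = R0 / 2"
  have R: "R > 0" "cball Z (2 * R) \<subseteq> S" using R0 by (auto simp: R_def)
  have cont: "continuous_on (cball Z (2 * R)) f"
    using continuous_on_subset[OF line_holomorphicD(1)[OF f] R(2)] .
  have "bounded (f ` cball Z (2 * R))"
    by (intro compact_imp_bounded compact_continuous_image cont) simp
  then obtain M where M: "\<And>W. W \<in> cball Z (2 * R) \<Longrightarrow> norm (f W) \<le> M"
    unfolding bounded_iff by blast
  have "M \<ge> 0" using M[of Z] R norm_ge_zero[of "f Z"] by (simp del: norm_ge_zero)
  have in_cb: "W + mscale t V \<in> cball Z (2 * R)" if "norm (W - Z) \<le> R" "norm t * norm V \<le> R" for W V t
  proof -
    have "norm (W + mscale t V - Z) \<le> norm (W - Z) + norm (mscale t V)"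
      by (metis add_diff_eq add.commute norm_triangle_ineq)
    then show ?thesis using that by (simp add: dist_norm norm_minus_commute)
  qed
  define L where "L W V = deriv (\<lambda>t. f (W + mscale t V)) 0" for W V
  have hol: "(\<lambda>t. f (W + mscale t V)) holomorphic_on cball 0 r"
    if "norm (W - Z) \<le> R" "r * norm V \<le> R" for W V r
  proof (rule holomorphic_on_subset[OF line_holomorphicD(2)[OF f]])
    show "cball 0 r \<subseteq> {t. W + mscale t V \<in> S}"
    proof
      fix t :: complex assume "t \<in> cball 0 r"
      then have "norm t * norm V \<le> r * norm V" by (intro mult_right_mono) auto
      then show "t \<in> {t. W + mscale t V \<in> S}" using in_cb[of W t V] that R by auto
    qed
  qed
  have rem: "norm (f (W + V) - f W - L W V) \<le> 2 * M * (norm V / R)\<^sup>2"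
    if W: "norm (W - Z) \<le> R" and V: "norm V \<le> R / 2" for W V
  proof (cases "V = 0")
    case True
    then show ?thesis by (simp add: L_def)
  next
    case False
    define r where "r = R / norm V"
    have r: "0 < r" "r * norm V = R" "1 \<le> r / 2" using False R V by (auto simp: r_def field_simps)
    have h: "(\<lambda>t. f (W + mscale t V)) holomorphic_on cball 0 r" using hol W r by simp
    have "norm (f (W + mscale 1 V) - (\<Sum>k<2. (deriv ^^ k) (\<lambda>t. f (W + mscale t V)) 0 / fact k * 1 ^ k))
        \<le> 2 * M * (norm (1::complex) / r)\<^sup>2"
    proof (rule taylor_remainder_bound)
      show "(\<lambda>t. f (W + mscale t V)) holomorphic_on ball 0 r"
        using h by (rule holomorphic_on_subset) auto
      show "continuous_on (cball 0 r) (\<lambda>t. f (W + mscale t V))"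
        using h by (rule holomorphic_on_imp_continuous_on)
      show "norm (f (W + mscale x V)) \<le> M" if "norm x = r" for x
        using that r W by (intro M in_cb) auto
    qed (use r in auto)
    then show ?thesis by (simp add: numeral_2_eq_2 L_def r_def algebra_simps)
  qed
  have rr: "R / (norm V + 1) > 0" "R / (norm V + 1) * norm V \<le> R" for V :: "complex^'n^'n"
  proof -
    have "norm V + 1 > 0" using norm_ge_zero[of V] by linarith
    then show "R / (norm V + 1) > 0" "R / (norm V + 1) * norm V \<le> R"
      using R(1) by (simp_all add: pos_divide_le_eq distrib_left)
  qed
  have scale: "L Z (mscale c V) = c * L Z V" for c V
  proof -
    define r where "r = R / (norm V + 1)"
    have r: "r > 0" "r * norm V \<le> R" using rr[of V] by (auto simp: r_def)
    have "(\<lambda>t. f (Z + mscale t V)) holomorphic_on ball 0 r"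
      by (rule holomorphic_on_subset[OF hol]) (use r R in auto)
    then have d: "((\<lambda>t. f (Z + mscale t V)) has_field_derivative L Z V) (at 0)"
      unfolding L_def using r by (intro holomorphic_derivI[of _ "ball 0 r"]) auto
    have "((\<lambda>t. f (Z + mscale (c * t) V)) has_field_derivative L Z V * c) (at 0)"
      using d by (intro DERIV_chain2[where f = "\<lambda>t. f (Z + mscale t V)" and g = "\<lambda>t. c * t"])
        (auto intro!: derivative_eq_intros)
    then show ?thesis by (simp add: L_def[of Z "mscale c V"] DERIV_imp_deriv mult.commute)
  qed
  have Lcont: "((\<lambda>s. L (Z + s *\<^sub>R W) V) \<longlongrightarrow> L Z V) (at_right (0::real))" for V W
  proof (rule tendstoI)
    fix e :: real assume e: "e > 0"
    define r where "r = R / (norm V + 1)"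
    have r: "r > 0" "r * norm V \<le> R" using rr[of V] by (auto simp: r_def)
    have "uniformly_continuous_on (cball Z (2 * R)) f"
      using cont by (rule compact_uniformly_continuous) simp
    then obtain d where d: "d > 0" "\<And>X Y. X \<in> cball Z (2 * R) \<Longrightarrow> Y \<in> cball Z (2 * R) \<Longrightarrow>
        dist Y X < d \<Longrightarrow> dist (f Y) (f X) < e * r / 2"
      using e r unfolding uniformly_continuous_on_def by (metis divide_pos_pos mult_pos_pos zero_less_numeral)
    have "dist (L (Z + s *\<^sub>R W) V) (L Z V) < e"
      if s: "0 < s" "s * norm W < min d R" for s
    proof -
      let ?W = "Z + s *\<^sub>R W"
      have W: "norm (?W - Z) \<le> R" using s by simp
      have h1: "(\<lambda>t. f (?W + mscale t V)) holomorphic_on cball 0 r"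
        and h2: "(\<lambda>t. f (Z + mscale t V)) holomorphic_on cball 0 r"
        using hol[of _ r V] W r R by auto
      have sub: "ball 0 r \<subseteq> cball (0::complex) r" by auto
      note b1 = holomorphic_on_subset[OF h1 sub] and b2 = holomorphic_on_subset[OF h2 sub]
      have "deriv (\<lambda>t. f (?W + mscale t V) - f (Z + mscale t V)) 0 = L ?W V - L Z V"
        unfolding L_def using r b1 b2
        by (intro deriv_diff) (auto intro: holomorphic_on_imp_differentiable_at)
      moreover have "norm ((deriv ^^ 1) (\<lambda>t. f (?W + mscale t V) - f (Z + mscale t V)) 0)
          \<le> fact 1 * (e * r / 2) / r ^ 1"
      proof (rule Cauchy_inequality)
        show "(\<lambda>t. f (?W + mscale t V) - f (Z + mscale t V)) holomorphic_on ball 0 r"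
          using b1 b2 by (rule holomorphic_on_diff)
        show "continuous_on (cball 0 r) (\<lambda>t. f (?W + mscale t V) - f (Z + mscale t V))"
          using holomorphic_on_diff[OF h1 h2] by (rule holomorphic_on_imp_continuous_on)
        fix x :: complex assume "norm (0 - x) = r"
        then have x: "norm x * norm V \<le> R" using r by simp
        have "dist (f (?W + mscale x V)) (f (Z + mscale x V)) < e * r / 2"
          using s x W R in_cb[of ?W x V] in_cb[of Z x V]
          by (intro d(2)) (auto simp: dist_norm)
        then show "norm (f (?W + mscale x V) - f (Z + mscale x V)) \<le> e * r / 2"
          by (simp add: dist_norm)
      qed (use r in auto)
      ultimately show ?thesis using r e by (simp add: dist_norm)
    qed
    moreover have "eventually (\<lambda>s. 0 < s \<and> s * norm W < min d R) (at_right (0::real))"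
    proof -
      have "((\<lambda>s::real. s * norm W) \<longlongrightarrow> 0 * norm W) (at_right 0)" by (intro tendsto_intros)
      then have "eventually (\<lambda>s. s * norm W < min d R) (at_right (0::real))"
        using d(1) R(1) by (intro order_tendstoD) auto
      then show ?thesis using eventually_at_right_less[of "0::real"] by eventually_elim simp
    qed
    ultimately show "eventually (\<lambda>s. dist (L (Z + s *\<^sub>R W) V) (L Z V) < e) (at_right (0::real))"
      by (metis (mono_tags, lifting) eventually_mono)
  qed
  have add: "L Z (V + W) = L Z V + L Z W" for V W
  proof -
    let ?N = "\<lambda>s. (f (Z + s *\<^sub>R W + s *\<^sub>R V) - f (Z + s *\<^sub>R W)) /\<^sub>R s"
    have quot: "((\<lambda>s. (f (X s + s *\<^sub>R Y) - f (X s)) /\<^sub>R s - L (X s) Y) \<longlongrightarrow> 0) (at_right (0::real))"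
      if X: "\<And>s. X s = Z \<or> X s = Z + s *\<^sub>R W" for X Y
    proof (rule Lim_null_comparison)
      show "((\<lambda>s. 2 * M * (norm Y / R)\<^sup>2 * s) \<longlongrightarrow> 0) (at_right (0::real))"
        by (auto intro!: tendsto_eq_intros)
      have l: "((\<lambda>s::real. s * norm W) \<longlongrightarrow> 0 * norm W) (at_right 0)"
        "((\<lambda>s::real. s * norm Y) \<longlongrightarrow> 0 * norm Y) (at_right 0)" by (intro tendsto_intros)+
      then have "eventually (\<lambda>s. s * norm W < R) (at_right (0::real))"
        "eventually (\<lambda>s. s * norm Y < R / 2) (at_right (0::real))"
        using order_tendstoD(2)[OF l(1), of R] order_tendstoD(2)[OF l(2), of "R / 2"] R(1) by auto
      then show "eventually (\<lambda>s. norm ((f (X s + s *\<^sub>R Y) - f (X s)) /\<^sub>R s - L (X s) Y)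
          \<le> 2 * M * (norm Y / R)\<^sup>2 * s) (at_right (0::real))"
        using eventually_at_right_less[of "0::real"]
      proof eventually_elim
        case (elim s)
        have Xs: "norm (X s - Z) \<le> R" using X[of s] elim R by auto
        have LX: "L (X s) (s *\<^sub>R Y) = s *\<^sub>R L (X s) Y"
        proof -
          define r where "r = R / (norm Y + 1)"
          have r: "r > 0" "r * norm Y \<le> R" using rr[of Y] by (auto simp: r_def)
          have "(\<lambda>t. f (X s + mscale t Y)) holomorphic_on ball 0 r"
            by (rule holomorphic_on_subset[OF hol]) (use r Xs in auto)
          then have d: "((\<lambda>t. f (X s + mscale t Y)) has_field_derivative L (X s) Y) (at 0)"
            unfolding L_def using r by (intro holomorphic_derivI[of _ "ball 0 r"]) auto
          have "((\<lambda>t. f (X s + mscale (of_real s * t) Y)) has_field_derivative L (X s) Y * of_real s) (at 0)"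
            using d by (intro DERIV_chain2[where f = "\<lambda>t. f (X s + mscale t Y)" and g = "\<lambda>t. of_real s * t"])
              (auto intro!: derivative_eq_intros)
          then have "deriv (\<lambda>t. f (X s + mscale (of_real s * t) Y)) 0 = L (X s) Y * of_real s"
            by (rule DERIV_imp_deriv)
          then have "L (X s) (mscale (of_real s) Y) = L (X s) Y * of_real s"
            by (simp only: L_def[of "X s" "mscale (of_real s) Y"] mscale_simps mult.commute)
          then show ?thesis
            by (simp add: mscale_of_real scaleR_conv_of_real[of s "L (X s) Y"] mult.commute)
        qed
        have "(f (X s + s *\<^sub>R Y) - f (X s)) /\<^sub>R s - L (X s) Y
            = (f (X s + s *\<^sub>R Y) - f (X s) - L (X s) (s *\<^sub>R Y)) /\<^sub>R s"
          unfolding LX scaleR_diff_right using elim by simp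
        then have "norm ((f (X s + s *\<^sub>R Y) - f (X s)) /\<^sub>R s - L (X s) Y)
            \<le> (2 * M * (norm (s *\<^sub>R Y) / R)\<^sup>2) / s"
          using rem[OF Xs, of "s *\<^sub>R Y"] elim
          by (simp only: norm_scaleR abs_inverse divide_inverse mult.commute[of "inverse _"])
            (simp add: mult_right_mono)
        also have "\<dots> = 2 * M * (norm Y / R)\<^sup>2 * s"
          using elim by (simp add: power2_eq_square)
        finally show ?case .
      qed
    qed
    have "((\<lambda>s. ((f (Z + s *\<^sub>R (V + W)) - f Z) /\<^sub>R s - L Z (V + W))
        - ((f (Z + s *\<^sub>R W + s *\<^sub>R V) - f (Z + s *\<^sub>R W)) /\<^sub>R s - L (Z + s *\<^sub>R W) V)
        - ((f (Z + s *\<^sub>R W) - f Z) /\<^sub>R s - L Z W)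
        - (L (Z + s *\<^sub>R W) V - L Z V)) \<longlongrightarrow> 0 - 0 - 0 - (L Z V - L Z V)) (at_right (0::real))"
      by (intro tendsto_diff quot Lcont tendsto_const) auto
    moreover have "((f (Z + s *\<^sub>R (V + W)) - f Z) /\<^sub>R s - L Z (V + W))
        - ((f (Z + s *\<^sub>R W + s *\<^sub>R V) - f (Z + s *\<^sub>R W)) /\<^sub>R s - L (Z + s *\<^sub>R W) V)
        - ((f (Z + s *\<^sub>R W) - f Z) /\<^sub>R s - L Z W)
        - (L (Z + s *\<^sub>R W) V - L Z V) = L Z V + L Z W - L Z (V + W)" for s
      by (simp add: algebra_simps)
    ultimately have "((\<lambda>s::real. L Z V + L Z W - L Z (V + W)) \<longlongrightarrow> 0) (at_right 0)" by simp
    then have "L Z V + L Z W - L Z (V + W) = 0"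
      by (simp add: tendsto_const_iff trivial_limit_at_right_real)
    then show ?thesis by simp
  qed
  have "linear (L Z)"
    using scale[of "of_real _"] by (intro linearI add) (simp add: mscale_of_real scaleR_conv_of_real)
  then have bl: "bounded_linear (L Z)" by (simp add: linear_conv_bounded_linear)
  have "(f has_derivative L Z) (at Z)"
    unfolding has_derivative_at
  proof (intro conjI bl)
    show "((\<lambda>h. norm (f (Z + h) - f Z - L Z h) / norm h) \<longlongrightarrow> 0) (at 0)"
    proof (rule Lim_null_comparison)
      show "((\<lambda>h::complex^'n^'n. 2 * M / R\<^sup>2 * norm h) \<longlongrightarrow> 0) (at 0)"
        by (intro tendsto_mult_right_zero tendsto_norm_zero tendsto_ident_at)
      have "eventually (\<lambda>h::complex^'n^'n. norm h < R / 2) (at 0)"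
        using R(1) order_tendstoD(2)[OF tendsto_norm_zero[OF tendsto_ident_at], of "R / 2"] by simp
      then show "eventually (\<lambda>h. norm (norm (f (Z + h) - f Z - L Z h) / norm h) \<le> 2 * M / R\<^sup>2 * norm h) (at 0)"
        using eventually_neq_at_within[of 0]
      proof eventually_elim
        case (elim h)
        then have "norm (f (Z + h) - f Z - L Z h) / norm h \<le> 2 * M * (norm h / R)\<^sup>2 / norm h"
          using rem[of Z h] R by (intro divide_right_mono) auto
        also have "\<dots> = 2 * M / R\<^sup>2 * norm h" using elim by (simp add: power2_eq_square)
        finally show ?case by simp
      qed
    qed
  qed
  then show "\<exists>f'. (f has_derivative f') (at Z within S) \<and>
      (\<forall>c V. f' (\<chi> i j. c * V $ i $ j) = c * f' V)"
    using scale by (intro exI[of _ "L Z"]) (auto simp: mscale_def has_derivative_at_withinI)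
qed

lemma holomorphic_matrix_iff: "open S \<Longrightarrow> holomorphic_matrix f S \<longleftrightarrow> line_holomorphic f S"
  using holomorphic_matrix_imp_line_holomorphic line_holomorphic_imp_holomorphic_matrix by blast

lemma line_holomorphic_subset: "line_holomorphic f S \<Longrightarrow> T \<subseteq> S \<Longrightarrow> line_holomorphic f T"
  unfolding line_holomorphic_def
  by (meson Collect_mono continuous_on_subset holomorphic_on_subset subsetD)

lemma line_holomorphic_add:
  "line_holomorphic f S \<Longrightarrow> line_holomorphic g S \<Longrightarrow> line_holomorphic (\<lambda>Z. f Z + g Z) S"
  by (auto simp: line_holomorphic_def intro: continuous_on_add holomorphic_on_add)

lemma line_holomorphic_mult:
  "line_holomorphic f S \<Longrightarrow> line_holomorphic g S \<Longrightarrow> line_holomorphic (\<lambda>Z. f Z * g Z) S"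
  by (auto simp: line_holomorphic_def intro: continuous_on_mult holomorphic_on_mult)

lemma line_holomorphic_const: "line_holomorphic (\<lambda>Z. c) S"
  by (simp add: line_holomorphic_def)

lemma line_holomorphic_sum:
  "(\<And>i. i \<in> I \<Longrightarrow> line_holomorphic (f i) S) \<Longrightarrow> line_holomorphic (\<lambda>Z. \<Sum>i\<in>I. f i Z) S"
  by (auto simp: line_holomorphic_def intro!: continuous_on_sum holomorphic_on_sum)

lemma line_holomorphic_cong:
  assumes "\<And>Z. Z \<in> S \<Longrightarrow> f Z = g Z"
  shows "line_holomorphic f S \<longleftrightarrow> line_holomorphic g S"
  unfolding line_holomorphic_def
  using assms by (intro conj_cong all_cong1 continuous_on_cong holomorphic_cong) auto

lemma line_holomorphic_compose_linear:
  assumes f: "line_holomorphic f S" and T: "linear T" "\<And>c Z. T (mscale c Z) = mscale c (T Z)"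
    and ST: "T ` S' \<subseteq> S"
  shows "line_holomorphic (\<lambda>Z. f (T Z)) S'"
  unfolding line_holomorphic_def
proof (intro conjI allI)
  have "continuous_on S' T"
    using T(1) by (intro linear_continuous_on) (simp add: linear_conv_bounded_linear)
  then show "continuous_on S' (\<lambda>Z. f (T Z))"
    by (rule continuous_on_compose2[OF line_holomorphicD(1)[OF f] _ ST])
  fix Z V
  have "(\<lambda>t. f (T Z + mscale t (T V))) holomorphic_on {t. Z + mscale t V \<in> S'}"
    by (rule holomorphic_on_subset[OF line_holomorphicD(2)[OF f]])
      (use ST T in \<open>auto simp: linear_add[OF T(1)] T(2)[symmetric]\<close>)
  then show "(\<lambda>t. f (T (Z + mscale t V))) holomorphic_on {t. Z + mscale t V \<in> S'}"
    by (simp add: linear_add[OF T(1)] T(2))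
qed

lemma line_holomorphic_translate:
  assumes f: "line_holomorphic f S" and ST: "(+) W ` S' \<subseteq> S"
  shows "line_holomorphic (\<lambda>Z. f (W + Z)) S'"
  unfolding line_holomorphic_def
proof (intro conjI allI)
  show "continuous_on S' (\<lambda>Z. f (W + Z))"
    using ST line_holomorphicD(1)[OF f]
    by (intro continuous_on_compose2[of S f S' "\<lambda>Z. W + Z"] continuous_intros) auto
  fix Z V
  have "(\<lambda>t. f ((W + Z) + mscale t V)) holomorphic_on {t. Z + mscale t V \<in> S'}"
    by (rule holomorphic_on_subset[OF line_holomorphicD(2)[OF f]])
      (use ST in \<open>auto simp: add.assoc\<close>)
  then show "(\<lambda>t. f (W + (Z + mscale t V))) holomorphic_on {t. Z + mscale t V \<in> S'}"
    by (simp add: add.assoc)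
qed

lemma line_holomorphic_linear:
  assumes g: "linear g" "\<And>c Z. g (mscale c Z) = c * g Z"
  shows "line_holomorphic g S"
  unfolding line_holomorphic_def
proof (intro conjI allI)
  show "continuous_on S g" using g(1) by (intro linear_continuous_on) (simp add: linear_conv_bounded_linear)
  fix Z V
  show "(\<lambda>t. g (Z + mscale t V)) holomorphic_on {t. Z + mscale t V \<in> S}"
    unfolding linear_add[OF g(1)] g(2) by (intro holomorphic_intros)
qed

lemma line_holomorphic_uniform_limit:
  assumes S: "open S" and f: "\<And>n. line_holomorphic (f n) S"
    and lim: "\<And>K. compact K \<Longrightarrow> K \<subseteq> S \<Longrightarrow> uniform_limit K f g sequentially"
  shows "line_holomorphic g S"
  unfolding line_holomorphic_def
proof (intro conjI allI)
  show "continuous_on S g"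
    unfolding continuous_on_eq_continuous_at[OF S]
  proof
    fix Z assume "Z \<in> S"
    then obtain e where e: "e > 0" "cball Z e \<subseteq> S" using S open_contains_cball by blast
    have "continuous_on (cball Z e) g"
    proof (rule uniform_limit_theorem)
      show "uniform_limit (cball Z e) f g sequentially" using e by (intro lim) auto
      show "\<forall>\<^sub>F n in sequentially. continuous_on (cball Z e) (f n)"
        using continuous_on_subset[OF line_holomorphicD(1)[OF f] e(2)] by simp
    qed simp
    then show "isCont g Z" using e(1) by (intro continuous_on_interior[of "cball Z e"]) auto
  qed
  fix Z V
  let ?T = "{t. Z + mscale t V \<in> S}"
  have "open ?T" using S by (rule open_line)
  show "(\<lambda>t. g (Z + mscale t V)) holomorphic_on ?T"
    unfolding holomorphic_on_def
  proof
    fix t0 assume "t0 \<in> ?T"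
    then obtain e where e: "e > 0" "cball t0 e \<subseteq> ?T" using \<open>open ?T\<close> open_contains_cball by blast
    have K: "compact ((\<lambda>t. Z + mscale t V) ` cball t0 e)"
      by (intro compact_continuous_image continuous_on_line) simp
    have "uniform_limit ((\<lambda>t. Z + mscale t V) ` cball t0 e) f g sequentially"
      using e by (intro lim K) auto
    then have ul: "uniform_limit (cball t0 e) (\<lambda>n t. f n (Z + mscale t V)) (\<lambda>t. g (Z + mscale t V)) sequentially"
      by (simp add: uniform_limit_iff)
    have hf: "(\<lambda>t. f n (Z + mscale t V)) holomorphic_on cball t0 e" for n
      using holomorphic_on_subset[OF line_holomorphicD(2)[OF f] e(2)] .
    have ev: "\<forall>\<^sub>F n in sequentially. continuous_on (cball t0 e) (\<lambda>t. f n (Z + mscale t V))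
        \<and> (\<lambda>t. f n (Z + mscale t V)) holomorphic_on ball t0 e"
      using holomorphic_on_imp_continuous_on[OF hf] holomorphic_on_subset[OF hf ball_subset_cball]
      by simp
    have "(\<lambda>t. g (Z + mscale t V)) holomorphic_on ball t0 e"
      by (rule holomorphic_uniform_limit[OF ev ul]) simp_all
    then have "(\<lambda>t. g (Z + mscale t V)) field_differentiable at t0"
      using e(1) by (auto intro: holomorphic_on_imp_differentiable_at)
    then show "(\<lambda>t. g (Z + mscale t V)) field_differentiable at t0 within ?T"
      by (rule field_differentiable_at_within)
  qed
qed

subsection \<open>Homogeneous expansions\<close>

text \<open>The region is the domain itself or a ball, the latter for mean values around other points.\<close>

locale circled_region =
  fixes S :: "(complex^'n^'n) set"
  assumes open_S: "open S" and bounded_S: "bounded S" and convex_S: "convex S" and zero_S: "0 \<in> S"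
    and circled: "\<And>c Z. norm c \<le> 1 \<Longrightarrow> Z \<in> S \<Longrightarrow> mscale c Z \<in> S"
begin

abbreviation shrink :: "real \<Rightarrow> (complex^'n^'n) set" where "shrink t \<equiv> (\<lambda>Z. t *\<^sub>R Z) ` S"

lemma closure_shrink:
  assumes t: "0 \<le> t" "t < 1" shows "closure (shrink t) \<subseteq> S"
proof -
  have "closure (shrink t) = (\<lambda>Z. t *\<^sub>R Z) ` closure S"
    using closure_scaleR[of t S] by simp
  moreover have "t *\<^sub>R Z \<in> S" if "Z \<in> closure S" for Z
  proof -
    have "Z - (1 - t) *\<^sub>R (Z - 0) \<in> interior S"
      using t that convex_S open_S zero_S
      by (intro mem_interior_closure_convex_shrink) (auto simp: interior_open)
    then show ?thesis using open_S by (simp add: interior_open algebra_simps)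
  qed
  ultimately show ?thesis by auto
qed

lemma shrink_subset: "0 \<le> t \<Longrightarrow> t < 1 \<Longrightarrow> shrink t \<subseteq> S"
  using order_trans[OF closure_subset closure_shrink[of t]] .

lemma in_shrink:
  assumes "Z \<in> S" obtains t U where "0 < t" "t < 1" "U \<in> S" "Z = t *\<^sub>R U"
proof -
  have "continuous_on UNIV (\<lambda>s::real. s *\<^sub>R Z)" by (intro continuous_intros)
  then have "open ((\<lambda>s::real. s *\<^sub>R Z) -` S)" using open_S by (intro open_vimage)
  moreover have "1 \<in> (\<lambda>s::real. s *\<^sub>R Z) -` S" using assms by simp
  ultimately obtain e where e: "e > 0" "ball 1 e \<subseteq> (\<lambda>s::real. s *\<^sub>R Z) -` S"
    using open_contains_ball by blast
  have "1 + e / 2 \<in> ball (1::real) e" using e by (simp add: dist_norm)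
  then have "(1 + e / 2) *\<^sub>R Z \<in> S" using e by blast
  then show ?thesis using e by (intro that[of "1 / (1 + e / 2)" "(1 + e / 2) *\<^sub>R Z"]) auto
qed

lemma bounded_on_shrink:
  assumes f: "continuous_on S f" and t: "0 \<le> t" "t < 1"
  obtains M where "0 \<le> M" "\<And>Z. Z \<in> shrink t \<Longrightarrow> norm (f Z :: complex) \<le> M"
proof -
  have "bounded (shrink t)" using bounded_S by (rule bounded_scaling)
  then have "compact (closure (shrink t))" by simp
  then have "bounded (f ` closure (shrink t))"
    by (intro compact_imp_bounded compact_continuous_image continuous_on_subset[OF f closure_shrink[OF t]])
  then obtain M where "\<And>Z. Z \<in> closure (shrink t) \<Longrightarrow> norm (f Z) \<le> M"
    unfolding bounded_iff by blast
  then show ?thesis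
    using that[of "max M 0"] closure_subset[of "shrink t"] by fastforce
qed

definition hom_part :: "nat \<Rightarrow> (complex^'n^'n \<Rightarrow> complex) \<Rightarrow> complex^'n^'n \<Rightarrow> complex" where
  "hom_part m f Z = (deriv ^^ m) (\<lambda>t. f (mscale t Z)) 0 / fact m"

lemma holomorphic_radial:
  assumes f: "line_holomorphic f S" and Z: "Z \<in> S"
  shows "(\<lambda>t. f (mscale t Z)) holomorphic_on cball 0 1"
  by (rule holomorphic_on_subset[OF line_holomorphicD(3)[OF f]]) (use Z in \<open>auto intro: circled\<close>)

lemma hom_part_sums:
  assumes f: "line_holomorphic f S" and Z: "Z \<in> S"
  shows "(\<lambda>m. hom_part m f Z) sums f Z"
proof -
  obtain t U where t: "0 < t" "t < 1" "U \<in> S" "Z = t *\<^sub>R U" using in_shrink[OF Z] .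
  have "(\<lambda>w. f (mscale w Z)) holomorphic_on ball 0 (1 / t)"
  proof (rule holomorphic_on_subset[OF line_holomorphicD(3)[OF f]])
    show "ball 0 (1 / t) \<subseteq> {w. mscale w Z \<in> S}"
    proof
      fix w :: complex assume "w \<in> ball 0 (1 / t)"
      then have "norm (w * of_real t) \<le> 1" using t by (simp add: norm_mult field_simps)
      then have "mscale (w * of_real t) U \<in> S" using t by (intro circled)
      moreover have "mscale w Z = mscale (w * of_real t) U"
        by (simp only: t(4) mscale_of_real[symmetric] mscale_simps)
      ultimately show "w \<in> {w. mscale w Z \<in> S}" by simp
    qed
  qed
  from holomorphic_power_series[OF this, of 1] t show ?thesis
    by (simp add: hom_part_def)
qed

lemma hom_part_homogeneous:
  assumes f: "line_holomorphic f S" and Z: "Z \<in> S" and c: "norm c \<le> 1"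
  shows "hom_part m f (mscale c Z) = c ^ m * hom_part m f Z"
proof -
  have "(deriv ^^ m) (\<lambda>w. f (mscale (c * w) Z)) 0 = c ^ m * (deriv ^^ m) (\<lambda>w. f (mscale w Z)) (c * 0)"
  proof (rule higher_deriv_compose_linear[where S = "ball 0 1" and T = "ball 0 1" and f = "\<lambda>w. f (mscale w Z)"])
    show "(\<lambda>w. f (mscale w Z)) holomorphic_on ball 0 1"
      using holomorphic_radial[OF f Z] by (rule holomorphic_on_subset) auto
    show "c * w \<in> ball 0 1" if "w \<in> ball 0 1" for w
    proof -
      have "norm c * norm w \<le> 1 * norm w" using c by (intro mult_right_mono) auto
      then show ?thesis using that by (simp add: norm_mult)
    qed
  qed auto
  then show ?thesis by (simp add: hom_part_def mult.commute)
qed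

lemma hom_part_bound:
  assumes f: "line_holomorphic f S" and Z: "Z \<in> S" and t: "0 < t" "t < 1"
    and M: "\<And>Z. Z \<in> shrink t \<Longrightarrow> norm (f Z) \<le> M"
  shows "norm (hom_part m f Z) \<le> M / t ^ m"
proof -
  have h: "(\<lambda>w. f (mscale w Z)) holomorphic_on cball 0 t"
    using holomorphic_radial[OF f Z] by (rule holomorphic_on_subset) (use t in auto)
  have "norm ((deriv ^^ m) (\<lambda>w. f (mscale w Z)) 0) \<le> fact m * M / t ^ m"
  proof (rule Cauchy_inequality)
    show "(\<lambda>w. f (mscale w Z)) holomorphic_on ball 0 t"
      using h by (rule holomorphic_on_subset) auto
    show "continuous_on (cball 0 t) (\<lambda>w. f (mscale w Z))"
      using h by (rule holomorphic_on_imp_continuous_on)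
    fix x :: complex assume "norm (0 - x) = t"
    then have x: "norm x = t" by simp
    have "mscale x Z = t *\<^sub>R mscale (x / of_real t) Z"
      using t by (simp add: mscale_of_real[symmetric])
    moreover have "mscale (x / of_real t) Z \<in> S" using Z x t by (intro circled) (auto simp: norm_divide)
    ultimately show "norm (f (mscale x Z)) \<le> M" by (intro M) auto
  qed (use t in auto)
  then show ?thesis by (simp add: hom_part_def norm_divide field_simps)
qed

text \<open>Each homogeneous part is a uniform limit of difference quotients of the lower ones.\<close>

lemma line_holomorphic_hom_part:
  assumes f: "line_holomorphic f S"
  shows "line_holomorphic (hom_part m f) S"
proof (induction m rule: less_induct)
  case (less m)
  obtain M where M: "0 \<le> M" "\<And>Z. Z \<in> shrink (1/2) \<Longrightarrow> norm (f Z) \<le> M"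
    using bounded_on_shrink[OF line_holomorphicD(1)[OF f], of "1/2"] by auto
  \<comment> \<open>The shift by \<open>4\<close> keeps \<open>w n\<close> within half the radius \<open>1/2\<close> at which the remainder is estimated.\<close>
  define w :: "nat \<Rightarrow> complex" where "w n = of_real (1 / (real n + 4))" for n :: nat
  have w: "w n \<noteq> 0" "norm (w n) = 1 / (real n + 4)" "norm (w n) \<le> 1/4" for n
  proof -
    show nw: "norm (w n) = 1 / (real n + 4)" unfolding w_def by (simp del: of_real_divide)
    show "norm (w n) \<le> 1/4" unfolding nw by (simp add: field_simps)
    show "w n \<noteq> 0" using nw by auto
  qed
  define q where "q n Z = (f (mscale (w n) Z) + (\<Sum>k<m. (- (w n ^ k)) * hom_part k f Z)) * (1 / w n ^ m)" for n :: nat and Z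
  have wS: "mscale (w n) ` S \<subseteq> S" for n
    using w(3)[of n] by (auto intro!: circled)
  have lq: "line_holomorphic (q n) S" for n
    unfolding q_def
    by (intro line_holomorphic_mult line_holomorphic_add line_holomorphic_sum line_holomorphic_const less
        line_holomorphic_compose_linear[OF f _ _ wS] bounded_linear.linear[OF bounded_linear_mscale])
      (auto simp: mult.commute)
  have bound: "norm (q n Z - hom_part m f Z) \<le> 2 * M * 2 ^ Suc m * (1 / (real n + 4))" if Z: "Z \<in> S" for n Z
  proof -
    have h: "(\<lambda>w. f (mscale w Z)) holomorphic_on cball 0 (1/2)"
      using holomorphic_radial[OF f Z] by (rule holomorphic_on_subset) auto
    have "norm (f (mscale (w n) Z) - (\<Sum>k<Suc m. (deriv ^^ k) (\<lambda>t. f (mscale t Z)) 0 / fact k * w n ^ k))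
        \<le> 2 * M * (norm (w n) / (1/2)) ^ Suc m"
    proof (rule taylor_remainder_bound)
      show "(\<lambda>w. f (mscale w Z)) holomorphic_on ball 0 (1/2)"
        using h by (rule holomorphic_on_subset) auto
      show "continuous_on (cball 0 (1/2)) (\<lambda>w. f (mscale w Z))"
        using h by (rule holomorphic_on_imp_continuous_on)
      fix x :: complex assume x: "norm x = 1/2"
      have "mscale x Z = (1/2) *\<^sub>R mscale (2 * x) Z"
        by (simp add: mscale_of_real[symmetric])
      moreover have "mscale (2 * x) Z \<in> S" using Z x by (intro circled) (auto simp: norm_mult)
      ultimately show "norm (f (mscale x Z)) \<le> M" by (intro M) auto
    qed (use w in auto)
    then have *: "norm (f (mscale (w n) Z) - (\<Sum>k<Suc m. hom_part k f Z * w n ^ k))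
        \<le> 2 * M * (2 * norm (w n)) ^ Suc m"
      by (simp add: hom_part_def mult.commute)
    have "q n Z - hom_part m f Z
        = (f (mscale (w n) Z) - (\<Sum>k<Suc m. hom_part k f Z * w n ^ k)) / w n ^ m"
    proof -
      have "(\<Sum>k<m. (- (w n ^ k)) * hom_part k f Z) = - (\<Sum>k<m. hom_part k f Z * w n ^ k)"
        by (simp add: sum_negf mult.commute)
      then show ?thesis using w(1)[of n] by (simp add: q_def add_divide_distrib diff_divide_distrib)
    qed
    then have "norm (q n Z - hom_part m f Z)
        = norm (f (mscale (w n) Z) - (\<Sum>k<Suc m. hom_part k f Z * w n ^ k)) / norm (w n) ^ m"
      by (simp only: norm_divide norm_power)
    also have "\<dots> \<le> (2 * M * (2 * norm (w n)) ^ Suc m) / norm (w n) ^ m"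
      using * by (rule divide_right_mono) simp
    also have "\<dots> = 2 * M * 2 ^ Suc m * norm (w n)"
      using w(1)[of n] by (simp add: power_mult_distrib)
    finally show ?thesis by (simp add: w(2))
  qed
  show ?case
  proof (rule line_holomorphic_uniform_limit[OF open_S lq])
    fix K assume K: "K \<subseteq> S"
    show "uniform_limit K q (hom_part m f) sequentially"
      unfolding uniform_limit_iff
    proof (intro allI impI)
      fix e :: real assume e: "e > 0"
      have "(\<lambda>n. 2 * M * 2 ^ Suc m * (1 / (real n + 4))) \<longlonglongrightarrow> 2 * M * 2 ^ Suc m * 0"
      proof (intro tendsto_intros)
        have "(\<lambda>n. 1 / real (n + 4)) \<longlonglongrightarrow> 0"
          using LIMSEQ_ignore_initial_segment[OF lim_1_over_n, of 4] by simp
        then show "(\<lambda>n. 1 / (real n + 4)) \<longlonglongrightarrow> 0" by simp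
      qed
      then have "\<forall>\<^sub>F n in sequentially. 2 * M * 2 ^ Suc m * (1 / (real n + 4)) < e"
        using e by (intro order_tendstoD) auto
      then show "\<forall>\<^sub>F n in sequentially. \<forall>Z\<in>K. dist (q n Z) (hom_part m f Z) < e"
      proof eventually_elim
        case (elim n)
        show ?case
        proof
          fix Z assume "Z \<in> K"
          then have "norm (q n Z - hom_part m f Z) \<le> 2 * M * 2 ^ Suc m * (1 / (real n + 4))"
            using K by (intro bound) auto
          then show "dist (q n Z) (hom_part m f Z) < e" using elim unfolding dist_norm by linarith
        qed
      qed
    qed
  qed
qed

lemma hom_part_summable_bound:
  assumes f: "line_holomorphic f S" and t: "0 < t" "t < 1"
  obtains b where "summable b" "\<And>m. 0 \<le> b m" "\<And>m Z. Z \<in> shrink t \<Longrightarrow> norm (hom_part m f Z) \<le> b m"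
proof -
  define s where "s = (t + 1) / 2"
  have s: "0 < s" "s < 1" "t < s" using t by (auto simp: s_def)
  obtain M where M: "0 \<le> M" "\<And>Z. Z \<in> shrink s \<Longrightarrow> norm (f Z) \<le> M"
    using bounded_on_shrink[OF line_holomorphicD(1)[OF f], of s] s by auto
  have "norm (hom_part m f Z) \<le> M * (t / s) ^ m" if Zt: "Z \<in> shrink t" for m Z
  proof -
    obtain U where U: "U \<in> S" "Z = t *\<^sub>R U" using Zt by blast
    have "hom_part m f Z = of_real t ^ m * hom_part m f U"
      using hom_part_homogeneous[OF f U(1), of "of_real t" m] t by (simp add: U mscale_of_real)
    then have "norm (hom_part m f Z) \<le> t ^ m * (M / s ^ m)"
      using mult_left_mono[OF hom_part_bound[OF f U(1) s(1,2) M(2), of m], of "t ^ m"] t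
      by (simp add: norm_mult norm_power)
    then show ?thesis by (simp add: power_divide mult.commute)
  qed
  moreover have "summable (\<lambda>m. M * (t / s) ^ m)"
    using s t by (intro summable_mult summable_geometric) auto
  ultimately show ?thesis using that[of "\<lambda>m. M * (t / s) ^ m"] M(1) s t by auto
qed

end

lemma circled_region_cartan_domain: "circled_region (cartan_domain :: (complex^'n^'n) set)"
  by unfold_locales (auto intro: open_cartan_domain bounded_cartan_domain convex_cartan_domain
      mscale_in_cartan_domain)

lemma circled_region_ball: "R > 0 \<Longrightarrow> circled_region (ball (0 :: complex^'n^'n) R)"
proof unfold_locales
  fix c :: complex and Z :: "complex^'n^'n" assume *: "norm c \<le> 1" "Z \<in> ball 0 R"
  then have "norm c * norm Z \<le> 1 * norm Z" by (intro mult_right_mono) auto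
  then show "mscale c Z \<in> ball 0 R" using * by simp
qed auto

section \<open>Function spaces with a semidefinite inner product\<close>

text \<open>Only semidefinite: a square integrable function that vanishes almost everywhere has norm \<open>0\<close>.\<close>

locale semi_inner =
  fixes V :: "('a \<Rightarrow> complex) set" and ip :: "('a \<Rightarrow> complex) \<Rightarrow> ('a \<Rightarrow> complex) \<Rightarrow> complex"
  assumes subspace_V: "cfun.subspace V"
    and ip_add: "f \<in> V \<Longrightarrow> g \<in> V \<Longrightarrow> h \<in> V \<Longrightarrow> ip (f + g) h = ip f h + ip g h"
    and ip_scale: "f \<in> V \<Longrightarrow> h \<in> V \<Longrightarrow> ip (cscale c f) h = c * ip f h"
    and ip_cnj: "f \<in> V \<Longrightarrow> g \<in> V \<Longrightarrow> ip g f = cnj (ip f g)"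
    and ip_pos: "f \<in> V \<Longrightarrow> 0 \<le> Re (ip f f)"
begin

lemma V_simps [simp, intro]:
  "0 \<in> V" "f \<in> V \<Longrightarrow> g \<in> V \<Longrightarrow> f + g \<in> V" "f \<in> V \<Longrightarrow> g \<in> V \<Longrightarrow> f - g \<in> V"
  "f \<in> V \<Longrightarrow> cscale c f \<in> V"
  using subspace_V cfun.subspace_0 cfun.subspace_add cfun.subspace_diff cfun.subspace_scale by blast+

lemma V_sum: "(\<And>i. i \<in> I \<Longrightarrow> u i \<in> V) \<Longrightarrow> (\<Sum>i\<in>I. u i) \<in> V"
  using subspace_V by (rule cfun.subspace_sum)

lemma ip_zero [simp]: "f \<in> V \<Longrightarrow> ip 0 f = 0" "f \<in> V \<Longrightarrow> ip f 0 = 0"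
proof -
  assume f: "f \<in> V"
  have "cscale 0 f = 0" by (simp add: cscale_def fun_eq_iff)
  then show "ip 0 f = 0" using ip_scale[OF f f, of 0] by simp
  then show "ip f 0 = 0" using ip_cnj[of 0 f] f by simp
qed

lemma ip_diff: "f \<in> V \<Longrightarrow> g \<in> V \<Longrightarrow> h \<in> V \<Longrightarrow> ip (f - g) h = ip f h - ip g h"
  using ip_add[of "f - g" g h] by simp

lemma ip_add_right: "f \<in> V \<Longrightarrow> g \<in> V \<Longrightarrow> h \<in> V \<Longrightarrow> ip h (f + g) = ip h f + ip h g"
  using ip_cnj[of "f + g" h] ip_cnj[of f h] ip_cnj[of g h] by (simp add: ip_add)

lemma ip_diff_right: "f \<in> V \<Longrightarrow> g \<in> V \<Longrightarrow> h \<in> V \<Longrightarrow> ip h (f - g) = ip h f - ip h g"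
  using ip_cnj[of "f - g" h] ip_cnj[of f h] ip_cnj[of g h] by (simp add: ip_diff)

lemma ip_scale_right: "f \<in> V \<Longrightarrow> h \<in> V \<Longrightarrow> ip h (cscale c f) = cnj c * ip h f"
  using ip_cnj[of "cscale c f" h] ip_cnj[of f h] by (simp add: ip_scale)

lemma ip_sum: "(\<And>i. i \<in> I \<Longrightarrow> u i \<in> V) \<Longrightarrow> h \<in> V \<Longrightarrow> ip (\<Sum>i\<in>I. u i) h = (\<Sum>i\<in>I. ip (u i) h)"
  by (induction I rule: infinite_finite_induct) (simp_all add: ip_add V_sum)

lemma ip_sum_right: "(\<And>i. i \<in> I \<Longrightarrow> u i \<in> V) \<Longrightarrow> h \<in> V \<Longrightarrow> ip h (\<Sum>i\<in>I. u i) = (\<Sum>i\<in>I. ip h (u i))"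
  by (induction I rule: infinite_finite_induct) (simp_all add: ip_add_right V_sum)

definition nrm :: "('a \<Rightarrow> complex) \<Rightarrow> real" where "nrm f = sqrt (Re (ip f f))"

lemma nrm_nonneg [simp]: "f \<in> V \<Longrightarrow> 0 \<le> nrm f"
  by (simp add: nrm_def ip_pos)

lemma nrm_sq: "f \<in> V \<Longrightarrow> (nrm f)\<^sup>2 = Re (ip f f)"
  by (simp add: nrm_def ip_pos)

lemma ip_self: "f \<in> V \<Longrightarrow> ip f f = of_real ((nrm f)\<^sup>2)"
  using ip_cnj[of f f] by (simp add: nrm_sq complex_eq_iff)

lemma nrm_sq_diff: "f \<in> V \<Longrightarrow> g \<in> V \<Longrightarrow> (nrm (f - g))\<^sup>2 = (nrm f)\<^sup>2 - 2 * Re (ip f g) + (nrm g)\<^sup>2"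
  using ip_cnj[of f g] by (simp add: nrm_sq ip_diff ip_diff_right)

lemma nrm_sq_add: "f \<in> V \<Longrightarrow> g \<in> V \<Longrightarrow> (nrm (f + g))\<^sup>2 = (nrm f)\<^sup>2 + 2 * Re (ip f g) + (nrm g)\<^sup>2"
  using ip_cnj[of f g] by (simp add: nrm_sq ip_add ip_add_right)

lemma nrm_cscale: "f \<in> V \<Longrightarrow> nrm (cscale c f) = norm c * nrm f"
proof -
  assume f: "f \<in> V"
  have "ip (cscale c f) (cscale c f) = of_real ((norm c)\<^sup>2 * (nrm f)\<^sup>2)"
  proof -
    have "ip (cscale c f) (cscale c f) = (c * cnj c) * ip f f"
      using f by (simp add: ip_scale ip_scale_right)
    then show ?thesis
      by (simp only: complex_norm_square[symmetric] ip_self[OF f] of_real_mult)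
  qed
  then have "(nrm (cscale c f))\<^sup>2 = (norm c * nrm f)\<^sup>2"
    using f by (simp add: nrm_sq power_mult_distrib)
  then show ?thesis using f by (simp add: power2_eq_iff_nonneg)
qed

lemma cauchy_schwarz:
  assumes f: "f \<in> V" and g: "g \<in> V" shows "norm (ip f g) \<le> nrm f * nrm g"
proof -
  define a where "a = ip f g"
  have main: "0 \<le> (nrm f)\<^sup>2 - 2 * t * (norm a)\<^sup>2 + t\<^sup>2 * (norm a)\<^sup>2 * (nrm g)\<^sup>2" for t :: real
  proof -
    have "ip f (cscale (of_real t * a) g) = of_real t * (a * cnj a)"
      using f g by (simp add: ip_scale_right a_def)
    then have "Re (ip f (cscale (of_real t * a) g)) = t * (norm a)\<^sup>2"
      unfolding complex_norm_square[symmetric] by (simp del: of_real_power)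
    moreover have "(nrm (cscale (of_real t * a) g))\<^sup>2 = t\<^sup>2 * (norm a)\<^sup>2 * (nrm g)\<^sup>2"
      using g by (simp add: nrm_cscale norm_mult power_mult_distrib)
    ultimately show ?thesis
      using nrm_sq_diff[OF f, of "cscale (of_real t * a) g"] g
        zero_le_power2[of "nrm (f - cscale (of_real t * a) g)"] by simp
  qed
  have "(norm a)\<^sup>2 \<le> (nrm f)\<^sup>2 * (nrm g)\<^sup>2"
  proof (cases "nrm g = 0")
    case True
    have "a = 0"
    proof (rule ccontr)
      assume "a \<noteq> 0"
      then have "2 * (((nrm f)\<^sup>2 + 1) / (2 * (norm a)\<^sup>2)) * (norm a)\<^sup>2 = (nrm f)\<^sup>2 + 1" by simp
      then show False using main[of "((nrm f)\<^sup>2 + 1) / (2 * (norm a)\<^sup>2)"] True by simp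
    qed
    then show ?thesis by simp
  next
    case False
    define s where "s = (nrm g)\<^sup>2"
    have s: "s > 0" using False by (simp add: s_def)
    have "(1 / s)\<^sup>2 * (norm a)\<^sup>2 * s = (norm a)\<^sup>2 / s" "2 * (1 / s) * (norm a)\<^sup>2 = 2 * ((norm a)\<^sup>2 / s)"
      using s by (simp_all add: power2_eq_square)
    then have "(norm a)\<^sup>2 / s \<le> (nrm f)\<^sup>2" using main[of "1 / s"] by (simp add: s_def[symmetric])
    then show ?thesis using s by (simp add: s_def[symmetric] pos_divide_le_eq)
  qed
  then have "(norm a)\<^sup>2 \<le> (nrm f * nrm g)\<^sup>2" by (simp add: power_mult_distrib)
  then have "norm a \<le> nrm f * nrm g" by (rule power2_le_imp_le) (simp add: f g)
  then show ?thesis by (simp add: a_def)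
qed

lemma nrm_triangle: "f \<in> V \<Longrightarrow> g \<in> V \<Longrightarrow> nrm (f + g) \<le> nrm f + nrm g"
proof -
  assume fg: "f \<in> V" "g \<in> V"
  have "Re (ip f g) \<le> nrm f * nrm g"
    using complex_Re_le_cmod[of "ip f g"] cauchy_schwarz[OF fg] by linarith
  then have "(nrm (f + g))\<^sup>2 \<le> (nrm f + nrm g)\<^sup>2"
    using fg by (simp add: nrm_sq_add power2_sum)
  then show ?thesis by (rule power2_le_imp_le) (simp add: fg)
qed

lemma nrm_minus_commute: "f \<in> V \<Longrightarrow> g \<in> V \<Longrightarrow> nrm (f - g) = nrm (g - f)"
proof -
  assume fg: "f \<in> V" "g \<in> V"
  have "f - g = cscale (-1) (g - f)" by (simp add: cscale_def fun_eq_iff)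
  then show ?thesis using fg nrm_cscale[of "g - f" "-1"] by simp
qed

lemma nrm_triangle_diff: "f \<in> V \<Longrightarrow> g \<in> V \<Longrightarrow> h \<in> V \<Longrightarrow> nrm (f - h) \<le> nrm (f - g) + nrm (g - h)"
  using nrm_triangle[of "f - g" "g - h"] by simp

definition complete_subspace :: "('a \<Rightarrow> complex) set \<Rightarrow> bool" where
  "complete_subspace W \<longleftrightarrow> (\<forall>X. (\<forall>n::nat. X n \<in> W) \<and>
      (\<forall>e>0. \<exists>N. \<forall>m\<ge>N. \<forall>n\<ge>N. nrm (X m - X n) < e) \<longrightarrow>
      (\<exists>g\<in>W. (\<lambda>n. nrm (X n - g)) \<longlonglongrightarrow> 0))"

text \<open>A minimizing sequence is Cauchy by the parallelogram law, and its limit is the projection.\<close>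

lemma projection_exists:
  assumes W: "W \<subseteq> V" "cfun.subspace W" "complete_subspace W" and f: "f \<in> V"
  shows "\<exists>g\<in>W. \<forall>h\<in>W. ip (f - g) h = 0"
proof -
  define d where "d = (INF h\<in>W. nrm (f - h))"
  have W0: "0 \<in> W" using W(2) by (rule cfun.subspace_0)
  have WV: "h \<in> V" if "h \<in> W" for h using that W(1) by blast
  have bdd: "bdd_below ((\<lambda>h. nrm (f - h)) ` W)"
    using f WV by (intro bdd_belowI2[of _ 0]) auto
  have d: "d \<le> nrm (f - h)" if "h \<in> W" for h
    unfolding d_def using that bdd by (rule cINF_lower[rotated])
  have d0: "0 \<le> d" unfolding d_def using W0 f WV by (intro cINF_greatest) auto
  have "\<exists>h\<in>W. nrm (f - h) < d + 1 / (real n + 1)" for n :: nat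
  proof -
    have "d < d + 1 / (real n + 1)" by simp
    then show ?thesis
      unfolding d_def using bdd W0 by (subst (asm) cINF_less_iff) (auto simp: d_def)
  qed
  then obtain X where X: "\<And>n. X n \<in> W" "\<And>n::nat. nrm (f - X n) < d + 1 / (real n + 1)" by metis
  note XV = WV[OF X(1)]
  have cau: "(nrm (X m - X n))\<^sup>2 \<le> (4 * d + 2) * (1 / (real m + 1) + 1 / (real n + 1))" for m n
  proof -
    define a b where "a = nrm (f - X m)" and "b = nrm (f - X n)"
    define p q where "p = 1 / (real m + 1)" and "q = 1 / (real n + 1)"
    have p: "0 < p" "p \<le> 1" "0 < q" "q \<le> 1" by (auto simp: p_def q_def)
    have ab: "0 \<le> a" "0 \<le> b" "a < d + p" "b < d + q"
      using X f XV by (auto simp: a_def b_def p_def q_def)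
    have mid: "cscale (1/2) (X m + X n) \<in> W"
      using W(2) X(1) by (intro cfun.subspace_scale cfun.subspace_add)
    have eq: "(f - X m) + (f - X n) = cscale 2 (f - cscale (1/2) (X m + X n))"
      by (simp add: cscale_def fun_eq_iff algebra_simps)
    have "2 * d \<le> nrm ((f - X m) + (f - X n))"
      unfolding eq using d[OF mid] f WV[OF mid] by (subst nrm_cscale) auto
    then have "(2 * d)\<^sup>2 \<le> (nrm ((f - X m) + (f - X n)))\<^sup>2" using d0 by (intro power_mono) auto
    moreover have "(nrm (X m - X n))\<^sup>2 + (nrm ((f - X m) + (f - X n)))\<^sup>2 = 2 * a\<^sup>2 + 2 * b\<^sup>2"
    proof -
      have "X m - X n = (f - X n) - (f - X m)" by simp
      then have "(nrm (X m - X n))\<^sup>2 = b\<^sup>2 - 2 * Re (ip (f - X n) (f - X m)) + a\<^sup>2"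
        using nrm_sq_diff[of "f - X n" "f - X m"] f XV by (simp add: a_def b_def)
      moreover have "Re (ip (f - X n) (f - X m)) = Re (ip (f - X m) (f - X n))"
        using ip_cnj[of "f - X m" "f - X n"] f XV by simp
      ultimately show ?thesis
        using nrm_sq_add[of "f - X m" "f - X n"] f XV by (simp add: a_def b_def)
    qed
    moreover have "a\<^sup>2 \<le> (d + p)\<^sup>2" "b\<^sup>2 \<le> (d + q)\<^sup>2" using ab by (auto intro: power_mono)
    moreover have "p\<^sup>2 \<le> p" "q\<^sup>2 \<le> q" using p by (auto simp: power2_eq_square mult_left_le)
    ultimately have "(nrm (X m - X n))\<^sup>2 \<le> 4 * d * p + 4 * d * q + 2 * p + 2 * q"
      by (simp add: power2_sum power_mult_distrib) 
    then show ?thesis unfolding p_def[symmetric] q_def[symmetric] by (simp add: algebra_simps)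
  qed
  have "\<exists>N. \<forall>m\<ge>N. \<forall>n\<ge>N. nrm (X m - X n) < e" if e: "e > 0" for e
  proof -
    obtain N :: nat where N: "(4 * d + 2) * 2 / e\<^sup>2 < real N" using reals_Archimedean2 by blast
    have "nrm (X m - X n) < e" if mn: "m \<ge> N" "n \<ge> N" for m n
    proof -
      have N1: "1 / (real m + 1) \<le> 1 / (real N + 1)" "1 / (real n + 1) \<le> 1 / (real N + 1)"
        using mn by (auto simp: frac_le)
      have "(nrm (X m - X n))\<^sup>2 \<le> (4 * d + 2) * (1 / (real N + 1) + 1 / (real N + 1))"
        using cau[of m n] N1 d0
        by (meson add_mono mult_left_mono order_trans add_nonneg_nonneg mult_nonneg_nonneg zero_le_numeral)
      also have "\<dots> = (4 * d + 2) * 2 / (real N + 1)" by (simp add: add_divide_distrib[symmetric])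
      also have "\<dots> < e\<^sup>2"
      proof -
        have "(4 * d + 2) * 2 < real N * e\<^sup>2" using N e by (simp add: pos_divide_less_eq)
        also have "\<dots> \<le> (real N + 1) * e\<^sup>2" by (intro mult_right_mono) auto
        finally show ?thesis by (simp add: pos_divide_less_eq mult.commute)
      qed
      finally show ?thesis by (rule power2_less_imp_less) (use e in simp)
    qed
    then show ?thesis by blast
  qed
  then obtain g where g: "g \<in> W" "(\<lambda>n. nrm (X n - g)) \<longlonglongrightarrow> 0"
    using W(3) X(1) unfolding complete_subspace_def by metis
  note gV = WV[OF g(1)]
  have "nrm (f - g) \<le> d"
  proof (rule LIMSEQ_le_const)
    have "(\<lambda>n. 1 / (real n + 1)) \<longlonglongrightarrow> 0"
      using LIMSEQ_inverse_real_of_nat by (simp add: inverse_eq_divide add.commute)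
    from tendsto_add[OF tendsto_add[OF tendsto_const[of d] this] g(2)]
    show "(\<lambda>n. d + 1 / (real n + 1) + nrm (X n - g)) \<longlonglongrightarrow> d" by simp
    have "nrm (f - g) \<le> d + 1 / (real n + 1) + nrm (X n - g)" for n
      using nrm_triangle_diff[OF f XV gV, of n] X(2)[of n] by linarith
    then show "\<exists>N. \<forall>n\<ge>N. nrm (f - g) \<le> d + 1 / (real n + 1) + nrm (X n - g)" by blast
  qed
  have "ip (f - g) h = 0" if h: "h \<in> W" for h
  proof (rule ccontr)
    assume ne: "ip (f - g) h \<noteq> 0"
    note hV = WV[OF h]
    define r where "r = f - g"
    have rV: "r \<in> V" using f gV by (simp add: r_def)
    define a where "a = ip r h"
    have a: "a \<noteq> 0" using ne by (simp add: a_def r_def)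
    have hn: "nrm h > 0"
      using cauchy_schwarz[OF rV hV] a nrm_nonneg[OF hV] by (cases "nrm h = 0") (auto simp: a_def)
    define c where "c = a / of_real ((nrm h)\<^sup>2)"
    have "ip r (cscale c h) = cnj c * a" using rV hV by (simp add: ip_scale_right a_def)
    also have "\<dots> = of_real ((norm a)\<^sup>2 / (nrm h)\<^sup>2)"
      by (simp add: c_def complex_norm_square mult.commute del: of_real_power)
    finally have "Re (ip r (cscale c h)) = (norm a)\<^sup>2 / (nrm h)\<^sup>2" by simp
    moreover have "(nrm (cscale c h))\<^sup>2 = (norm a)\<^sup>2 / (nrm h)\<^sup>2"
      using hV hn by (simp add: nrm_cscale c_def norm_divide norm_mult power2_eq_square)
    ultimately have "(nrm (r - cscale c h))\<^sup>2 = (nrm r)\<^sup>2 - (norm a)\<^sup>2 / (nrm h)\<^sup>2"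
      using nrm_sq_diff[OF rV, of "cscale c h"] hV by simp
    moreover have "(norm a)\<^sup>2 / (nrm h)\<^sup>2 > 0" using a hn by simp
    ultimately have "(nrm (r - cscale c h))\<^sup>2 < (nrm r)\<^sup>2" by linarith
    moreover have "d \<le> nrm (r - cscale c h)"
    proof -
      have "g + cscale c h \<in> W" using W(2) g(1) h by (intro cfun.subspace_add cfun.subspace_scale)
      from d[OF this] show ?thesis by (simp add: r_def diff_diff_eq)
    qed
    then have "(nrm r)\<^sup>2 \<le> (nrm (r - cscale c h))\<^sup>2"
      using \<open>nrm (f - g) \<le> d\<close> d0 rV by (intro power_mono) (auto simp: r_def)
    ultimately show False by simp
  qed
  then show ?thesis using g(1) by blast
qed

text \<open>The vectors are added one at a time; the component \<open>v\<close> of the new vector orthogonal to the old ones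
  adjusts the new equation without changing the others. Independence modulo vectors of norm \<open>0\<close> gives
  \<open>nrm v \<noteq> 0\<close>.\<close>

lemma gram_system_solvable:
  assumes I: "finite I" and u: "\<And>i. i \<in> I \<Longrightarrow> u i \<in> V"
    and indep: "\<And>c. nrm (\<Sum>i\<in>I. cscale (c i) (u i)) = 0 \<Longrightarrow> \<forall>i\<in>I. c i = 0"
  shows "\<exists>c. \<forall>m\<in>I. ip (\<Sum>i\<in>I. cscale (c i) (u i)) (u m) = t m"
  using I u indep
proof (induction I arbitrary: t rule: finite_induct)
  case empty
  then show ?case by simp
next
  case (insert k I)
  let ?x = "\<lambda>c. \<Sum>i\<in>I. cscale (c i) (u i)"
  have uV: "u i \<in> V" if "i \<in> I" for i using insert.prems(1) that by simp
  have ukV: "u k \<in> V" using insert.prems(1) by simp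
  have xV: "?x c \<in> V" for c using uV by (intro V_sum) auto
  have ind: "\<forall>i\<in>I. c i = 0" if "nrm (?x c) = 0" for c
  proof -
    have eq: "(\<Sum>i\<in>insert k I. cscale ((c(k := 0)) i) (u i)) = ?x c"
    proof -
      have "(\<Sum>i\<in>insert k I. cscale ((c(k := 0)) i) (u i)) = cscale 0 (u k) + (\<Sum>i\<in>I. cscale ((c(k := 0)) i) (u i))"
        using insert.hyps by simp
      also have "cscale 0 (u k) = 0" by (simp add: cscale_def fun_eq_iff)
      also have "(\<Sum>i\<in>I. cscale ((c(k := 0)) i) (u i)) = ?x c"
        using insert.hyps by (intro sum.cong) auto
      finally show ?thesis by simp
    qed
    have "\<forall>i\<in>insert k I. (c(k := 0)) i = 0" by (rule insert.prems(2)) (use that eq in simp)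
    moreover have "(c(k := 0)) i = c i" if "i \<in> I" for i using that insert.hyps by auto
    ultimately show ?thesis by (metis insertI2)
  qed
  note IH = insert.IH[OF uV ind]
  obtain e where e: "\<forall>m\<in>I. ip (?x e) (u m) = ip (u k) (u m)" using IH[of "\<lambda>m. ip (u k) (u m)"] by blast
  define v where "v = u k - ?x e"
  have vV: "v \<in> V" using ukV xV by (simp add: v_def)
  have v0: "ip v (u m) = 0" if "m \<in> I" for m
    using e that ukV xV uV by (simp add: v_def ip_diff)
  have vv: "ip v (u k) = of_real ((nrm v)\<^sup>2)"
  proof -
    have "ip v (?x e) = 0" using uV vV v0 by (subst ip_sum_right) (auto simp: ip_scale_right)
    moreover have "ip v (u k - ?x e) = ip v (u k) - ip v (?x e)" by (rule ip_diff_right[OF ukV xV vV])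
    ultimately have "ip v (u k) = ip v v" unfolding v_def[symmetric] by simp
    then show ?thesis using vV by (simp add: ip_self)
  qed
  have nv: "nrm v \<noteq> 0"
  proof
    assume "nrm v = 0"
    define c where "c i = (if i = k then 1 else - e i)" for i
    have "(\<Sum>i\<in>insert k I. cscale (c i) (u i)) = v"
    proof -
      have "(\<Sum>i\<in>I. cscale (c i) (u i)) = (\<Sum>i\<in>I. - cscale (e i) (u i))"
        using insert.hyps by (intro sum.cong) (auto simp: c_def cscale_def fun_eq_iff)
      moreover have "cscale (c k) (u k) = u k" by (simp add: c_def cscale_def)
      ultimately show ?thesis using insert.hyps by (simp add: v_def sum_negf)
    qed
    then have "\<forall>i\<in>insert k I. c i = 0" using insert.prems(2)[of c] \<open>nrm v = 0\<close> by simp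
    then show False by (simp add: c_def)
  qed
  obtain c0 where c0: "\<forall>m\<in>I. ip (?x c0) (u m) = t m" using IH[of t] by blast
  define \<alpha> where "\<alpha> = (t k - ip (?x c0) (u k)) / of_real ((nrm v)\<^sup>2)"
  define c where "c i = (if i = k then \<alpha> else c0 i - \<alpha> * e i)" for i
  have xc: "(\<Sum>i\<in>insert k I. cscale (c i) (u i)) = ?x c0 + cscale \<alpha> v"
  proof -
    have "(\<Sum>i\<in>I. cscale (c i) (u i)) = (\<Sum>i\<in>I. cscale (c0 i) (u i) - cscale \<alpha> (cscale (e i) (u i)))"
      using insert.hyps by (intro sum.cong) (auto simp: c_def cscale_def fun_eq_iff algebra_simps)
    also have "\<dots> = ?x c0 - cscale \<alpha> (?x e)"
      by (simp add: sum_subtractf cfun.scale_sum_right)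
    finally show ?thesis
      using insert.hyps by (simp add: c_def v_def cfun.scale_right_diff_distrib)
  qed
  have "ip (\<Sum>i\<in>insert k I. cscale (c i) (u i)) (u m) = t m" if "m \<in> insert k I" for m
  proof (cases "m = k")
    case True
    then show ?thesis
      unfolding xc using ukV vV xV nv by (simp add: ip_add ip_scale vv \<alpha>_def)
  next
    case False
    then have "m \<in> I" using that by simp
    then show ?thesis
      unfolding xc using uV vV xV c0 v0 by (simp add: ip_add ip_scale)
  qed
  then show ?case by blast
qed

definition orthonormal :: "('a \<Rightarrow> complex) set \<Rightarrow> bool" where
  "orthonormal E \<longleftrightarrow> E \<subseteq> V \<and> (\<forall>e\<in>E. \<forall>e'\<in>E. ip e e' = (if e = e' then 1 else 0))"

definition proj :: "('a \<Rightarrow> complex) set \<Rightarrow> ('a \<Rightarrow> complex) \<Rightarrow> 'a \<Rightarrow> complex" where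
  "proj E f = (\<Sum>e\<in>E. cscale (ip f e) e)"

lemma span_subset_V: "E \<subseteq> V \<Longrightarrow> cfun.span E \<subseteq> V"
  using subspace_V by (rule cfun.span_minimal[rotated])

lemma proj_in_span: "proj E f \<in> cfun.span E"
  unfolding proj_def by (intro cfun.span_sum cfun.span_scale cfun.span_base)

lemma proj_orthogonal:
  assumes E: "finite E" "orthonormal E" and f: "f \<in> V" and h: "h \<in> cfun.span E"
  shows "ip (f - proj E f) h = 0"
proof -
  have EV: "E \<subseteq> V" using E by (simp add: orthonormal_def)
  have pV: "proj E f \<in> V" using proj_in_span span_subset_V[OF EV] by blast
  have base: "ip (f - proj E f) e = 0" if e: "e \<in> E" for e
  proof -
    have "ip (proj E f) e = (\<Sum>e'\<in>E. ip f e' * ip e' e)"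
      unfolding proj_def using EV e by (subst ip_sum) (auto simp: ip_scale subset_iff)
    also have "\<dots> = (\<Sum>e'\<in>E. if e' = e then ip f e' else 0)"
      using E e by (intro sum.cong) (auto simp: orthonormal_def)
    also have "\<dots> = ip f e" using E e by simp
    finally show ?thesis using f pV EV e by (simp add: ip_diff subset_iff)
  qed
  have "cfun.span E \<subseteq> {h \<in> V. ip (f - proj E f) h = 0}"
  proof (rule cfun.span_minimal)
    show "cfun.subspace {h \<in> V. ip (f - proj E f) h = 0}"
      using f pV by (simp add: cfun.subspace_def ip_add_right ip_scale_right)
  qed (use EV base in auto)
  then show ?thesis using h by blast
qed

lemma orthonormal_basis_exists:
  assumes B: "finite B" "B \<subseteq> V" and def: "\<And>f. f \<in> cfun.span B \<Longrightarrow> nrm f = 0 \<Longrightarrow> f = 0"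
  shows "\<exists>E. finite E \<and> orthonormal E \<and> cfun.span E = cfun.span B"
  using B def
proof (induction B rule: finite_induct)
  case empty
  then show ?case by (intro exI[of _ "{}"]) (simp add: orthonormal_def)
next
  case (insert b B)
  have sub: "cfun.span B \<subseteq> cfun.span (insert b B)" by (intro cfun.span_mono) auto
  have "\<exists>E. finite E \<and> orthonormal E \<and> cfun.span E = cfun.span B"
  proof (rule insert.IH)
    show "B \<subseteq> V" using insert.prems(1) by simp
    show "f = 0" if "f \<in> cfun.span B" "nrm f = 0" for f using insert.prems(2)[of f] that sub by blast
  qed
  then obtain E where E: "finite E" "orthonormal E" "cfun.span E = cfun.span B" by blast
  have EV: "E \<subseteq> V" using E by (simp add: orthonormal_def)
  define v where "v = b - proj E b"
  have bV: "b \<in> V" using insert.prems by simp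
  have pV: "proj E b \<in> V" using proj_in_span span_subset_V[OF EV] by blast
  have vV: "v \<in> V" using bV pV by (simp add: v_def)
  have span_b: "cfun.span (insert b E) = cfun.span (insert b B)"
    using E(3) by (simp add: cfun.span_insert)
  show ?case
  proof (cases "v = 0")
    case True
    then have "b \<in> cfun.span E" using proj_in_span[of E b] by (simp add: v_def)
    then have "cfun.span E = cfun.span (insert b B)" using span_b by (simp add: cfun.span_redundant)
    then show ?thesis using E by blast
  next
    case False
    have vspan: "v \<in> cfun.span (insert b B)"
      unfolding v_def using proj_in_span[of E b] E(3) sub
      by (intro cfun.span_diff) (auto intro: cfun.span_base)
    then have nv: "nrm v > 0" using insert.prems(2)[of v] False nrm_nonneg[OF vV] by fastforce
    define w where "w = cscale (of_real (1 / nrm v)) v"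
    have wV: "w \<in> V" using vV by (simp add: w_def)
    have orth: "ip w e = 0" "ip e w = 0" if "e \<in> E" for e
    proof -
      have "ip v e = 0"
        unfolding v_def using E bV that by (intro proj_orthogonal) (auto intro: cfun.span_base)
      then show "ip w e = 0" using vV that EV by (simp add: w_def ip_scale subset_iff)
      then show "ip e w = 0" using ip_cnj[of w e] wV that EV by (simp add: subset_iff)
    qed
    have "nrm w = 1" using vV nv by (simp add: w_def nrm_cscale norm_divide)
    then have "ip w w = 1" using wV by (simp add: ip_self)
    then have "orthonormal (insert w E)"
      using E wV orth by (auto simp: orthonormal_def)
    moreover have "cfun.span (insert w E) = cfun.span (insert b B)"
    proof -
      have "w \<in> cfun.span (insert b E)"
        using vspan span_b unfolding w_def by (intro cfun.span_scale) simp
      moreover have "b \<in> cfun.span (insert w E)"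
      proof -
        have "v = cscale (of_real (nrm v)) w" using nv by (simp add: w_def cscale_def fun_eq_iff)
        then have "v \<in> cfun.span (insert w E)"
          by (metis cfun.span_base cfun.span_scale insertI1)
        moreover have "proj E b \<in> cfun.span (insert w E)"
          using proj_in_span[of E b] cfun.span_mono[of E "insert w E"] by blast
        ultimately have "v + proj E b \<in> cfun.span (insert w E)" by (rule cfun.span_add)
        then show ?thesis by (simp add: v_def)
      qed
      ultimately have "cfun.span (insert w E) = cfun.span (insert b E)"
        by (intro equalityI cfun.span_minimal cfun.subspace_span insert_subsetI)
          (auto intro: cfun.span_base)
      then show ?thesis using span_b by simp
    qed
    ultimately show ?thesis using E(1) by blast
  qed
qed

text \<open>The last part contains Pythagoras in the form in which the Bessel inequality is used.\<close>

lemma proj_properties: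
  assumes E: "finite E" "orthonormal E" and f: "f \<in> V"
  shows "nrm (proj E f) \<le> nrm f" "(nrm (proj E f))\<^sup>2 = (\<Sum>e\<in>E. (norm (ip f e))\<^sup>2)"
proof -
  have EV: "E \<subseteq> V" using E by (simp add: orthonormal_def)
  have pV: "proj E f \<in> V" using proj_in_span span_subset_V[OF EV] by blast
  have 0: "ip (f - proj E f) (proj E f) = 0" using E f proj_in_span by (rule proj_orthogonal)
  have "(nrm f)\<^sup>2 = (nrm ((f - proj E f) + proj E f))\<^sup>2" by simp
  also have "\<dots> = (nrm (f - proj E f))\<^sup>2 + (nrm (proj E f))\<^sup>2"
    using f pV by (subst nrm_sq_add) (auto simp: 0)
  finally have "(nrm (proj E f))\<^sup>2 \<le> (nrm f)\<^sup>2" by simp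
  then show "nrm (proj E f) \<le> nrm f" by (rule power2_le_imp_le) (simp add: f)
  have "ip (proj E f) (proj E f) = ip f (proj E f)" using 0 f pV by (simp add: ip_diff)
  also have "\<dots> = (\<Sum>e\<in>E. cnj (ip f e) * ip f e)"
    unfolding proj_def using EV f by (subst ip_sum_right) (auto simp: ip_scale_right subset_iff)
  also have "\<dots> = of_real (\<Sum>e\<in>E. (norm (ip f e))\<^sup>2)"
    unfolding of_real_sum complex_norm_square by (simp add: mult.commute)
  finally show "(nrm (proj E f))\<^sup>2 = (\<Sum>e\<in>E. (norm (ip f e))\<^sup>2)"
    using pV by (simp add: nrm_sq)
qed

end

section \<open>Mean values and orthogonality of the homogeneous parts\<close>

lemma (in circled_region) integral_hom_part_sums:
  fixes k :: "complex^'n^'n \<Rightarrow> complex"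
  assumes f: "line_holomorphic f S" and t: "0 < t" "t < 1"
    and k: "integrable N k" "\<And>Z. Z \<notin> shrink t \<Longrightarrow> k Z = 0"
    and meas: "\<And>m. (\<lambda>Z. hom_part m f Z * k Z) \<in> borel_measurable N"
  shows "(\<lambda>m. LINT Z|N. hom_part m f Z * k Z) sums (LINT Z|N. f Z * k Z)"
proof -
  obtain b where b: "summable b" "\<And>m. 0 \<le> b m"
    "\<And>m Z. Z \<in> shrink t \<Longrightarrow> norm (hom_part m f Z) \<le> b m"
    using hom_part_summable_bound[OF f t] by blast
  have le: "norm (hom_part m f Z * k Z) \<le> b m * norm (k Z)" for m Z
    using b(2)[of m] b(3)[of Z m] k(2)[of Z]
    by (cases "Z \<in> shrink t") (auto simp: norm_mult intro: mult_right_mono)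
  have int: "integrable N (\<lambda>Z. hom_part m f Z * k Z)" for m
  proof (rule Bochner_Integration.integrable_bound[OF _ meas])
    show "integrable N (\<lambda>Z. b m * norm (k Z))" using k(1) by simp
    show "AE Z in N. norm (hom_part m f Z * k Z) \<le> norm (b m * norm (k Z))"
      using le b(2) by (simp add: abs_of_nonneg)
  qed
  have "(\<lambda>m. LINT Z|N. hom_part m f Z * k Z) sums (LINT Z|N. (\<Sum>m. hom_part m f Z * k Z))"
  proof (rule sums_integral[OF int])
    have "summable (\<lambda>m. norm (hom_part m f Z * k Z))" for Z
      by (rule summable_comparison_test[OF _ summable_mult2[OF b(1), of "norm (k Z)"]])
        (use le in auto)
    then show "AE Z in N. summable (\<lambda>m. norm (hom_part m f Z * k Z))" by simp
    have "(LINT Z|N. norm (hom_part m f Z * k Z)) \<le> b m * (LINT Z|N. norm (k Z))" for m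
    proof -
      have "(LINT Z|N. norm (hom_part m f Z * k Z)) \<le> (LINT Z|N. b m * norm (k Z))"
        using int k(1) le by (intro integral_mono) auto
      then show ?thesis by simp
    qed
    then show "summable (\<lambda>m. LINT Z|N. norm (hom_part m f Z * k Z))"
      by (intro summable_comparison_test[OF _ summable_mult2[OF b(1), of "LINT Z|N. norm (k Z)"]]) auto
  qed
  also have "(\<lambda>Z. \<Sum>m. hom_part m f Z * k Z) = (\<lambda>Z. f Z * k Z)"
  proof
    fix Z
    show "(\<Sum>m. hom_part m f Z * k Z) = f Z * k Z"
    proof (cases "Z \<in> shrink t")
      case True
      then have "Z \<in> S" using shrink_subset[of t] t by auto
      then show ?thesis using sums_mult2[OF hom_part_sums[OF f], of Z "k Z"] by (simp add: sums_iff)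
    qed (simp add: k(2))
  qed
  finally show ?thesis .
qed

lemma cis_neg_one_power: "m \<noteq> 0 \<Longrightarrow> cis (pi / real m) ^ m = -1"
proof -
  assume "m \<noteq> 0"
  then have *: "real m * (pi / real m) = pi" by simp
  show ?thesis using arg_cong[OF *, of cis] by (simp add: Complex.DeMoivre del: of_nat_0_eq_iff)
qed

text \<open>Multiplication by \<open>c\<close> with \<open>c ^ m = -1\<close> preserves the ball, so the homogeneous parts of positive
  degree integrate to \<open>0\<close>.\<close>

lemma mean_value_ball:
  fixes f :: "complex^'n^'n \<Rightarrow> complex"
  assumes f: "line_holomorphic f (ball Z R)" and r: "0 < r" "r < R"
  shows "(LINT W:ball Z r|lborel. f W) = f Z * measure lborel (ball Z r)"
proof -
  have R: "R > 0" using r by simp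
  interpret circled_region "ball (0 :: complex^'n^'n) R" using R by (rule circled_region_ball)
  define g where "g V = f (Z + V)" for V
  have g: "line_holomorphic g (ball 0 R)"
    unfolding g_def by (rule line_holomorphic_translate[OF f]) (auto simp: dist_norm)
  let ?k = "indicator (ball (0::complex^'n^'n) r) :: _ \<Rightarrow> complex"
  have cont: "continuous_on (ball 0 r) (hom_part m g)" for m
    by (rule continuous_on_subset[OF line_holomorphicD(1)[OF line_holomorphic_hom_part[OF g]]])
      (use r in auto)
  have meas: "(\<lambda>V. hom_part m g V * ?k V) \<in> borel_measurable lborel" for m
  proof -
    have "(\<lambda>V. indicator (ball 0 r) V *\<^sub>R hom_part m g V) \<in> borel_measurable borel"
      by (intro borel_measurable_continuous_on_indicator cont) simp
    moreover have "(\<lambda>V. hom_part m g V * ?k V) = (\<lambda>V. indicator (ball 0 r) V *\<^sub>R hom_part m g V)"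
      by (auto simp: fun_eq_iff indicator_def)
    ultimately show ?thesis by simp
  qed
  have fin: "emeasure lborel (ball (0::complex^'n^'n) r) < \<infinity>" by (rule emeasure_lborel_ball_finite)
  have shr: "shrink (r / R) = ball 0 r"
    using R by (subst ball_scale) (use r in auto)
  have keq: "?k = (\<lambda>x. of_real (indicator (ball 0 r) x))" by (auto simp: fun_eq_iff indicator_def)
  have k: "integrable lborel ?k"
  proof -
    show ?thesis unfolding keq using fin by (intro integrable_of_real integrable_real_indicator) auto
  qed
  have s: "(\<lambda>m. LINT V|lborel. hom_part m g V * ?k V) sums (LINT V|lborel. g V * ?k V)"
    by (rule integral_hom_part_sums[OF g, of "r / R"])
      (use r R k meas shr in auto)
  have zero: "(LINT V|lborel. hom_part m g V * ?k V) = 0" if m: "m \<noteq> 0" for m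
  proof -
    define c where "c = cis (pi / real m)"
    have c: "norm c = 1" "c ^ m = -1" using m cis_neg_one_power by (auto simp: c_def)
    have iso: "orthogonal_transformation (mscale c :: complex^'n^'n \<Rightarrow> _)"
      using c bounded_linear.linear[OF bounded_linear_mscale] by (simp add: orthogonal_transformation)
    have [measurable]: "(mscale c :: complex^'n^'n \<Rightarrow> _) \<in> borel_measurable borel"
      by (intro borel_measurable_continuous_onI continuous_intros)
    have "(LINT V|lborel. hom_part m g V * ?k V)
        = (LINT V|distr lborel borel (mscale c). hom_part m g V * ?k V)"
      by (simp add: lborel_distr_isometry[OF iso])
    also have "\<dots> = (LINT V|lborel. hom_part m g (mscale c V) * ?k (mscale c V))"
      using meas[of m] by (intro integral_distr) auto
    also have "\<dots> = (LINT V|lborel. - (hom_part m g V * ?k V))"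
    proof (rule Bochner_Integration.integral_cong[OF refl])
      fix V
      show "hom_part m g (mscale c V) * ?k (mscale c V) = - (hom_part m g V * ?k V)"
        using hom_part_homogeneous[OF g, of V c m] c r by (auto simp: indicator_def)
    qed
    also have "\<dots> = - (LINT V|lborel. hom_part m g V * ?k V)" by simp
    finally show ?thesis by (simp add: eq_neg_iff_add_eq_0 flip: mult_2)
  qed
  have "(\<lambda>m. LINT V|lborel. hom_part m g V * ?k V) sums (LINT V|lborel. hom_part 0 g V * ?k V)"
    using sums_finite[of "{0::nat}" "\<lambda>m. LINT V|lborel. hom_part m g V * ?k V"] zero by simp
  then have "(LINT V|lborel. g V * ?k V) = (LINT V|lborel. hom_part 0 g V * ?k V)"
    using s sums_unique2 by blast
  also have "\<dots> = g 0 * (LINT V|lborel. ?k V)"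
    by (simp add: hom_part_def)
  also have "(LINT V|lborel. ?k V) = measure lborel (ball Z r)"
  proof -
    have "(LINT V|lborel. ?k V) = of_real (LINT V|lborel. indicator (ball (0::complex^'n^'n) r) V)"
      unfolding keq by (rule integral_complex_of_real)
    then show ?thesis using r(1) by (simp add: content_ball)
  qed
  finally have eq: "(LINT V|lborel. g V * ?k V) = f Z * measure lborel (ball Z r)" by (simp add: g_def)
  have fm: "(\<lambda>W. indicator (ball Z r) W *\<^sub>R f W) \<in> borel_measurable borel"
  proof (rule borel_measurable_continuous_on_indicator)
    show "continuous_on (ball Z r) f"
      by (rule continuous_on_subset[OF line_holomorphicD(1)[OF f]]) (use r in auto)
  qed simp
  have "(LINT W:ball Z r|lborel. f W) = (LINT W|distr lborel borel ((+) Z). indicator (ball Z r) W *\<^sub>R f W)"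
    by (simp add: lborel_distr_plus set_lebesgue_integral_def)
  also have "\<dots> = (LINT V|lborel. indicator (ball Z r) (Z + V) *\<^sub>R f (Z + V))"
    using fm by (intro integral_distr) auto
  also have "\<dots> = (LINT V|lborel. g V * ?k V)"
    by (intro Bochner_Integration.integral_cong) (auto simp: indicator_def g_def dist_norm)
  finally show ?thesis using eq by simp
qed

section \<open>The weighted Bergman space\<close>

lemma borel_measurable_cnj [measurable]:
  fixes f :: "'a \<Rightarrow> complex"
  assumes "f \<in> borel_measurable M" shows "(\<lambda>x. cnj (f x)) \<in> borel_measurable M"
  using assms by (rule measurable_compose) (intro borel_measurable_continuous_onI continuous_intros)

context bergman
begin

abbreviation L2 :: "(complex^'n^'n \<Rightarrow> complex) set" where "L2 \<equiv> L2_space lam"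
abbreviation A2 :: "(complex^'n^'n \<Rightarrow> complex) set" where "A2 \<equiv> bergman_space lam"

lemma L2_iff: "f \<in> L2 \<longleftrightarrow> f \<in> borel_measurable mu \<and> integrable mu (\<lambda>Z. (norm (f Z))\<^sup>2)"
  by (simp add: L2_space_def)

lemma integrable_L2_mult:
  assumes f: "f \<in> L2" and g: "g \<in> L2"
  shows "integrable mu (\<lambda>Z. f Z * g Z)" "integrable mu (\<lambda>Z. f Z * cnj (g Z))"
proof -
  have m [measurable]: "f \<in> borel_measurable mu" "g \<in> borel_measurable mu" using f g by (auto simp: L2_iff)
  have i: "integrable mu (\<lambda>Z. (norm (f Z))\<^sup>2 + (norm (g Z))\<^sup>2)" using f g by (auto simp: L2_iff)
  have b: "norm (x * y) \<le> (norm x)\<^sup>2 + (norm y)\<^sup>2" for x y :: complex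
    using sum_squares_bound[of "norm x" "norm y"] mult_nonneg_nonneg[OF norm_ge_zero norm_ge_zero, of x y]
    unfolding norm_mult by linarith
  show "integrable mu (\<lambda>Z. f Z * g Z)"
    by (rule Bochner_Integration.integrable_bound[OF i]) (use b in \<open>auto simp del: norm_mult intro: order_trans\<close>)
  show "integrable mu (\<lambda>Z. f Z * cnj (g Z))"
    by (rule Bochner_Integration.integrable_bound[OF i], measurable)
      (use b[of _ "cnj _"] in \<open>simp add: abs_of_nonneg\<close>)
qed

lemma L2_add: assumes "f \<in> L2" "g \<in> L2" shows "f + g \<in> L2"
proof -
  have m [measurable]: "f \<in> borel_measurable mu" "g \<in> borel_measurable mu" using assms by (auto simp: L2_iff)
  have i: "integrable mu (\<lambda>Z. 2 * (norm (f Z))\<^sup>2 + 2 * (norm (g Z))\<^sup>2)" using assms by (auto simp: L2_iff)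
  have b: "(norm (x + y))\<^sup>2 \<le> 2 * (norm x)\<^sup>2 + 2 * (norm y)\<^sup>2" for x y :: complex
  proof -
    have "(norm (x + y))\<^sup>2 \<le> (norm x + norm y)\<^sup>2" by (intro power_mono norm_triangle_ineq) simp
    also have "\<dots> \<le> 2 * (norm x)\<^sup>2 + 2 * (norm y)\<^sup>2"
      using sum_squares_bound[of "norm x" "norm y"] by (simp add: power2_sum)
    finally show ?thesis .
  qed
  have "integrable mu (\<lambda>Z. (norm (f Z + g Z))\<^sup>2)"
    by (rule Bochner_Integration.integrable_bound[OF i], measurable) (use b in \<open>simp add: abs_of_nonneg\<close>)
  then show ?thesis by (simp add: L2_iff plus_fun_def)
qed

lemma L2_cscale: assumes "f \<in> L2" shows "cscale c f \<in> L2"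
  using assms by (auto simp: L2_iff cscale_def norm_mult power_mult_distrib)

lemma L2_bounded_mult:
  assumes f: "f \<in> L2" and a: "a \<in> borel_measurable mu" "AE Z in mu. norm (a Z) \<le> C"
  shows "(\<lambda>Z. a Z * f Z) \<in> L2"
proof -
  have m [measurable]: "f \<in> borel_measurable mu" "a \<in> borel_measurable mu" using f a by (auto simp: L2_iff)
  have i: "integrable mu (\<lambda>Z. C\<^sup>2 * (norm (f Z))\<^sup>2)" using f by (auto simp: L2_iff)
  have "integrable mu (\<lambda>Z. (norm (a Z * f Z))\<^sup>2)"
  proof (rule Bochner_Integration.integrable_bound[OF i], measurable)
    show "AE Z in mu. norm ((norm (a Z * f Z))\<^sup>2) \<le> norm (C\<^sup>2 * (norm (f Z))\<^sup>2)"
      using a(2) by eventually_elim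
        (auto simp: norm_mult power_mult_distrib abs_of_nonneg intro!: mult_right_mono power_mono)
  qed
  then show ?thesis by (simp add: L2_iff)
qed

lemma subspace_L2: "cfun.subspace L2"
  unfolding cfun.subspace_def using L2_add L2_cscale by (auto simp: L2_iff zero_fun_def)

sublocale L2: semi_inner "L2_space lam :: (complex^'n^'n \<Rightarrow> complex) set" "ip lam"
proof
  show "cfun.subspace L2" by (rule subspace_L2)
  fix f g h :: "complex^'n^'n \<Rightarrow> complex"
  show "ip lam (f + g) h = ip lam f h + ip lam g h" if "f \<in> L2" "g \<in> L2" "h \<in> L2"
    using integrable_L2_mult(2) that by (simp add: ip_def distrib_right)
  show "ip lam (cscale c f) h = c * ip lam f h" for c
    by (simp add: ip_def cscale_def mult.assoc)
  show "ip lam g f = cnj (ip lam f g)"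
  proof -
    have "cnj (ip lam f g) = (LINT Z|mu. cnj (f Z * cnj (g Z)))"
      unfolding ip_def by (rule Bochner_Integration.integral_cnj[symmetric])
    then show ?thesis by (simp add: ip_def mult.commute)
  qed
  show "0 \<le> Re (ip lam f f)" if "f \<in> L2"
  proof -
    have "ip lam f f = (LINT Z|mu. complex_of_real ((norm (f Z))\<^sup>2))"
      by (simp add: ip_def complex_norm_square del: of_real_power)
    then show ?thesis by (simp add: integral_of_real del: of_real_power)
  qed
qed

lemma L2_norm_nrm: "L2_norm lam f = L2.nrm f"
  by (simp add: L2_norm_def L2.nrm_def)

lemma nrm_sq_integral: "f \<in> L2 \<Longrightarrow> (L2.nrm f)\<^sup>2 = (LINT Z|mu. (norm (f Z))\<^sup>2)"
proof -
  assume f: "f \<in> L2"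
  have "ip lam f f = (LINT Z|mu. complex_of_real ((norm (f Z))\<^sup>2))"
    by (simp add: ip_def complex_norm_square del: of_real_power)
  then show ?thesis using f by (simp add: L2.nrm_sq integral_of_real del: of_real_power)
qed

lemma nrm_zero_AE:
  assumes f: "f \<in> L2" and 0: "L2.nrm f = 0" shows "AE Z in mu. f Z = 0"
proof -
  have "(LINT Z|mu. (norm (f Z))\<^sup>2) = 0" using nrm_sq_integral[OF f] 0 by simp
  then have "AE Z in mu. (norm (f Z))\<^sup>2 = 0"
    using f by (subst (asm) integral_nonneg_eq_0_iff_AE) (auto simp: L2_iff)
  then show ?thesis by eventually_elim simp
qed

subsection \<open>Elements of the Bergman space\<close>

lemma A2_iff:
  "f \<in> A2 \<longleftrightarrow> f \<in> L2 \<and> line_holomorphic f dom \<and> (\<forall>Z. Z \<notin> dom \<longrightarrow> f Z = 0)"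
  by (simp add: bergman_space_def holomorphic_matrix_iff[OF open_cartan_domain])

lemma A2_L2: "f \<in> A2 \<Longrightarrow> f \<in> L2" by (simp add: A2_iff)

lemma A2_holomorphic: "f \<in> A2 \<Longrightarrow> line_holomorphic f dom" by (simp add: A2_iff)

lemma A2_continuous: "f \<in> A2 \<Longrightarrow> continuous_on dom f"
  using A2_holomorphic line_holomorphicD(1) by blast

lemma A2_outside: "f \<in> A2 \<Longrightarrow> Z \<notin> dom \<Longrightarrow> f Z = 0" by (simp add: A2_iff)

lemma A2_subset: "A2 \<subseteq> L2" using A2_L2 by blast

lemma subspace_A2: "cfun.subspace A2"
proof -
  have s: "f + g = (\<lambda>Z. f Z + g Z)" for f g :: "complex^'n^'n \<Rightarrow> complex" by (simp add: fun_eq_iff)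
  show ?thesis
    unfolding cfun.subspace_def
  proof (intro conjI ballI allI)
    show "0 \<in> A2" 
      using L2.V_simps(1) line_holomorphic_const[of 0 dom] by (simp add: A2_iff zero_fun_def)
    fix f assume f: "f \<in> A2"
    show "f + g \<in> A2" if g: "g \<in> A2" for g
      using f g L2_add[of f g] unfolding A2_iff s by (auto intro: line_holomorphic_add)
    show "cscale c f \<in> A2" for c
      using f L2_cscale[of f c] unfolding A2_iff cscale_def
      by (auto intro: line_holomorphic_mult line_holomorphic_const)
  qed
qed

lemma A2_simps [simp, intro]:
  "0 \<in> A2" "f \<in> A2 \<Longrightarrow> g \<in> A2 \<Longrightarrow> f + g \<in> A2" "f \<in> A2 \<Longrightarrow> g \<in> A2 \<Longrightarrow> f - g \<in> A2"
  "f \<in> A2 \<Longrightarrow> cscale c f \<in> A2"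
  using subspace_A2 cfun.subspace_0 cfun.subspace_add cfun.subspace_diff cfun.subspace_scale by blast+

lemma A2_definite:
  assumes f: "f \<in> A2" and 0: "L2.nrm f = 0" shows "f = 0"
proof
  fix Z
  show "f Z = 0 Z"
    using AE_dom_continuous_zero[OF A2_continuous[OF f] nrm_zero_AE[OF A2_L2[OF f] 0], of Z]
      A2_outside[OF f, of Z] by (cases "Z \<in> dom") auto
qed

lemma bounded_holomorphic_in_A2:
  assumes f: "line_holomorphic f dom" and b: "\<And>Z. Z \<in> dom \<Longrightarrow> norm (f Z) \<le> C"
  shows "(\<lambda>Z. if Z \<in> dom then f Z else 0) \<in> A2"
proof -
  let ?g = "\<lambda>Z. if Z \<in> dom then f Z else 0"
  have g: "line_holomorphic ?g dom"
    using f by (subst line_holomorphic_cong[of dom ?g f]) auto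
  have m [measurable]: "?g \<in> borel_measurable mu"
    using line_holomorphicD(1)[OF g] by (rule borel_measurable_mu_continuous)
  have "integrable mu (\<lambda>Z. (norm (?g Z))\<^sup>2)"
  proof (rule mu.integrable_const_bound[of _ "C\<^sup>2"])
    show "AE Z in mu. norm ((norm (?g Z))\<^sup>2) \<le> C\<^sup>2"
      using b by (intro AE_I2) (auto intro!: power_mono)
  qed measurable
  then show ?thesis using g m by (simp add: A2_iff L2_iff)
qed

lemma integral_norm_le_nrm:
  assumes f: "f \<in> L2" shows "integrable mu f" "(LINT Z|mu. norm (f Z)) \<le> L2.nrm f"
proof -
  have m [measurable]: "f \<in> borel_measurable mu" using f by (auto simp: L2_iff)
  have one: "(\<lambda>Z. 1) \<in> L2" by (simp add: L2_iff)
  have nf: "(\<lambda>Z. of_real (norm (f Z))) \<in> L2" using f by (simp add: L2_iff)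
  show "integrable mu f" using integrable_L2_mult(1)[OF f one] by simp
  have "ip lam (\<lambda>Z. of_real (norm (f Z))) (\<lambda>Z. 1) = of_real (LINT Z|mu. norm (f Z))"
    by (simp add: ip_def integral_of_real)
  moreover have "L2.nrm (\<lambda>Z. of_real (norm (f Z))) = L2.nrm f"
  proof (rule power2_eq_imp_eq)
    show "(L2.nrm (\<lambda>Z. of_real (norm (f Z))))\<^sup>2 = (L2.nrm f)\<^sup>2"
      using nrm_sq_integral[OF f] nrm_sq_integral[OF nf] by simp
  qed (use f nf in auto)
  moreover have "L2.nrm (\<lambda>Z. 1) = 1"
    by (simp add: L2.nrm_def ip_def)
  moreover have "norm (of_real (LINT Z|mu. norm (f Z)) :: complex) = (LINT Z|mu. norm (f Z))"
    by (simp add: integral_nonneg)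
  ultimately show "(LINT Z|mu. norm (f Z)) \<le> L2.nrm f"
    using L2.cauchy_schwarz[OF nf one] by simp
qed

text \<open>The value at the centre of a ball is the Lebesgue mean over the ball, and the weight is bounded below
  on a compact neighbourhood of \<open>K\<close>.\<close>

lemma point_evaluation_bound:
  assumes K: "compact K" "K \<subseteq> dom"
  obtains C where "C > 0" "\<And>f Z. f \<in> A2 \<Longrightarrow> Z \<in> K \<Longrightarrow> norm (f Z) \<le> C * L2.nrm f"
proof -
  obtain e where e: "e > 0" "(\<Union>x\<in>K. cball x e) \<subseteq> dom"
    using compact_subset_open_imp_cball_epsilon_subset[OF K(1) open_cartan_domain K(2)] .
  have "{x + y |x y. x \<in> K \<and> y \<in> cball 0 e} = (\<Union>x\<in>K. cball x e)"
  proof (intro equalityI subsetI)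
    fix z assume "z \<in> (\<Union>x\<in>K. cball x e)"
    then obtain x where "x \<in> K" "dist x z \<le> e" by auto
    then have "z = x + (z - x)" "z - x \<in> cball 0 e" by (auto simp: dist_norm norm_minus_commute)
    then show "z \<in> {x + y |x y. x \<in> K \<and> y \<in> cball 0 e}" using \<open>x \<in> K\<close> by blast
  next
    fix z assume "z \<in> {x + y |x y. x \<in> K \<and> y \<in> cball 0 e}"
    then obtain x y where "x \<in> K" "norm y \<le> e" "z = x + y" by auto
    then show "z \<in> (\<Union>x\<in>K. cball x e)" by (auto simp: dist_norm intro!: bexI[of _ x])
  qed
  then have "compact (\<Union>x\<in>K. cball x e)" using compact_sums[OF K(1) compact_cball[of 0 e]] by simp
  then obtain d where d: "d > 0" "\<And>Z. Z \<in> (\<Union>x\<in>K. cball x e) \<Longrightarrow> d \<le> weight Z"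
    using weight_lower_bound e(2) by metis
  define v where "v = measure lborel (ball (0::complex^'n^'n) (e / 2))"
  have v: "v > 0" unfolding v_def using e by (intro content_ball_pos) simp
  have "norm (f Z) \<le> 1 / (d * v) * L2.nrm f" if f: "f \<in> A2" and Z: "Z \<in> K" for f Z
  proof -
    have sub: "ball Z e \<subseteq> dom" "ball Z (e / 2) \<subseteq> (\<Union>x\<in>K. cball x e)" "ball Z (e / 2) \<subseteq> dom"
      using Z e by (force simp: subset_iff)+
    have vZ: "measure lborel (ball Z (e / 2)) = v"
      using e by (simp add: v_def content_ball)
    have "norm (f Z) * v = norm (f Z * measure lborel (ball Z (e / 2)))"
      using v by (simp add: norm_mult vZ)
    also have "\<dots> = norm (LINT W:ball Z (e / 2)|lborel. f W)"
      using e sub(1) by (subst mean_value_ball[of f Z e])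
        (auto intro: line_holomorphic_subset[OF A2_holomorphic[OF f]])
    also have "\<dots> \<le> (LINT W|mu. norm (f W)) / d"
    proof (rule set_integral_lborel_le(2))
      show "d \<le> weight W" if "W \<in> ball Z (e / 2)" for W using d(2) sub(2) that by blast
    qed (use sub(3) d(1) f A2_continuous integral_norm_le_nrm(1) A2_L2 in auto)
    also have "\<dots> \<le> L2.nrm f / d"
      using integral_norm_le_nrm(2)[OF A2_L2[OF f]] d(1) by (intro divide_right_mono) auto
    finally show ?thesis using v d(1) by (simp add: field_simps)
  qed
  then show ?thesis using that[of "1 / (d * v)"] v d(1) by simp
qed

text \<open>Point evaluations make an \<open>L\<^sup>2\<close> Cauchy sequence locally uniformly Cauchy; Fatou's lemma turns
  the pointwise limit into an \<open>L\<^sup>2\<close> limit.\<close>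

lemma complete_A2: "L2.complete_subspace A2"
  unfolding L2.complete_subspace_def
proof (intro allI impI)
  fix X :: "nat \<Rightarrow> complex^'n^'n \<Rightarrow> complex"
  assume "(\<forall>n. X n \<in> A2) \<and> (\<forall>e>0. \<exists>N. \<forall>m\<ge>N. \<forall>n\<ge>N. L2.nrm (X m - X n) < e)"
  then have X: "\<And>n. X n \<in> A2"
    and cau: "\<And>e. e > 0 \<Longrightarrow> \<exists>N. \<forall>m\<ge>N. \<forall>n\<ge>N. L2.nrm (X m - X n) < e" by blast+
  have XL: "X n \<in> L2" for n using X A2_L2 by blast
  have unif: "\<exists>N. \<forall>m\<ge>N. \<forall>n\<ge>N. \<forall>Z\<in>K. norm (X m Z - X n Z) < e"
    if K: "compact K" "K \<subseteq> dom" and e: "e > 0" for K e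
  proof -
    obtain C where C: "C > 0" "\<And>f Z. f \<in> A2 \<Longrightarrow> Z \<in> K \<Longrightarrow> norm (f Z) \<le> C * L2.nrm f"
      using point_evaluation_bound[OF K] by blast
    obtain N where N: "\<And>m n. m \<ge> N \<Longrightarrow> n \<ge> N \<Longrightarrow> L2.nrm (X m - X n) < e / C"
      using cau[of "e / C"] e C(1) by auto
    have "norm (X m Z - X n Z) < e" if "m \<ge> N" "n \<ge> N" "Z \<in> K" for m n Z
    proof -
      have "norm ((X m - X n) Z) \<le> C * L2.nrm (X m - X n)" using X that by (intro C(2)[of "X m - X n" Z]) auto
      also have "\<dots> < e" using N[OF that(1,2)] C(1) by (simp add: field_simps)
      finally show ?thesis by simp
    qed
    then show ?thesis by blast
  qed
  define g where "g Z = (if Z \<in> dom then lim (\<lambda>n. X n Z) else 0)" for Z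
  have lim: "(\<lambda>n. X n Z) \<longlonglongrightarrow> g Z" for Z
  proof (cases "Z \<in> dom")
    case True
    have "Cauchy (\<lambda>n. X n Z)"
      unfolding Cauchy_def dist_norm using unif[of "{Z}"] True by auto
    then show ?thesis using True by (simp add: g_def convergent_LIMSEQ_iff Cauchy_convergent_iff)
  next
    case False
    then show ?thesis using A2_outside[OF X] by (simp add: g_def)
  qed
  have hol: "line_holomorphic g dom"
  proof (rule line_holomorphic_uniform_limit[OF open_cartan_domain A2_holomorphic[OF X]])
    fix K assume K: "compact K" "K \<subseteq> dom"
    show "uniform_limit K X g sequentially"
      unfolding uniform_limit_sequentially_iff
    proof (intro allI impI)
      fix e :: real assume e: "e > 0"
      obtain N where N: "\<And>m n Z. m \<ge> N \<Longrightarrow> n \<ge> N \<Longrightarrow> Z \<in> K \<Longrightarrow> norm (X m Z - X n Z) < e / 2"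
        using unif[OF K, of "e / 2"] e by auto
      have "dist (X n Z) (g Z) < e" if nZ: "n \<ge> N" "Z \<in> K" for n Z
      proof -
        have "(\<lambda>m. norm (X n Z - X m Z)) \<longlonglongrightarrow> norm (X n Z - g Z)"
          by (intro tendsto_intros lim)
        moreover have "\<forall>m\<ge>N. norm (X n Z - X m Z) \<le> e / 2"
          using N nZ by (auto intro: less_imp_le)
        ultimately have "norm (X n Z - g Z) \<le> e / 2"
          using LIMSEQ_le_const2 by blast
        then show ?thesis using e by (simp add: dist_norm)
      qed
      then show "\<exists>N. \<forall>n\<ge>N. \<forall>Z\<in>K. dist (X n Z) (g Z) < e" by blast
    qed
  qed
  have gm [measurable]: "g \<in> borel_measurable mu"
    using line_holomorphicD(1)[OF hol] by (rule borel_measurable_mu_continuous)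
  have Xm [measurable]: "X n \<in> borel_measurable mu" for n using XL by (simp add: L2_iff)
  have fatou: "X n - g \<in> L2 \<and> L2.nrm (X n - g) \<le> e"
    if e: "e > 0" and N: "\<And>m. m \<ge> N \<Longrightarrow> L2.nrm (X n - X m) < e" for n e N
  proof -
    have "(\<integral>\<^sup>+Z. ennreal ((norm (X n Z - g Z))\<^sup>2) \<partial>mu)
        = (\<integral>\<^sup>+Z. liminf (\<lambda>m. ennreal ((norm (X n Z - X m Z))\<^sup>2)) \<partial>mu)"
    proof (rule nn_integral_cong)
      fix Z
      have "(\<lambda>m. ennreal ((norm (X n Z - X m Z))\<^sup>2)) \<longlonglongrightarrow> ennreal ((norm (X n Z - g Z))\<^sup>2)"
        by (intro tendsto_ennrealI tendsto_intros lim)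
      then show "ennreal ((norm (X n Z - g Z))\<^sup>2) = liminf (\<lambda>m. ennreal ((norm (X n Z - X m Z))\<^sup>2))"
        by (rule lim_imp_Liminf[OF sequentially_bot, symmetric])
    qed
    also have "\<dots> \<le> liminf (\<lambda>m. \<integral>\<^sup>+Z. ennreal ((norm (X n Z - X m Z))\<^sup>2) \<partial>mu)"
      by (rule nn_integral_liminf) measurable
    also have "\<dots> \<le> ennreal (e\<^sup>2)"
    proof (rule Liminf_le)
      show "\<forall>\<^sub>F m in sequentially. (\<integral>\<^sup>+Z. ennreal ((norm (X n Z - X m Z))\<^sup>2) \<partial>mu) \<le> ennreal (e\<^sup>2)"
        unfolding eventually_sequentially
      proof (intro exI allI impI)
        fix m assume m: "m \<ge> N"
        have L: "X n - X m \<in> L2" using XL by simp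
        have "(\<integral>\<^sup>+Z. ennreal ((norm (X n Z - X m Z))\<^sup>2) \<partial>mu) = ennreal (LINT Z|mu. (norm ((X n - X m) Z))\<^sup>2)"
          using L by (subst nn_integral_eq_integral[symmetric]) (auto simp: L2_iff fun_diff_def)
        also have "\<dots> = ennreal ((L2.nrm (X n - X m))\<^sup>2)" using nrm_sq_integral[OF L] by simp
        also have "\<dots> \<le> ennreal (e\<^sup>2)"
          using N[OF m] L by (intro ennreal_leI power_mono) auto
        finally show "(\<integral>\<^sup>+Z. ennreal ((norm (X n Z - X m Z))\<^sup>2) \<partial>mu) \<le> ennreal (e\<^sup>2)" .
      qed
    qed simp
    finally have le: "(\<integral>\<^sup>+Z. ennreal ((norm (X n Z - g Z))\<^sup>2) \<partial>mu) \<le> ennreal (e\<^sup>2)" .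
    have int: "integrable mu (\<lambda>Z. (norm (X n Z - g Z))\<^sup>2)"
      by (rule integrableI_bounded) (use le in \<open>auto simp: le_less_trans less_top\<close>)
    then have L: "X n - g \<in> L2" by (simp add: L2_iff fun_diff_def)
    have "ennreal (LINT Z|mu. (norm (X n Z - g Z))\<^sup>2) \<le> ennreal (e\<^sup>2)"
      using le by (subst (asm) nn_integral_eq_integral[OF int]) auto
    then have "(L2.nrm (X n - g))\<^sup>2 \<le> e\<^sup>2"
      using nrm_sq_integral[OF L] by (simp add: ennreal_le_iff)
    then show ?thesis using L e by (auto intro: power2_le_imp_le)
  qed
  obtain N0 where N0: "\<And>m n. m \<ge> N0 \<Longrightarrow> n \<ge> N0 \<Longrightarrow> L2.nrm (X m - X n) < 1" using cau[of 1] by auto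
  have "X N0 - g \<in> L2" using fatou[of 1 N0 N0] N0 by auto
  from L2.V_simps(3)[OF XL[of N0] this] have gL: "g \<in> L2" by simp
  have gA: "g \<in> A2" using gL hol by (simp add: A2_iff g_def)
  have "(\<lambda>n. L2.nrm (X n - g)) \<longlonglongrightarrow> 0"
  proof (rule LIMSEQ_I)
    fix e :: real assume e: "e > 0"
    obtain N where N: "\<And>m n. m \<ge> N \<Longrightarrow> n \<ge> N \<Longrightarrow> L2.nrm (X m - X n) < e / 2" using cau[of "e / 2"] e by auto
    have "norm (L2.nrm (X n - g) - 0) < e" if n: "n \<ge> N" for n
    proof -
      have "L2.nrm (X n - g) \<le> e / 2" using fatou[of "e / 2" N n] N[OF n] e by auto
      then show ?thesis using e XL gL by simp
    qed
    then show "\<exists>N. \<forall>n\<ge>N. norm (L2.nrm (X n - g) - 0) < e" by blast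
  qed
  then show "\<exists>g\<in>A2. (\<lambda>n. L2.nrm (X n - g)) \<longlonglongrightarrow> 0" using gA by blast
qed

end

section \<open>Finite dimensionality from separating functionals\<close>

lemma finite_dimensional_separating:
  fixes V :: "('a \<Rightarrow> complex) set" and l :: "'b \<Rightarrow> ('a \<Rightarrow> complex) \<Rightarrow> complex"
  assumes "finite I" "cfun.subspace V"
    and add: "\<And>i f g. i \<in> I \<Longrightarrow> l i (f + g) = l i f + l i g"
    and scale: "\<And>i c f. i \<in> I \<Longrightarrow> l i (cscale c f) = c * l i f"
    and sep: "\<And>f. f \<in> V \<Longrightarrow> \<forall>i\<in>I. l i f = 0 \<Longrightarrow> f = 0"
  shows "finite_dimensional V"
  using assms
proof (induction I arbitrary: V rule: finite_induct)
  case empty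
  have "f = 0" if "f \<in> V" for f using empty.prems(4)[OF that] by blast
  moreover have "0 \<in> V" using empty.prems(1) by (rule cfun.subspace_0)
  ultimately have "V = {0}" by blast
  then show ?case unfolding finite_dimensional_def by (intro exI[of _ "{}"]) simp
next
  case (insert k I)
  define V0 where "V0 = {f \<in> V. l k f = 0}"
  have V0: "cfun.subspace V0"
    unfolding cfun.subspace_def
  proof (intro conjI ballI allI)
    have z: "cscale 0 (0 :: 'a \<Rightarrow> complex) = 0" by (simp add: cscale_def fun_eq_iff)
    have "l k (cscale 0 0) = 0 * l k 0" by (rule insert.prems(3)) simp
    then have "l k 0 = 0" by (simp only: z mult_zero_left)
    then show "0 \<in> V0" using cfun.subspace_0[OF insert.prems(1)] by (simp add: V0_def)
    fix f assume f: "f \<in> V0"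
    show "f + g \<in> V0" if "g \<in> V0" for g
    proof -
      have "l k f = 0" "l k g = 0" "f \<in> V" "g \<in> V" using f that by (auto simp: V0_def)
      moreover have "l k (f + g) = l k f + l k g" by (rule insert.prems(2)) simp
      ultimately show ?thesis unfolding V0_def using cfun.subspace_add[OF insert.prems(1)] by (metis (mono_tags) CollectI add_0)
    qed
    show "cscale c f \<in> V0" for c
    proof -
      have "l k f = 0" "f \<in> V" using f by (auto simp: V0_def)
      moreover have "l k (cscale c f) = c * l k f" by (rule insert.prems(3)) simp
      ultimately show ?thesis unfolding V0_def using cfun.subspace_scale[OF insert.prems(1)] by (metis (mono_tags) CollectI mult_zero_right)
    qed
  qed
  have "finite_dimensional V0"
  proof (rule insert.IH[OF V0])
    show "f = 0" if "f \<in> V0" "\<forall>i\<in>I. l i f = 0" for f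
    proof (rule insert.prems(4))
      show "f \<in> V" "\<forall>i\<in>insert k I. l i f = 0" using that unfolding V0_def by blast+
    qed
  qed (use insert.prems(2,3) in \<open>blast+\<close>)
  then obtain B where B: "finite B" "V0 = cfun.span B" by (auto simp: finite_dimensional_def)
  show ?case
  proof (cases "V0 = V")
    case True
    then show ?thesis using B by (auto simp: finite_dimensional_def)
  next
    case False
    then obtain b where b: "b \<in> V" "l k b \<noteq> 0" by (auto simp: V0_def)
    have "V = cfun.span (insert b B)"
    proof
      show "cfun.span (insert b B) \<subseteq> V"
        using b B cfun.span_superset[of B] insert.prems(1)
        by (intro cfun.span_minimal) (auto simp: V0_def)
      show "V \<subseteq> cfun.span (insert b B)"
      proof
        fix f assume f: "f \<in> V"
        have "l k (f + cscale (- (l k f / l k b)) b) = l k f + l k (cscale (- (l k f / l k b)) b)"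
          by (rule insert.prems(2)) simp
        also have "l k (cscale (- (l k f / l k b)) b) = - (l k f / l k b) * l k b"
          by (rule insert.prems(3)) simp
        also have "l k f + - (l k f / l k b) * l k b = 0" using b(2) by simp
        finally have "l k (f + cscale (- (l k f / l k b)) b) = 0" .
        moreover have "f + cscale (- (l k f / l k b)) b \<in> V"
          by (intro cfun.subspace_add cfun.subspace_scale insert.prems(1) f b(1))
        ultimately have "f + cscale (- (l k f / l k b)) b \<in> V0"
          unfolding V0_def by blast
        then have "f - cscale (l k f / l k b) b \<in> cfun.span B"
          unfolding B(2)[symmetric] by (metis cfun.scale_minus_left diff_conv_add_uminus)
        then show "f \<in> cfun.span (insert b B)" by (subst cfun.span_insert) blast
      qed
    qed
    then show ?thesis using B(1) by (auto simp: finite_dimensional_def)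
  qed
qed

lemma subspace_of_finite_dimensional:
  assumes W: "finite_dimensional W" and V: "cfun.subspace V" "V \<subseteq> W"
  obtains B where "finite B" "B \<subseteq> V" "cfun.independent B" "cfun.span B = V"
proof -
  obtain B0 where B0: "finite B0" "W = cfun.span B0" using W by (auto simp: finite_dimensional_def)
  obtain B where B: "B \<subseteq> V" "cfun.independent B" "V \<subseteq> cfun.span B"
    using cfun.maximal_independent_subset[of V] by blast
  have "finite B" using cfun.independent_span_bound[OF B0(1) B(2)] B V B0 by auto
  moreover have "cfun.span B = V" using B V cfun.span_minimal[of B V] by blast
  ultimately show ?thesis using that B by blast
qed

lemma finite_dimensional_subspace:
  "finite_dimensional W \<Longrightarrow> cfun.subspace V \<Longrightarrow> V \<subseteq> W \<Longrightarrow> finite_dimensional V"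
  by (metis finite_dimensional_def subspace_of_finite_dimensional)

lemma subspace_finite_dimensional: "finite_dimensional W \<Longrightarrow> cfun.subspace W"
  by (auto simp: finite_dimensional_def)

section \<open>Toeplitz operators and the representation\<close>

lemma unitary_group_inv:
  assumes h: "h \<in> unitary_pairs"
  shows "inv\<^bsub>unitary_group \<times>\<times> unitary_group\<^esub> h = uinv h"
proof -
  obtain A B where AB: "h = (A, B)" "A \<in> carrier unitary_group" "B \<in> carrier unitary_group"
    using h by auto
  have m: "mult unitary_group = (**)" "one unitary_group = mat 1" by (simp_all add: unitary_group_def)
  have u: "C = conj_transpose X" if "X ** C = mat 1" "X \<in> carrier unitary_group" for X C :: "complex^'n^'n"
    using that by (metis matrix_mul_assoc matrix_mul_lid matrix_mul_rid unitary_iff)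
  show ?thesis
    unfolding m_inv_def
  proof (rule the_equality)
    show "uinv h \<in> carrier (unitary_group \<times>\<times> unitary_group) \<and>
        h \<otimes>\<^bsub>unitary_group \<times>\<times> unitary_group\<^esub> uinv h = \<one>\<^bsub>unitary_group \<times>\<times> unitary_group\<^esub> \<and>
        uinv h \<otimes>\<^bsub>unitary_group \<times>\<times> unitary_group\<^esub> h = \<one>\<^bsub>unitary_group \<times>\<times> unitary_group\<^esub>"
      using AB uinv_unitary[OF h] unitary_right
      by (auto simp: DirProd_def uinv_def m unitary_iff)
    fix y assume "y \<in> carrier (unitary_group \<times>\<times> unitary_group) \<and>
        h \<otimes>\<^bsub>unitary_group \<times>\<times> unitary_group\<^esub> y = \<one>\<^bsub>unitary_group \<times>\<times> unitary_group\<^esub> \<and>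
        y \<otimes>\<^bsub>unitary_group \<times>\<times> unitary_group\<^esub> h = \<one>\<^bsub>unitary_group \<times>\<times> unitary_group\<^esub>"
    then show "y = uinv h" using AB u by (cases y) (auto simp: DirProd_def uinv_def m)
  qed
qed

lemma subgroup_unitary:
  assumes H: "subgroup H (unitary_group \<times>\<times> unitary_group)"
  shows "H \<subseteq> unitary_pairs" "h \<in> H \<Longrightarrow> uinv h \<in> H"
proof -
  show sub: "H \<subseteq> unitary_pairs" using subgroup.subset[OF H] by (simp add: DirProd_def)
  show "uinv h \<in> H" if "h \<in> H"
    using subgroup.m_inv_closed[OF H that] unitary_group_inv[of h] sub that by auto
qed

lemma bergman_rep_umap: "bergman_rep h f = (\<lambda>Z. f (umap h Z))"
  by (cases h) (simp add: bergman_rep_def umap_def)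

lemma bergman_rep_add: "bergman_rep h (f + g) = bergman_rep h f + bergman_rep h g"
  and bergman_rep_diff: "bergman_rep h (f - g) = bergman_rep h f - bergman_rep h g"
  and bergman_rep_cscale: "bergman_rep h (cscale c f) = cscale c (bergman_rep h f)"
  and bergman_rep_zero: "bergman_rep h 0 = 0"
  by (simp_all add: bergman_rep_umap fun_eq_iff cscale_def)

lemma bergman_rep_uinv:
  assumes "h \<in> unitary_pairs"
  shows "bergman_rep h (bergman_rep (uinv h) f) = f" "bergman_rep (uinv h) (bergman_rep h f) = f"
  using umap_uinv[OF assms] by (simp_all add: bergman_rep_umap)

context bergman
begin

lemma bergman_proj:
  assumes f: "f \<in> L2"
  shows bergman_proj_in: "bergman_proj lam f \<in> A2"
    and bergman_proj_orth: "h \<in> A2 \<Longrightarrow> ip lam (f - bergman_proj lam f) h = 0"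
proof -
  obtain g where g: "g \<in> A2" "\<forall>h\<in>A2. ip lam (f - g) h = 0"
    using L2.projection_exists[OF A2_subset subspace_A2 complete_A2 f] by blast
  have "bergman_proj lam f \<in> A2 \<and> (\<forall>h\<in>A2. ip lam (f - bergman_proj lam f) h = 0)"
    unfolding bergman_proj_def
  proof (rule theI[of _ g])
    show "g \<in> A2 \<and> (\<forall>h\<in>A2. ip lam (f - g) h = 0)" using g by blast
    fix g' assume g': "g' \<in> A2 \<and> (\<forall>h\<in>A2. ip lam (f - g') h = 0)"
    have d: "g' - g \<in> A2" using g g' by simp
    have "ip lam (g' - g) (g' - g) = ip lam ((f - g) - (f - g')) (g' - g)" by simp
    also have "\<dots> = ip lam (f - g) (g' - g) - ip lam (f - g') (g' - g)"
      using f g(1) g' d A2_L2 by (intro L2.ip_diff) auto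
    also have "\<dots> = 0" using g(2) g' d by simp
    finally have "L2.nrm (g' - g) = 0" by (simp add: L2.nrm_def)
    then show "g' = g" using A2_definite[OF d] by simp
  qed
  then show "bergman_proj lam f \<in> A2" "h \<in> A2 \<Longrightarrow> ip lam (f - bergman_proj lam f) h = 0" by blast+
qed

lemma ip_bergman_proj: "f \<in> L2 \<Longrightarrow> h \<in> A2 \<Longrightarrow> ip lam (bergman_proj lam f) h = ip lam f h"
  using bergman_proj_orth[of f h] bergman_proj_in[of f] A2_L2 by (simp add: L2.ip_diff)

lemma A2_eqI:
  assumes f: "f \<in> A2" and g: "g \<in> A2" and eq: "\<And>h. h \<in> A2 \<Longrightarrow> ip lam f h = ip lam g h"
  shows "f = g"
proof -
  have d: "f - g \<in> A2" using f g by simp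
  have "ip lam (f - g) (f - g) = 0"
    using eq[OF d] f g d A2_L2 by (simp add: L2.ip_diff)
  then have "L2.nrm (f - g) = 0" by (simp add: L2.nrm_def)
  then show ?thesis using A2_definite[OF d] by simp
qed

lemma nrm_bergman_proj_le: "f \<in> L2 \<Longrightarrow> L2.nrm (bergman_proj lam f) \<le> L2.nrm f"
proof -
  assume f: "f \<in> L2"
  define g where "g = bergman_proj lam f"
  have g: "g \<in> A2" "g \<in> L2" using bergman_proj_in[OF f] A2_L2 by (auto simp: g_def)
  have "(L2.nrm g)\<^sup>2 = norm (ip lam g g)" using L2.ip_self[OF g(2)] by (simp add: norm_power)
  also have "\<dots> = norm (ip lam f g)" using ip_bergman_proj[OF f g(1)] by (simp add: g_def)
  also have "\<dots> \<le> L2.nrm f * L2.nrm g" using f g(2) by (rule L2.cauchy_schwarz)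
  finally have "L2.nrm g * L2.nrm g \<le> L2.nrm f * L2.nrm g" by (simp add: power2_eq_square)
  then have "L2.nrm g \<le> L2.nrm f"
    using L2.nrm_nonneg[OF g(2)] L2.nrm_nonneg[OF f] by (cases "L2.nrm g = 0") auto
  then show ?thesis by (simp add: g_def)
qed

lemma symbolsD:
  assumes "a \<in> symbols"
  shows "a \<in> borel_measurable mu" "\<exists>C\<ge>0. AE Z in mu. norm (a Z) \<le> C"
proof -
  show "a \<in> borel_measurable mu" using assms by (simp add: symbols_def borel_measurable_mu_iff)
  obtain C where C: "AE Z in mu. norm (a Z) \<le> C" using assms by (auto simp: symbols_def AE_mu_iff)
  have "AE Z in mu. norm (a Z) \<le> max C 0" using C by eventually_elim simp
  then show "\<exists>C\<ge>0. AE Z in mu. norm (a Z) \<le> C" by (intro exI[of _ "max C 0"]) simp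
qed

lemma symbolsI:
  assumes "a \<in> borel_measurable mu" "AE Z in mu. norm (a Z) \<le> C" shows "a \<in> symbols"
  using assms by (auto simp: symbols_def borel_measurable_mu_iff AE_mu_iff)

lemma symbol_mult_L2: "a \<in> symbols \<Longrightarrow> f \<in> L2 \<Longrightarrow> (\<lambda>Z. a Z * f Z) \<in> L2"
  using L2_bounded_mult[OF _ symbolsD(1)] symbolsD(2) by blast

lemma toeplitz_in_A2: "a \<in> symbols \<Longrightarrow> f \<in> A2 \<Longrightarrow> toeplitz lam a f \<in> A2"
  unfolding toeplitz_def by (intro bergman_proj_in symbol_mult_L2 A2_L2)

lemma ip_toeplitz:
  "a \<in> symbols \<Longrightarrow> f \<in> A2 \<Longrightarrow> g \<in> A2 \<Longrightarrow> ip lam (toeplitz lam a f) g = (LINT Z|mu. a Z * (f Z * cnj (g Z)))"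
  unfolding toeplitz_def by (subst ip_bergman_proj) (auto intro: symbol_mult_L2 A2_L2 simp: ip_def mult.assoc)

lemma toeplitz_bounded_operator:
  assumes a: "a \<in> symbols" shows "toeplitz lam a \<in> bounded_operators lam A2 A2"
proof -
  obtain C where C: "C \<ge> 0" "AE Z in mu. norm (a Z) \<le> C" using symbolsD(2)[OF a] by blast
  note mL = symbol_mult_L2[OF a A2_L2]
  have add: "toeplitz lam a (f + g) = toeplitz lam a f + toeplitz lam a g" if f: "f \<in> A2" and g: "g \<in> A2" for f g
  proof (rule A2_eqI)
    fix h assume h: "h \<in> A2"
    have eq: "(\<lambda>Z. a Z * (f + g) Z) = (\<lambda>Z. a Z * f Z) + (\<lambda>Z. a Z * g Z)"
      by (simp add: fun_eq_iff distrib_left)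
    show "ip lam (toeplitz lam a (f + g)) h = ip lam (toeplitz lam a f + toeplitz lam a g) h"
      using f g h mL A2_L2 bergman_proj_in unfolding toeplitz_def eq
      by (simp add: ip_bergman_proj L2.ip_add)
  qed (use f g toeplitz_in_A2[OF a] in auto)
  have scale: "toeplitz lam a (cscale c f) = cscale c (toeplitz lam a f)" if f: "f \<in> A2" for c f
  proof (rule A2_eqI)
    fix h assume h: "h \<in> A2"
    have eq: "(\<lambda>Z. a Z * cscale c f Z) = cscale c (\<lambda>Z. a Z * f Z)"
      by (simp add: fun_eq_iff cscale_def)
    show "ip lam (toeplitz lam a (cscale c f)) h = ip lam (cscale c (toeplitz lam a f)) h"
      using f h mL A2_L2 bergman_proj_in unfolding toeplitz_def eq
      by (simp add: ip_bergman_proj L2.ip_scale)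
  qed (use f toeplitz_in_A2[OF a] in auto)
  have bound: "L2.nrm (toeplitz lam a f) \<le> C * L2.nrm f" if f: "f \<in> A2" for f
  proof -
    have "L2.nrm (toeplitz lam a f) \<le> L2.nrm (\<lambda>Z. a Z * f Z)"
      unfolding toeplitz_def by (intro nrm_bergman_proj_le mL f)
    also have "(L2.nrm (\<lambda>Z. a Z * f Z))\<^sup>2 \<le> (C * L2.nrm f)\<^sup>2"
    proof -
      have "(LINT Z|mu. (norm (a Z * f Z))\<^sup>2) \<le> (LINT Z|mu. C\<^sup>2 * (norm (f Z))\<^sup>2)"
      proof (rule integral_mono_AE)
        show "AE Z in mu. (norm (a Z * f Z))\<^sup>2 \<le> C\<^sup>2 * (norm (f Z))\<^sup>2"
          using C(2) by eventually_elim (auto simp: norm_mult power_mult_distrib intro!: mult_right_mono power_mono)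
      qed (use mL[OF f] A2_L2[OF f] in \<open>auto simp: L2_iff\<close>)
      then show ?thesis
        using nrm_sq_integral[OF mL[OF f]] nrm_sq_integral[OF A2_L2[OF f]] by (simp add: power_mult_distrib)
    qed
    then have "L2.nrm (\<lambda>Z. a Z * f Z) \<le> C * L2.nrm f"
      by (rule power2_le_imp_le) (use C A2_L2[OF f] in simp)
    finally show ?thesis .
  qed
  show ?thesis
    unfolding bounded_operators_def L2_norm_nrm
    using add scale bound toeplitz_in_A2[OF a] by blast
qed

subsection \<open>Unitarity of the representation\<close>

lemma L2_compose_isometry:
  assumes T: "domain_isometry T" and f: "f \<in> L2" shows "(\<lambda>Z. f (T Z)) \<in> L2"
proof -
  have m: "f \<in> borel_measurable mu" using f by (simp add: L2_iff)
  have "(\<lambda>Z. f (T Z)) \<in> borel_measurable mu"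
    using measurable_compose[OF domain_isometry_measurable[OF T] m] .
  moreover have "integrable mu (\<lambda>Z. (norm (f (T Z)))\<^sup>2)"
    using integrable_domain_isometry[OF T, of "\<lambda>Z. (norm (f Z))\<^sup>2"] f m by (simp add: L2_iff)
  ultimately show ?thesis by (simp add: L2_iff)
qed

lemma ip_compose_isometry:
  assumes T: "domain_isometry T" and f: "f \<in> L2" and g: "g \<in> L2"
  shows "ip lam (\<lambda>Z. f (T Z)) (\<lambda>Z. g (T Z)) = ip lam f g"
  unfolding ip_def
proof (rule integral_domain_isometry[OF T, of "\<lambda>Z. f Z * cnj (g Z)"])
  have [measurable]: "f \<in> borel_measurable mu" "g \<in> borel_measurable mu" using f g by (auto simp: L2_iff)
  show "(\<lambda>Z. f Z * cnj (g Z)) \<in> borel_measurable mu" by measurable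
qed

lemma rep_L2: "h \<in> unitary_pairs \<Longrightarrow> f \<in> L2 \<Longrightarrow> bergman_rep h f \<in> L2"
  unfolding bergman_rep_umap by (rule L2_compose_isometry[OF domain_isometry_umap])

lemma rep_A2: assumes h: "h \<in> unitary_pairs" and f: "f \<in> A2" shows "bergman_rep h f \<in> A2"
proof -
  have "line_holomorphic (\<lambda>Z. f (umap h Z)) dom"
    by (rule line_holomorphic_compose_linear[OF A2_holomorphic[OF f] linear_umap mscale_umap])
      (use h umap_in_cartan_domain in auto)
  then show ?thesis
    using rep_L2[OF h A2_L2[OF f]] A2_outside[OF f] umap_in_cartan_domain_iff[OF h]
    by (simp add: A2_iff bergman_rep_umap)
qed

lemma ip_rep:
  "h \<in> unitary_pairs \<Longrightarrow> f \<in> L2 \<Longrightarrow> g \<in> L2 \<Longrightarrow> ip lam (bergman_rep h f) (bergman_rep h g) = ip lam f g"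
  unfolding bergman_rep_umap by (rule ip_compose_isometry[OF domain_isometry_umap])

lemma nrm_rep: "h \<in> unitary_pairs \<Longrightarrow> f \<in> L2 \<Longrightarrow> L2.nrm (bergman_rep h f) = L2.nrm f"
  by (simp add: L2.nrm_def ip_rep)

lemma ip_rep_left:
  "h \<in> unitary_pairs \<Longrightarrow> f \<in> L2 \<Longrightarrow> g \<in> L2 \<Longrightarrow> ip lam (bergman_rep h f) g = ip lam f (bergman_rep (uinv h) g)"
  using ip_rep[of h f "bergman_rep (uinv h) g"] by (simp add: bergman_rep_uinv rep_L2 uinv_unitary)

section \<open>Homogeneous functions\<close>

sublocale dom: circled_region "cartan_domain :: (complex^'n^'n) set"
  by (rule circled_region_cartan_domain)

definition homogeneous :: "nat \<Rightarrow> (complex^'n^'n \<Rightarrow> complex) set" where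
  "homogeneous m = {f \<in> A2. \<forall>c Z. norm c \<le> 1 \<longrightarrow> Z \<in> dom \<longrightarrow> f (mscale c Z) = c ^ m * f Z}"

lemma homogeneousD:
  "f \<in> homogeneous m \<Longrightarrow> f \<in> A2"
  "f \<in> homogeneous m \<Longrightarrow> norm c \<le> 1 \<Longrightarrow> Z \<in> dom \<Longrightarrow> f (mscale c Z) = c ^ m * f Z"
  by (auto simp: homogeneous_def)

lemma subspace_homogeneous: "cfun.subspace (homogeneous m)"
  unfolding cfun.subspace_def homogeneous_def
  by (auto simp: distrib_left cscale_def[abs_def] intro: A2_simps(4)[unfolded cscale_def])

lemma rep_homogeneous:
  assumes h: "h \<in> unitary_pairs" and f: "f \<in> homogeneous m" shows "bergman_rep h f \<in> homogeneous m"
  using f h unfolding homogeneous_def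
  by (auto simp: rep_A2 bergman_rep_umap mscale_umap umap_in_cartan_domain)
    (auto simp: bergman_rep_umap[symmetric] rep_A2)

definition hom_component :: "nat \<Rightarrow> (complex^'n^'n \<Rightarrow> complex) \<Rightarrow> complex^'n^'n \<Rightarrow> complex" where
  "hom_component m f Z = (if Z \<in> dom then dom.hom_part m f Z else 0)"

lemma hom_component_homogeneous:
  assumes f: "f \<in> A2" shows "hom_component m f \<in> homogeneous m"
proof -
  note lf = A2_holomorphic[OF f]
  obtain M where M: "0 \<le> M" "\<And>Z. Z \<in> dom.shrink (1/2) \<Longrightarrow> norm (f Z) \<le> M"
    using dom.bounded_on_shrink[OF A2_continuous[OF f], of "1/2"] by auto
  have "hom_component m f \<in> A2"
    unfolding hom_component_def
    by (rule bounded_holomorphic_in_A2[OF dom.line_holomorphic_hom_part[OF lf]])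
      (rule dom.hom_part_bound[OF lf _ _ _ M(2), of _ "1/2"], auto)
  then show ?thesis
    using dom.hom_part_homogeneous[OF lf]
    by (auto simp: homogeneous_def hom_component_def mscale_in_cartan_domain)
qed

text \<open>Homogeneous functions of different degrees are orthogonal even over \<open>t\<close> times the domain, where
  the homogeneous expansion converges uniformly: multiplication by a suitable scalar of modulus \<open>1\<close>
  preserves the measure and this set, and changes the sign of the integrand.\<close>

lemma integral_homogeneous_parts_orthogonal:
  assumes f: "f \<in> A2" and mj: "m \<noteq> j" and t: "0 < t" "t < 1"
  shows "(LINT Z|mu. hom_component m f Z * (indicator (dom.shrink t) Z * cnj (hom_component j f Z))) = 0"
    (is "integral\<^sup>L mu ?F = 0")
proof -
  define x where "x = pi / (real m - real j)"
  define c where "c = cis x"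
  have c1: "norm c = 1" by (simp add: c_def)
  have cc: "c ^ m * cnj (c ^ j) = -1"
  proof -
    have "c ^ m * cnj (c ^ j) = cis (real m * x) * cis (- (real j * x))"
      by (simp only: c_def Complex.DeMoivre cis_cnj)
    also have "\<dots> = cis ((real m - real j) * x)" by (simp add: cis_mult algebra_simps)
    also have "(real m - real j) * x = pi" using mj by (simp add: x_def)
    finally show ?thesis by simp
  qed
  note T = domain_isometry_mscale[OF c1]
  have sh: "mscale c Z \<in> dom.shrink t \<longleftrightarrow> Z \<in> dom.shrink t" for Z :: "complex^'n^'n"
  proof -
    have "Z \<in> dom.shrink t \<longleftrightarrow> (1 / t) *\<^sub>R Z \<in> dom" for Z :: "complex^'n^'n"
      using t by (auto simp: image_iff intro!: bexI[of _ "(1 / t) *\<^sub>R Z"])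
    moreover have "(1 / t) *\<^sub>R mscale c Z = mscale c ((1 / t) *\<^sub>R Z)"
      by (simp only: mscale_of_real[symmetric] mscale_simps mult.commute)
    ultimately show ?thesis using T by (simp add: domain_isometry_def)
  qed
  have hm: "hom_component i f \<in> A2" for i using hom_component_homogeneous[OF f] homogeneousD by blast
  have "dom.shrink t \<in> sets borel"
  proof (rule borel_open)
    show "open (dom.shrink t)" using open_scaling[of t dom] t open_cartan_domain by simp
  qed
  then have ind: "(\<lambda>Z. indicator (dom.shrink t) Z :: complex) \<in> borel_measurable mu"
    by (intro borel_measurable_mu_borel borel_measurable_indicator)
  note [measurable] = ind
  have [measurable]: "hom_component i f \<in> borel_measurable mu" for i using A2_L2[OF hm] by (simp add: L2_iff)
  have Fm: "?F \<in> borel_measurable mu" by measurable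
  have "integral\<^sup>L mu ?F = (LINT Z|mu. ?F (mscale c Z))"
    using integral_domain_isometry[OF T Fm] by simp
  also have "\<dots> = (LINT Z|mu. - ?F Z)"
  proof (rule Bochner_Integration.integral_cong[OF refl])
    fix Z assume "Z \<in> space mu"
    then have Z: "Z \<in> dom" by simp
    have "hom_component i f (mscale c Z) = c ^ i * hom_component i f Z" for i
      using homogeneousD(2)[OF hom_component_homogeneous[OF f], of c Z i] c1 Z by simp
    then have "?F (mscale c Z) = (c ^ m * cnj (c ^ j)) * ?F Z"
      by (simp add: sh indicator_def)
    then show "?F (mscale c Z) = - ?F Z" unfolding cc by simp
  qed
  also have "\<dots> = - integral\<^sup>L mu ?F" by (rule Bochner_Integration.integral_minus)
  finally show ?thesis by (simp add: eq_neg_iff_add_eq_0 flip: mult_2)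
qed

text \<open>The homogeneous components of \<open>f\<close> are orthogonal to each other, so orthogonality to a component forces
  that component to vanish. As the expansion converges uniformly only on smaller sets, this is shown over \<open>t\<close> times the
  domain for \<open>t < 1\<close>, followed by the limit \<open>t \<rightarrow> 1\<close>.\<close>

lemma homogeneous_total:
  assumes f: "f \<in> A2" and orth: "\<And>m p. p \<in> homogeneous m \<Longrightarrow> ip lam f p = 0"
  shows "f = 0"
proof -
  note lf = A2_holomorphic[OF f]
  have hm: "hom_component i f \<in> A2" for i using hom_component_homogeneous[OF f] homogeneousD by blast
  have hmeas [measurable]: "hom_component i f \<in> borel_measurable mu" for i using A2_L2[OF hm] by (simp add: L2_iff)
  have fm [measurable]: "f \<in> borel_measurable mu" using A2_L2[OF f] by (simp add: L2_iff)
  have zero: "hom_component j f = 0" for j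
  proof -
    let ?p = "hom_component j f"
    have "dom.shrink t \<in> sets borel" if "t > 0" for t
    proof (rule borel_open)
      show "open (dom.shrink t)" using open_scaling[of t dom] that open_cartan_domain by simp
    qed
    then have ind: "(\<lambda>Z. indicator (dom.shrink t) Z :: complex) \<in> borel_measurable mu" if "t > 0" for t
      using that by (intro borel_measurable_mu_borel borel_measurable_indicator)
    have eq: "(LINT Z|mu. f Z * (indicator (dom.shrink t) Z * cnj (?p Z)))
        = (LINT Z|mu. ?p Z * (indicator (dom.shrink t) Z * cnj (?p Z)))" if t: "0 < t" "t < 1" for t
    proof -
      note [measurable] = ind[OF t(1)]
      have sub: "Z \<in> dom" if "Z \<in> dom.shrink t" for Z using dom.shrink_subset[of t] t that by auto
      let ?k = "\<lambda>Z. indicator (dom.shrink t) Z * cnj (?p Z)"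
      have cong: "dom.hom_part m f Z * ?k Z = hom_component m f Z * ?k Z" for m Z
        using sub[of Z] by (auto simp: hom_component_def indicator_def)
      have s: "(\<lambda>m. LINT Z|mu. dom.hom_part m f Z * ?k Z) sums (LINT Z|mu. f Z * ?k Z)"
      proof (rule dom.integral_hom_part_sums[OF lf t])
        have "integrable mu (\<lambda>Z. cnj (?p Z))"
          using integral_norm_le_nrm(1)[OF A2_L2[OF hm]] by simp
        then show "integrable mu ?k"
        proof (rule Bochner_Integration.integrable_bound)
          show "?k \<in> borel_measurable mu" by measurable
        qed (auto simp: indicator_def)
        show "(\<lambda>Z. dom.hom_part m f Z * ?k Z) \<in> borel_measurable mu" for m
          unfolding cong by measurable
      qed simp
      have "(LINT Z|mu. dom.hom_part m f Z * ?k Z) = 0" if "m \<noteq> j" for m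
        unfolding cong using integral_homogeneous_parts_orthogonal[OF f that t] by simp
      then have "(\<lambda>m. LINT Z|mu. dom.hom_part m f Z * ?k Z) sums (LINT Z|mu. dom.hom_part j f Z * ?k Z)"
        using sums_finite[of "{j}" "\<lambda>m. LINT Z|mu. dom.hom_part m f Z * ?k Z"] by simp
      then show ?thesis using s sums_unique2 unfolding cong by blast
    qed
    define t where "t n = 1 - 1 / (real n + 2)" for n
    have t: "0 < t n" "t n < 1" for n by (auto simp: t_def)
    have tlim: "t \<longlonglongrightarrow> 1"
    proof -
      have "(\<lambda>n. 1 / real (n + 2)) \<longlonglongrightarrow> 0"
        using LIMSEQ_ignore_initial_segment[OF lim_1_over_n, of 2] by simp
      then have "(\<lambda>n. 1 - 1 / real (n + 2)) \<longlonglongrightarrow> 1 - 0" by (intro tendsto_diff tendsto_const)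
      then show ?thesis by (simp add: t_def[abs_def] add.commute)
    qed
    have lim: "(\<lambda>n. LINT Z|mu. g Z * (indicator (dom.shrink (t n)) Z * cnj (?p Z))) \<longlonglongrightarrow> ip lam g ?p"
      if g: "g \<in> L2" for g
      unfolding ip_def
    proof (rule integral_dominated_convergence[where w = "\<lambda>Z. norm (g Z * cnj (?p Z))"])
      have [measurable]: "g \<in> borel_measurable mu" using g by (simp add: L2_iff)
      show "(\<lambda>Z. g Z * cnj (?p Z)) \<in> borel_measurable mu" by measurable
      show "(\<lambda>Z. g Z * (indicator (dom.shrink (t n)) Z * cnj (?p Z))) \<in> borel_measurable mu" for n
      proof -
        note [measurable] = ind[OF t(1)[of n]]
        show ?thesis by measurable
      qed
      show "integrable mu (\<lambda>Z. norm (g Z * cnj (?p Z)))"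
        using integrable_L2_mult(2)[OF g A2_L2[OF hm]] by (rule integrable_norm)
      show "AE Z in mu. (\<lambda>n. g Z * (indicator (dom.shrink (t n)) Z * cnj (?p Z))) \<longlonglongrightarrow> g Z * cnj (?p Z)"
      proof (rule AE_I2)
        fix Z assume "Z \<in> space mu"
        then have "Z \<in> dom" by simp
        then obtain s U where s: "0 < s" "s < 1" "U \<in> dom" "Z = s *\<^sub>R U" using dom.in_shrink by metis
        have "\<forall>\<^sub>F n in sequentially. s < t n" using order_tendstoD(1)[OF tlim s(2)] .
        then have "\<forall>\<^sub>F n in sequentially. g Z * (indicator (dom.shrink (t n)) Z * cnj (?p Z)) = g Z * cnj (?p Z)"
        proof eventually_elim
          case (elim n)
          have "mscale (of_real (s / t n)) U \<in> dom"
            using s elim t[of n] by (intro mscale_in_cartan_domain) (auto simp: norm_divide)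
          moreover have "Z = t n *\<^sub>R mscale (of_real (s / t n)) U"
            using t(1)[of n] by (simp only: s(4) mscale_of_real[symmetric] mscale_simps) simp
          ultimately have "Z \<in> dom.shrink (t n)" by blast
          then show ?case by simp
        qed
        then show "(\<lambda>n. g Z * (indicator (dom.shrink (t n)) Z * cnj (?p Z))) \<longlonglongrightarrow> g Z * cnj (?p Z)"
          by (rule tendsto_eventually)
      qed
      show "AE Z in mu. norm (g Z * (indicator (dom.shrink (t n)) Z * cnj (?p Z))) \<le> norm (g Z * cnj (?p Z))" for n
        by (auto simp: indicator_def)
    qed
    have "ip lam f ?p = ip lam ?p ?p"
      by (rule LIMSEQ_unique[OF lim[OF A2_L2[OF f]]]) (unfold eq[OF t], rule lim[OF A2_L2[OF hm]])
    then have "ip lam ?p ?p = 0" using orth[OF hom_component_homogeneous[OF f]] by simp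
    then have "L2.nrm ?p = 0" by (simp add: L2.nrm_def)
    then show ?thesis using A2_definite[OF hm] by simp
  qed
  show ?thesis
  proof
    fix Z
    show "f Z = 0 Z"
    proof (cases "Z \<in> dom")
      case True
      have "dom.hom_part m f Z = 0" for m
        using fun_cong[OF zero[of m], of Z] True by (simp add: hom_component_def)
      then show ?thesis using dom.hom_part_sums[OF lf True] by (simp add: sums_iff)
    qed (use A2_outside[OF f] in simp)
  qed
qed

text \<open>The extension of a homogeneous function from the domain to all matrices: the factor moves \<open>Z\<close> into the
  domain, and homogeneity makes any other such factor give the same value.\<close>

definition hom_extension :: "nat \<Rightarrow> (complex^'n^'n \<Rightarrow> complex) \<Rightarrow> complex^'n^'n \<Rightarrow> complex" where
  "hom_extension m f Z = of_real ((2 * (1 + norm Z)) ^ m) * f ((1 / (2 * (1 + norm Z))) *\<^sub>R Z)"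

lemma hom_extension_scale:
  assumes f: "f \<in> homogeneous m" and s: "0 < s" "s * norm Z \<le> 1/2" "s \<le> 1/2"
  shows "hom_extension m f Z = of_real ((1 / s) ^ m) * f (s *\<^sub>R Z)"
proof -
  define r where "r = 1 / (2 * (1 + norm Z))"
  have r: "r > 0" "2 * (1 + norm Z) = 1 / r" "r * norm Z < 1"
  proof -
    have "1 + norm Z > 0" using norm_ge_zero[of Z] by linarith
    then show "r > 0" "2 * (1 + norm Z) = 1 / r" "r * norm Z < 1"
      by (auto simp: r_def field_simps)
  qed
  have in_dom: "s *\<^sub>R Z \<in> dom" "r *\<^sub>R Z \<in> dom"
    using s r by (auto intro!: norm_less_1_in_cartan_domain)
  show ?thesis
  proof (cases "r \<le> s")
    case True
    have "f (mscale (of_real (r / s)) (s *\<^sub>R Z)) = of_real (r / s) ^ m * f (s *\<^sub>R Z)"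
      using True s r in_dom by (intro homogeneousD(2)[OF f]) (auto simp: norm_divide)
    moreover have "mscale (of_real (r / s)) (s *\<^sub>R Z) = r *\<^sub>R Z" using s by (simp only: mscale_of_real) simp
    ultimately show ?thesis
      using r s unfolding hom_extension_def r(2) r_def[symmetric]
      by (simp add: power_divide)
  next
    case False
    have "f (mscale (of_real (s / r)) (r *\<^sub>R Z)) = of_real (s / r) ^ m * f (r *\<^sub>R Z)"
      using False s r in_dom by (intro homogeneousD(2)[OF f]) (auto simp: norm_divide)
    moreover have "mscale (of_real (s / r)) (r *\<^sub>R Z) = s *\<^sub>R Z" using r by (simp only: mscale_of_real) simp
    ultimately show ?thesis
      using r s unfolding hom_extension_def r(2) r_def[symmetric]
      by (simp add: power_divide)
  qed
qed

lemma hom_extension_eq: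
  assumes f: "f \<in> homogeneous m" and Z: "Z \<in> dom" shows "hom_extension m f Z = f Z"
proof -
  define s where "s = 1 / (2 * (1 + norm Z))"
  have n: "1 + norm Z > 0" using norm_ge_zero[of Z] by linarith
  then have s: "0 < s" "s \<le> 1/2" "s * norm Z \<le> 1/2" by (auto simp: s_def field_simps)
  have "f (mscale (of_real s) Z) = of_real s ^ m * f Z"
    using s Z by (intro homogeneousD(2)[OF f]) auto
  then show ?thesis
    using hom_extension_scale[OF f s(1,3,2)] s by (simp add: mscale_of_real power_divide)
qed

text \<open>The extension is entire on every complex line and of growth at most \<open>\<bar>w\<bar> ^ m\<close>, so Liouville's theorem
  applies.\<close>

lemma hom_extension_polynomial:
  assumes f: "f \<in> homogeneous m"
  shows "\<exists>c. \<forall>w. hom_extension m f (X + mscale w Y) = (\<Sum>k\<le>m. c k * w ^ k)"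
proof -
  let ?p = "\<lambda>w. hom_extension m f (X + mscale w Y)"
  have fA: "f \<in> A2" using f by (rule homogeneousD)
  have "?p holomorphic_on UNIV"
    unfolding holomorphic_on_def
  proof
    fix w0 :: complex
    define N where "N = 1 + norm X + (norm w0 + 1) * norm Y"
    have N: "N \<ge> 1" unfolding N_def by simp
    define s where "s = 1 / (2 * N)"
    have s: "0 < s" "s \<le> 1/2" using N by (auto simp: s_def field_simps)
    have nb: "s * norm (X + mscale w Y) \<le> 1/2" if "w \<in> ball w0 1" for w
    proof -
      have "norm w \<le> norm w0 + 1"
        using that norm_triangle_ineq[of w0 "w - w0"] by (simp add: dist_norm norm_minus_commute)
      then have "norm w * norm Y \<le> (norm w0 + 1) * norm Y" by (intro mult_right_mono) auto
      then have "norm (X + mscale w Y) \<le> N"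
        using norm_triangle_ineq[of X "mscale w Y"] by (simp add: N_def)
      then have "s * norm (X + mscale w Y) \<le> s * N" using s by (intro mult_left_mono) auto
      then show ?thesis using N by (simp add: s_def)
    qed
    have eq: "?p w = of_real ((1 / s) ^ m) * f (s *\<^sub>R X + mscale w (s *\<^sub>R Y))" if "w \<in> ball w0 1" for w
    proof -
      have "s *\<^sub>R (X + mscale w Y) = s *\<^sub>R X + mscale w (s *\<^sub>R Y)"
        by (simp only: mscale_of_real[symmetric] mscale_add_right mscale_simps mult.commute)
      then show ?thesis using hom_extension_scale[OF f s(1) nb[OF that] s(2)] by simp
    qed
    have "(\<lambda>w. f (s *\<^sub>R X + mscale w (s *\<^sub>R Y))) holomorphic_on ball w0 1"
    proof (rule holomorphic_on_subset[OF line_holomorphicD(2)[OF A2_holomorphic[OF fA]]])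
      show "ball w0 1 \<subseteq> {t. s *\<^sub>R X + mscale t (s *\<^sub>R Y) \<in> dom}"
      proof
        fix w assume w: "w \<in> ball w0 1"
        have "s *\<^sub>R X + mscale w (s *\<^sub>R Y) = s *\<^sub>R (X + mscale w Y)"
          by (simp only: mscale_of_real[symmetric] mscale_add_right mscale_simps mult.commute)
        moreover have "norm (s *\<^sub>R (X + mscale w Y)) < 1" using nb[OF w] s by simp
        ultimately show "w \<in> {t. s *\<^sub>R X + mscale t (s *\<^sub>R Y) \<in> dom}"
          by (simp add: norm_less_1_in_cartan_domain)
      qed
    qed
    then have "(\<lambda>w. of_real ((1 / s) ^ m) * f (s *\<^sub>R X + mscale w (s *\<^sub>R Y))) holomorphic_on ball w0 1"
      by (intro holomorphic_on_mult holomorphic_on_const)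
    then have "?p holomorphic_on ball w0 1"
      by (rule holomorphic_transform) (simp add: eq)
    then show "?p field_differentiable at w0 within UNIV"
      by (auto intro: holomorphic_on_imp_differentiable_at)
  qed
  moreover obtain M where M: "0 \<le> M" "\<And>Z. Z \<in> dom.shrink (1/2) \<Longrightarrow> norm (f Z) \<le> M"
    using dom.bounded_on_shrink[OF A2_continuous[OF fA], of "1/2"] by auto
  have grow: "norm (?p w) \<le> M * (2 * (1 + norm X + norm Y)) ^ m * norm w ^ m" if w: "1 \<le> norm w" for w
  proof -
    define Z where "Z = X + mscale w Y"
    have n: "1 + norm Z > 0" using norm_ge_zero[of Z] by linarith
    have "(1 / (1 + norm Z)) *\<^sub>R Z \<in> dom"
      using n by (intro norm_less_1_in_cartan_domain) (simp add: field_simps)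
    moreover have "(1 / (2 * (1 + norm Z))) *\<^sub>R Z = (1/2) *\<^sub>R ((1 / (1 + norm Z)) *\<^sub>R Z)" by simp
    ultimately have "norm (f ((1 / (2 * (1 + norm Z))) *\<^sub>R Z)) \<le> M" by (intro M(2)) blast
    then have "norm (hom_extension m f Z) \<le> (2 * (1 + norm Z)) ^ m * M"
      using n unfolding hom_extension_def norm_mult norm_of_real by (intro mult_mono) auto
    also have "(2 * (1 + norm Z)) ^ m \<le> (2 * (1 + norm X + norm Y) * norm w) ^ m"
    proof (rule power_mono)
      have "norm Z \<le> norm X + norm w * norm Y"
        unfolding Z_def using norm_triangle_ineq[of X "mscale w Y"] by simp
      moreover have "1 + norm X \<le> (1 + norm X) * norm w"
        using mult_left_mono[OF w, of "1 + norm X"] by simp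
      ultimately show "2 * (1 + norm Z) \<le> 2 * (1 + norm X + norm Y) * norm w"
        by (simp add: algebra_simps)
    qed (use n in simp)
    finally show ?thesis using M(1) by (simp add: Z_def power_mult_distrib mult_right_mono mult_ac)
  qed
  ultimately have "?p w = (\<Sum>k\<le>m. (deriv ^^ k) ?p 0 / fact k * w ^ k)" for w
    by (intro Liouville_polynomial[where A = 1]) auto
  then show ?thesis by (intro exI[of _ "\<lambda>k. (deriv ^^ k) ?p 0 / fact k"]) blast
qed

text \<open>A polynomial of degree at most \<open>m\<close> in each entry is determined by its values on a grid with \<open>m + 1\<close> values
  for each entry.\<close>

lemma homogeneous_grid_zero:
  assumes f: "f \<in> homogeneous m"
    and zero: "\<And>Z. (\<And>i j. Z $ i $ j \<in> of_nat ` {..m}) \<Longrightarrow> hom_extension m f Z = 0"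
  shows "f = 0"
proof -
  let ?G = "of_nat ` {..m} :: complex set"
  have cardG: "card ?G = Suc m"
    by (subst card_image) (auto simp: inj_on_def)
  have "(\<And>i j. (i, j) \<notin> C \<Longrightarrow> Z $ i $ j \<in> ?G) \<Longrightarrow> hom_extension m f Z = 0"
    for C :: "('n \<times> 'n) set" and Z
  proof (induction C arbitrary: Z rule: finite_induct[OF finite])
    case 1
    then show ?case by (intro zero) simp
  next
    case (2 ij C)
    obtain i0 j0 where ij: "ij = (i0, j0)" by force
    define X where "X = (\<chi> i j. if i = i0 \<and> j = j0 then 0 else Z $ i $ j)"
    define Y :: "complex^'n^'n" where "Y = (\<chi> i j. if i = i0 \<and> j = j0 then 1 else 0)"
    have XY: "(X + mscale w Y) $ i $ j = (if i = i0 \<and> j = j0 then w else Z $ i $ j)" for w i j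
      by (simp add: X_def Y_def)
    obtain c where c: "\<And>w. hom_extension m f (X + mscale w Y) = (\<Sum>k\<le>m. c k * w ^ k)"
      using hom_extension_polynomial[OF f, of X Y] by blast
    have "hom_extension m f (X + mscale w Y) = 0" if w: "w \<in> ?G" for w
    proof (rule 2(3))
      fix i j assume "(i, j) \<notin> C"
      then show "(X + mscale w Y) $ i $ j \<in> ?G"
        unfolding XY using 2(4)[of i j] w by (cases "i = i0 \<and> j = j0") (simp_all only: ij insert_iff prod.inject if_True if_False simp_thms)
    qed
    then have sub: "?G \<subseteq> {w. (\<Sum>k\<le>m. c k * w ^ k) = 0}" using c by auto
    have "\<forall>k\<le>m. c k = 0"
    proof (rule ccontr)
      assume "\<not> (\<forall>k\<le>m. c k = 0)"
      then obtain k where "k \<le> m" "c k \<noteq> 0" by blast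
      then have "finite {w. (\<Sum>k\<le>m. c k * w ^ k) = 0}" "card {w. (\<Sum>k\<le>m. c k * w ^ k) = 0} \<le> m"
        using Transcendental.polyfun_rootbound[of c k m] by auto
      then show False using card_mono[OF _ sub] cardG by simp
    qed
    then have "hom_extension m f (X + mscale (Z $ i0 $ j0) Y) = 0" by (simp add: c)
    moreover have "X + mscale (Z $ i0 $ j0) Y = Z" unfolding vec_eq_iff XY by simp
    ultimately show ?case by simp
  qed
  from this[of UNIV] have "hom_extension m f Z = 0" for Z by simp
  then have "f Z = 0" for Z
    using hom_extension_eq[OF f, of Z] A2_outside[OF homogeneousD(1)[OF f], of Z] by (cases "Z \<in> dom") auto
  then show ?thesis by (simp add: fun_eq_iff)
qed

lemma finite_dimensional_homogeneous: "finite_dimensional (homogeneous m)"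
proof -
  let ?G = "of_nat ` {..m} :: complex set"
  define I :: "(complex^'n^'n) set" where "I = {Z. \<forall>i j. Z $ i $ j \<in> ?G}"
  have "finite I"
  proof (rule finite_subset)
    show "I \<subseteq> (\<lambda>g. \<chi> i j. g (i, j)) ` (Pi\<^sub>E UNIV (\<lambda>_. ?G))"
    proof
      fix Z assume Z: "Z \<in> I"
      show "Z \<in> (\<lambda>g. \<chi> i j. g (i, j)) ` (Pi\<^sub>E UNIV (\<lambda>_. ?G))"
        by (rule image_eqI[of _ _ "\<lambda>(i, j). Z $ i $ j"]) (use Z in \<open>auto simp: I_def vec_eq_iff\<close>)
    qed
    show "finite ((\<lambda>g. \<chi> i j. g (i, j)) ` (Pi\<^sub>E (UNIV :: ('n \<times> 'n) set) (\<lambda>_. ?G)))"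
      by (intro finite_imageI finite_PiE) auto
  qed
  then show ?thesis
  proof (rule finite_dimensional_separating[OF _ subspace_homogeneous, where l = "\<lambda>Z f. hom_extension m f Z"])
    fix f assume f: "f \<in> homogeneous m" "\<forall>Z\<in>I. hom_extension m f Z = 0"
    then show "f = 0" by (intro homogeneous_grid_zero[of f m]) (auto simp: I_def)
  qed (simp_all add: hom_extension_def distrib_left cscale_def mult.left_commute)
qed

end

section \<open>Polarization\<close>

text \<open>Divide by one of the functions \<open>f k\<close> and apply \<open>d/dz\<close>: this kills the conjugate holomorphic
  summand \<open>cnj (g k)\<close> and leaves an identity with one term less.\<close>

lemma polarization_complex:
  fixes f g :: "'i \<Rightarrow> complex \<Rightarrow> complex"
  assumes "finite I" and "open S" "connected S"
    and "\<And>i. i \<in> I \<Longrightarrow> f i holomorphic_on S" "\<And>i. i \<in> I \<Longrightarrow> g i holomorphic_on S"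
    and "\<And>z. z \<in> S \<Longrightarrow> (\<Sum>i\<in>I. f i z * cnj (g i z)) = 0"
    and "z \<in> S" "w \<in> S"
  shows "(\<Sum>i\<in>I. f i z * cnj (g i w)) = 0"
  using assms
proof (induction I arbitrary: f S z w rule: finite_induct)
  case empty
  then show ?case by simp
next
  case (insert k I)
  note S = insert.prems(1,2) and fh = insert.prems(3) and gh = insert.prems(4) and zero = insert.prems(5)
  show ?case
  proof (cases "\<forall>z\<in>S. f k z = 0")
    case True
    have "(\<Sum>i\<in>I. f i z * cnj (g i w)) = 0"
    proof (rule insert.IH[OF S])
      show "(\<Sum>i\<in>I. f i z * cnj (g i z)) = 0" if "z \<in> S" for z
        using zero[OF that] True that insert.hyps by simp
    qed (use fh gh insert.prems(6,7) in auto)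
    then show ?thesis using insert.hyps True insert.prems(6) by simp
  next
    case False
    then obtain z0 where z0: "z0 \<in> S" "f k z0 \<noteq> 0" by blast
    have "continuous_on S (f k)" using fh[of k] holomorphic_on_imp_continuous_on by simp
    then have "open (S \<inter> f k -` (- {0}))"
      using S(1) by (intro continuous_open_preimage) auto
    moreover have "z0 \<in> S \<inter> f k -` (- {0})" using z0 by simp
    ultimately obtain r where r: "r > 0" "ball z0 r \<subseteq> S \<inter> f k -` (- {0})"
      using open_contains_ball by metis
    define B where "B = ball z0 r"
    have B: "open B" "connected B" "convex B" "z0 \<in> B" "B \<subseteq> S" using r by (auto simp: B_def)
    have fk: "f k z \<noteq> 0" if "z \<in> B" for z using r that by (auto simp: B_def)
    define a where "a i z = f i z / f k z" for i z
    have ah: "a i holomorphic_on B" if "i \<in> I" for i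
      unfolding a_def using fh[of i] fh[of k] that B(5) fk
      by (intro holomorphic_on_divide) (auto intro: holomorphic_on_subset)
    have ghB: "g i holomorphic_on B" if "i \<in> insert k I" for i
      using gh[OF that] B(5) by (rule holomorphic_on_subset)
    have K0: "(\<Sum>i\<in>I. a i z * cnj (g i z)) + cnj (g k z) = 0" if z: "z \<in> B" for z
    proof -
      have "f k z * ((\<Sum>i\<in>I. a i z * cnj (g i z)) + cnj (g k z)) = (\<Sum>i\<in>insert k I. f i z * cnj (g i z))"
        using insert.hyps fk[OF z] by (simp add: a_def distrib_left sum_distrib_left)
      then show ?thesis using zero[of z] z B(5) fk[OF z] by auto
    qed
    have A0: "(\<Sum>i\<in>I. deriv (a i) z * cnj (g i z)) = 0" if z: "z \<in> B" for z
    proof -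
      define A where "A = (\<Sum>i\<in>I. deriv (a i) z * cnj (g i z))"
      define Q where "Q = (\<Sum>i\<in>I. a i z * cnj (deriv (g i) z)) + cnj (deriv (g k) z)"
      have da: "(a i has_derivative (\<lambda>h. deriv (a i) z * h)) (at z)" if "i \<in> I" for i
        using holomorphic_derivI[OF ah[OF that] B(1) z] by (simp add: has_field_derivative_def)
      have dg: "((\<lambda>z. cnj (g i z)) has_derivative (\<lambda>h. cnj (deriv (g i) z * h))) (at z)" if "i \<in> insert k I" for i
        using holomorphic_derivI[OF ghB[OF that] B(1) z]
        by (intro has_derivative_cnj) (simp add: has_field_derivative_def)
      have "((\<lambda>z. (\<Sum>i\<in>I. a i z * cnj (g i z)) + cnj (g k z)) has_derivative
          (\<lambda>h. (\<Sum>i\<in>I. a i z * cnj (deriv (g i) z * h) + deriv (a i) z * h * cnj (g i z))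
             + cnj (deriv (g k) z * h))) (at z)"
        by (intro has_derivative_add has_derivative_sum has_derivative_mult da dg) auto
      then have "((\<lambda>z. 0) has_derivative
          (\<lambda>h. (\<Sum>i\<in>I. a i z * cnj (deriv (g i) z * h) + deriv (a i) z * h * cnj (g i z))
             + cnj (deriv (g k) z * h))) (at z)"
        by (rule has_derivative_transform_within_open[OF _ B(1) z]) (use K0 in simp)
      moreover have "((\<lambda>z. 0::complex) has_derivative (\<lambda>h. 0)) (at z)" by simp
      ultimately have "(\<lambda>h. (\<Sum>i\<in>I. a i z * cnj (deriv (g i) z * h) + deriv (a i) z * h * cnj (g i z))
             + cnj (deriv (g k) z * h)) = (\<lambda>h. 0)"
        by (rule has_derivative_unique)
      moreover have "(\<Sum>i\<in>I. a i z * cnj (deriv (g i) z * h) + deriv (a i) z * h * cnj (g i z))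
             + cnj (deriv (g k) z * h) = cnj h * Q + h * A" for h
        by (simp add: Q_def A_def sum.distrib sum_distrib_left distrib_left mult_ac)
      ultimately have D: "cnj h * Q + h * A = 0" for h by metis
      have "A = 0" using D[of 1] D[of \<i>] by (simp add: complex_eq_iff)
      then show ?thesis by (simp add: A_def)
    qed
    have IH: "(\<Sum>i\<in>I. deriv (a i) z * cnj (g i w)) = 0" if "z \<in> B" "w \<in> B" for z w
      by (rule insert.IH[OF B(1,2)]) (use ah ghB A0 that B(1) in \<open>auto intro: holomorphic_deriv\<close>)
    have BB: "(\<Sum>i\<in>insert k I. f i z * cnj (g i w)) = 0" if z: "z \<in> B" and w: "w \<in> B" for z w
    proof -
      have "\<exists>c. \<forall>z\<in>B. (\<Sum>i\<in>I. a i z * cnj (g i w)) = c"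
      proof (rule has_field_derivative_zero_constant[OF B(3)])
        fix x assume x: "x \<in> B"
        have "((\<lambda>z. \<Sum>i\<in>I. a i z * cnj (g i w)) has_field_derivative
            (\<Sum>i\<in>I. deriv (a i) x * cnj (g i w))) (at x)"
          using holomorphic_derivI[OF ah B(1) x] by (intro DERIV_sum DERIV_cmult_right) auto
        then show "((\<lambda>z. \<Sum>i\<in>I. a i z * cnj (g i w)) has_field_derivative 0) (at x within B)"
          unfolding IH[OF x w] by (rule has_field_derivative_at_within)
      qed
      then have "(\<Sum>i\<in>I. a i z * cnj (g i w)) = (\<Sum>i\<in>I. a i w * cnj (g i w))" using z w by metis
      then have "f k z * ((\<Sum>i\<in>I. a i z * cnj (g i w)) + cnj (g k w)) = 0" using K0[OF w] by simp
      then show ?thesis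
        using insert.hyps fk[OF z] by (simp add: a_def distrib_left sum_distrib_left add.commute)
    qed
    have SB: "(\<Sum>i\<in>insert k I. f i z * cnj (g i w)) = 0" if z: "z \<in> S" and w: "w \<in> B" for z w
    proof (rule analytic_continuation_open[where s = B and s' = S and f = "\<lambda>z. \<Sum>i\<in>insert k I. f i z * cnj (g i w)" and g = "\<lambda>_. 0"])
      show "(\<lambda>z. \<Sum>i\<in>insert k I. f i z * cnj (g i w)) holomorphic_on S"
        using fh by (intro holomorphic_on_sum holomorphic_on_mult holomorphic_on_const) auto
    qed (use B S BB w z in auto)
    have "(\<Sum>i\<in>insert k I. cnj (f i z) * g i w) = 0"
    proof (rule analytic_continuation_open[where s = B and s' = S and f = "\<lambda>w. \<Sum>i\<in>insert k I. cnj (f i z) * g i w" and g = "\<lambda>_. 0"])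
      show "(\<lambda>w. \<Sum>i\<in>insert k I. cnj (f i z) * g i w) holomorphic_on S"
        using gh by (intro holomorphic_on_sum holomorphic_on_mult holomorphic_on_const) auto
      fix w assume "w \<in> B"
      then have "cnj (\<Sum>i\<in>insert k I. f i z * cnj (g i w)) = 0" using SB[OF insert.prems(6)] by simp
      then show "(\<Sum>i\<in>insert k I. cnj (f i z) * g i w) = 0" by (simp only: cnj_sum complex_cnj_mult complex_cnj_cnj)
    qed (use B S insert.prems(7) in auto)
    then have "cnj (\<Sum>i\<in>insert k I. cnj (f i z) * g i w) = 0" by simp
    then show ?thesis by (simp only: cnj_sum complex_cnj_mult complex_cnj_cnj)
  qed
qed

text \<open>The complex line through \<open>Z\<close> and \<open>W\<close> meets the convex set in a connected set that contains both points.\<close>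

lemma polarization:
  fixes f g :: "'i \<Rightarrow> complex^'n^'n \<Rightarrow> complex"
  assumes I: "finite I" and S: "open S" "convex S"
    and f: "\<And>i. i \<in> I \<Longrightarrow> line_holomorphic (f i) S" and g: "\<And>i. i \<in> I \<Longrightarrow> line_holomorphic (g i) S"
    and zero: "\<And>Z. Z \<in> S \<Longrightarrow> (\<Sum>i\<in>I. f i Z * cnj (g i Z)) = 0"
    and Z: "Z \<in> S" and W: "W \<in> S"
  shows "(\<Sum>i\<in>I. f i Z * cnj (g i W)) = 0"
proof -
  define T where "T = {t. Z + mscale t (W - Z) \<in> S}"
  have "convex T"
  proof (rule convexI)
    fix x y :: complex and u v :: real
    assume *: "x \<in> T" "y \<in> T" "0 \<le> u" "0 \<le> v" "u + v = 1"
    have "Z + mscale (u *\<^sub>R x + v *\<^sub>R y) (W - Z) = (u + v) *\<^sub>R Z + mscale (u *\<^sub>R x + v *\<^sub>R y) (W - Z)"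
      using * by simp
    also have "\<dots> = u *\<^sub>R (Z + mscale x (W - Z)) + v *\<^sub>R (Z + mscale y (W - Z))"
      by (simp only: mscale_of_real[symmetric] scaleR_conv_of_real[of _ x] scaleR_conv_of_real[of _ y]
          mscale_add_left mscale_add_right mscale_simps of_real_add) (simp add: algebra_simps)
    finally show "u *\<^sub>R x + v *\<^sub>R y \<in> T"
      using S(2) * unfolding T_def by (simp add: convexD)
  qed
  then have "connected T" by (rule convex_connected)
  have "open T" unfolding T_def using S(1) by (rule open_line)
  have "(\<Sum>i\<in>I. f i (Z + mscale 0 (W - Z)) * cnj (g i (Z + mscale 1 (W - Z)))) = 0"
  proof (rule polarization_complex[OF I \<open>open T\<close> \<open>connected T\<close>, where
        f = "\<lambda>i t. f i (Z + mscale t (W - Z))" and g = "\<lambda>i t. g i (Z + mscale t (W - Z))"])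
    show "(\<lambda>t. f i (Z + mscale t (W - Z))) holomorphic_on T"
      "(\<lambda>t. g i (Z + mscale t (W - Z))) holomorphic_on T" if "i \<in> I" for i
      unfolding T_def using line_holomorphicD(2) f[OF that] g[OF that] by blast+
    show "(\<Sum>i\<in>I. f i (Z + mscale t (W - Z)) * cnj (g i (Z + mscale t (W - Z)))) = 0" if "t \<in> T" for t
      using that by (intro zero) (simp add: T_def)
    show "0 \<in> T" "1 \<in> T" using Z W by (simp_all add: T_def)
  qed
  then show ?thesis by simp
qed

section \<open>The symbol is determined by the Toeplitz operator\<close>

text \<open>Linear combinations of the functions \<open>f * cnj g\<close> with \<open>f\<close> and \<open>g\<close> entire form an algebra that
  contains the real polynomials, which are dense by Stone--Weierstrass.\<close>

inductive_set hol_products :: "(complex^'n^'n \<Rightarrow> complex) set" where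
  base: "line_holomorphic f UNIV \<Longrightarrow> line_holomorphic g UNIV \<Longrightarrow> (\<lambda>Z. f Z * cnj (g Z)) \<in> hol_products"
| add: "p \<in> hol_products \<Longrightarrow> q \<in> hol_products \<Longrightarrow> (\<lambda>Z. p Z + q Z) \<in> hol_products"

lemma hol_products_mult:
  assumes p: "p \<in> hol_products" and q: "q \<in> hol_products" shows "(\<lambda>Z. p Z * q Z) \<in> hol_products"
  using p
proof induction
  case (base f g)
  from q show ?case
  proof induction
    case (base f' g')
    have "(\<lambda>Z. (f Z * f' Z) * cnj (g Z * g' Z)) \<in> hol_products"
      by (intro hol_products.base line_holomorphic_mult \<open>line_holomorphic f UNIV\<close> base)
        (use \<open>line_holomorphic g UNIV\<close> in simp)
    then show ?case by (simp add: mult_ac)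
  next
    case (add p' q')
    then show ?case using hol_products.add by (simp add: distrib_left)
  qed
next
  case (add p' q')
  then show ?case using hol_products.add by (simp add: distrib_right)
qed

lemma real_polynomial_hol_products:
  fixes p :: "complex^'n^'n \<Rightarrow> real"
  assumes "real_polynomial_function p"
  shows "(\<lambda>Z. of_real (p Z)) \<in> hol_products"
  using assms
proof induction
  case (linear l)
  then have l: "linear l" by (rule bounded_linear.linear)
  define g where "g Z = (of_real (l Z) - \<i> * of_real (l (mscale \<i> Z))) / 2" for Z
  have lm: "l (mscale c Z) = Re c * l Z + Im c * l (mscale \<i> Z)" for c Z
  proof -
    have "mscale c Z = Re c *\<^sub>R Z + Im c *\<^sub>R mscale \<i> Z"
      by (simp add: vec_eq_iff complex_eq_iff scaleR_conv_of_real[of _ "_ :: complex"])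
    then show ?thesis by (simp add: linear_add[OF l] linear_scale[OF l])
  qed
  have ll: "l (Z + W) = l Z + l W" "l (r *\<^sub>R Z) = r * l Z" for Z W r
    by (simp_all add: linear_add[OF l] linear_scale[OF l])
  have "linear g"
  proof (rule linearI)
    show "g (Z + W) = g Z + g W" for Z W
      by (simp add: g_def ll mscale_add_right algebra_simps add_divide_distrib diff_divide_distrib)
    show "g (r *\<^sub>R Z) = r *\<^sub>R g Z" for r Z
    proof -
      have "mscale \<i> (r *\<^sub>R Z) = r *\<^sub>R mscale \<i> Z"
        by (simp only: mscale_of_real[symmetric] mscale_simps mult.commute)
      then show ?thesis
        by (simp only: g_def ll scaleR_conv_of_real[of r "_ :: complex"])
          (simp add: algebra_simps diff_divide_distrib)
    qed
  qed
  moreover have "g (mscale c Z) = c * g Z" for c Z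
  proof -
    have "l (mscale \<i> (mscale c Z)) = - Im c * l Z + Re c * l (mscale \<i> Z)"
      using lm[of "\<i> * c" Z] by simp
    then show ?thesis unfolding g_def lm[of c Z] by (simp add: complex_eq_iff algebra_simps)
  qed
  ultimately have g: "line_holomorphic g UNIV" by (rule line_holomorphic_linear)
  have "(\<lambda>Z. g Z * cnj 1 + 1 * cnj (g Z)) \<in> hol_products"
    by (intro hol_products.intros g line_holomorphic_const)
  moreover have "g Z * cnj 1 + 1 * cnj (g Z) = of_real (l Z)" for Z
    by (simp add: g_def complex_eq_iff)
  ultimately show ?case by simp
next
  case (const c)
  have "(\<lambda>Z. of_real c * cnj 1) \<in> hol_products"
    by (intro hol_products.base line_holomorphic_const)
  then show ?case by simp
next
  case (add f g)
  then show ?case using hol_products.add by simp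
next
  case (mult f g)
  then show ?case using hol_products_mult by simp
qed

lemma hol_products_continuous: "p \<in> hol_products \<Longrightarrow> continuous_on UNIV p"
  by (induction rule: hol_products.induct) (auto intro!: continuous_intros dest: line_holomorphicD(1))

context bergman
begin

lemma integrable_bounded_mult:
  fixes a b :: "complex^'n^'n \<Rightarrow> complex"
  assumes a: "a \<in> borel_measurable mu" "AE Z in mu. norm (a Z) \<le> C" and b: "b \<in> borel_measurable mu"
    and B: "\<And>Z. Z \<in> dom \<Longrightarrow> norm (b Z) \<le> B"
  shows "integrable mu (\<lambda>Z. a Z * b Z)"
proof (rule mu.integrable_const_bound[of _ "C * B"])
  show "AE Z in mu. norm (a Z * b Z) \<le> C * B"
    using a(2) AE_space
  proof eventually_elim
    case (elim Z)
    then show ?case unfolding norm_mult using B[of Z] by (intro mult_mono) (auto intro: order_trans[OF norm_ge_zero])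
  qed
  show "(\<lambda>Z. a Z * b Z) \<in> borel_measurable mu" using a b by measurable
qed

lemma entire_in_A2:
  assumes "line_holomorphic f UNIV" shows "(\<lambda>Z. if Z \<in> dom then f Z else 0) \<in> A2"
proof -
  have "compact (f ` closure dom)"
    using bounded_cartan_domain continuous_on_subset[OF line_holomorphicD(1)[OF assms]]
    by (intro compact_continuous_image) auto
  from compact_imp_bounded[OF this] obtain C where "\<And>Z. Z \<in> closure dom \<Longrightarrow> norm (f Z) \<le> C"
    unfolding bounded_iff by blast
  then show ?thesis
    using closure_subset[of dom] line_holomorphic_subset[OF assms, of dom]
    by (intro bounded_holomorphic_in_A2[where C = C]) auto
qed

text \<open>If \<open>b\<close> were positive on a set of positive measure, then also on a closed set of positive measure.\<close>

lemma symbol_zero_real: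
  fixes b :: "complex^'n^'n \<Rightarrow> real"
  assumes b: "b \<in> borel_measurable mu" "AE Z in mu. \<bar>b Z\<bar> \<le> C"
    and int: "\<And>T. closed T \<Longrightarrow> (LINT Z|mu. b Z * indicator T Z) = 0"
  shows "AE Z in mu. b Z \<le> 0"
proof -
  define S where "S = {Z \<in> dom. 0 < b Z}"
  have "S \<in> sets mu" using b(1) measurable_sets[OF b(1), of "{0<..}"] by (simp add: S_def vimage_def Int_def conj_commute)
  then have SL: "S \<in> sets lebesgue" "S \<subseteq> dom"
    by (auto simp: sets_mu sets_restrict_space_iff)
  have small: "emeasure lebesgue S \<le> ennreal e" if e: "e > 0" for e
  proof -
    obtain T where T: "closed T" "T \<subseteq> S" "S - T \<in> lmeasurable" "emeasure lebesgue (S - T) < ennreal e"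
      using sets_lebesgue_inner_closed[OF SL(1) e] .
    have [measurable]: "b \<in> borel_measurable mu" by (rule b)
    have Tm: "T \<in> sets borel" using T(1) by (rule borel_closed)
    have im [measurable]: "(\<lambda>Z. indicator T Z :: real) \<in> borel_measurable mu"
      using Tm by (intro borel_measurable_mu_borel borel_measurable_indicator)
    have "integrable mu (\<lambda>Z. b Z * indicator T Z)"
    proof (rule mu.integrable_const_bound[of _ C])
      show "AE Z in mu. norm (b Z * indicator T Z) \<le> C"
        using b(2) by eventually_elim (auto simp: indicator_def)
    qed measurable
    moreover have "0 \<le> b Z * indicator T Z" for Z using T(2) by (auto simp: S_def indicator_def)
    ultimately have "AE Z in mu. b Z * indicator T Z = 0"
      using integral_nonneg_eq_0_iff_AE[of mu "\<lambda>Z. b Z * indicator T Z"] int[OF T(1)] by simp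
    then have "AE Z in mu. Z \<notin> T"
      by eventually_elim (use T(2) in \<open>auto simp: S_def indicator_def\<close>)
    then have "AE Z in lebesgue_on dom. Z \<notin> T" by (simp add: AE_mu_iff)
    then have "AE Z in lebesgue. Z \<in> dom \<longrightarrow> Z \<notin> T" by (subst (asm) AE_restrict_space_iff) auto
    then have "AE Z in lebesgue. Z \<notin> T" by eventually_elim (use T(2) SL(2) in auto)
    then have "T \<in> null_sets lebesgue" using Tm by (subst AE_iff_null_sets) auto
    then have T0: "emeasure lebesgue T = 0" by auto
    have "emeasure lebesgue (T \<union> (S - T)) \<le> emeasure lebesgue T + emeasure lebesgue (S - T)"
      by (rule emeasure_subadditive) (use Tm SL(1) in auto)
    moreover have "T \<union> (S - T) = S" using T(2) by blast
    ultimately have "emeasure lebesgue S \<le> emeasure lebesgue T + emeasure lebesgue (S - T)"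
      by (simp only:)
    then show ?thesis using T0 T(4) by (simp add: order.strict_implies_order order.strict_trans1)
  qed
  have "emeasure lebesgue S \<le> 0"
    by (rule ennreal_le_epsilon) (use small in simp)
  then have "S \<in> null_sets lebesgue" using SL(1) by (intro null_setsI) simp_all
  then have "AE Z in lebesgue. Z \<notin> S" by (rule AE_not_in)
  then have "AE Z in lebesgue_on dom. Z \<notin> S"
    by (subst AE_restrict_space_iff) auto
  then have "AE Z in mu. Z \<notin> S" by (simp add: AE_mu_iff)
  then show ?thesis using AE_space by eventually_elim (auto simp: S_def not_less)
qed

text \<open>Orthogonality extends from the products \<open>f * cnj g\<close> to continuous functions by approximation with
  polynomials, and from there to indicators of closed sets by dominated convergence.\<close>

lemma symbol_zero:
  assumes a: "a \<in> symbols" and zero: "\<And>f g. f \<in> A2 \<Longrightarrow> g \<in> A2 \<Longrightarrow> (LINT Z|mu. a Z * (f Z * cnj (g Z))) = 0"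
  shows "AE Z in mu. a Z = 0"
proof -
  have am [measurable]: "a \<in> borel_measurable mu" by (rule symbolsD(1)[OF a])
  obtain C where C: "C \<ge> 0" "AE Z in mu. norm (a Z) \<le> C" using symbolsD(2)[OF a] by blast
  have cm: "p \<in> borel_measurable mu" if "continuous_on UNIV p" for p :: "complex^'n^'n \<Rightarrow> complex"
    using that by (intro borel_measurable_mu_continuous continuous_on_subset[OF that]) auto
  have bd: "\<exists>B. \<forall>Z\<in>dom. norm (p Z) \<le> B" if "continuous_on UNIV p" for p :: "complex^'n^'n \<Rightarrow> complex"
  proof -
    have "compact (p ` closure dom)"
      using bounded_cartan_domain continuous_on_subset[OF that] by (intro compact_continuous_image) auto
    from compact_imp_bounded[OF this] obtain B where "\<And>Z. Z \<in> closure dom \<Longrightarrow> norm (p Z) \<le> B"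
      unfolding bounded_iff by blast
    then show ?thesis using closure_subset[of dom] by (intro exI[of _ B]) auto
  qed
  have intc: "integrable mu (\<lambda>Z. a Z * p Z)" if p: "continuous_on UNIV p" for p
    using bd[OF p] integrable_bounded_mult[OF am C(2) cm[OF p]] by blast
  have prod: "(LINT Z|mu. a Z * p Z) = 0" if "p \<in> hol_products" for p
    using that
  proof induction
    case (base f g)
    let ?f = "\<lambda>Z. if Z \<in> dom then f Z else 0" and ?g = "\<lambda>Z. if Z \<in> dom then g Z else 0"
    have "(LINT Z|mu. a Z * (?f Z * cnj (?g Z))) = 0"
      by (intro zero entire_in_A2 base)
    moreover have "(LINT Z|mu. a Z * (f Z * cnj (g Z))) = (LINT Z|mu. a Z * (?f Z * cnj (?g Z)))"
      by (rule Bochner_Integration.integral_cong) auto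
    ultimately show ?case by simp
  next
    case (add p q)
    then show ?case
      using intc[OF hol_products_continuous[OF add.hyps(1)]] intc[OF hol_products_continuous[OF add.hyps(2)]]
      by (simp add: distrib_left)
  qed
  have cont: "(LINT Z|mu. a Z * of_real (h Z)) = 0" if h: "continuous_on UNIV h" for h :: "complex^'n^'n \<Rightarrow> real"
  proof -
    have "norm (LINT Z|mu. a Z * of_real (h Z)) \<le> e" if e: "e > 0" for e
    proof -
      define d where "d = e / (C + 1)"
      have d: "d > 0" "C * d \<le> e" using e C(1) by (auto simp: d_def field_simps)
      obtain p where p: "real_polynomial_function p" "\<And>Z. Z \<in> closure dom \<Longrightarrow> \<bar>h Z - p Z\<bar> < d"
        using Stone_Weierstrass_real_polynomial_function[of "closure dom" h d] d(1) bounded_cartan_domain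
          continuous_on_subset[OF h] by auto
      have pc: "continuous_on UNIV (\<lambda>Z. complex_of_real (p Z))"
        using hol_products_continuous[OF real_polynomial_hol_products[OF p(1)]] .
      have hc: "continuous_on UNIV (\<lambda>Z. complex_of_real (h Z))" using h by (intro continuous_intros)
      have "(LINT Z|mu. a Z * of_real (h Z)) = (LINT Z|mu. a Z * of_real (h Z)) - (LINT Z|mu. a Z * of_real (p Z))"
        using prod[OF real_polynomial_hol_products[OF p(1)]] by simp
      also have "\<dots> = (LINT Z|mu. a Z * of_real (h Z) - a Z * of_real (p Z))"
        by (rule Bochner_Integration.integral_diff[symmetric]) (intro intc hc pc)+
      finally have "norm (LINT Z|mu. a Z * of_real (h Z)) = norm (LINT Z|mu. a Z * of_real (h Z) - a Z * of_real (p Z))"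
        by simp
      also have "\<dots> \<le> (LINT Z|mu. norm (a Z * of_real (h Z) - a Z * of_real (p Z)))"
        by (rule integral_norm_bound)
      also have "\<dots> \<le> (LINT Z|mu. C * d)"
      proof (rule integral_mono_AE)
        show "integrable mu (\<lambda>Z. norm (a Z * of_real (h Z) - a Z * of_real (p Z)))"
          by (intro integrable_norm Bochner_Integration.integrable_diff intc hc pc)
        show "AE Z in mu. norm (a Z * of_real (h Z) - a Z * of_real (p Z)) \<le> C * d"
          using C(2) AE_space
        proof eventually_elim
          case (elim Z)
          have "norm (a Z * of_real (h Z) - a Z * of_real (p Z)) = norm (a Z) * \<bar>h Z - p Z\<bar>"
            by (simp add: right_diff_distrib[symmetric] norm_mult flip: of_real_diff)
          also have "\<dots> \<le> C * d"
            using elim C(1) p(2)[of Z] closure_subset[of dom] by (intro mult_mono) auto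
          finally show ?case .
        qed
      qed simp
      also have "\<dots> = C * d" by simp
      finally show ?thesis using d(2) by simp
    qed
    then have "norm (LINT Z|mu. a Z * of_real (h Z)) \<le> 0" by (rule field_le_epsilon) simp
    then show ?thesis by simp
  qed
  have closed: "(LINT Z|mu. a Z * indicator T Z) = 0" if T: "closed T" for T
  proof (cases "T = {}")
    case False
    \<comment> \<open>These continuous functions decrease to the indicator of \<open>T\<close>.\<close>
    define h where "h n Z = max 0 (1 - real n * infdist Z T)" for n Z
    have hc: "continuous_on UNIV (h n)" for n
      unfolding h_def by (intro continuous_intros)
    have hb: "0 \<le> h n Z" "h n Z \<le> 1" for n Z
      using infdist_nonneg[of Z T] by (auto simp: h_def)
    have "(\<lambda>n. LINT Z|mu. a Z * of_real (h n Z)) \<longlonglongrightarrow> (LINT Z|mu. a Z * indicator T Z)"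
    proof (rule integral_dominated_convergence[where w = "\<lambda>_. C"])
      have "(\<lambda>Z. indicator T Z :: complex) \<in> borel_measurable mu"
        using borel_closed[OF T] by (intro borel_measurable_mu_borel borel_measurable_indicator)
      then show "(\<lambda>Z. a Z * indicator T Z) \<in> borel_measurable mu" by measurable
      show "(\<lambda>Z. a Z * of_real (h n Z)) \<in> borel_measurable mu" for n
        using intc[of "\<lambda>Z. of_real (h n Z)"] hc by (auto intro!: continuous_intros)
      show "AE Z in mu. (\<lambda>n. a Z * of_real (h n Z)) \<longlonglongrightarrow> a Z * indicator T Z"
      proof (rule AE_I2)
        fix Z
        have "(\<lambda>n. h n Z) \<longlonglongrightarrow> indicator T Z"
        proof (cases "Z \<in> T")
          case True
          then show ?thesis by (simp add: h_def)
        next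
          case F: False
          then have pos: "infdist Z T > 0"
            using T False in_closed_iff_infdist_zero[of T Z] infdist_nonneg[of Z T] by auto
          obtain N :: nat where "1 / infdist Z T < real N" using reals_Archimedean2 by blast
          then have "1 < real N * infdist Z T" using pos by (simp add: pos_divide_less_eq)
          then have "h n Z = 0" if "n \<ge> N" for n
          proof -
            have "real N * infdist Z T \<le> real n * infdist Z T" using that pos by (intro mult_right_mono) auto
            then have "1 - real n * infdist Z T \<le> 0" using \<open>1 < real N * infdist Z T\<close> by linarith
            then show ?thesis unfolding h_def by (rule max_absorb1)
          qed
          then have "\<forall>\<^sub>F n in sequentially. h n Z = 0" by (auto simp: eventually_sequentially)
          then show ?thesis using F by (simp add: tendsto_eventually)
        qed
        then have "(\<lambda>n. a Z * of_real (h n Z)) \<longlonglongrightarrow> a Z * of_real (indicator T Z)"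
          by (intro tendsto_intros)
        then show "(\<lambda>n. a Z * of_real (h n Z)) \<longlonglongrightarrow> a Z * indicator T Z"
          by (simp add: indicator_def of_bool_def split: if_splits)
      qed
      show "AE Z in mu. norm (a Z * of_real (h n Z)) \<le> C" for n
        using C(2)
      proof eventually_elim
        case (elim Z)
        have "norm (a Z) * \<bar>h n Z\<bar> \<le> C * 1" using elim hb[of n Z] C(1) by (intro mult_mono) auto
        then show ?case by (simp add: norm_mult)
      qed
    qed simp
    moreover have "(LINT Z|mu. a Z * of_real (h n Z)) = 0" for n by (rule cont[OF hc])
    ultimately show ?thesis by (simp add: LIMSEQ_const_iff)
  qed simp
  have part: "AE Z in mu. s * Re (c * a Z) \<le> 0" if cs: "norm c = 1" "\<bar>s\<bar> = 1" for c :: complex and s :: real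
  proof (rule symbol_zero_real)
    show "(\<lambda>Z. s * Re (c * a Z)) \<in> borel_measurable mu" by measurable
    show "AE Z in mu. \<bar>s * Re (c * a Z)\<bar> \<le> C"
      using C(2)
    proof eventually_elim
      case (elim Z)
      then show ?case using abs_Re_le_cmod[of "c * a Z"] cs by (simp add: abs_mult norm_mult)
    qed
    fix T :: "(complex^'n^'n) set" assume T: "closed T"
    have im: "(\<lambda>Z. indicator T Z :: complex) \<in> borel_measurable mu"
      using borel_closed[OF T] by (intro borel_measurable_mu_borel borel_measurable_indicator)
    have int: "integrable mu (\<lambda>Z. a Z * indicator T Z)"
      by (rule integrable_bounded_mult[OF am C(2) im, where B = 1]) (auto simp: indicator_def)
    have "(LINT Z|mu. s * Re (c * a Z) * indicator T Z) = (LINT Z|mu. s * Re (c * (a Z * indicator T Z)))"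
      by (rule Bochner_Integration.integral_cong) (auto simp: indicator_def)
    also have "\<dots> = s * Re (LINT Z|mu. c * (a Z * indicator T Z))"
      using integral_Re[OF integrable_mult_right[OF int, of c]] by simp
    also have "\<dots> = 0" using closed[OF T] by simp
    finally show "(LINT Z|mu. s * Re (c * a Z) * indicator T Z) = 0" .
  qed
  have "AE Z in mu. 1 * Re (1 * a Z) \<le> 0 \<and> (-1) * Re (1 * a Z) \<le> 0
      \<and> 1 * Re (\<i> * a Z) \<le> 0 \<and> (-1) * Re (\<i> * a Z) \<le> 0"
    by (intro AE_conjI part) auto
  then show ?thesis by eventually_elim (simp add: complex_eq_iff)
qed

end

section \<open>Intertwining operators\<close>

context bergman
begin

lemma bounded_operatorsD:
  assumes "T \<in> bounded_operators lam A2 A2"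
  shows "f \<in> A2 \<Longrightarrow> T f \<in> A2"
    and "f \<in> A2 \<Longrightarrow> g \<in> A2 \<Longrightarrow> T (f + g) = T f + T g"
    and "f \<in> A2 \<Longrightarrow> T (cscale c f) = cscale c (T f)"
    and "\<exists>C\<ge>0. \<forall>f\<in>A2. L2.nrm (T f) \<le> C * L2.nrm f"
proof -
  show "f \<in> A2 \<Longrightarrow> T f \<in> A2" "f \<in> A2 \<Longrightarrow> g \<in> A2 \<Longrightarrow> T (f + g) = T f + T g"
    "f \<in> A2 \<Longrightarrow> T (cscale c f) = cscale c (T f)"
    using assms by (auto simp: bounded_operators_def)
  obtain C where C: "\<And>f. f \<in> A2 \<Longrightarrow> L2.nrm (T f) \<le> C * L2.nrm f"
    using assms unfolding bounded_operators_def L2_norm_nrm by blast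
  have "L2.nrm (T f) \<le> max C 0 * L2.nrm f" if "f \<in> A2" for f
    using order_trans[OF C[OF that] mult_right_mono[of C "max C 0" "L2.nrm f"]] that A2_L2 by simp
  then show "\<exists>C\<ge>0. \<forall>f\<in>A2. L2.nrm (T f) \<le> C * L2.nrm f" by (intro exI[of _ "max C 0"]) simp
qed

lemma bounded_operatorsI:
  assumes "\<And>f. f \<in> A2 \<Longrightarrow> T f \<in> A2"
    and "\<And>f g. f \<in> A2 \<Longrightarrow> g \<in> A2 \<Longrightarrow> T (f + g) = T f + T g"
    and "\<And>f c. f \<in> A2 \<Longrightarrow> T (cscale c f) = cscale c (T f)"
    and "\<And>f. f \<in> A2 \<Longrightarrow> L2.nrm (T f) \<le> C * L2.nrm f"
  shows "T \<in> bounded_operators lam A2 A2"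
  unfolding bounded_operators_def L2_norm_nrm using assms by blast

lemma bounded_operators_diff:
  assumes T: "T \<in> bounded_operators lam A2 A2" and f: "f \<in> A2" and g: "g \<in> A2"
  shows "T (f - g) = T f - T g"
proof -
  have "T f = T ((f - g) + g)" by simp
  also have "\<dots> = T (f - g) + T g" using f g by (intro bounded_operatorsD(2)[OF T]) auto
  finally show ?thesis by simp
qed

lemma bounded_operators_zero: "T \<in> bounded_operators lam A2 A2 \<Longrightarrow> T 0 = 0"
  using bounded_operators_diff[of T 0 0] by simp

lemma bounded_operators_add:
  assumes S: "S \<in> bounded_operators lam A2 A2" and T: "T \<in> bounded_operators lam A2 A2"
  shows "(\<lambda>f. S f + T f) \<in> bounded_operators lam A2 A2"
proof -
  note SD = bounded_operatorsD[OF S] and TD = bounded_operatorsD[OF T]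
  obtain C D where C: "\<forall>f\<in>A2. L2.nrm (S f) \<le> C * L2.nrm f" and D: "\<forall>f\<in>A2. L2.nrm (T f) \<le> D * L2.nrm f"
    using SD(4) TD(4) by blast
  show ?thesis
  proof (rule bounded_operatorsI[where C = "C + D"])
    fix f assume f: "f \<in> A2"
    show "S f + T f \<in> A2" using SD(1)[OF f] TD(1)[OF f] by simp
    show "S (f + g) + T (f + g) = (S f + T f) + (S g + T g)" if "g \<in> A2" for g
      using SD(2)[OF f that] TD(2)[OF f that] by (simp add: add_ac)
    show "S (cscale c f) + T (cscale c f) = cscale c (S f + T f)" for c
      using SD(3)[OF f] TD(3)[OF f] by (simp add: cfun.scale_right_distrib)
    have "L2.nrm (S f + T f) \<le> L2.nrm (S f) + L2.nrm (T f)"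
      using SD(1)[OF f] TD(1)[OF f] A2_L2 by (intro L2.nrm_triangle) auto
    also have "\<dots> \<le> (C + D) * L2.nrm f" using C D f by (simp add: distrib_right add_mono)
    finally show "L2.nrm (S f + T f) \<le> (C + D) * L2.nrm f" .
  qed
qed

lemma bounded_operators_scale:
  assumes T: "T \<in> bounded_operators lam A2 A2"
  shows "(\<lambda>f. cscale c (T f)) \<in> bounded_operators lam A2 A2"
proof -
  note TD = bounded_operatorsD[OF T]
  obtain D where D: "\<forall>f\<in>A2. L2.nrm (T f) \<le> D * L2.nrm f"
    using TD(4) by blast
  show ?thesis
  proof (rule bounded_operatorsI[where C = "norm c * D"])
    fix f assume f: "f \<in> A2"
    show "cscale c (T f) \<in> A2" using TD(1)[OF f] by simp
    show "cscale c (T (f + g)) = cscale c (T f) + cscale c (T g)" if "g \<in> A2" for g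
      using TD(2)[OF f that] by (simp add: cfun.scale_right_distrib)
    show "cscale c (T (cscale d f)) = cscale d (cscale c (T f))" for d
      using TD(3)[OF f] by (simp add: mult.commute)
    show "L2.nrm (cscale c (T f)) \<le> (norm c * D) * L2.nrm f"
      using D f A2_L2[OF TD(1)[OF f]] by (simp add: L2.nrm_cscale mult.assoc mult_left_mono)
  qed
qed

lemma bounded_operators_compose:
  assumes S: "S \<in> bounded_operators lam A2 A2" and T: "T \<in> bounded_operators lam A2 A2"
  shows "(\<lambda>f. S (T f)) \<in> bounded_operators lam A2 A2"
proof -
  note SD = bounded_operatorsD[OF S] and TD = bounded_operatorsD[OF T]
  obtain C D where C: "C \<ge> 0" "\<forall>f\<in>A2. L2.nrm (S f) \<le> C * L2.nrm f" and D: "\<forall>f\<in>A2. L2.nrm (T f) \<le> D * L2.nrm f"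
    using SD(4) TD(4) by blast
  show ?thesis
  proof (rule bounded_operatorsI[where C = "C * D"])
    fix f assume f: "f \<in> A2"
    show "S (T f) \<in> A2" using SD(1) TD(1)[OF f] by simp
    show "S (T (f + g)) = S (T f) + S (T g)" if "g \<in> A2" for g
      using SD(2) TD(1,2) f that by simp
    show "S (T (cscale c f)) = cscale c (S (T f))" for c
      using SD(3) TD(1,3) f by simp
    have "L2.nrm (S (T f)) \<le> C * L2.nrm (T f)" using C(2) TD(1)[OF f] by blast
    also have "\<dots> \<le> C * (D * L2.nrm f)" using C(1) D f by (intro mult_left_mono) auto
    finally show "L2.nrm (S (T f)) \<le> C * D * L2.nrm f" by (simp add: mult.assoc)
  qed
qed

lemma invariant_symbol_umap: "invariant_symbol H a \<longleftrightarrow> (\<forall>h\<in>H. AE Z in mu. a (umap h Z) = a Z)"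
  unfolding invariant_symbol_def AE_mu_iff umap_def by (auto simp: case_prod_beta)

text \<open>After moving the representation to the other side and changing variables, only the symbol is left
  composed with the group element.\<close>

lemma ip_rep_toeplitz:
  assumes h: "h \<in> unitary_pairs" and a: "a \<in> symbols" and f: "f \<in> A2" and g: "g \<in> A2"
  shows "ip lam (bergman_rep h (toeplitz lam a f)) g = (LINT Z|mu. a (umap h Z) * (bergman_rep h f Z * cnj (g Z)))"
proof -
  let ?g = "bergman_rep (uinv h) g"
  let ?F = "\<lambda>Z. a Z * (f Z * cnj (?g Z))"
  have gA: "?g \<in> A2" using rep_A2[OF uinv_unitary[OF h] g] .
  note [measurable] = symbolsD(1)[OF a]
  have [measurable]: "f \<in> borel_measurable mu" "?g \<in> borel_measurable mu"
    using f gA A2_L2 by (auto simp: L2_iff)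
  have "ip lam (bergman_rep h (toeplitz lam a f)) g = ip lam (toeplitz lam a f) ?g"
    using h a f g by (intro ip_rep_left) (auto intro: A2_L2 toeplitz_in_A2)
  also have "\<dots> = (LINT Z|mu. ?F Z)" using a f gA by (rule ip_toeplitz)
  also have "\<dots> = (LINT Z|mu. ?F (umap h Z))"
    by (rule integral_domain_isometry[OF domain_isometry_umap[OF h], symmetric]) measurable
  finally show ?thesis using umap_uinv[OF h] by (simp add: bergman_rep_umap)
qed

text \<open>The conjugate of the Toeplitz operator by \<open>h\<close> has the symbol \<open>a \<circ> umap h\<close>, and symbols are determined by
  their operators.\<close>

lemma toeplitz_commutes_iff:
  assumes h: "h \<in> unitary_pairs" and a: "a \<in> symbols"
  shows "(\<forall>f\<in>A2. toeplitz lam a (bergman_rep h f) = bergman_rep h (toeplitz lam a f))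
    \<longleftrightarrow> (AE Z in mu. a (umap h Z) = a Z)"
proof
  have am [measurable]: "a \<in> borel_measurable mu" by (rule symbolsD(1)[OF a])
  have ahm [measurable]: "(\<lambda>Z. a (umap h Z)) \<in> borel_measurable mu"
    using measurable_compose[OF domain_isometry_measurable[OF domain_isometry_umap[OF h]] am] .
  assume ae: "AE Z in mu. a (umap h Z) = a Z"
  show "\<forall>f\<in>A2. toeplitz lam a (bergman_rep h f) = bergman_rep h (toeplitz lam a f)"
  proof
    fix f assume f: "f \<in> A2"
    have rf: "bergman_rep h f \<in> A2" using h f by (rule rep_A2)
    show "toeplitz lam a (bergman_rep h f) = bergman_rep h (toeplitz lam a f)"
    proof (rule A2_eqI)
      fix g assume g: "g \<in> A2"
      have [measurable]: "bergman_rep h f \<in> borel_measurable mu" "g \<in> borel_measurable mu"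
        using rf g A2_L2 by (auto simp: L2_iff)
      have "(LINT Z|mu. a Z * (bergman_rep h f Z * cnj (g Z))) = (LINT Z|mu. a (umap h Z) * (bergman_rep h f Z * cnj (g Z)))"
      proof (rule integral_cong_AE)
        show "AE Z in mu. a Z * (bergman_rep h f Z * cnj (g Z)) = a (umap h Z) * (bergman_rep h f Z * cnj (g Z))"
          using ae by eventually_elim simp
      qed measurable
      then show "ip lam (toeplitz lam a (bergman_rep h f)) g = ip lam (bergman_rep h (toeplitz lam a f)) g"
        using ip_toeplitz[OF a rf g] ip_rep_toeplitz[OF h a f g] by simp
    qed (use rf f a h toeplitz_in_A2 rep_A2 in auto)
  qed
next
  have am [measurable]: "a \<in> borel_measurable mu" by (rule symbolsD(1)[OF a])
  have ahm [measurable]: "(\<lambda>Z. a (umap h Z)) \<in> borel_measurable mu"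
    using measurable_compose[OF domain_isometry_measurable[OF domain_isometry_umap[OF h]] am] .
  obtain C where C: "AE Z in mu. norm (a Z) \<le> C" using symbolsD(2)[OF a] by blast
  have Ch: "AE Z in mu. norm (a (umap h Z)) \<le> C"
    using AE_domain_isometry[OF domain_isometry_umap[OF h] C] .
  define d where "d Z = a (umap h Z) - a Z" for Z
  have ds: "d \<in> symbols"
  proof (rule symbolsI[where C = "C + C"])
    show "d \<in> borel_measurable mu" unfolding d_def by measurable
    show "AE Z in mu. norm (d Z) \<le> C + C"
      using C Ch by eventually_elim (auto simp: d_def intro: order_trans[OF norm_triangle_ineq4])
  qed
  assume com: "\<forall>f\<in>A2. toeplitz lam a (bergman_rep h f) = bergman_rep h (toeplitz lam a f)"
  have "AE Z in mu. d Z = 0"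
  proof (rule symbol_zero[OF ds])
    fix f g assume f: "f \<in> A2" and g: "g \<in> A2"
    define f' where "f' = bergman_rep (uinv h) f"
    have f': "f' \<in> A2" "bergman_rep h f' = f"
      using rep_A2[OF uinv_unitary[OF h] f] bergman_rep_uinv[OF h] by (auto simp: f'_def)
    have prod: "(\<lambda>Z. f Z * cnj (g Z)) \<in> borel_measurable mu"
      using integrable_L2_mult(2)[OF A2_L2[OF f] A2_L2[OF g]] by auto
    have int: "integrable mu (\<lambda>Z. b Z * (f Z * cnj (g Z)))" if b: "b \<in> symbols" for b
      using integrable_L2_mult(2)[OF symbol_mult_L2[OF b A2_L2[OF f]] A2_L2[OF g]] by (simp add: mult.assoc)
    have ahs: "(\<lambda>Z. a (umap h Z)) \<in> symbols" using ahm Ch by (rule symbolsI)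
    have "(LINT Z|mu. d Z * (f Z * cnj (g Z)))
        = (LINT Z|mu. a (umap h Z) * (f Z * cnj (g Z)) - a Z * (f Z * cnj (g Z)))"
      by (simp add: d_def left_diff_distrib)
    also have "\<dots> = (LINT Z|mu. a (umap h Z) * (f Z * cnj (g Z))) - (LINT Z|mu. a Z * (f Z * cnj (g Z)))"
      by (rule Bochner_Integration.integral_diff[OF int[OF ahs] int[OF a]])
    also have "\<dots> = ip lam (bergman_rep h (toeplitz lam a f')) g - ip lam (toeplitz lam a f) g"
      using ip_rep_toeplitz[OF h a f'(1) g] ip_toeplitz[OF a f g] f'(2) by simp
    also have "bergman_rep h (toeplitz lam a f') = toeplitz lam a f"
      using com f' by metis
    finally show "(LINT Z|mu. d Z * (f Z * cnj (g Z))) = 0" by simp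
  qed
  then show "AE Z in mu. a (umap h Z) = a Z" by eventually_elim (simp add: d_def)
qed

end

locale bergman_subgroup = bergman lam dimtype
  for lam :: real and dimtype :: "'n::finite itself" +
  fixes H :: "((complex^'n^'n) \<times> (complex^'n^'n)) set"
  assumes subgroup_H: "subgroup H (unitary_group \<times>\<times> unitary_group)"
begin

lemma H_unitary: "h \<in> H \<Longrightarrow> h \<in> unitary_pairs" and H_inv: "h \<in> H \<Longrightarrow> uinv h \<in> H"
  using subgroup_unitary[OF subgroup_H] by blast+

abbreviation Endo :: "((complex^'n^'n \<Rightarrow> complex) \<Rightarrow> complex^'n^'n \<Rightarrow> complex) set" where
  "Endo \<equiv> intertwining_operators lam H A2 A2"

lemma Endo_iff: "T \<in> Endo \<longleftrightarrow> T \<in> bounded_operators lam A2 A2 \<and>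
    (\<forall>h\<in>H. \<forall>f\<in>A2. T (bergman_rep h f) = bergman_rep h (T f))"
  by (simp add: intertwining_operators_def)

lemma EndoD: "T \<in> Endo \<Longrightarrow> T \<in> bounded_operators lam A2 A2"
  "T \<in> Endo \<Longrightarrow> h \<in> H \<Longrightarrow> f \<in> A2 \<Longrightarrow> T (bergman_rep h f) = bergman_rep h (T f)"
  by (auto simp: Endo_iff)

lemma invariant_symbol_iff_toeplitz:
  assumes a: "a \<in> symbols" shows "invariant_symbol H a \<longleftrightarrow> toeplitz lam a \<in> Endo"
  unfolding invariant_symbol_umap Endo_iff
  using toeplitz_commutes_iff[OF H_unitary a] toeplitz_bounded_operator[OF a] by blast

lemma Endo_closed:
  assumes T: "T \<in> bounded_operators lam A2 A2"
    and approx: "\<And>e. e > 0 \<Longrightarrow> \<exists>S\<in>Endo. \<forall>f\<in>A2. L2.nrm (T f - S f) \<le> e * L2.nrm f"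
  shows "T \<in> Endo"
  unfolding Endo_iff
proof (intro conjI ballI T)
  fix h f assume h: "h \<in> H" and f: "f \<in> A2"
  note hu = H_unitary[OF h] and TA = bounded_operatorsD(1)[OF T]
  have rf: "bergman_rep h f \<in> A2" using hu f by (rule rep_A2)
  define d where "d = T (bergman_rep h f) - bergman_rep h (T f)"
  have dA: "d \<in> A2" unfolding d_def using TA rf f hu rep_A2 by simp
  have "L2.nrm d \<le> 0 + e" if e: "e > 0" for e
  proof -
    define e' where "e' = e / (2 * (L2.nrm f + 1))"
    have nf: "0 \<le> L2.nrm f" using A2_L2[OF f] by simp
    have e': "e' > 0" "2 * (e' * L2.nrm f) \<le> e"
      using e nf by (auto simp: e'_def field_simps)
    obtain S where S: "S \<in> Endo" "\<forall>f\<in>A2. L2.nrm (T f - S f) \<le> e' * L2.nrm f" using approx[OF e'(1)] by blast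
    note SA = bounded_operatorsD(1)[OF EndoD(1)[OF S(1)]]
    have "d = (T (bergman_rep h f) - S (bergman_rep h f)) + bergman_rep h (S f - T f)"
      using EndoD(2)[OF S(1) h f] by (simp add: d_def bergman_rep_diff)
    then have "L2.nrm d \<le> L2.nrm (T (bergman_rep h f) - S (bergman_rep h f)) + L2.nrm (bergman_rep h (S f - T f))"
      using TA SA rf f hu rep_A2 A2_L2 by (metis A2_simps(3) L2.nrm_triangle)
    also have "L2.nrm (bergman_rep h (S f - T f)) = L2.nrm (T f - S f)"
      using TA[OF f] SA[OF f] A2_L2 nrm_rep[OF hu] L2.nrm_minus_commute by simp
    also have "L2.nrm (T (bergman_rep h f) - S (bergman_rep h f)) \<le> e' * L2.nrm f"
      using bspec[OF S(2) rf] nrm_rep[OF hu A2_L2[OF f]] by simp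
    also have "L2.nrm (T f - S f) \<le> e' * L2.nrm f" using S(2) f by blast
    finally show ?thesis using e'(2) by simp
  qed
  then have "L2.nrm d \<le> 0" by (rule field_le_epsilon)
  then have "L2.nrm d = 0" using A2_L2[OF dA] by (simp add: order_antisym)
  then have "d = 0" using A2_definite[OF dA] by simp
  then show "T (bergman_rep h f) = bergman_rep h (T f)" by (simp add: d_def)
qed

lemma Endo_subalgebra: "unital_banach_subalgebra lam Endo"
  unfolding unital_banach_subalgebra_def
proof (intro conjI ballI allI impI)
  show "Endo \<subseteq> bounded_operators lam A2 A2" using EndoD(1) by blast
  have "(\<lambda>f. f) \<in> bounded_operators lam A2 A2"
    by (rule bounded_operatorsI[where C = 1]) simp_all
  then show "(\<lambda>f. f) \<in> Endo" by (simp add: Endo_iff)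
  fix T assume T: "T \<in> Endo"
  note TA = bounded_operatorsD(1)[OF EndoD(1)[OF T]]
  show "(\<lambda>f. cscale c (T f)) \<in> Endo" for c
    using bounded_operators_scale[OF EndoD(1)[OF T]] EndoD(2)[OF T]
    by (simp add: Endo_iff bergman_rep_cscale)
  fix S assume S: "S \<in> Endo"
  show "(\<lambda>f. S f + T f) \<in> Endo"
    using bounded_operators_add[OF EndoD(1)[OF S] EndoD(1)[OF T]] EndoD(2)[OF T] EndoD(2)[OF S]
    by (simp add: Endo_iff bergman_rep_add)
  show "(\<lambda>f. S (T f)) \<in> Endo"
    using bounded_operators_compose[OF EndoD(1)[OF S] EndoD(1)[OF T]] EndoD(2)[OF T] EndoD(2)[OF S] TA
    by (simp add: Endo_iff)
next
  fix T assume "T \<in> bounded_operators lam A2 A2"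
    and "\<forall>e>0. \<exists>S\<in>Endo. \<forall>f\<in>A2. L2_norm lam (T f - S f) \<le> e * L2_norm lam f"
  then show "T \<in> Endo" by (intro Endo_closed) (simp_all add: L2_norm_nrm)
qed

lemma toeplitz_algebra_subset_Endo: "toeplitz_algebra lam (invariant_symbols H) \<subseteq> Endo"
proof -
  have "toeplitz lam ` invariant_symbols H \<subseteq> Endo"
    using invariant_symbol_iff_toeplitz by (auto simp: invariant_symbols_def)
  then show ?thesis using Endo_subalgebra by (auto simp: toeplitz_algebra_def)
qed

lemma toeplitz_in_algebra:
  "a \<in> invariant_symbols H \<Longrightarrow> toeplitz lam a \<in> toeplitz_algebra lam (invariant_symbols H)"
  by (auto simp: toeplitz_algebra_def)

end

section \<open>Realizing intertwining operators on finite dimensional subspaces\<close>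

lemma (in semi_inner) orthonormal_independent:
  assumes E: "finite E" "orthonormal E" and z: "(\<Sum>e\<in>E. cscale (d e) e) = 0" and e: "e \<in> E"
  shows "d e = 0"
proof -
  have EV: "x \<in> V" if "x \<in> E" for x using E that by (auto simp: orthonormal_def)
  have "0 = ip (\<Sum>x\<in>E. cscale (d x) x) e" using z EV[OF e] by (simp only: ip_zero)
  also have "\<dots> = (\<Sum>x\<in>E. d x * ip x e)" using EV e by (subst ip_sum) (auto simp: ip_scale)
  also have "\<dots> = (\<Sum>x\<in>E. if x = e then d x else 0)"
    using E e by (intro sum.cong) (auto simp: orthonormal_def)
  also have "\<dots> = d e" using E e by simp
  finally show ?thesis by simp
qed

lemma (in semi_inner) proj_eq_self:
  assumes E: "finite E" "orthonormal E" and def: "\<And>f. f \<in> cfun.span E \<Longrightarrow> nrm f = 0 \<Longrightarrow> f = 0"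
    and f: "f \<in> cfun.span E"
  shows "proj E f = f"
proof -
  have fV: "f \<in> V" using f span_subset_V[of E] E by (auto simp: orthonormal_def)
  have d: "f - proj E f \<in> cfun.span E" using f proj_in_span by (rule cfun.span_diff)
  have "ip (f - proj E f) (f - proj E f) = 0" by (rule proj_orthogonal[OF E fV d])
  then have "f - proj E f = 0" by (intro def d) (simp add: nrm_def)
  then show ?thesis by simp
qed

context bergman
begin

lemma finite_dimensional_orthonormal_basis:
  assumes "finite_dimensional W" "W \<subseteq> A2"
  obtains E where "finite E" "L2.orthonormal E" "cfun.span E = W"
proof -
  obtain B where B: "finite B" "W = cfun.span B" using assms(1) by (auto simp: finite_dimensional_def)
  have BA: "cfun.span B \<subseteq> A2" using B assms by simp
  have "B \<subseteq> L2" using cfun.span_superset[of B] BA A2_subset by (rule order_trans[OF order_trans])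
  moreover have "f = 0" if "f \<in> cfun.span B" "L2.nrm f = 0" for f using that BA A2_definite by blast
  ultimately have "\<exists>E. finite E \<and> L2.orthonormal E \<and> cfun.span E = cfun.span B"
    using B(1) by (intro L2.orthonormal_basis_exists)
  then show ?thesis using that B(2) by metis
qed

text \<open>The reproducing kernel of the span of the orthonormal set \<open>E\<close>, on the diagonal.\<close>

definition diag_kernel :: "(complex^'n^'n \<Rightarrow> complex) set \<Rightarrow> complex^'n^'n \<Rightarrow> real" where
  "diag_kernel E Z = (\<Sum>e\<in>E. (norm (e Z))\<^sup>2)"

lemma diag_kernel_nonneg [simp]: "0 \<le> diag_kernel E Z"
  by (simp add: diag_kernel_def sum_nonneg)

lemma norm_sq_le_diag_kernel: "finite E \<Longrightarrow> e \<in> E \<Longrightarrow> (norm (e Z))\<^sup>2 \<le> diag_kernel E Z"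
  unfolding diag_kernel_def by (rule member_le_sum) auto

lemma norm_le_sqrt_diag_kernel: "finite E \<Longrightarrow> e \<in> E \<Longrightarrow> norm (e Z) \<le> sqrt (diag_kernel E Z)"
  by (rule real_le_rsqrt) (rule norm_sq_le_diag_kernel)

lemma span_diag_kernel_zero:
  assumes E: "finite E" and f: "f \<in> cfun.span E" and 0: "diag_kernel E Z = 0"
  shows "f Z = 0"
proof -
  have "cfun.span E \<subseteq> {f. f Z = 0}"
  proof (rule cfun.span_minimal)
    show "E \<subseteq> {f. f Z = 0}" using norm_sq_le_diag_kernel[OF E, of _ Z] 0 by fastforce
    show "cfun.subspace {f. f Z = 0}" by (simp add: cfun.subspace_def cscale_def)
  qed
  then show ?thesis using f by blast
qed

text \<open>The kernel at \<open>Z\<close> is the square norm of evaluation at \<open>Z\<close> on the span, and the value of \<open>f\<close> at \<open>umap h Z\<close>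
  is the value at \<open>Z\<close> of an element of the span with the same norm. The inverse of \<open>h\<close> gives the
  opposite inequality.\<close>

lemma diag_kernel_umap_le:
  assumes E: "finite E" "L2.orthonormal E" "cfun.span E \<subseteq> A2"
    and h: "h \<in> unitary_pairs"
    and inv: "\<And>f. f \<in> cfun.span E \<Longrightarrow> bergman_rep h f \<in> cfun.span E"
  shows "diag_kernel E (umap h Z) \<le> diag_kernel E Z"
proof -
  let ?W = "cfun.span E"
  have EL: "E \<subseteq> L2" using E(2) by (simp add: L2.orthonormal_def)
  have WL: "f \<in> L2" if "f \<in> ?W" for f using that E(3) A2_L2 by blast
  define k where "k = diag_kernel E (umap h Z)"
  define f where "f = (\<Sum>e\<in>E. cscale (cnj (e (umap h Z))) e)"
  have fW: "f \<in> ?W" unfolding f_def by (intro cfun.span_sum cfun.span_scale cfun.span_base)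
  have sum_apply: "(\<Sum>e\<in>E. g e) Y = (\<Sum>e\<in>E. g e Y)" for g :: "_ \<Rightarrow> complex^'n^'n \<Rightarrow> complex" and Y
    using E(1) by (induction E rule: finite_induct) auto
  have "f (umap h Z) = of_real k"
    unfolding f_def sum_apply k_def diag_kernel_def of_real_sum cscale_def complex_norm_square
    by (simp add: mult.commute)
  moreover have nf: "(L2.nrm f)\<^sup>2 = k"
  proof -
    have "ip lam f e = cnj (e (umap h Z))" if e: "e \<in> E" for e
    proof -
      have "ip lam f e = (\<Sum>e'\<in>E. cnj (e' (umap h Z)) * ip lam e' e)"
        unfolding f_def using EL e by (subst L2.ip_sum) (auto simp: L2.ip_scale subset_iff)
      also have "\<dots> = (\<Sum>e'\<in>E. if e' = e then cnj (e' (umap h Z)) else 0)"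
        using E(2) e by (intro sum.cong) (auto simp: L2.orthonormal_def)
      finally show ?thesis using E(1) e by simp
    qed
    moreover have "L2.proj E f = f"
      using E fW A2_definite by (intro L2.proj_eq_self) auto
    ultimately show ?thesis
      using L2.proj_properties(2)[OF E(1,2) WL[OF fW]] by (simp add: k_def diag_kernel_def)
  qed
  moreover have "(norm (g Z))\<^sup>2 \<le> diag_kernel E Z * (L2.nrm g)\<^sup>2" if g: "g \<in> ?W" for g
  proof -
    have pg: "L2.proj E g = g" using E g A2_definite by (intro L2.proj_eq_self) auto
    have "g Z = L2.proj E g Z" using pg by simp
    also have "\<dots> = (\<Sum>e\<in>E. ip lam g e * e Z)"
      unfolding L2.proj_def sum_apply cscale_def ..
    finally have "norm (g Z) \<le> (\<Sum>e\<in>E. norm (ip lam g e) * norm (e Z))"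
      using norm_sum[of "\<lambda>e. ip lam g e * e Z" E] by (simp add: norm_mult)
    then have "(norm (g Z))\<^sup>2 \<le> (\<Sum>e\<in>E. norm (ip lam g e) * norm (e Z))\<^sup>2" by (intro power_mono) auto
    also have "\<dots> \<le> (\<Sum>e\<in>E. (norm (ip lam g e))\<^sup>2) * (\<Sum>e\<in>E. (norm (e Z))\<^sup>2)"
      by (rule Cauchy_Schwarz_ineq_sum)
    also have "(\<Sum>e\<in>E. (norm (ip lam g e))\<^sup>2) = (L2.nrm g)\<^sup>2"
      using L2.proj_properties(2)[OF E(1,2) WL[OF g]] pg by simp
    finally show ?thesis by (simp add: diag_kernel_def mult.commute)
  qed
  from this[OF inv[OF fW]] have "(norm (f (umap h Z)))\<^sup>2 \<le> diag_kernel E Z * (L2.nrm f)\<^sup>2"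
    using nrm_rep[OF h WL[OF fW]] by (simp add: bergman_rep_umap)
  ultimately have "k * k \<le> diag_kernel E Z * k" by (simp add: power2_eq_square)
  moreover have "0 \<le> k" by (simp add: k_def)
  ultimately have "k \<le> diag_kernel E Z" by (cases "k = 0") (auto simp: mult_le_cancel_right)
  then show ?thesis by (simp add: k_def)
qed

text \<open>With \<open>k\<close> the kernel, \<open>a * f * cnj g\<close> is the product of \<open>a * sqrt k\<close> and the conjugate of this function, for
  \<open>f\<close> and \<open>g\<close> in the span. Prescribing the coefficients of a Toeplitz operator is therefore a Gram system for
  these functions, which the factor \<open>sqrt k\<close> in the denominator makes square integrable.\<close>

definition kernel_product ::
    "(complex^'n^'n \<Rightarrow> complex) set \<Rightarrow> (complex^'n^'n \<Rightarrow> complex) \<Rightarrow> (complex^'n^'n \<Rightarrow> complex) \<Rightarrow>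
     complex^'n^'n \<Rightarrow> complex" where
  "kernel_product E f g Z = cnj (f Z) * g Z / of_real (sqrt (diag_kernel E Z))"

lemma diag_kernel_measurable:
  assumes "E \<subseteq> L2" shows "(\<lambda>Z. diag_kernel E Z) \<in> borel_measurable mu"
  unfolding diag_kernel_def
proof (rule borel_measurable_sum)
  fix e assume "e \<in> E"
  then have [measurable]: "e \<in> borel_measurable mu" using assms by (auto simp: L2_iff)
  show "(\<lambda>Z. (norm (e Z))\<^sup>2) \<in> borel_measurable mu" by measurable
qed

lemma kernel_product_L2:
  assumes E: "finite E" "E \<subseteq> L2" and e: "e \<in> E" "e' \<in> E" shows "kernel_product E e e' \<in> L2"
proof -
  note [measurable] = diag_kernel_measurable[OF E(2)]
  have [measurable]: "e \<in> borel_measurable mu" "e' \<in> borel_measurable mu" using e E by (auto simp: L2_iff)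
  have m [measurable]: "kernel_product E e e' \<in> borel_measurable mu" unfolding kernel_product_def by measurable
  have "integrable mu (\<lambda>Z. (norm (kernel_product E e e' Z))\<^sup>2)"
  proof (rule Bochner_Integration.integrable_bound)
    show "integrable mu (\<lambda>Z. diag_kernel E Z)"
      unfolding diag_kernel_def using E by (intro Bochner_Integration.integrable_sum) (auto simp: L2_iff)
    have "(norm (kernel_product E e e' Z))\<^sup>2 \<le> diag_kernel E Z" for Z
    proof (cases "diag_kernel E Z = 0")
      case False
      then have p: "diag_kernel E Z > 0" by (simp add: order_less_le)
      have "(norm (e Z))\<^sup>2 * (norm (e' Z))\<^sup>2 \<le> diag_kernel E Z * diag_kernel E Z"
        using E e by (intro mult_mono norm_sq_le_diag_kernel) auto
      then show ?thesis
        using p by (simp add: kernel_product_def norm_divide norm_mult power_mult_distrib power_divide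
            pos_divide_le_eq)
    qed (simp add: kernel_product_def)
    then show "AE Z in mu. norm ((norm (kernel_product E e e' Z))\<^sup>2) \<le> norm (diag_kernel E Z)"
      by (intro AE_I2) simp
  qed measurable
  then show ?thesis using m by (simp add: L2_iff)
qed

text \<open>Polarization turns a relation between the products \<open>cnj e * e'\<close> on the diagonal into a relation
  between the functions \<open>cnj (e W) * e' Z\<close> of two variables, which are independent because the
  elements of \<open>E\<close> are.\<close>

lemma kernel_product_independent:
  assumes E: "finite E" "L2.orthonormal E" "E \<subseteq> A2"
    and z: "L2.nrm (\<Sum>p\<in>E \<times> E. cscale (c p) (kernel_product E (fst p) (snd p))) = 0"
  shows "\<forall>p\<in>E \<times> E. c p = 0"
proof -
  have EL: "E \<subseteq> L2" using E(3) A2_subset by blast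
  have sum_apply: "(\<Sum>i\<in>I. g i) Y = (\<Sum>i\<in>I. g i Y)" if "finite I"
    for I :: "'i set" and g :: "'i \<Rightarrow> complex^'n^'n \<Rightarrow> complex" and Y
    using that by (induction I rule: finite_induct) auto
  let ?x = "\<Sum>p\<in>E \<times> E. cscale (c p) (kernel_product E (fst p) (snd p))"
  let ?F = "\<lambda>Z. \<Sum>p\<in>E \<times> E. (c p * snd p Z) * cnj (fst p Z)"
  have fin: "finite (E \<times> E)" using E(1) by simp
  have xL: "?x \<in> L2" using E(1) EL by (intro L2.V_sum L2.V_simps kernel_product_L2) auto
  have x_eq: "?x Z = ?F Z / of_real (sqrt (diag_kernel E Z))" for Z
    unfolding sum_apply[OF fin] sum_divide_distrib
    by (intro sum.cong) (auto simp: cscale_def kernel_product_def)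
  have "AE Z in mu. ?F Z = 0"
    using nrm_zero_AE[OF xL z]
  proof eventually_elim
    case (elim Z)
    show ?case
    proof (cases "diag_kernel E Z = 0")
      case True
      then have "e Z = 0" if "e \<in> E" for e using norm_sq_le_diag_kernel[OF E(1) that, of Z] by simp
      then show ?thesis by (intro sum.neutral) auto
    next
      case False
      then show ?thesis using elim unfolding x_eq by simp
    qed
  qed
  moreover have "continuous_on dom ?F"
    using E(3) A2_continuous by (intro continuous_intros) auto
  ultimately have F0: "?F Z = 0" if "Z \<in> dom" for Z using AE_dom_continuous_zero that by blast
  have F2: "(\<Sum>p\<in>E \<times> E. (c p * snd p Z) * cnj (fst p W)) = 0" if "Z \<in> dom" "W \<in> dom" for Z W
  proof (rule polarization[OF fin open_cartan_domain convex_cartan_domain, where f = "\<lambda>p Z. c p * snd p Z" and g = fst])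
    fix p assume p: "p \<in> E \<times> E"
    show "line_holomorphic (\<lambda>Z. c p * snd p Z) dom" "line_holomorphic (fst p) dom"
      using p E(3) A2_holomorphic by (auto intro!: line_holomorphic_mult line_holomorphic_const)
  qed (use F0 that in auto)
  have F3: "(\<Sum>e\<in>E. c (e, e') * cnj (e W)) = 0" if e': "e' \<in> E" and W: "W \<in> dom" for e' W
  proof -
    define d where "d e' = (\<Sum>e\<in>E. c (e, e') * cnj (e W))" for e'
    have "(\<Sum>e'\<in>E. cscale (d e') e') = 0"
    proof
      fix Z
      have "(\<Sum>e'\<in>E. cscale (d e') e') Z = (\<Sum>e'\<in>E. \<Sum>e\<in>E. c (e, e') * e' Z * cnj (e W))"
        unfolding sum_apply[OF E(1)] by (simp add: cscale_def d_def sum_distrib_right sum_distrib_left mult_ac)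
      also have "\<dots> = (\<Sum>e\<in>E. \<Sum>e'\<in>E. c (e, e') * e' Z * cnj (e W))" by (rule sum.swap)
      also have "\<dots> = (\<Sum>p\<in>E \<times> E. (c p * snd p Z) * cnj (fst p W))"
        by (simp add: sum.cartesian_product case_prod_beta)
      also have "\<dots> = 0"
      proof (cases "Z \<in> dom")
        case False
        then show ?thesis using E(3) A2_outside by (intro sum.neutral) auto
      qed (rule F2[OF _ W])
      finally show "(\<Sum>e'\<in>E. cscale (d e') e') Z = 0 Z" by simp
    qed
    from L2.orthonormal_independent[OF E(1,2) this e'] show ?thesis by (simp add: d_def)
  qed
  show ?thesis
  proof
    fix p assume "p \<in> E \<times> E"
    then obtain e0 e' where p: "p = (e0, e')" "e0 \<in> E" "e' \<in> E" by auto
    have "(\<Sum>e\<in>E. cscale (cnj (c (e, e'))) e) = 0"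
    proof
      fix W
      show "(\<Sum>e\<in>E. cscale (cnj (c (e, e'))) e) W = 0 W"
      proof (cases "W \<in> dom")
        case True
        have "cnj (\<Sum>e\<in>E. c (e, e') * cnj (e W)) = 0" using F3[OF p(3) True] by simp
        then show ?thesis unfolding sum_apply[OF E(1)] by (simp add: cscale_def)
      next
        case False
        then show ?thesis unfolding sum_apply[OF E(1)] cscale_def using E(3) A2_outside
          by (simp, intro sum.neutral) auto
      qed
    qed
    from L2.orthonormal_independent[OF E(1,2) this p(2)] show "c p = 0" by (simp add: p(1))
  qed
qed

end

context bergman_subgroup
begin

text \<open>The symbol is sought in the span of the functions \<open>cnj e * e' / k\<close>, \<open>k\<close> the kernel of \<open>W\<close> on the
  diagonal. They are bounded, the group permutes their span because \<open>k\<close> is invariant, and by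
  independence the symbol in this span is unique. Hence it is invariant, without averaging over the
  group.\<close>

theorem finite_dimensional_realization:
  assumes T: "T \<in> Endo" and W: "invariant_subspace lam H W" "finite_dimensional W"
  shows "\<exists>a\<in>invariant_symbols H. \<forall>f\<in>W. \<forall>g\<in>W. ip lam (T f) g = ip lam (toeplitz lam a f) g"
proof -
  have WA: "W \<subseteq> A2" and sW: "cfun.subspace W" and Winv: "\<And>h f. h \<in> H \<Longrightarrow> f \<in> W \<Longrightarrow> bergman_rep h f \<in> W"
    using W(1) by (auto simp: invariant_subspace_def)
  obtain E where E: "finite E" "L2.orthonormal E" "cfun.span E = W"
    using finite_dimensional_orthonormal_basis[OF W(2) WA] .
  have EW: "E \<subseteq> W" using E(3) cfun.span_superset by blast
  have EA: "E \<subseteq> A2" using EW WA by blast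
  have EL: "E \<subseteq> L2" using EA A2_subset by blast
  note TB = EndoD(1)[OF T]
  define k where "k = diag_kernel E"
  define u where "u = kernel_product E"
  have km [measurable]: "k \<in> borel_measurable mu" using diag_kernel_measurable[OF EL] by (simp add: k_def)
  have k0: "0 \<le> k Z" for Z by (simp add: k_def)
  have k_inv: "k (umap h Z) = k Z" if h: "h \<in> H" for h Z
  proof (rule antisym)
    have le: "k (umap h Z) \<le> k Z" if h: "h \<in> H" for h Z
      unfolding k_def
      by (rule diag_kernel_umap_le[OF E(1,2) _ H_unitary[OF h]]) (use E(3) WA Winv[OF h] in auto)
    show "k (umap h Z) \<le> k Z" using h by (rule le)
    show "k Z \<le> k (umap h Z)" using le[OF H_inv[OF h], of "umap h Z"] umap_uinv[OF H_unitary[OF h]] by simp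
  qed
  have uL: "u e e' \<in> L2" if "e \<in> E" "e' \<in> E" for e e'
    unfolding u_def using E(1) EL that by (rule kernel_product_L2)
  have u_add: "u (f + f') g = u f g + u f' g" "u f (g + g') = u f g + u f g'" for f f' g g'
    by (simp_all add: u_def kernel_product_def fun_eq_iff distrib_left distrib_right add_divide_distrib)
  have u_scale: "u (cscale c f) g = cscale (cnj c) (u f g)" "u f (cscale c g) = cscale c (u f g)" for c f g
    by (simp_all add: u_def kernel_product_def fun_eq_iff cscale_def)
  have u_zero: "u 0 g = 0" "u f 0 = 0" for f g
    by (simp_all add: u_def kernel_product_def fun_eq_iff)
  define U where "U = cfun.span ((\<lambda>p. u (fst p) (snd p)) ` (E \<times> E))"
  have UL: "U \<subseteq> L2" unfolding U_def using uL by (intro L2.span_subset_V) auto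
  have uU: "u f g \<in> U" if f: "f \<in> W" and g: "g \<in> W" for f g
  proof -
    have 1: "W \<subseteq> {g. u e g \<in> U}" if e: "e \<in> E" for e
      unfolding E(3)[symmetric]
    proof (rule cfun.span_minimal)
      show "E \<subseteq> {g. u e g \<in> U}"
        unfolding U_def using e by (auto intro!: cfun.span_base image_eqI[of _ _ "(e, _)"])
      show "cfun.subspace {g. u e g \<in> U}"
        unfolding cfun.subspace_def mem_Collect_eq u_add u_scale u_zero U_def
        by (auto intro: cfun.span_add cfun.span_scale cfun.span_zero)
    qed
    have "W \<subseteq> {f. u f g \<in> U}"
      unfolding E(3)[symmetric]
    proof (rule cfun.span_minimal)
      show "E \<subseteq> {f. u f g \<in> U}" using 1 g by blast
      show "cfun.subspace {f. u f g \<in> U}"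
        unfolding cfun.subspace_def mem_Collect_eq u_add u_scale u_zero U_def
        by (auto intro: cfun.span_add cfun.span_scale cfun.span_zero)
    qed
    then show ?thesis using f by blast
  qed
  obtain c where c: "\<And>e e'. e \<in> E \<Longrightarrow> e' \<in> E \<Longrightarrow>
      ip lam (\<Sum>p\<in>E \<times> E. cscale (c p) (u (fst p) (snd p))) (u e e') = ip lam (T e) e'"
  proof -
    have "\<exists>c. \<forall>q\<in>E \<times> E. ip lam (\<Sum>p\<in>E \<times> E. cscale (c p) (u (fst p) (snd p))) (u (fst q) (snd q))
        = ip lam (T (fst q)) (snd q)"
    proof (rule L2.gram_system_solvable)
      show "finite (E \<times> E)" using E(1) by simp
      show "u (fst p) (snd p) \<in> L2" if "p \<in> E \<times> E" for p using that uL by auto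
      show "\<forall>p\<in>E \<times> E. c p = 0" if "L2.nrm (\<Sum>p\<in>E \<times> E. cscale (c p) (u (fst p) (snd p))) = 0" for c
        using kernel_product_independent[OF E(1,2) EA] that by (simp add: u_def)
    qed
    then show ?thesis using that by auto
  qed
  define x where "x = (\<Sum>p\<in>E \<times> E. cscale (c p) (u (fst p) (snd p)))"
  have sum_apply: "x Z = (\<Sum>p\<in>E \<times> E. c p * u (fst p) (snd p) Z)" for Z
  proof -
    have "(\<Sum>p\<in>I. cscale (c p) (u (fst p) (snd p))) Z = (\<Sum>p\<in>I. c p * u (fst p) (snd p) Z)" if "finite I" for I
      using that by (induction I rule: finite_induct) (auto simp: cscale_def)
    then show ?thesis using E(1) by (simp add: x_def)
  qed
  have xU: "x \<in> U"
    unfolding x_def U_def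
  proof (intro cfun.span_sum cfun.span_scale)
    fix p assume "p \<in> E \<times> E"
    then show "u (fst p) (snd p) \<in> cfun.span ((\<lambda>p. u (fst p) (snd p)) ` (E \<times> E))"
      by (intro cfun.span_base imageI)
  qed
  have xL: "x \<in> L2" using xU UL by blast
  have [measurable]: "x \<in> borel_measurable mu" using xL by (simp add: L2_iff)
  define a where "a Z = x Z / of_real (sqrt (k Z))" for Z
  have ukz: "u f g Z = 0" if "k Z = 0" for f g Z using that by (simp add: u_def kernel_product_def k_def)
  have az: "a Z = 0" if "k Z = 0" for Z using that by (simp add: a_def)
  have as: "a \<in> symbols"
  proof (rule symbolsI[where C = "\<Sum>p\<in>E \<times> E. norm (c p)"])
    show "a \<in> borel_measurable mu" unfolding a_def by measurable
    have "norm (a Z) \<le> (\<Sum>p\<in>E \<times> E. norm (c p))" for Z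
    proof (cases "k Z = 0")
      case True
      then show ?thesis by (simp add: az sum_nonneg)
    next
      case False
      then have kp: "k Z > 0" using k0[of Z] by simp
      have "norm (x Z) \<le> (\<Sum>p\<in>E \<times> E. norm (c p) * sqrt (k Z))"
        unfolding sum_apply
      proof (rule sum_norm_le)
        fix p assume p: "p \<in> E \<times> E"
        have "norm (fst p Z) * norm (snd p Z) \<le> sqrt (k Z) * sqrt (k Z)"
          using p E(1) k0 unfolding k_def by (intro mult_mono norm_le_sqrt_diag_kernel) auto
        then have "norm (u (fst p) (snd p) Z) \<le> sqrt (k Z)"
          using kp by (simp add: u_def kernel_product_def k_def[symmetric] norm_divide norm_mult pos_divide_le_eq)
        then show "norm (c p * u (fst p) (snd p) Z) \<le> norm (c p) * sqrt (k Z)"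
          unfolding norm_mult by (intro mult_left_mono) auto
      qed
      also have "\<dots> = (\<Sum>p\<in>E \<times> E. norm (c p)) * sqrt (k Z)" by (simp add: sum_distrib_right)
      finally show ?thesis using kp by (simp add: a_def norm_divide pos_divide_le_eq)
    qed
    then show "AE Z in mu. norm (a Z) \<le> (\<Sum>p\<in>E \<times> E. norm (c p))" by simp
  qed
  have ip_u: "(a' Z * of_real (sqrt (k Z))) * cnj (u f g Z) = a' Z * (f Z * cnj (g Z))"
    if "f \<in> W" "g \<in> W" for a' :: "complex^'n^'n \<Rightarrow> complex" and f g Z
  proof (cases "k Z = 0")
    case True
    then have "f Z = 0" using span_diag_kernel_zero[OF E(1), of f Z] that E(3) by (simp add: k_def)
    then show ?thesis using True by simp
  next
    case False
    then show ?thesis by (simp add: u_def kernel_product_def k_def)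
  qed
  have xa: "x Z = a Z * of_real (sqrt (k Z))" for Z
  proof (cases "k Z = 0")
    case True
    then show ?thesis by (simp add: sum_apply ukz az)
  next
    case False
    then show ?thesis by (simp add: a_def)
  qed
  have base: "ip lam (toeplitz lam a e) e' = ip lam (T e) e'" if e: "e \<in> E" "e' \<in> E" for e e'
  proof -
    have "ip lam (toeplitz lam a e) e' = (LINT Z|mu. a Z * (e Z * cnj (e' Z)))"
      using as EA e by (intro ip_toeplitz) auto
    also have "\<dots> = ip lam x (u e e')"
      unfolding ip_def xa ip_u[OF subsetD[OF EW e(1)] subsetD[OF EW e(2)], of a] ..
    also have "\<dots> = ip lam (T e) e'" unfolding x_def using e by (rule c)
    finally show ?thesis .
  qed
  note TaB = toeplitz_bounded_operator[OF as]
  have comp: "ip lam (toeplitz lam a f) g = ip lam (T f) g" if f: "f \<in> W" and g: "g \<in> W" for f g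
  proof -
    have 1: "W \<subseteq> {f \<in> A2. ip lam (toeplitz lam a f) e' = ip lam (T f) e'}" if e': "e' \<in> E" for e'
      unfolding E(3)[symmetric]
    proof (rule cfun.span_minimal)
      show "E \<subseteq> {f \<in> A2. ip lam (toeplitz lam a f) e' = ip lam (T f) e'}" using base e' EA by blast
      have e'L: "e' \<in> L2" using e' EL by blast
      note TL = A2_L2[OF bounded_operatorsD(1)[OF TB]] A2_L2[OF bounded_operatorsD(1)[OF TaB]]
      show "cfun.subspace {f \<in> A2. ip lam (toeplitz lam a f) e' = ip lam (T f) e'}"
        unfolding cfun.subspace_def
        using e'L TL bounded_operators_zero[OF TB] bounded_operators_zero[OF TaB]
        by (auto simp: bounded_operatorsD(2,3)[OF TB] bounded_operatorsD(2,3)[OF TaB] L2.ip_add L2.ip_scale)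
    qed
    have TfL: "T f \<in> L2" "toeplitz lam a f \<in> L2"
      using f WA bounded_operatorsD(1)[OF TB] bounded_operatorsD(1)[OF TaB] A2_L2 by blast+
    have "W \<subseteq> {g \<in> L2. ip lam (toeplitz lam a f) g = ip lam (T f) g}"
      unfolding E(3)[symmetric]
    proof (rule cfun.span_minimal)
      show "E \<subseteq> {g \<in> L2. ip lam (toeplitz lam a f) g = ip lam (T f) g}" using 1 f EL by blast
      show "cfun.subspace {g \<in> L2. ip lam (toeplitz lam a f) g = ip lam (T f) g}"
        unfolding cfun.subspace_def using TfL by (auto simp: L2.ip_add_right L2.ip_scale_right)
    qed
    then show ?thesis using g by blast
  qed
  have "AE Z in mu. a (umap h Z) = a Z" if h: "h \<in> H" for h
  proof -
    note hu = H_unitary[OF h] and hi = H_inv[OF h]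
    note iso = domain_isometry_umap[OF hu]
    define y where "y Z = (a (umap h Z) - a Z) * of_real (sqrt (k Z))" for Z
    have x_rep: "(\<lambda>Z. a (umap h Z) * of_real (sqrt (k Z))) = bergman_rep h x"
      by (simp add: bergman_rep_umap fun_eq_iff xa k_inv[OF h])
    have rep_u: "bergman_rep h (u f g) = u (bergman_rep h f) (bergman_rep h g)" for f g
      using k_inv[OF h] by (simp add: bergman_rep_umap u_def kernel_product_def k_def fun_eq_iff)
    have "cfun.span ((\<lambda>p. u (fst p) (snd p)) ` (E \<times> E)) \<subseteq> {v. bergman_rep h v \<in> U}"
    proof (rule cfun.span_minimal)
      show "(\<lambda>p. u (fst p) (snd p)) ` (E \<times> E) \<subseteq> {v. bergman_rep h v \<in> U}"
        using EW by (auto simp: rep_u intro!: uU Winv[OF h])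
      show "cfun.subspace {v. bergman_rep h v \<in> U}"
        unfolding cfun.subspace_def mem_Collect_eq bergman_rep_add bergman_rep_cscale bergman_rep_zero U_def
        by (auto intro: cfun.span_add cfun.span_scale cfun.span_zero)
    qed
    from this[folded U_def] have rxU: "bergman_rep h x \<in> U" using xU by blast
    have y_eq: "y = bergman_rep h x - x"
      unfolding x_rep[symmetric] by (simp add: y_def fun_eq_iff xa left_diff_distrib)
    have yU: "y \<in> U" unfolding y_eq using rxU xU unfolding U_def by (rule cfun.span_diff)
    have yL: "y \<in> L2" using yU UL by blast
    have y_orth: "ip lam y (u f g) = 0" if f: "f \<in> E" and g: "g \<in> E" for f g
    proof -
      have fg: "f \<in> W" "g \<in> W" "f \<in> A2" "g \<in> A2" using f g EW WA by auto
      define f' g' where "f' = bergman_rep (uinv h) f" and "g' = bergman_rep (uinv h) g"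
      have f': "f' \<in> W" "g' \<in> W" "f' \<in> A2" "bergman_rep h f' = f"
        using Winv[OF hi] fg WA bergman_rep_uinv(1)[OF hu] by (auto simp: f'_def g'_def)
      have ugL: "u f g \<in> L2" using f g by (rule uL)
      have "ip lam y (u f g) = ip lam (bergman_rep h x) (u f g) - ip lam x (u f g)"
        unfolding y_eq using rxU xL UL ugL by (intro L2.ip_diff) auto
      also have "ip lam x (u f g) = ip lam (T f) g" unfolding x_def using f g by (rule c)
      also have "ip lam (bergman_rep h x) (u f g) = (LINT Z|mu. a (umap h Z) * (f Z * cnj (g Z)))"
        unfolding x_rep[symmetric] ip_def ip_u[OF fg(1,2), of "\<lambda>Z. a (umap h Z)"] ..
      also have "\<dots> = ip lam (bergman_rep h (toeplitz lam a f')) g"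
        using ip_rep_toeplitz[OF hu as f'(3) fg(4)] f'(4) by simp
      also have "\<dots> = ip lam (toeplitz lam a f') g'"
        unfolding g'_def using as f'(3) fg hu by (intro ip_rep_left A2_L2 toeplitz_in_A2)
      also have "\<dots> = ip lam (T f') g'" using f' by (intro comp)
      also have "\<dots> = ip lam (bergman_rep (uinv h) (T f)) (bergman_rep (uinv h) g)"
        using EndoD(2)[OF T hi fg(3)] by (simp add: f'_def g'_def)
      also have "\<dots> = ip lam (T f) g"
        using fg uinv_unitary[OF hu] bounded_operatorsD(1)[OF TB] by (intro ip_rep A2_L2)
      finally show ?thesis by simp
    qed
    have "U \<subseteq> {v \<in> L2. ip lam y v = 0}"
      unfolding U_def
    proof (rule cfun.span_minimal)
      show "(\<lambda>p. u (fst p) (snd p)) ` (E \<times> E) \<subseteq> {v \<in> L2. ip lam y v = 0}" using y_orth uL by auto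
      show "cfun.subspace {v \<in> L2. ip lam y v = 0}"
        unfolding cfun.subspace_def using yL by (auto simp: L2.ip_add_right L2.ip_scale_right)
    qed
    then have "ip lam y y = 0" using yU by blast
    then have "L2.nrm y = 0" by (simp add: L2.nrm_def)
    from nrm_zero_AE[OF yL this] show "AE Z in mu. a (umap h Z) = a Z"
    proof eventually_elim
      case (elim Z)
      then show ?case using k_inv[OF h, of Z] by (cases "k Z = 0") (auto simp: y_def az)
    qed
  qed
  then have "a \<in> invariant_symbols H" using as by (simp add: invariant_symbols_def invariant_symbol_umap)
  then show ?thesis using comp by (intro bexI[of _ a]) auto
qed

end

section \<open>Eigenvectors of operators on finite dimensional function spaces\<close>

text \<open>A polynomial of least degree that annihilates some nonzero vector of \<open>K\<close> is linear up to a factor: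
  split off a root by the fundamental theorem of algebra.\<close>

lemma eigenvector_exists:
  fixes T :: "('a \<Rightarrow> complex) \<Rightarrow> 'a \<Rightarrow> complex"
  assumes K: "finite_dimensional K" "K \<noteq> {0}"
    and TK: "\<And>f. f \<in> K \<Longrightarrow> T f \<in> K"
    and add: "\<And>f g. f \<in> K \<Longrightarrow> g \<in> K \<Longrightarrow> T (f + g) = T f + T g"
    and scale: "\<And>c f. f \<in> K \<Longrightarrow> T (cscale c f) = cscale c (T f)"
  shows "\<exists>c. \<exists>w\<in>K. w \<noteq> 0 \<and> T w = cscale c w"
proof -
  have sK: "cfun.subspace K" using K(1) by (rule subspace_finite_dimensional)
  have T0: "T 0 = 0" using scale[OF cfun.subspace_0[OF sK], of 0] by simp
  have Tsum: "T (\<Sum>i\<in>I. u i) = (\<Sum>i\<in>I. T (u i))" if "finite I" "\<And>i. i \<in> I \<Longrightarrow> u i \<in> K"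
    for I :: "nat set" and u
    using that by (induction I rule: finite_induct) (simp_all add: T0 add cfun.subspace_sum[OF sK])
  have powK: "(T ^^ i) v \<in> K" if "v \<in> K" for i v using that by (induction i) (simp_all add: TK)
  \<comment> \<open>For \<open>N \<ge> degree p\<close> this is \<open>p(T)\<close> applied to \<open>v\<close>.\<close>
  define act where "act N p v = (\<Sum>i\<le>N. cscale (coeff p i) ((T ^^ i) v))" for N p v
  have actK: "act N p v \<in> K" if "v \<in> K" for N p v
    unfolding act_def using that by (intro cfun.subspace_sum[OF sK] cfun.subspace_scale[OF sK] powK)
  have act_ge: "act N p v = act (degree p) p v" if "degree p \<le> N" for N p v
    unfolding act_def using that
    by (intro sum.mono_neutral_right) (auto simp: coeff_eq_0)
  have act_shift: "act (Suc N) (pCons 0 q) v = T (act N q v)" if v: "v \<in> K" for N q v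
  proof -
    have "T (act N q v) = (\<Sum>i\<le>N. cscale (coeff q i) ((T ^^ Suc i) v))"
      unfolding act_def using powK[OF v] by (subst Tsum) (auto simp: scale cfun.subspace_scale[OF sK])
    then show ?thesis
      unfolding act_def by (subst sum.atMost_Suc_shift) simp
  qed
  have act_root: "act (Suc N) ([:-c, 1:] * q) v = T (act N q v) - cscale c (act (Suc N) q v)" if v: "v \<in> K" for N c q v
  proof -
    have "[:-c, 1:] * q = smult (-c) q + pCons 0 q" by simp
    then have "act (Suc N) ([:-c, 1:] * q) v = act (Suc N) (smult (-c) q + pCons 0 q) v" by (simp only:)
    also have "\<dots> = cscale (-c) (act (Suc N) q v) + act (Suc N) (pCons 0 q) v"
      unfolding act_def coeff_add coeff_smult cfun.scale_left_distrib sum.distrib cfun.scale_sum_right cfun.scale_scale ..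
    finally show ?thesis by (simp only: act_shift[OF v] cfun.scale_minus_left) simp
  qed
  define good where "good d \<longleftrightarrow> (\<exists>p v. p \<noteq> 0 \<and> degree p = d \<and> v \<in> K \<and> v \<noteq> 0 \<and> act d p v = 0)" for d
  have "\<exists>d. good d"
  proof -
    obtain v where v: "v \<in> K" "v \<noteq> 0" using K(2) cfun.subspace_0[OF sK] by blast
    obtain B where B: "finite B" "K = cfun.span B" using K(1) by (auto simp: finite_dimensional_def)
    let ?N = "card B"
    obtain p where p: "p \<noteq> 0" "degree p \<le> ?N" "act ?N p v = 0"
    proof (cases "inj_on (\<lambda>i. (T ^^ i) v) {..?N}")
      case False
      then obtain i j where ij: "i < j" "j \<le> ?N" "(T ^^ i) v = (T ^^ j) v"
        unfolding inj_on_def by (metis atMost_iff nat_neq_iff)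
      let ?p = "monom 1 j - monom 1 i :: complex poly"
      have "coeff ?p j \<noteq> 0" using ij by simp
      then have "?p \<noteq> 0" by (metis coeff_0)
      moreover have "degree ?p \<le> ?N"
        using ij by (intro degree_diff_le) (auto intro: order_trans[OF degree_monom_le])
      moreover have "act ?N ?p v = (\<Sum>l\<le>?N. (if l = j then (T ^^ l) v else 0) - (if l = i then (T ^^ l) v else 0))"
        unfolding act_def using ij by (intro sum.cong) (auto simp: cscale_def fun_eq_iff)
      then have "act ?N ?p v = 0" using ij by (simp add: sum_subtractf)
      ultimately show ?thesis by (rule that)
    next
      case True
      define S where "S = (\<lambda>i. (T ^^ i) v) ` {..?N}"
      have "card S = Suc ?N" unfolding S_def using card_image[OF True] by simp
      moreover have "S \<subseteq> cfun.span B" using powK[OF v(1)] B(2) by (auto simp: S_def)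
      ultimately have "cfun.dependent S"
        using cfun.independent_span_bound[OF B(1), of S] by auto
      moreover have fS: "finite S" by (simp add: S_def)
      ultimately obtain r where r: "\<exists>x\<in>S. r x \<noteq> 0" "(\<Sum>x\<in>S. cscale (r x) x) = 0"
        using cfun.dependent_finite by blast
      define p where "p = (\<Sum>i\<le>?N. monom (r ((T ^^ i) v)) i)"
      have cp: "coeff p l = (if l \<le> ?N then r ((T ^^ l) v) else 0)" for l
        unfolding p_def coeff_sum by (simp add: sum.delta)
      show ?thesis
      proof (rule that[of p])
        show "p \<noteq> 0"
        proof -
          obtain i where i: "i \<le> ?N" "r ((T ^^ i) v) \<noteq> 0" using r(1) by (auto simp: S_def)
          then have "coeff p i \<noteq> 0" by (simp add: cp)
          then show ?thesis by (metis coeff_0)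
        qed
        show "degree p \<le> ?N" by (rule degree_le) (simp add: cp)
        have "act ?N p v = (\<Sum>i\<le>?N. cscale (r ((T ^^ i) v)) ((T ^^ i) v))"
          unfolding act_def by (intro sum.cong) (auto simp: cp)
        also have "\<dots> = (\<Sum>x\<in>S. cscale (r x) x)"
          unfolding S_def by (subst sum.reindex[OF True]) simp
        finally show "act ?N p v = 0" using r(2) by simp
      qed
    qed
    then have "good (degree p)" using v act_ge[OF p(2)] by (auto simp: good_def)
    then show ?thesis ..
  qed
  then obtain d where d: "good d" "\<And>d'. d' < d \<Longrightarrow> \<not> good d'" using exists_least_iff[of good] by blast
  then obtain p v where p: "p \<noteq> 0" "degree p = d" "v \<in> K" "v \<noteq> 0" "act d p v = 0" by (auto simp: good_def)
  have "d \<noteq> 0"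
  proof
    assume "d = 0"
    then have "cscale (coeff p 0) v = 0" using p(5) by (simp add: act_def)
    moreover have "coeff p 0 \<noteq> 0" using p \<open>d = 0\<close> by (metis leading_coeff_0_iff)
    ultimately show False using p(4) by simp
  qed
  then obtain N where N: "d = Suc N" by (cases d) auto
  have "\<not> constant (poly p)" using p(2) \<open>d \<noteq> 0\<close> by (simp add: constant_degree)
  then obtain c where "poly p c = 0" using fundamental_theorem_of_algebra by blast
  then obtain q where q: "p = [:-c, 1:] * q" unfolding poly_eq_0_iff_dvd dvd_def by blast
  have "q \<noteq> 0" using q p(1) by (metis mult_zero_right)
  then have "degree p = Suc (degree q)" unfolding q by (subst degree_mult_eq) (simp_all del: mult_pCons_left)
  then have dq: "degree q = N" using p(2) N by simp
  define w where "w = act N q v"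
  have "w \<noteq> 0" using d(2)[of N] N dq p(3,4) \<open>q \<noteq> 0\<close> by (auto simp: good_def w_def)
  moreover have "w \<in> K" unfolding w_def using p(3) by (rule actK)
  moreover have "T w = cscale c w"
  proof -
    have "act (Suc N) q v = w" using act_ge[of q "Suc N" v] dq by (simp add: w_def)
    moreover have "act (Suc N) ([:-c, 1:] * q) v = 0" using p(5) unfolding q[symmetric] N .
    ultimately show ?thesis using act_root[OF p(3), of N c q] unfolding w_def[symmetric] by simp
  qed
  ultimately show ?thesis by blast
qed

section \<open>Isotypic components\<close>

context bergman_subgroup
begin

lemma Endo_algebra:
  shows Endo_id: "(\<lambda>f. f) \<in> Endo"
    and Endo_add: "S \<in> Endo \<Longrightarrow> T \<in> Endo \<Longrightarrow> (\<lambda>f. S f + T f) \<in> Endo"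
    and Endo_scale: "T \<in> Endo \<Longrightarrow> (\<lambda>f. cscale c (T f)) \<in> Endo"
    and Endo_compose: "S \<in> Endo \<Longrightarrow> T \<in> Endo \<Longrightarrow> (\<lambda>f. S (T f)) \<in> Endo"
proof -
  note B = Endo_subalgebra[unfolded unital_banach_subalgebra_def]
  note B2 = conjunct2[OF B]
  note B3 = conjunct2[OF B2]
  note B4 = conjunct2[OF B3]
  note B5 = conjunct2[OF B4]
  show "(\<lambda>f. f) \<in> Endo" by (rule conjunct1[OF B2])
  show "S \<in> Endo \<Longrightarrow> T \<in> Endo \<Longrightarrow> (\<lambda>f. S f + T f) \<in> Endo"
    by (rule conjunct1[OF B3, rule_format])
  show "T \<in> Endo \<Longrightarrow> (\<lambda>f. cscale c (T f)) \<in> Endo"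
    by (rule conjunct1[OF B4, rule_format])
  show "S \<in> Endo \<Longrightarrow> T \<in> Endo \<Longrightarrow> (\<lambda>f. S (T f)) \<in> Endo"
    by (rule conjunct1[OF B5, rule_format])
qed

lemma mem_closure: "f \<in> bergman_closure lam V \<longleftrightarrow> f \<in> A2 \<and> (\<forall>e>0. \<exists>g\<in>V. L2.nrm (f - g) < e)"
  by (simp add: bergman_closure_def L2_norm_nrm)

lemma closure_mono:
  "(V :: (complex^'n^'n \<Rightarrow> complex) set) \<subseteq> W \<Longrightarrow> bergman_closure lam V \<subseteq> bergman_closure lam W"
  unfolding subset_iff mem_closure by blast

lemma subset_closure: "V \<subseteq> A2 \<Longrightarrow> V \<subseteq> bergman_closure lam V"
proof
  fix f assume "V \<subseteq> A2" and f: "f \<in> V"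
  have "L2.nrm (f - f) = 0" by (simp add: L2.nrm_def)
  then show "f \<in> bergman_closure lam V" using f \<open>V \<subseteq> A2\<close> by (auto simp: mem_closure intro!: bexI[of _ f])
qed

text \<open>Isotypic components are closures, so intertwining operators and group elements need only be
  considered on the span of the copies.\<close>

lemma closure_bounded_image:
  assumes T: "T \<in> bounded_operators lam A2 A2" and V: "V \<subseteq> A2" and im: "\<And>f. f \<in> V \<Longrightarrow> T f \<in> bergman_closure lam W"
    and W: "W \<subseteq> A2" and f: "f \<in> bergman_closure lam V"
  shows "T f \<in> bergman_closure lam W"
  unfolding mem_closure
proof (intro conjI allI impI)
  have fA: "f \<in> A2" using f by (simp add: mem_closure)
  note TA = bounded_operatorsD(1)[OF T]
  show "T f \<in> A2" using fA by (rule TA)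
  fix e :: real assume e: "e > 0"
  obtain C where C: "C \<ge> 0" "\<And>f. f \<in> A2 \<Longrightarrow> L2.nrm (T f) \<le> C * L2.nrm f"
    using bounded_operatorsD(4)[OF T] by blast
  define d where "d = e / (2 * (C + 1))"
  have d: "d > 0" "C * d \<le> e / 2" using e C(1) by (auto simp: d_def field_simps)
  obtain g where g: "g \<in> V" "L2.nrm (f - g) < d" using f d(1) by (auto simp: mem_closure)
  have gA: "g \<in> A2" using g V by blast
  obtain g' where g': "g' \<in> W" "L2.nrm (T g - g') < e / 2"
    using im[OF g(1)] e by (metis half_gt_zero mem_closure)
  have "L2.nrm (T f - g') \<le> L2.nrm (T f - T g) + L2.nrm (T g - g')"
    using fA gA g' W TA A2_L2 by (intro L2.nrm_triangle_diff) auto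
  also have "L2.nrm (T f - T g) \<le> C * L2.nrm (f - g)"
    using C(2)[of "f - g"] fA gA bounded_operators_diff[OF T fA gA] by simp
  also have "C * L2.nrm (f - g) \<le> e / 2"
    using mult_left_mono[OF less_imp_le[OF g(2)] C(1)] d(2) by simp
  finally have "L2.nrm (T f - g') < e" using g'(2) by linarith
  then show "\<exists>g\<in>W. L2.nrm (T f - g) < e" using g' by blast
qed

lemma closure_subspace:
  assumes V: "cfun.subspace V" "V \<subseteq> A2" shows "cfun.subspace (bergman_closure lam V)"
  unfolding cfun.subspace_def
proof (intro conjI ballI allI)
  show "0 \<in> bergman_closure lam V" using subset_closure[OF V(2)] cfun.subspace_0[OF V(1)] by blast
  fix f assume f: "f \<in> bergman_closure lam V"
  have fA: "f \<in> A2" using f by (simp add: mem_closure)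
  show "f + g \<in> bergman_closure lam V" if g: "g \<in> bergman_closure lam V" for g
    unfolding mem_closure
  proof (intro conjI allI impI)
    have gA: "g \<in> A2" using g by (simp add: mem_closure)
    show "f + g \<in> A2" using fA gA by simp
    fix e :: real assume e: "e > 0"
    obtain f' g' where f': "f' \<in> V" "L2.nrm (f - f') < e / 2" and g': "g' \<in> V" "L2.nrm (g - g') < e / 2"
      using f g e by (metis half_gt_zero mem_closure)
    have eq: "(f + g) - (f' + g') = (f - f') + (g - g')" by simp
    have "L2.nrm ((f + g) - (f' + g')) \<le> L2.nrm (f - f') + L2.nrm (g - g')"
      unfolding eq using fA gA f' g' V(2) A2_L2 by (intro L2.nrm_triangle L2.V_simps) auto
    then have "L2.nrm ((f + g) - (f' + g')) < e" using f'(2) g'(2) by linarith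
    then show "\<exists>h\<in>V. L2.nrm (f + g - h) < e" using cfun.subspace_add[OF V(1) f'(1) g'(1)] by blast
  qed
  show "cscale c f \<in> bergman_closure lam V" for c
  proof (rule closure_bounded_image[OF _ V(2) _ V(2) f, where T = "cscale c"])
    show "cscale c \<in> bounded_operators lam A2 A2"
      using bounded_operators_scale[OF EndoD(1)[OF Endo_id], of c] .
    show "cscale c g \<in> bergman_closure lam V" if "g \<in> V" for g
      using cfun.subspace_scale[OF V(1) that] subset_closure[OF V(2)] by blast
  qed
qed

lemma bounded_operator_rep: "h \<in> unitary_pairs \<Longrightarrow> bergman_rep h \<in> bounded_operators lam A2 A2"
  by (rule bounded_operatorsI[where C = 1])
    (auto simp: rep_A2 bergman_rep_add bergman_rep_cscale nrm_rep A2_L2)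

lemma finite_dimensional_closed:
  assumes W: "finite_dimensional W" "W \<subseteq> A2" shows "bergman_closure lam W = W"
proof
  show "W \<subseteq> bergman_closure lam W" using W(2) by (rule subset_closure)
  obtain E where E: "finite E" "L2.orthonormal E" "cfun.span E = W"
    using finite_dimensional_orthonormal_basis[OF W] .
  show "bergman_closure lam W \<subseteq> W"
  proof
    fix f assume f: "f \<in> bergman_closure lam W"
    then have fA: "f \<in> A2" by (simp add: mem_closure)
    have pW: "L2.proj E f \<in> W" using L2.proj_in_span[of E f] E(3) by simp
    define r where "r = f - L2.proj E f"
    have rA: "r \<in> A2" unfolding r_def using fA pW W(2) by auto
    have "L2.nrm r \<le> 0 + e" if e: "e > 0" for e
    proof -
      obtain g where g: "g \<in> W" "L2.nrm (f - g) < e" using f e by (auto simp: mem_closure)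
      have gA: "g \<in> A2" using g W(2) by blast
      have d: "L2.proj E f - g \<in> W"
        using pW g(1) subspace_finite_dimensional[OF W(1)] by (intro cfun.subspace_diff)
      have "ip lam r (L2.proj E f - g) = 0"
        unfolding r_def using E(1,2) A2_L2[OF fA] by (rule L2.proj_orthogonal) (use d E(3) in simp)
      then have "(L2.nrm (r + (L2.proj E f - g)))\<^sup>2 = (L2.nrm r)\<^sup>2 + (L2.nrm (L2.proj E f - g))\<^sup>2"
        using rA d W(2) A2_L2 by (subst L2.nrm_sq_add) auto
      moreover have "r + (L2.proj E f - g) = f - g" by (simp add: r_def)
      ultimately have "(L2.nrm r)\<^sup>2 \<le> (L2.nrm (f - g))\<^sup>2" by simp
      then have "L2.nrm r \<le> L2.nrm (f - g)" by (rule power2_le_imp_le) (use fA gA A2_L2 in auto)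
      then show ?thesis using g(2) by simp
    qed
    then have "L2.nrm r \<le> 0" by (rule field_le_epsilon)
    then have "r = 0" using A2_definite[OF rA] A2_L2[OF rA] by (simp add: order_antisym)
    then show "f \<in> W" using pW by (simp add: r_def)
  qed
qed

lemma invariant_subspaceD:
  "invariant_subspace lam H W \<Longrightarrow> W \<subseteq> A2" "invariant_subspace lam H W \<Longrightarrow> cfun.subspace W"
  "invariant_subspace lam H W \<Longrightarrow> h \<in> H \<Longrightarrow> f \<in> W \<Longrightarrow> bergman_rep h f \<in> W"
  by (auto simp: invariant_subspace_def)

lemma finite_dimensional_submodule:
  "invariant_subspace lam H W \<Longrightarrow> finite_dimensional W \<Longrightarrow> submodule lam H W"
  unfolding submodule_def using finite_dimensional_closed invariant_subspaceD(1) by blast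

lemma irreducibleD:
  assumes "irreducible_submodule lam H K"
  shows "invariant_subspace lam H K" "K \<noteq> {0}" "submodule lam H K"
    "submodule lam H L \<Longrightarrow> L \<subseteq> K \<Longrightarrow> L = {0} \<or> L = K"
  using assms by (auto simp: irreducible_submodule_def submodule_def)

abbreviation Hom :: "(complex^'n^'n \<Rightarrow> complex) set \<Rightarrow>
    ((complex^'n^'n \<Rightarrow> complex) \<Rightarrow> complex^'n^'n \<Rightarrow> complex) set" where
  "Hom K \<equiv> intertwining_operators lam H K A2"

lemma HomD:
  assumes "\<phi> \<in> intertwining_operators lam H K L"
  shows "f \<in> K \<Longrightarrow> \<phi> f \<in> L" "f \<in> K \<Longrightarrow> g \<in> K \<Longrightarrow> \<phi> (f + g) = \<phi> f + \<phi> g"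
    "f \<in> K \<Longrightarrow> \<phi> (cscale c f) = cscale c (\<phi> f)" "\<exists>C. \<forall>f\<in>K. L2.nrm (\<phi> f) \<le> C * L2.nrm f"
    "h \<in> H \<Longrightarrow> f \<in> K \<Longrightarrow> \<phi> (bergman_rep h f) = bergman_rep h (\<phi> f)"
proof -
  note B = assms[unfolded intertwining_operators_def bounded_operators_def L2_norm_nrm mem_Collect_eq]
  note C = conjunct1[OF B]
  show "f \<in> K \<Longrightarrow> \<phi> f \<in> L" by (rule subsetD[OF conjunct1[OF C] imageI])
  show "f \<in> K \<Longrightarrow> g \<in> K \<Longrightarrow> \<phi> (f + g) = \<phi> f + \<phi> g"
    by (rule conjunct1[OF conjunct2[OF C], rule_format])
  show "f \<in> K \<Longrightarrow> \<phi> (cscale c f) = cscale c (\<phi> f)"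
    by (rule conjunct1[OF conjunct2[OF conjunct2[OF C]], rule_format])
  show "\<exists>C. \<forall>f\<in>K. L2.nrm (\<phi> f) \<le> C * L2.nrm f"
    by (rule conjunct2[OF conjunct2[OF conjunct2[OF C]]])
  show "h \<in> H \<Longrightarrow> f \<in> K \<Longrightarrow> \<phi> (bergman_rep h f) = bergman_rep h (\<phi> f)"
    by (rule conjunct2[OF B, rule_format])
qed

lemma HomI:
  assumes "\<And>f. f \<in> K \<Longrightarrow> \<phi> f \<in> L" "\<And>f g. f \<in> K \<Longrightarrow> g \<in> K \<Longrightarrow> \<phi> (f + g) = \<phi> f + \<phi> g"
    "\<And>c f. f \<in> K \<Longrightarrow> \<phi> (cscale c f) = cscale c (\<phi> f)" "\<And>f. f \<in> K \<Longrightarrow> L2.nrm (\<phi> f) \<le> C * L2.nrm f"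
    "\<And>h f. h \<in> H \<Longrightarrow> f \<in> K \<Longrightarrow> \<phi> (bergman_rep h f) = bergman_rep h (\<phi> f)"
  shows "\<phi> \<in> intertwining_operators lam H K L"
  unfolding intertwining_operators_def bounded_operators_def L2_norm_nrm mem_Collect_eq
  by (intro conjI image_subsetI ballI allI exI[of _ C] assms)

lemma Hom_restrict:
  assumes \<phi>: "\<phi> \<in> intertwining_operators lam H K L" and "K' \<subseteq> K" and "\<And>f. f \<in> K' \<Longrightarrow> \<phi> f \<in> L'"
  shows "\<phi> \<in> intertwining_operators lam H K' L'"
proof -
  obtain C where C: "\<forall>f\<in>K. L2.nrm (\<phi> f) \<le> C * L2.nrm f" using HomD(4)[OF \<phi>] by blast
  have sub: "f \<in> K' \<Longrightarrow> f \<in> K" for f using assms(2) by (rule subsetD)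
  show ?thesis by (rule HomI[where C = C]) (auto simp: sub HomD(2,3,5)[OF \<phi>] C assms(3))
qed

lemma Endo_Hom: "T \<in> Endo \<Longrightarrow> K \<subseteq> A2 \<Longrightarrow> T \<in> Hom K"
  by (rule Hom_restrict) (auto dest: HomD(1))

lemma Hom_mono: "\<phi> \<in> intertwining_operators lam H K L \<Longrightarrow> L \<subseteq> A2 \<Longrightarrow> \<phi> \<in> Hom K"
  by (rule Hom_restrict) (auto dest: HomD(1))

lemma Hom_compose:
  assumes \<phi>: "\<phi> \<in> Hom K" and T: "T \<in> Endo" shows "(\<lambda>f. T (\<phi> f)) \<in> Hom K"
proof -
  note TB = EndoD(1)[OF T]
  obtain C where C: "\<forall>f\<in>K. L2.nrm (\<phi> f) \<le> C * L2.nrm f" using HomD(4)[OF \<phi>] by blast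
  obtain D where D: "D \<ge> 0" "\<forall>f\<in>A2. L2.nrm (T f) \<le> D * L2.nrm f" using bounded_operatorsD(4)[OF TB] by blast
  have "L2.nrm (T (\<phi> f)) \<le> (D * C) * L2.nrm f" if f: "f \<in> K" for f
  proof -
    have "L2.nrm (T (\<phi> f)) \<le> D * L2.nrm (\<phi> f)" using D(2) HomD(1)[OF \<phi> f] by blast
    also have "\<dots> \<le> D * (C * L2.nrm f)" using C f D(1) by (intro mult_left_mono) auto
    finally show ?thesis by (simp add: mult.assoc)
  qed
  moreover have "T (\<phi> (f + g)) = T (\<phi> f) + T (\<phi> g)" if "f \<in> K" "g \<in> K" for f g
    using HomD(1,2)[OF \<phi>] bounded_operatorsD(2)[OF TB] that by simp
  moreover have "T (\<phi> (cscale c f)) = cscale c (T (\<phi> f))" if "f \<in> K" for c f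
    using HomD(1,3)[OF \<phi>] bounded_operatorsD(3)[OF TB] that by simp
  moreover have "T (\<phi> (bergman_rep h f)) = bergman_rep h (T (\<phi> f))" if "h \<in> H" "f \<in> K" for h f
    using HomD(1,5)[OF \<phi>] EndoD(2)[OF T] that by simp
  moreover have "T (\<phi> f) \<in> A2" if "f \<in> K" for f using HomD(1)[OF \<phi>] bounded_operatorsD(1)[OF TB] that by simp
  ultimately show ?thesis by - (rule HomI[where C = "D * C"], blast+)
qed

lemma Hom_kernel:
  assumes \<phi>: "\<phi> \<in> Hom K" and K: "invariant_subspace lam H K"
  shows "invariant_subspace lam H {f \<in> K. \<phi> f = 0}"
proof -
  note sK = invariant_subspaceD(2)[OF K]
  have "\<phi> 0 = 0" using HomD(3)[OF \<phi> cfun.subspace_0[OF sK], of 0] by simp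
  then have "cfun.subspace {f \<in> K. \<phi> f = 0}"
    unfolding cfun.subspace_def
    by (auto simp: HomD(2,3)[OF \<phi>] intro: cfun.subspace_0[OF sK] cfun.subspace_add[OF sK] cfun.subspace_scale[OF sK])
  then show ?thesis
    unfolding invariant_subspace_def using invariant_subspaceD(1)[OF K]
    by (auto simp: HomD(5)[OF \<phi>] bergman_rep_zero invariant_subspaceD(3)[OF K])
qed

text \<open>Schur's lemma: the kernel is an invariant subspace of \<open>K\<close>, and closed as it has finite dimension.\<close>

lemma Hom_zero_or_injective:
  assumes K: "irreducible_submodule lam H K" "finite_dimensional K" and \<phi>: "\<phi> \<in> Hom K"
  shows "(\<forall>f\<in>K. \<phi> f = 0) \<or> inj_on \<phi> K"
proof -
  note iK = irreducibleD(1)[OF K(1)] note sK = invariant_subspaceD(2)[OF iK]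
  let ?N = "{f \<in> K. \<phi> f = 0}"
  have N: "invariant_subspace lam H ?N" using Hom_kernel[OF \<phi> iK] .
  have "finite_dimensional ?N"
    by (rule finite_dimensional_subspace[OF K(2) invariant_subspaceD(2)[OF N]]) auto
  then have "?N = {0} \<or> ?N = K"
    using finite_dimensional_submodule[OF N] by (intro irreducibleD(4)[OF K(1)]) auto
  then show ?thesis
  proof
    assume N0: "?N = {0}"
    have "inj_on \<phi> K"
    proof (rule inj_onI)
      fix f g assume fg: "f \<in> K" "g \<in> K" "\<phi> f = \<phi> g"
      have d: "f - g \<in> K" using fg sK by (intro cfun.subspace_diff)
      have "\<phi> f = \<phi> ((f - g) + g)" by simp
      also have "\<dots> = \<phi> (f - g) + \<phi> g" using d fg(2) by (rule HomD(2)[OF \<phi>])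
      finally have "f - g \<in> ?N" using d fg(3) by simp
      then show "f = g" unfolding N0 by simp
    qed
    then show ?thesis ..
  qed blast
qed

lemma Hom_image:
  assumes K: "invariant_subspace lam H K" "finite_dimensional K" and \<phi>: "\<phi> \<in> Hom K"
  shows "invariant_subspace lam H (\<phi> ` K)" "finite_dimensional (\<phi> ` K)"
proof -
  note sK = invariant_subspaceD(2)[OF K(1)]
  have \<phi>0: "\<phi> 0 = 0" using HomD(3)[OF \<phi> cfun.subspace_0[OF sK], of 0] by simp
  have s: "cfun.subspace (\<phi> ` K)"
    unfolding cfun.subspace_def
  proof (intro conjI ballI allI)
    show "0 \<in> \<phi> ` K" 
      using cfun.subspace_0[OF sK] by (rule rev_image_eqI) (rule \<phi>0[symmetric])
    fix f' assume "f' \<in> \<phi> ` K"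
    then obtain f where f: "f \<in> K" "f' = \<phi> f" by blast
    show "f' + g' \<in> \<phi> ` K" if g': "g' \<in> \<phi> ` K" for g'
    proof -
      obtain g where g: "g \<in> K" "g' = \<phi> g" using g' by blast
      show ?thesis
        unfolding f(2) g(2) HomD(2)[OF \<phi> f(1) g(1), symmetric]
        by (intro imageI cfun.subspace_add[OF sK] f g)
    qed
    show "cscale c f' \<in> \<phi> ` K" for c
      unfolding f(2) HomD(3)[OF \<phi> f(1), symmetric] by (intro imageI cfun.subspace_scale[OF sK] f)
  qed
  show "invariant_subspace lam H (\<phi> ` K)"
    unfolding invariant_subspace_def
  proof (intro conjI ballI s image_subsetI)
    show "\<phi> f \<in> A2" if "f \<in> K" for f using that by (rule HomD(1)[OF \<phi>])
    fix h f' assume h: "h \<in> H" and "f' \<in> \<phi> ` K"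
    then obtain f where f: "f \<in> K" "f' = \<phi> f" by blast
    show "bergman_rep h f' \<in> \<phi> ` K"
      unfolding f(2) HomD(5)[OF \<phi> h f(1), symmetric]
      by (intro imageI invariant_subspaceD(3)[OF K(1) h f(1)])
  qed
  obtain B where B: "finite B" "K = cfun.span B" using K(2) by (auto simp: finite_dimensional_def)
  have "cfun.span (\<phi> ` B) = \<phi> ` K"
  proof
    show "cfun.span (\<phi> ` B) \<subseteq> \<phi> ` K"
      using s B(2) cfun.span_superset[of B] by (intro cfun.span_minimal) auto
    have "cfun.span B \<subseteq> {f \<in> K. \<phi> f \<in> cfun.span (\<phi> ` B)}"
    proof (rule cfun.span_minimal)
      show "B \<subseteq> {f \<in> K. \<phi> f \<in> cfun.span (\<phi> ` B)}"
        using B(2) cfun.span_superset[of B] cfun.span_superset[of "\<phi> ` B"] by auto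
      show "cfun.subspace {f \<in> K. \<phi> f \<in> cfun.span (\<phi> ` B)}"
        unfolding cfun.subspace_def using \<phi>0
        by (auto simp: HomD(2,3)[OF \<phi>] cfun.span_zero cfun.span_add cfun.span_scale
            cfun.subspace_0[OF sK] cfun.subspace_add[OF sK] cfun.subspace_scale[OF sK])
    qed
    then show "\<phi> ` K \<subseteq> cfun.span (\<phi> ` B)" using B(2) by blast
  qed
  then show "finite_dimensional (\<phi> ` K)" using B(1) unfolding finite_dimensional_def by blast
qed

abbreviation copies :: "(complex^'n^'n \<Rightarrow> complex) set \<Rightarrow> (complex^'n^'n \<Rightarrow> complex) set" where
  "copies K \<equiv> \<Union>{L. submodule lam H L \<and> equivalent_submodules lam H K L}"

lemma copies_A2: "copies K \<subseteq> A2" "cfun.span (copies K) \<subseteq> A2"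
proof -
  show "copies K \<subseteq> A2" by (auto simp: submodule_def invariant_subspace_def)
  then show "cfun.span (copies K) \<subseteq> A2" using subspace_A2 by (rule cfun.span_minimal)
qed

lemma copies_isotypic: "copies K \<subseteq> isotypic_component lam H K"
  unfolding isotypic_component_def
  using cfun.span_superset[of "copies K"] subset_closure[OF copies_A2(2)] by (rule order_trans)

lemma isotypic_subspace: "cfun.subspace (isotypic_component lam H K)"
  unfolding isotypic_component_def by (rule closure_subspace[OF cfun.subspace_span copies_A2(2)])

lemma isotypic_A2: "isotypic_component lam H K \<subseteq> A2"
  unfolding isotypic_component_def by (auto simp: mem_closure)

lemma irreducible_subset_isotypic:
  assumes K: "irreducible_submodule lam H K" shows "K \<subseteq> isotypic_component lam H K"
proof -
  have "(\<lambda>f. f) \<in> intertwining_operators lam H K K"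
    by (rule HomI[where C = 1]) auto
  moreover have "bij_betw (\<lambda>f. f) K K" by (simp add: bij_betw_def)
  ultimately have "equivalent_submodules lam H K K" by (auto simp: equivalent_submodules_def)
  then show ?thesis using irreducibleD(3)[OF K] copies_isotypic[of K] by blast
qed

text \<open>If \<open>\<phi>\<close> does not vanish on \<open>K\<close>, its image is a copy of \<open>K\<close>.\<close>

lemma Hom_image_isotypic:
  assumes K: "irreducible_submodule lam H K" "finite_dimensional K" and \<phi>: "\<phi> \<in> Hom K"
  shows "\<phi> ` K \<subseteq> isotypic_component lam H K"
  using Hom_zero_or_injective[OF K \<phi>]
proof
  assume "\<forall>f\<in>K. \<phi> f = 0"
  then show ?thesis using cfun.subspace_0[OF isotypic_subspace] by auto
next
  assume inj: "inj_on \<phi> K"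
  have "\<phi> \<in> intertwining_operators lam H K (\<phi> ` K)"
    using \<phi> by (rule Hom_restrict) auto
  then have "equivalent_submodules lam H K (\<phi> ` K)"
    using inj by (auto simp: equivalent_submodules_def bij_betw_def)
  moreover have "submodule lam H (\<phi> ` K)"
    using Hom_image[OF irreducibleD(1)[OF K(1)] K(2) \<phi>] by (rule finite_dimensional_submodule)
  ultimately show ?thesis using copies_isotypic[of K] by blast
qed

lemma Endo_preserves_isotypic:
  assumes K: "irreducible_submodule lam H K" "finite_dimensional K" and T: "T \<in> Endo"
    and f: "f \<in> isotypic_component lam H K"
  shows "T f \<in> isotypic_component lam H K"
proof -
  let ?V = "isotypic_component lam H K"
  note TB = EndoD(1)[OF T]
  have span: "T g \<in> ?V" if "g \<in> cfun.span (copies K)" for g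
  proof -
    have "cfun.span (copies K) \<subseteq> {g \<in> A2. T g \<in> ?V}"
    proof (rule cfun.span_minimal)
      show "copies K \<subseteq> {g \<in> A2. T g \<in> ?V}"
      proof
        fix g assume g: "g \<in> copies K"
        then obtain L where L: "g \<in> L" "submodule lam H L" "equivalent_submodules lam H K L" by blast
        then obtain \<psi> where \<psi>: "\<psi> \<in> intertwining_operators lam H K L" "bij_betw \<psi> K L"
          by (auto simp: equivalent_submodules_def)
        have "L \<subseteq> A2" using L(2) by (simp add: submodule_def invariant_subspace_def)
        then have "(\<lambda>f. T (\<psi> f)) \<in> Hom K" using Hom_compose[OF Hom_mono[OF \<psi>(1)] T] by simp
        then have "(\<lambda>f. T (\<psi> f)) ` K \<subseteq> ?V" by (rule Hom_image_isotypic[OF K])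
        moreover obtain f where "f \<in> K" "g = \<psi> f" using \<psi>(2) L(1) by (auto simp: bij_betw_def)
        ultimately show "g \<in> {g \<in> A2. T g \<in> ?V}" using \<open>L \<subseteq> A2\<close> L(1) by auto
      qed
      show "cfun.subspace {g \<in> A2. T g \<in> ?V}"
        unfolding cfun.subspace_def using bounded_operators_zero[OF TB]
        by (auto simp: bounded_operatorsD(2,3)[OF TB] cfun.subspace_0[OF isotypic_subspace]
            cfun.subspace_add[OF isotypic_subspace] cfun.subspace_scale[OF isotypic_subspace])
    qed
    then show ?thesis using that by blast
  qed
  show ?thesis
    using closure_bounded_image[OF TB copies_A2(2) _ copies_A2(2)] span f
    unfolding isotypic_component_def by blast
qed

lemma isotypic_invariant: "invariant_subspace lam H (isotypic_component lam H K)"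
  unfolding invariant_subspace_def
proof (intro conjI isotypic_A2 isotypic_subspace ballI image_subsetI)
  fix h f assume h: "h \<in> H" and f: "f \<in> isotypic_component lam H K"
  have "cfun.span (copies K) \<subseteq> {g. bergman_rep h g \<in> cfun.span (copies K)}"
  proof (rule cfun.span_minimal)
    show "copies K \<subseteq> {g. bergman_rep h g \<in> cfun.span (copies K)}"
    proof
      fix g assume "g \<in> copies K"
      then obtain L where L: "g \<in> L" "submodule lam H L" "equivalent_submodules lam H K L" by blast
      then have "bergman_rep h g \<in> L" using h by (auto simp: submodule_def intro: invariant_subspaceD(3))
      then have "bergman_rep h g \<in> copies K" using L(2,3) by blast
      then show "g \<in> {g. bergman_rep h g \<in> cfun.span (copies K)}" by (simp only: mem_Collect_eq cfun.span_base)
    qed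
    show "cfun.subspace {g. bergman_rep h g \<in> cfun.span (copies K)}"
      unfolding cfun.subspace_def mem_Collect_eq bergman_rep_add bergman_rep_cscale bergman_rep_zero
      by (auto intro: cfun.span_add cfun.span_scale cfun.span_zero)
  qed
  then have "bergman_rep h g \<in> bergman_closure lam (cfun.span (copies K))" if "g \<in> cfun.span (copies K)" for g
    using that subset_closure[OF copies_A2(2)] by blast
  then show "bergman_rep h f \<in> isotypic_component lam H K"
    using closure_bounded_image[OF bounded_operator_rep[OF H_unitary[OF h]] copies_A2(2) _ copies_A2(2)] f
    unfolding isotypic_component_def by blast
qed

text \<open>A nonzero invariant subspace of least dimension is irreducible.\<close>

lemma irreducible_exists:
  assumes N: "invariant_subspace lam H N" "finite_dimensional N" "N \<noteq> {0}"
  obtains K where "irreducible_submodule lam H K" "K \<subseteq> N" "finite_dimensional K"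
proof -
  define good where "good d \<longleftrightarrow> (\<exists>K B. invariant_subspace lam H K \<and> K \<noteq> {0} \<and> K \<subseteq> N \<and>
      finite B \<and> cfun.independent B \<and> cfun.span B = K \<and> card B = d)" for d
  have good: "\<exists>B. finite B \<and> cfun.independent B \<and> cfun.span B = K \<and> B \<subseteq> K"
    if "invariant_subspace lam H K" "K \<subseteq> N" for K
    using subspace_of_finite_dimensional[OF N(2) invariant_subspaceD(2)[OF that(1)] that(2)] by metis
  have "\<exists>d. good d" using good[OF N(1)] N unfolding good_def by blast
  then obtain d where d: "good d" "\<And>d'. d' < d \<Longrightarrow> \<not> good d'" using exists_least_iff[of good] by blast
  then obtain K B where K: "invariant_subspace lam H K" "K \<noteq> {0}" "K \<subseteq> N"
    and B: "finite B" "cfun.independent B" "cfun.span B = K" "card B = d" unfolding good_def by blast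
  have fK: "finite_dimensional K" using B by (auto simp: finite_dimensional_def)
  have "irreducible_submodule lam H K"
    unfolding irreducible_submodule_def
  proof (intro conjI allI impI finite_dimensional_submodule[OF K(1) fK] K(2))
    fix L assume L: "submodule lam H L \<and> L \<subseteq> K"
    then have iL: "invariant_subspace lam H L" by (simp add: submodule_def)
    show "L = {0} \<or> L = K"
    proof (rule ccontr)
      assume ne: "\<not> (L = {0} \<or> L = K)"
      obtain BL where BL: "finite BL" "cfun.independent BL" "cfun.span BL = L" "BL \<subseteq> L"
        using good[OF iL] L K(3) by blast
      obtain x where x: "x \<in> K" "x \<notin> L" using ne L by blast
      have "x \<notin> BL" using x BL(4) by blast
      have "cfun.independent (insert x BL)" using BL(2,3) x(2) by (intro cfun.independent_insertI) auto
      moreover have "insert x BL \<subseteq> cfun.span B" using x BL(4) L B(3) by auto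
      ultimately have "card (insert x BL) \<le> card B" using cfun.independent_span_bound[OF B(1)] by blast
      then have "card BL < d" using BL(1) \<open>x \<notin> BL\<close> B(4) by simp
      moreover have "good (card BL)" unfolding good_def using iL ne L K(3) BL by blast
      ultimately show False using d(2) by blast
    qed
  qed
  then show ?thesis using that K(3) fK by blast
qed

text \<open>For an eigenvalue \<open>c\<close>, the intertwining operator \<open>T - c\<close> is not injective on \<open>K\<close>, so it vanishes there.\<close>

lemma Hom_scalar:
  assumes K: "irreducible_submodule lam H K" "finite_dimensional K"
    and T: "T \<in> Endo" and TK: "\<And>f. f \<in> K \<Longrightarrow> T f \<in> K"
  shows "\<exists>c. \<forall>f\<in>K. T f = cscale c f"
proof -
  note iK = irreducibleD(1)[OF K(1)] note KA = invariant_subspaceD(1)[OF iK]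
  note TB = EndoD(1)[OF T]
  obtain c w where w: "w \<in> K" "w \<noteq> 0" "T w = cscale c w"
  proof -
    have "\<exists>c. \<exists>w\<in>K. w \<noteq> 0 \<and> T w = cscale c w"
    proof (rule eigenvector_exists[OF K(2) irreducibleD(2)[OF K(1)] TK])
      show "T (f + g) = T f + T g" if "f \<in> K" "g \<in> K" for f g
        using that KA by (intro bounded_operatorsD(2)[OF TB]) auto
      show "T (cscale c f) = cscale c (T f)" if "f \<in> K" for c f
        using that KA by (intro bounded_operatorsD(3)[OF TB]) auto
    qed
    then show ?thesis using that by blast
  qed
  have "(\<lambda>f. T f + cscale (-c) f) \<in> Endo"
    by (rule Endo_add[OF T Endo_scale[OF Endo_id]])
  from Hom_zero_or_injective[OF K Endo_Hom[OF this KA]]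
  have "\<forall>f\<in>K. T f + cscale (-c) f = 0"
  proof
    assume inj: "inj_on (\<lambda>f. T f + cscale (-c) f) K"
    have "T w + cscale (-c) w = T 0 + cscale (-c) 0"
      using w(3) bounded_operators_zero[OF TB] by simp
    from inj_onD[OF inj this w(1) cfun.subspace_0[OF invariant_subspaceD(2)[OF iK]]] have "w = 0" .
    then show ?thesis using w(2) by simp
  qed
  then show ?thesis by (intro exI[of _ c]) (simp add: eq_neg_iff_add_eq_0[symmetric])
qed

text \<open>The commutator of two intertwining operators vanishes on every finite dimensional irreducible submodule,
  where both act as scalars. Its kernel among the homogeneous functions of a given degree is everything,
  for otherwise the orthogonal complement would contain such a submodule. The kernel on the Bergman
  space is a closed subspace, hence the whole space, as homogeneous functions are total.\<close>

lemma multiplicity_free_imp_commuting: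
  assumes mf: "multiplicity_free lam H" and S: "S \<in> Endo" and T: "T \<in> Endo" and f: "f \<in> A2"
  shows "S (T f) = T (S f)"
proof -
  define C where "C f = S (T f) + cscale (-1) (T (S f))" for f
  have CE: "C \<in> Endo"
    unfolding C_def by (rule Endo_add[OF Endo_compose[OF S T] Endo_scale[OF Endo_compose[OF T S]]])
  note CB = EndoD(1)[OF CE]
  have irr: "C f = 0" if K: "irreducible_submodule lam H K" "finite_dimensional K" and f: "f \<in> K" for K f
  proof -
    let ?V = "isotypic_component lam H K"
    note sub = irreducible_subset_isotypic[OF K(1)]
    have "?V \<noteq> {0}" using sub irreducibleD(2)[OF K(1)] cfun.subspace_0[OF invariant_subspaceD(2)[OF irreducibleD(1)[OF K(1)]]] by blast
    moreover have "?V \<in> isotypic_components lam H" using K(1) by (simp add: isotypic_components_def)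
    ultimately have "irreducible_submodule lam H ?V" using mf by (auto simp: multiplicity_free_def)
    then have VK: "?V = K" using irreducibleD(4)[OF _ irreducibleD(3)[OF K(1)] sub] irreducibleD(2)[OF K(1)] by blast
    note KA = invariant_subspaceD(1)[OF irreducibleD(1)[OF K(1)]]
    have pres: "R g \<in> K" if "R \<in> Endo" "g \<in> K" for R g
      using Hom_image_isotypic[OF K Endo_Hom[OF that(1) KA]] that(2) VK by blast
    obtain s where s: "\<forall>f\<in>K. S f = cscale s f" using Hom_scalar[OF K S pres[OF S]] by blast
    obtain t where t: "\<forall>f\<in>K. T f = cscale t f" using Hom_scalar[OF K T pres[OF T]] by blast
    have "S (T f) = cscale (s * t) f" "T (S f) = cscale (s * t) f"
      using s t pres[OF S f] pres[OF T f] f by (auto simp: mult.commute)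
    then show ?thesis by (simp add: C_def cfun.scale_minus_left)
  qed
  have hom: "C f = 0" if f: "f \<in> homogeneous m" for f m
  proof -
    let ?M = "homogeneous m"
    have MA: "?M \<subseteq> A2" using homogeneousD(1) by blast
    have iM: "invariant_subspace lam H ?M"
      unfolding invariant_subspace_def using MA subspace_homogeneous rep_homogeneous H_unitary by blast
    define M' where "M' = {f \<in> ?M. C f = 0}"
    have iM': "invariant_subspace lam H M'" unfolding M'_def by (rule Hom_kernel[OF Endo_Hom[OF CE MA] iM])
    have M'M: "M' \<subseteq> ?M" by (auto simp: M'_def)
    have M'L: "M' \<subseteq> L2" using M'M MA A2_subset by blast
    have fM': "finite_dimensional M'"
      by (rule finite_dimensional_subspace[OF finite_dimensional_homogeneous invariant_subspaceD(2)[OF iM'] M'M])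
    define N where "N = {f \<in> ?M. \<forall>g\<in>M'. ip lam f g = 0}"
    have NM: "N \<subseteq> ?M" by (auto simp: N_def)
    have subL2: "?M \<subseteq> L2" using MA A2_subset by blast
    have sN: "cfun.subspace N"
      unfolding cfun.subspace_def N_def
      using subL2 M'L cfun.subspace_0[OF subspace_homogeneous] cfun.subspace_add[OF subspace_homogeneous]
        cfun.subspace_scale[OF subspace_homogeneous]
      by (auto simp: L2.ip_add L2.ip_scale subset_iff)
    have "bergman_rep h g \<in> N" if h: "h \<in> H" and g: "g \<in> N" for h g
    proof -
      have "ip lam (bergman_rep h g) g' = 0" if g': "g' \<in> M'" for g'
      proof -
        have "ip lam (bergman_rep h g) g' = ip lam g (bergman_rep (uinv h) g')"
          using H_unitary[OF h] g g' NM subL2 M'L by (intro ip_rep_left) auto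
        also have "\<dots> = 0" using g invariant_subspaceD(3)[OF iM' H_inv[OF h] g'] by (simp add: N_def)
        finally show ?thesis .
      qed
      then show ?thesis using invariant_subspaceD(3)[OF iM h] g by (simp add: N_def)
    qed
    then have iN: "invariant_subspace lam H N"
      unfolding invariant_subspace_def using sN NM MA by blast
    have fN: "finite_dimensional N"
      by (rule finite_dimensional_subspace[OF finite_dimensional_homogeneous sN NM])
    have "N = {0}"
    proof (rule ccontr)
      assume "N \<noteq> {0}"
      then obtain K where K: "irreducible_submodule lam H K" "K \<subseteq> N" "finite_dimensional K"
        using irreducible_exists[OF iN fN] by blast
      have "g = 0" if g: "g \<in> K" for g
      proof -
        have "g \<in> M'" using irr[OF K(1,3) g] g K(2) NM by (auto simp: M'_def)
        then have "ip lam g g = 0" using g K(2) by (auto simp: N_def)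
        then have "L2.nrm g = 0" by (simp add: L2.nrm_def)
        then show ?thesis using A2_definite g K(2) NM MA by blast
      qed
      then have "K \<subseteq> {0}" by blast
      then show False
        using irreducibleD(2)[OF K(1)] cfun.subspace_0[OF invariant_subspaceD(2)[OF irreducibleD(1)[OF K(1)]]] by blast
    qed
    obtain E where E: "finite E" "L2.orthonormal E" "cfun.span E = M'"
      using finite_dimensional_orthonormal_basis[OF fM'] M'M MA by blast
    have p: "L2.proj E f \<in> M'" using L2.proj_in_span[of E f] E(3) by simp
    have "f - L2.proj E f \<in> N"
      unfolding N_def
    proof (intro CollectI conjI ballI)
      show "f - L2.proj E f \<in> ?M" using f p M'M by (intro cfun.subspace_diff[OF subspace_homogeneous]) auto
      show "ip lam (f - L2.proj E f) g = 0" if "g \<in> M'" for g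
        using E(1,2) f subL2 that E(3) by (intro L2.proj_orthogonal) auto
    qed
    then have "f = L2.proj E f" using \<open>N = {0}\<close> by simp
    then show ?thesis using p by (simp add: M'_def)
  qed
  define Z where "Z = {f \<in> A2. C f = 0}"
  have ZA: "Z \<subseteq> A2" by (auto simp: Z_def)
  have iA: "invariant_subspace lam H A2"
    unfolding invariant_subspace_def using subspace_A2 rep_A2 H_unitary by blast
  have sZ: "cfun.subspace Z"
    unfolding Z_def by (rule invariant_subspaceD(2)[OF Hom_kernel[OF CE iA]])
  have "L2.complete_subspace Z"
    unfolding L2.complete_subspace_def
  proof (intro allI impI)
    fix X :: "nat \<Rightarrow> complex^'n^'n \<Rightarrow> complex"
    assume X: "(\<forall>n. X n \<in> Z) \<and> (\<forall>e>0. \<exists>N. \<forall>m\<ge>N. \<forall>n\<ge>N. L2.nrm (X m - X n) < e)"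
    then have XA: "X n \<in> A2" and XC: "C (X n) = 0" for n by (auto simp: Z_def)
    obtain g where g: "g \<in> A2" "(\<lambda>n. L2.nrm (X n - g)) \<longlonglongrightarrow> 0"
    proof -
      have "(\<forall>n. X n \<in> A2) \<and> (\<forall>e>0. \<exists>N. \<forall>m\<ge>N. \<forall>n\<ge>N. L2.nrm (X m - X n) < e)"
        by (rule conjI[OF allI[OF XA] conjunct2[OF X]])
      from complete_A2[unfolded L2.complete_subspace_def, rule_format, OF this]
      show ?thesis by (elim bexE) (rule that)
    qed
    obtain D where D: "D \<ge> 0" "\<And>f. f \<in> A2 \<Longrightarrow> L2.nrm (C f) \<le> D * L2.nrm f"
      using bounded_operatorsD(4)[OF CB] by metis
    have CgA: "C g \<in> A2" using bounded_operatorsD(1)[OF CB g(1)] .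
    have le: "L2.nrm (C g) \<le> D * L2.nrm (X n - g)" for n
    proof -
      have "C (X n - g) = 0 - C g" using bounded_operators_diff[OF CB XA g(1)] XC by simp
      then have "L2.nrm (C g) = L2.nrm (C (X n - g))"
        using L2.nrm_minus_commute[of 0 "C g"] CgA A2_L2 by simp
      then show ?thesis using D(2)[of "X n - g"] XA g(1) by simp
    qed
    have "(\<lambda>n. D * L2.nrm (X n - g)) \<longlonglongrightarrow> D * 0" by (intro tendsto_intros g)
    then have "L2.nrm (C g) \<le> D * 0" by (rule LIMSEQ_le_const) (use le in blast)
    then have "L2.nrm (C g) = 0" using A2_L2[OF CgA] by (simp add: order_antisym)
    then have "g \<in> Z" using A2_definite[OF CgA] g(1) by (simp add: Z_def)
    then show "\<exists>g\<in>Z. (\<lambda>n. L2.nrm (X n - g)) \<longlonglongrightarrow> 0" using g(2) by blast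
  qed
  then obtain g where g: "g \<in> Z" "\<forall>h\<in>Z. ip lam (f - g) h = 0"
    using L2.projection_exists[OF order_trans[OF ZA A2_subset] sZ _ A2_L2[OF f]] by blast
  have "f - g = 0"
  proof (rule homogeneous_total)
    show "f - g \<in> A2" using f g ZA by blast
    show "ip lam (f - g) p = 0" if "p \<in> homogeneous m" for m p
      using g(2) hom[OF that] homogeneousD(1)[OF that] by (auto simp: Z_def)
  qed
  then have "C f = 0" using g(1) by (simp add: Z_def)
  then show ?thesis by (simp add: C_def cfun.scale_minus_left)
qed

text \<open>If a second copy \<open>L\<close> of \<open>K\<close> occurs, the part of \<open>L\<close> orthogonal to \<open>K\<close> is a copy orthogonal to \<open>K\<close>. The
  projection onto \<open>K\<close> and the operator that carries \<open>K\<close> to this copy do not commute, and on the finite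
  dimensional isotypic component both are given by Toeplitz operators with invariant symbols.\<close>

lemma commuting_imp_isotypic_irreducible:
  assumes K: "irreducible_submodule lam H K" and fV: "finite_dimensional (isotypic_component lam H K)"
    and com: "commuting_on A2 (toeplitz_algebra lam (invariant_symbols H))"
  shows "isotypic_component lam H K = K"
proof -
  let ?V = "isotypic_component lam H K"
  note iK = irreducibleD(1)[OF K] note KA = invariant_subspaceD(1)[OF iK] and sK = invariant_subspaceD(2)[OF iK]
  note KV = irreducible_subset_isotypic[OF K]
  have fK: "finite_dimensional K" using fV sK KV by (rule finite_dimensional_subspace)
  obtain E where E: "finite E" "L2.orthonormal E" "cfun.span E = K"
    using finite_dimensional_orthonormal_basis[OF fK KA] .
  define P where "P = L2.proj E"
  have PK: "P f \<in> K" for f using L2.proj_in_span[of E f] E(3) by (simp add: P_def)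
  have orth: "ip lam (f - P f) g = 0" if "f \<in> A2" "g \<in> K" for f g
    unfolding P_def using E(1,2) that A2_L2 E(3) by (intro L2.proj_orthogonal) auto
  have P_unique: "P f = g" if f: "f \<in> A2" and g: "g \<in> K" and o: "\<And>k. k \<in> K \<Longrightarrow> ip lam (f - g) k = 0" for f g
  proof -
    have d: "P f - g \<in> K" using PK g sK by (intro cfun.subspace_diff)
    have "ip lam (P f - g) (P f - g) = ip lam ((f - g) - (f - P f)) (P f - g)" by simp
    also have "\<dots> = ip lam (f - g) (P f - g) - ip lam (f - P f) (P f - g)"
      using f g d PK KA A2_L2 by (intro L2.ip_diff) blast+
    also have "\<dots> = 0" using o[OF d] orth[OF f d] by simp
    finally have "L2.nrm (P f - g) = 0" by (simp add: L2.nrm_def)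
    then show ?thesis using A2_definite[of "P f - g"] d KA by auto
  qed
  have P_self: "P f = f" if "f \<in> K" for f using that KA A2_L2 by (intro P_unique) auto
  have PE: "P \<in> Endo"
    unfolding Endo_iff
  proof (intro conjI ballI)
    show "P \<in> bounded_operators lam A2 A2"
    proof (rule bounded_operatorsI[where C = 1])
      fix f assume f: "f \<in> A2"
      show "P f \<in> A2" using PK KA by blast
      show "P (f + g) = P f + P g" if g: "g \<in> A2" for g
      proof (rule P_unique)
        show "P f + P g \<in> K" using PK sK by (intro cfun.subspace_add)
        fix k assume k: "k \<in> K"
        have "f + g - (P f + P g) = (f - P f) + (g - P g)" by simp
        then have "ip lam (f + g - (P f + P g)) k = ip lam ((f - P f) + (g - P g)) k" by (simp only:)
        also have "\<dots> = ip lam (f - P f) k + ip lam (g - P g) k"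
          using f g k PK KA A2_L2 by (intro L2.ip_add L2.V_simps) blast+
        finally show "ip lam (f + g - (P f + P g)) k = 0" using orth[OF f k] orth[OF g k] by simp
      qed (use f g in simp)
      show "P (cscale c f) = cscale c (P f)" for c
      proof (rule P_unique)
        show "cscale c (P f) \<in> K" using PK sK by (intro cfun.subspace_scale)
        fix k assume k: "k \<in> K"
        have "ip lam (cscale c f - cscale c (P f)) k = ip lam (cscale c (f - P f)) k"
          by (simp add: cfun.scale_right_diff_distrib)
        also have "\<dots> = c * ip lam (f - P f) k"
          using f k PK KA A2_L2 by (intro L2.ip_scale L2.V_simps) blast+
        finally show "ip lam (cscale c f - cscale c (P f)) k = 0" using orth[OF f k] by simp
      qed (use f in simp)
      show "L2.nrm (P f) \<le> 1 * L2.nrm f"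
        unfolding P_def using L2.proj_properties(1)[OF E(1,2) A2_L2[OF f]] by simp
    qed
    fix h f assume h: "h \<in> H" and f: "f \<in> A2"
    note hu = H_unitary[OF h]
    show "P (bergman_rep h f) = bergman_rep h (P f)"
    proof (rule P_unique)
      show "bergman_rep h f \<in> A2" using hu f by (rule rep_A2)
      show "bergman_rep h (P f) \<in> K" using iK h PK by (rule invariant_subspaceD(3))
      fix k assume k: "k \<in> K"
      have "ip lam (bergman_rep h (f - P f)) k = ip lam (f - P f) (bergman_rep (uinv h) k)"
        using hu f k PK KA A2_L2 by (intro ip_rep_left L2.V_simps) blast+
      also have "\<dots> = 0" using orth[OF f] invariant_subspaceD(3)[OF iK H_inv[OF h] k] by blast
      finally show "ip lam (bergman_rep h f - bergman_rep h (P f)) k = 0" by (simp add: bergman_rep_diff)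
    qed
  qed
  have sub: "L \<subseteq> K" if L: "submodule lam H L" "equivalent_submodules lam H K L" for L
  proof (rule ccontr)
    assume nsub: "\<not> L \<subseteq> K"
    obtain \<psi> where \<psi>: "\<psi> \<in> intertwining_operators lam H K L" "bij_betw \<psi> K L"
      using L(2) by (auto simp: equivalent_submodules_def)
    have LA: "L \<subseteq> A2" using L(1) by (simp add: submodule_def invariant_subspace_def)
    note \<psi>H = Hom_mono[OF \<psi>(1) LA]
    define Q where "Q f = f + cscale (-1) (P f)" for f
    have Q_eq: "Q f = f - P f" for f by (simp add: Q_def cfun.scale_minus_left)
    have QE: "Q \<in> Endo"
      unfolding Q_def by (rule Endo_add[OF Endo_id Endo_scale[OF PE]])
    define \<phi> where "\<phi> f = Q (\<psi> f)" for f
    have \<phi>H: "\<phi> \<in> Hom K" unfolding \<phi>_def by (rule Hom_compose[OF \<psi>H QE])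
    obtain f0 where f0: "f0 \<in> K" "\<psi> f0 \<notin> K" using nsub \<psi>(2) by (auto simp: bij_betw_def)
    have "\<phi> f0 \<noteq> 0" using f0(2) PK[of "\<psi> f0"] by (auto simp: \<phi>_def Q_eq)
    then have inj: "inj_on \<phi> K" using Hom_zero_or_injective[OF K fK \<phi>H] f0(1) by blast
    have f0n: "f0 \<noteq> 0" using f0(2) HomD(3)[OF \<psi>H f0(1), of 0] cfun.subspace_0[OF sK] by auto
    have P\<phi>: "P (\<phi> f) = 0" if f: "f \<in> K" for f
    proof -
      have "\<psi> f \<in> A2" using HomD(1)[OF \<psi>H f] .
      then have "P (\<psi> f - P (\<psi> f)) = P (\<psi> f) - P (P (\<psi> f))"
        using PK KA by (intro bounded_operators_diff[OF EndoD(1)[OF PE]]) auto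
      then show ?thesis using P_self[OF PK] by (simp add: \<phi>_def Q_eq)
    qed
    define S where "S f = \<phi> (P f)" for f
    have SE: "S \<in> Endo"
    proof -
      obtain C where C: "\<And>f. f \<in> K \<Longrightarrow> L2.nrm (\<phi> f) \<le> C * L2.nrm f" using HomD(4)[OF \<phi>H] by blast
      note PB = EndoD(1)[OF PE]
      have "S \<in> bounded_operators lam A2 A2"
      proof (rule bounded_operatorsI[where C = "max C 0"])
        fix f assume f: "f \<in> A2"
        show "S f \<in> A2" unfolding S_def using PK by (rule HomD(1)[OF \<phi>H])
        show "S (f + g) = S f + S g" if "g \<in> A2" for g
          unfolding S_def using bounded_operatorsD(2)[OF PB f that] HomD(2)[OF \<phi>H PK PK] by simp
        show "S (cscale c f) = cscale c (S f)" for c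
          unfolding S_def using bounded_operatorsD(3)[OF PB f] HomD(3)[OF \<phi>H PK] by simp
        have "L2.nrm (P f) \<le> L2.nrm f"
          unfolding P_def using L2.proj_properties(1)[OF E(1,2) A2_L2[OF f]] .
        moreover have "0 \<le> L2.nrm (P f)" using PK KA A2_L2 by (intro L2.nrm_nonneg) blast
        ultimately have "C * L2.nrm (P f) \<le> max C 0 * L2.nrm f" by (intro mult_mono) auto
        then show "L2.nrm (S f) \<le> max C 0 * L2.nrm f" unfolding S_def using C[OF PK, of f] by linarith
      qed
      moreover have "S (bergman_rep h f) = bergman_rep h (S f)" if "h \<in> H" "f \<in> A2" for h f
        unfolding S_def using EndoD(2)[OF PE that] HomD(5)[OF \<phi>H that(1) PK] by simp
      ultimately show ?thesis by (simp add: Endo_iff)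
    qed
    have real: "\<exists>a\<in>invariant_symbols H. \<forall>f\<in>?V. toeplitz lam a f = R f" if R: "R \<in> Endo" for R
    proof -
      obtain a where a: "a \<in> invariant_symbols H" "\<forall>f\<in>?V. \<forall>g\<in>?V. ip lam (R f) g = ip lam (toeplitz lam a f) g"
        using finite_dimensional_realization[OF R isotypic_invariant fV] by blast
      have aE: "toeplitz lam a \<in> Endo"
        using toeplitz_algebra_subset_Endo toeplitz_in_algebra[OF a(1)] by blast
      have "toeplitz lam a f = R f" if f: "f \<in> ?V" for f
      proof -
        have V: "toeplitz lam a f \<in> ?V" "R f \<in> ?V"
          using Endo_preserves_isotypic[OF K fK _ f] aE R by blast+
        have d: "toeplitz lam a f - R f \<in> ?V" using V isotypic_subspace by (intro cfun.subspace_diff)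
        have "ip lam (toeplitz lam a f - R f) (toeplitz lam a f - R f) = 0"
        proof -
          have "ip lam (toeplitz lam a f - R f) (toeplitz lam a f - R f)
              = ip lam (toeplitz lam a f) (toeplitz lam a f - R f) - ip lam (R f) (toeplitz lam a f - R f)"
            by (rule L2.ip_diff) (rule A2_L2[OF subsetD[OF isotypic_A2[of K]]], rule V d)+
          also have "\<dots> = 0" using bspec[OF bspec[OF a(2) f] d] by (simp only: diff_self)
          finally show ?thesis .
        qed
        then have "L2.nrm (toeplitz lam a f - R f) = 0" by (simp add: L2.nrm_def)
        then show ?thesis using A2_definite[of "toeplitz lam a f - R f"] d isotypic_A2[of K] by auto
      qed
      then show ?thesis using a(1) by blast
    qed
    obtain a where a: "a \<in> invariant_symbols H" "\<And>f. f \<in> ?V \<Longrightarrow> toeplitz lam a f = P f" using real[OF PE] by blast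
    obtain b where b: "b \<in> invariant_symbols H" "\<And>f. f \<in> ?V \<Longrightarrow> toeplitz lam b f = S f" using real[OF SE] by blast
    have fV0: "f0 \<in> ?V" using f0(1) KV by blast
    have SV: "S f0 \<in> ?V" by (rule Endo_preserves_isotypic[OF K fK SE fV0])
    have "toeplitz lam a (toeplitz lam b f0) = toeplitz lam b (toeplitz lam a f0)"
      using com toeplitz_in_algebra[OF a(1)] toeplitz_in_algebra[OF b(1)] f0(1) KA
      by (auto simp: commuting_on_def)
    moreover have "toeplitz lam a (toeplitz lam b f0) = P (S f0)" using a(2)[OF SV] b(2)[OF fV0] by simp
    moreover have "toeplitz lam b (toeplitz lam a f0) = S f0"
      using a(2)[OF fV0] b(2)[OF fV0] P_self[OF f0(1)] by simp
    moreover have "S f0 = \<phi> f0" by (simp add: S_def P_self[OF f0(1)])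
    ultimately have "\<phi> f0 = 0" using P\<phi>[OF f0(1)] by simp
    then show False using \<open>\<phi> f0 \<noteq> 0\<close> by simp
  qed
  have "cfun.span (copies K) \<subseteq> K" using sub sK by (intro cfun.span_minimal) blast+
  then have "?V \<subseteq> K"
    unfolding isotypic_component_def using closure_mono finite_dimensional_closed[OF fK KA] by blast
  then show ?thesis using KV by blast
qed

lemma commuting_iff_multiplicity_free:
  assumes fin: "\<forall>V\<in>isotypic_components lam H. finite_dimensional V"
  shows "commuting_on A2 (toeplitz_algebra lam (invariant_symbols H)) \<longleftrightarrow> multiplicity_free lam H"
proof
  assume com: "commuting_on A2 (toeplitz_algebra lam (invariant_symbols H))"
  show "multiplicity_free lam H"
    unfolding multiplicity_free_def
  proof
    fix V assume V: "V \<in> isotypic_components lam H"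
    then obtain K where K: "irreducible_submodule lam H K" "V = isotypic_component lam H K"
      by (auto simp: isotypic_components_def)
    then have "V = K" using commuting_imp_isotypic_irreducible[OF K(1) _ com] fin V by blast
    then show "V = {0} \<or> irreducible_submodule lam H V" using K(1) by simp
  qed
next
  assume "multiplicity_free lam H"
  then show "commuting_on A2 (toeplitz_algebra lam (invariant_symbols H))"
    unfolding commuting_on_def
    using multiplicity_free_imp_commuting toeplitz_algebra_subset_Endo by blast
qed

end

theorem proposition4p2:
  fixes H :: "((complex^'n^'n) \<times> (complex^'n^'n)) set" and lam :: real
  assumes "subgroup H (unitary_group \<times>\<times> unitary_group)"
    and "closed H"
    and "lam > 2 * real CARD('n) - 1"
  shows "((\<forall>a\<in>symbols. invariant_symbol H a \<longleftrightarrow>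
            toeplitz lam a \<in> intertwining_operators lam H (bergman_space lam) (bergman_space lam))
          \<and> toeplitz_algebra lam (invariant_symbols H)
              \<subseteq> intertwining_operators lam H (bergman_space lam) (bergman_space lam))
      \<and> (\<forall>T\<in>intertwining_operators lam H (bergman_space lam) (bergman_space lam).
           \<forall>W. invariant_subspace lam H W \<and> finite_dimensional W \<longrightarrow>
             (\<exists>a\<in>invariant_symbols H. \<forall>f\<in>W. \<forall>g\<in>W. ip lam (T f) g = ip lam (toeplitz lam a f) g))
      \<and> ((\<forall>V\<in>isotypic_components lam H. finite_dimensional V) \<longrightarrow>
           (commuting_on (bergman_space lam) (toeplitz_algebra lam (invariant_symbols H))
             \<longleftrightarrow> multiplicity_free lam H))"
proof -
  interpret bergman_subgroup lam "TYPE('n)" H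
    by (intro bergman_subgroup.intro bergman.intro bergman_subgroup_axioms.intro assms)
  show ?thesis
  proof (intro conjI ballI allI impI)
    fix a :: "complex^'n^'n \<Rightarrow> complex" assume "a \<in> symbols"
    then show "invariant_symbol H a \<longleftrightarrow> toeplitz lam a \<in> Endo"
      by (rule invariant_symbol_iff_toeplitz)
  next
    show "toeplitz_algebra lam (invariant_symbols H) \<subseteq> Endo"
      by (rule toeplitz_algebra_subset_Endo)
  next
    fix T and W :: "(complex^'n^'n \<Rightarrow> complex) set"
    assume "T \<in> Endo" and W: "invariant_subspace lam H W \<and> finite_dimensional W"
    then show "\<exists>a\<in>invariant_symbols H. \<forall>f\<in>W. \<forall>g\<in>W. ip lam (T f) g = ip lam (toeplitz lam a f) g"
      by (intro finite_dimensional_realization conjunct1[OF W] conjunct2[OF W])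
  next
    assume "\<forall>V\<in>isotypic_components lam H. finite_dimensional V"
    then show "commuting_on A2 (toeplitz_algebra lam (invariant_symbols H)) \<longleftrightarrow> multiplicity_free lam H"
      by (rule commuting_iff_multiplicity_free)
  qed
qed

end
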